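(* Let $\mathbb{K}$ be an algebraically closed field of characteristic zero, let $S$ be a scheme over $\mathbb{K}$ and let $p\in S$ be a closed point (with residue field $\mathbb{K}$). Let $A$ be a flat family of graded algebras over $S$. Then there exists a natural linear map $$\kappa_p:T_pS\to \mathrm{HH}^2_0(A_p),$$ called the Kodaira–Spencer map.
   Context: $T_pS=\mathrm{Hom}_{\mathbb{K}}(\mathfrak{m}_p/\mathfrak{m}_p^2,\mathbb{K})$ is the Zariski tangent space of $S$ at $p$, where $\mathfrak{m}_p$ is the maximal ideal of the local ring $\mathcal{O}_{S,p}$. $A_p=A\otimes_{\mathcal{O}_S}\kappa(p)$ is the fibre algebra of $A$ at $p$, where $\kappa(p)$ is the residue field at $p$. For a graded $\mathbb{K}$-algebra $B$, $\mathrm{HH}^2_0(B)$ is the internal degree zero component of the second Hochschild cohomology of $B$ with coefficients in $B$, i.e. the cohomology in cohomological degree 2 of the subcomplex of degree-preserving maps in the Hochschild cochain complex $\mathrm{Hom}_{\mathbb{K}}(B^{\otimes n},B)$. *)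

theory Defs
  imports "HOL-Analysis.Abstract_Topology" "HOL-Algebra.Algebra"
begin

section \<open>Modules, linear maps, dual numbers\<close>

text \<open>
  All algebraic structures are records with an explicit carrier.  Algebras are associative and
  unital but not necessarily commutative, so the library locale \<^locale>\<open>algebra\<close> (which is about
  commutative algebras) is not the right notion.  Gradings are indexed by the integers; a grading by
  natural numbers is one with zero components in negative degrees.
\<close>

record ('r, 'a) graded_algebra = "('r, 'a) module" +
  grade :: "int \<Rightarrow> 'a set"

definition assoc_algebra :: "('r, 'm) ring_scheme \<Rightarrow> ('r, 'a, 'n) module_scheme \<Rightarrow> bool" where
  "assoc_algebra R A \<longleftrightarrow> module R A \<and> ring A \<and>
     (\<forall>r\<in>carrier R. \<forall>x\<in>carrier A. \<forall>y\<in>carrier A.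
        (r \<odot>\<^bsub>A\<^esub> x) \<otimes>\<^bsub>A\<^esub> y = r \<odot>\<^bsub>A\<^esub> (x \<otimes>\<^bsub>A\<^esub> y) \<and>
        x \<otimes>\<^bsub>A\<^esub> (r \<odot>\<^bsub>A\<^esub> y) = r \<odot>\<^bsub>A\<^esub> (x \<otimes>\<^bsub>A\<^esub> y))"

definition linear_maps ::
  "('r, 'k) ring_scheme \<Rightarrow> ('r, 'm, 'p) module_scheme \<Rightarrow> ('r, 'n, 'q) module_scheme \<Rightarrow> ('m \<Rightarrow> 'n) set"
where
  "linear_maps R M N = {f \<in> carrier M \<rightarrow> carrier N.
     (\<forall>x\<in>carrier M. \<forall>y\<in>carrier M. f (x \<oplus>\<^bsub>M\<^esub> y) = f x \<oplus>\<^bsub>N\<^esub> f y) \<and>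
     (\<forall>r\<in>carrier R. \<forall>x\<in>carrier M. f (r \<odot>\<^bsub>M\<^esub> x) = r \<odot>\<^bsub>N\<^esub> f x)}"

text \<open>Where only the module structure matters, the ring fields of a module record are \<^term>\<open>undefined\<close>.\<close>

definition dual_space :: "('k, 'p) ring_scheme \<Rightarrow> ('k, 'm, 'n) module_scheme \<Rightarrow> ('k, 'm \<Rightarrow> 'k) module" where
  "dual_space K M =
     \<lparr>carrier = linear_maps K M \<lparr>carrier = carrier K, monoid.mult = monoid.mult K, one = one K,
          ring.zero = ring.zero K, add = add K, smult = monoid.mult K\<rparr> \<inter> extensional (carrier M),
      monoid.mult = undefined, one = undefined,
      ring.zero = (\<lambda>x\<in>carrier M. \<zero>\<^bsub>K\<^esub>),
      add = (\<lambda>f g. \<lambda>x\<in>carrier M. f x \<oplus>\<^bsub>K\<^esub> g x),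
      smult = (\<lambda>c f. \<lambda>x\<in>carrier M. c \<otimes>\<^bsub>K\<^esub> f x)\<rparr>"

definition quotient_module :: "('r, 'm, 'n) module_scheme \<Rightarrow> 'm set \<Rightarrow> ('r, 'm set) module" where
  "quotient_module M N =
     \<lparr>carrier = a_rcosets\<^bsub>M\<^esub> N, monoid.mult = undefined, one = undefined,
      ring.zero = N, add = set_add M,
      smult = (\<lambda>c C. \<Union>x\<in>C. N +>\<^bsub>M\<^esub> (c \<odot>\<^bsub>M\<^esub> x))\<rparr>"

definition restrict_scalars ::
  "('s \<Rightarrow> 'r) \<Rightarrow> ('r, 'a) graded_algebra \<Rightarrow> ('s, 'a) graded_algebra" where
  "restrict_scalars \<phi> A =
     \<lparr>carrier = carrier A, monoid.mult = monoid.mult A, one = one A, ring.zero = ring.zero A, add = add A,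
      smult = (\<lambda>c x. \<phi> c \<odot>\<^bsub>A\<^esub> x), grade = grade A\<rparr>"

text \<open>\<open>K[\<epsilon>]/(\<epsilon>\<^sup>2)\<close>, with \<open>(x, y)\<close> standing for \<open>x + y \<epsilon>\<close>.\<close>

definition dual_numbers :: "('k, 'm) ring_scheme \<Rightarrow> ('k \<times> 'k) ring" where
  "dual_numbers K =
     \<lparr>carrier = carrier K \<times> carrier K,
      monoid.mult = (\<lambda>(x, y) (x', y'). (x \<otimes>\<^bsub>K\<^esub> x', (x \<otimes>\<^bsub>K\<^esub> y') \<oplus>\<^bsub>K\<^esub> (y \<otimes>\<^bsub>K\<^esub> x'))),
      one = (\<one>\<^bsub>K\<^esub>, \<zero>\<^bsub>K\<^esub>), ring.zero = (\<zero>\<^bsub>K\<^esub>, \<zero>\<^bsub>K\<^esub>),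
      add = (\<lambda>(x, y) (x', y'). (x \<oplus>\<^bsub>K\<^esub> x', y \<oplus>\<^bsub>K\<^esub> y'))\<rparr>"


section \<open>Tensor products and flatness\<close>

text \<open>
  Elements of \<open>M \<otimes>\<^sub>R N\<close> are classes of formal sums \<open>x\<^sub>1 \<otimes> y\<^sub>1 + \<dots> + x\<^sub>n \<otimes> y\<^sub>n\<close>, written as lists of
  pairs, modulo the congruence generated by commutativity of the sum and by bilinearity.  Additive
  inverses need no formal symbols since \<open>(-x) \<otimes> y\<close> is an inverse of \<open>x \<otimes> y\<close>.
\<close>

inductive tensor_eq ::
  "('r, 'k) ring_scheme \<Rightarrow> ('r, 'm, 'p) module_scheme \<Rightarrow> ('r, 'n, 'q) module_scheme \<Rightarrow>
   ('m \<times> 'n) list \<Rightarrow> ('m \<times> 'n) list \<Rightarrow> bool"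
  for R M N
where
  refl: "set xs \<subseteq> carrier M \<times> carrier N \<Longrightarrow> tensor_eq R M N xs xs"
| sym: "tensor_eq R M N xs ys \<Longrightarrow> tensor_eq R M N ys xs"
| trans: "tensor_eq R M N xs ys \<Longrightarrow> tensor_eq R M N ys zs \<Longrightarrow> tensor_eq R M N xs zs"
| append: "tensor_eq R M N xs ys \<Longrightarrow> tensor_eq R M N xs' ys' \<Longrightarrow>
    tensor_eq R M N (xs @ xs') (ys @ ys')"
| commute: "set xs \<subseteq> carrier M \<times> carrier N \<Longrightarrow> set ys \<subseteq> carrier M \<times> carrier N \<Longrightarrow>
    tensor_eq R M N (xs @ ys) (ys @ xs)"
| add_left: "x \<in> carrier M \<Longrightarrow> x' \<in> carrier M \<Longrightarrow> y \<in> carrier N \<Longrightarrow>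
    tensor_eq R M N [(x \<oplus>\<^bsub>M\<^esub> x', y)] [(x, y), (x', y)]"
| add_right: "x \<in> carrier M \<Longrightarrow> y \<in> carrier N \<Longrightarrow> y' \<in> carrier N \<Longrightarrow>
    tensor_eq R M N [(x, y \<oplus>\<^bsub>N\<^esub> y')] [(x, y), (x, y')]"
| balanced: "r \<in> carrier R \<Longrightarrow> x \<in> carrier M \<Longrightarrow> y \<in> carrier N \<Longrightarrow>
    tensor_eq R M N [(r \<odot>\<^bsub>M\<^esub> x, y)] [(x, r \<odot>\<^bsub>N\<^esub> y)]"
| zero: "y \<in> carrier N \<Longrightarrow> tensor_eq R M N [(\<zero>\<^bsub>M\<^esub>, y)] []"

definition tensor_class ::
  "('r, 'k) ring_scheme \<Rightarrow> ('r, 'm, 'p) module_scheme \<Rightarrow> ('r, 'n, 'q) module_scheme \<Rightarrow>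
   ('m \<times> 'n) list \<Rightarrow> ('m \<times> 'n) list set" where
  "tensor_class R M N xs = {ys. tensor_eq R M N xs ys}"

definition tensor_carrier ::
  "('r, 'k) ring_scheme \<Rightarrow> ('r, 'm, 'p) module_scheme \<Rightarrow> ('r, 'n, 'q) module_scheme \<Rightarrow>
   ('m \<times> 'n) list set set" where
  "tensor_carrier R M N = tensor_class R M N ` {xs. set xs \<subseteq> carrier M \<times> carrier N}"

text \<open>
  Here and below, \<open>the_elem (f ` C)\<close> is the common value on an equivalence class \<open>C\<close> of an operation
  \<open>f\<close> on representatives.
\<close>

text \<open>
  Flatness: tensoring with \<open>M\<close> preserves injectivity of linear maps.  A quantifier inside a HOL
  formula ranges over the modules with carrier in one fixed type.  Lists of ring elements are used:
  this type contains copies of all ideals of \<open>R\<close> and of \<open>R\<close> itself, and these already detect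
  flatness, so the restriction is harmless.
\<close>

definition flat_module :: "('r, 'k) ring_scheme \<Rightarrow> ('r, 'm, 'p) module_scheme \<Rightarrow> bool" where
  "flat_module R M \<longleftrightarrow>
     (\<forall>(N :: ('r, 'r list) module) (N' :: ('r, 'r list) module) f.
        module R N \<and> module R N' \<and> f \<in> linear_maps R N N' \<and> inj_on f (carrier N) \<longrightarrow>
        inj_on (\<lambda>C. the_elem ((\<lambda>xs. tensor_class R M N' (map (\<lambda>(x, y). (x, f y)) xs)) ` C))
          (tensor_carrier R M N))"

definition ring_via :: "('r \<Rightarrow> 's) \<Rightarrow> ('s, 'k) ring_scheme \<Rightarrow> ('r, 's) module" where
  "ring_via \<phi> R' =
     \<lparr>carrier = carrier R', monoid.mult = monoid.mult R', one = one R', ring.zero = ring.zero R', add = add R',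
      smult = (\<lambda>r x. \<phi> r \<otimes>\<^bsub>R'\<^esub> x)\<rparr>"

text \<open>The graded \<open>R'\<close>-algebra \<open>A \<otimes>\<^sub>R R'\<close>, for a ring homomorphism \<open>\<phi> : R \<rightarrow> R'\<close>.\<close>

definition base_change ::
  "('r, 'k) ring_scheme \<Rightarrow> ('r \<Rightarrow> 's) \<Rightarrow> ('s, 'l) ring_scheme \<Rightarrow> ('r, 'a) graded_algebra \<Rightarrow>
   ('s, ('a \<times> 's) list set) graded_algebra" where
  "base_change R \<phi> R' A = (let cls = tensor_class R A (ring_via \<phi> R') in
     \<lparr>carrier = tensor_carrier R A (ring_via \<phi> R'),
      monoid.mult = (\<lambda>C D. the_elem ((\<lambda>(xs, ys).
                cls [(a \<otimes>\<^bsub>A\<^esub> a', b \<otimes>\<^bsub>R'\<^esub> b'). (a, b) \<leftarrow> xs, (a', b') \<leftarrow> ys]) ` (C \<times> D))),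
      one = cls [(\<one>\<^bsub>A\<^esub>, \<one>\<^bsub>R'\<^esub>)],
      ring.zero = cls [],
      add = (\<lambda>C D. the_elem ((\<lambda>(xs, ys). cls (xs @ ys)) ` (C \<times> D))),
      smult = (\<lambda>c C. the_elem ((\<lambda>xs. cls (map (\<lambda>(a, b). (a, c \<otimes>\<^bsub>R'\<^esub> b)) xs)) ` C)),
      grade = (\<lambda>i. cls ` {xs. set xs \<subseteq> grade A i \<times> carrier R'})\<rparr>)"


section \<open>Hochschild cohomology in internal degree zero\<close>

text \<open>
  \<open>Hom\<^sub>K(B\<^sup>\<otimes>\<^sup>n, B)\<close> is rendered as the space of \<open>K\<close>-multilinear maps in \<open>n\<close> arguments, given as a list
  of length \<open>n\<close>.
\<close>

definition tuples :: "('b, 'm) ring_scheme \<Rightarrow> nat \<Rightarrow> 'b list set" where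
  "tuples B n = {xs. length xs = n \<and> set xs \<subseteq> carrier B}"

definition hochschild_cochains ::
  "('k, 'm) ring_scheme \<Rightarrow> ('k, 'b) graded_algebra \<Rightarrow> nat \<Rightarrow> ('k, 'b list \<Rightarrow> 'b) module" where
  "hochschild_cochains K B n =
     \<lparr>carrier = {f \<in> extensional (tuples B n) \<inter> (tuples B n \<rightarrow> carrier B).
         (\<forall>xs\<in>tuples B n. \<forall>i<n. \<forall>x\<in>carrier B. \<forall>y\<in>carrier B.
            f (xs[i := x \<oplus>\<^bsub>B\<^esub> y]) = f (xs[i := x]) \<oplus>\<^bsub>B\<^esub> f (xs[i := y])) \<and>
         (\<forall>xs\<in>tuples B n. \<forall>i<n. \<forall>c\<in>carrier K. \<forall>x\<in>carrier B.
            f (xs[i := c \<odot>\<^bsub>B\<^esub> x]) = c \<odot>\<^bsub>B\<^esub> f (xs[i := x])) \<and>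
         (\<forall>xs\<in>tuples B n. \<forall>d. (\<forall>i<n. xs ! i \<in> grade B (d i)) \<longrightarrow> f xs \<in> grade B (\<Sum>i<n. d i))},
      monoid.mult = undefined, one = undefined,
      ring.zero = (\<lambda>xs\<in>tuples B n. \<zero>\<^bsub>B\<^esub>),
      add = (\<lambda>f g. \<lambda>xs\<in>tuples B n. f xs \<oplus>\<^bsub>B\<^esub> g xs),
      smult = (\<lambda>c f. \<lambda>xs\<in>tuples B n. c \<odot>\<^bsub>B\<^esub> f xs)\<rparr>"

definition alternate :: "('b, 'm) ring_scheme \<Rightarrow> nat \<Rightarrow> 'b \<Rightarrow> 'b" where
  "alternate B k x = (if even k then x else \<ominus>\<^bsub>B\<^esub> x)"

text \<open>
  \<open>(df)(x\<^sub>0, \<dots>, x\<^sub>n) = x\<^sub>0 f(x\<^sub>1, \<dots>, x\<^sub>n) + \<Sum> (-1)\<^sup>i\<^sup>+\<^sup>1 f(\<dots>, x\<^sub>i x\<^sub>i\<^sub>+\<^sub>1, \<dots>) + (-1)\<^sup>n\<^sup>+\<^sup>1 f(x\<^sub>0, \<dots>, x\<^sub>n\<^sub>-\<^sub>1) x\<^sub>n\<close>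
\<close>

definition hochschild_differential ::
  "('b, 'm) ring_scheme \<Rightarrow> nat \<Rightarrow> ('b list \<Rightarrow> 'b) \<Rightarrow> ('b list \<Rightarrow> 'b)" where
  "hochschild_differential B n f = (\<lambda>xs\<in>tuples B (Suc n).
     (hd xs \<otimes>\<^bsub>B\<^esub> f (tl xs)) \<oplus>\<^bsub>B\<^esub>
     (\<Oplus>\<^bsub>B\<^esub>i\<in>{..<n}. alternate B (i + 1)
        (f (take i xs @ (xs ! i \<otimes>\<^bsub>B\<^esub> xs ! (i + 1)) # drop (i + 2) xs))) \<oplus>\<^bsub>B\<^esub>
     alternate B (n + 1) (f (butlast xs) \<otimes>\<^bsub>B\<^esub> last xs))"

definition hochschild_cocycles ::
  "('k, 'm) ring_scheme \<Rightarrow> ('k, 'b) graded_algebra \<Rightarrow> nat \<Rightarrow> ('b list \<Rightarrow> 'b) set" where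
  "hochschild_cocycles K B n = {f \<in> carrier (hochschild_cochains K B n).
     hochschild_differential B n f = \<zero>\<^bsub>hochschild_cochains K B (Suc n)\<^esub>}"

definition hochschild_coboundaries ::
  "('k, 'm) ring_scheme \<Rightarrow> ('k, 'b) graded_algebra \<Rightarrow> nat \<Rightarrow> ('b list \<Rightarrow> 'b) set" where
  "hochschild_coboundaries K B n = (case n of
       0 \<Rightarrow> {\<zero>\<^bsub>hochschild_cochains K B 0\<^esub>}
     | Suc k \<Rightarrow> hochschild_differential B k ` carrier (hochschild_cochains K B k))"

definition HH0 ::
  "('k, 'm) ring_scheme \<Rightarrow> ('k, 'b) graded_algebra \<Rightarrow> nat \<Rightarrow> ('k, ('b list \<Rightarrow> 'b) set) module" where
  "HH0 K B n = quotient_module (hochschild_cochains K B n\<lparr>carrier := hochschild_cocycles K B n\<rparr>)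
     (hochschild_coboundaries K B n)"


section \<open>Sheaves and stalks\<close>

text \<open>
  A sheaf is given by its sections and restriction maps; only values on open sets are relevant.
\<close>

definition sheaf_on ::
  "'x topology \<Rightarrow> ('x set \<Rightarrow> 'a set) \<Rightarrow> ('x set \<Rightarrow> 'x set \<Rightarrow> 'a \<Rightarrow> 'a) \<Rightarrow> bool" where
  "sheaf_on T F \<rho> \<longleftrightarrow>
     (\<forall>U V. openin T U \<and> openin T V \<and> V \<subseteq> U \<longrightarrow> \<rho> U V \<in> F U \<rightarrow> F V) \<and>
     (\<forall>U. openin T U \<longrightarrow> (\<forall>s\<in>F U. \<rho> U U s = s)) \<and>
     (\<forall>U V W. openin T U \<and> openin T V \<and> openin T W \<and> V \<subseteq> U \<and> W \<subseteq> V \<longrightarrow>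
        (\<forall>s\<in>F U. \<rho> V W (\<rho> U V s) = \<rho> U W s)) \<and>
     (\<forall>\<U> s. (\<forall>V\<in>\<U>. openin T V \<and> s V \<in> F V) \<and>
        (\<forall>V\<in>\<U>. \<forall>W\<in>\<U>. \<rho> V (V \<inter> W) (s V) = \<rho> W (V \<inter> W) (s W)) \<longrightarrow>
        (\<exists>!t. t \<in> F (\<Union>\<U>) \<and> (\<forall>V\<in>\<U>. \<rho> (\<Union>\<U>) V t = s V)))"

definition germ ::
  "'x topology \<Rightarrow> ('x set \<Rightarrow> ('a, 'm) ring_scheme) \<Rightarrow> ('x set \<Rightarrow> 'x set \<Rightarrow> 'a \<Rightarrow> 'a) \<Rightarrow>
   'x \<Rightarrow> 'x set \<Rightarrow> 'a \<Rightarrow> ('x set \<times> 'a) set" where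
  "germ T F \<rho> x U s = {(V, t). openin T V \<and> x \<in> V \<and> t \<in> carrier (F V) \<and>
     (\<exists>W. openin T W \<and> x \<in> W \<and> W \<subseteq> U \<inter> V \<and> \<rho> U W s = \<rho> V W t)}"

definition germs ::
  "'x topology \<Rightarrow> ('x set \<Rightarrow> ('a, 'm) ring_scheme) \<Rightarrow> ('x set \<Rightarrow> 'x set \<Rightarrow> 'a \<Rightarrow> 'a) \<Rightarrow>
   'x \<Rightarrow> ('x set \<Rightarrow> 'a set) \<Rightarrow> ('x set \<times> 'a) set set" where
  "germs T F \<rho> x G = {germ T F \<rho> x U s | U s. openin T U \<and> x \<in> U \<and> s \<in> G U}"

definition germ_lift ::
  "'x topology \<Rightarrow> ('x set \<Rightarrow> ('a, 'm) ring_scheme) \<Rightarrow> ('x set \<Rightarrow> 'x set \<Rightarrow> 'a \<Rightarrow> 'a) \<Rightarrow> 'x \<Rightarrow>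
   ('x set \<Rightarrow> 'x set \<Rightarrow> 'b \<Rightarrow> 'b) \<Rightarrow> ('x set \<Rightarrow> 'b \<Rightarrow> 'a \<Rightarrow> 'a) \<Rightarrow>
   ('x set \<times> 'b) set \<Rightarrow> ('x set \<times> 'a) set \<Rightarrow> ('x set \<times> 'a) set" where
  "germ_lift T F \<rho> x \<rho>' op C D = the_elem ((\<lambda>((U, s), (V, t)).
     germ T F \<rho> x (U \<inter> V) (op (U \<inter> V) (\<rho>' U (U \<inter> V) s) (\<rho> V (U \<inter> V) t))) ` (C \<times> D))"


section \<open>Locally ringed spaces and schemes\<close>

record ('x, 'r) ringed_space =
  Top :: "'x topology"
  Sec :: "'x set \<Rightarrow> 'r ring"
  Res :: "'x set \<Rightarrow> 'x set \<Rightarrow> 'r \<Rightarrow> 'r"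

definition is_ringed_space :: "('x, 'r, 'm) ringed_space_scheme \<Rightarrow> bool" where
  "is_ringed_space L \<longleftrightarrow>
     (\<forall>U. openin (Top L) U \<longrightarrow> cring (Sec L U)) \<and>
     (\<forall>U V. openin (Top L) U \<and> openin (Top L) V \<and> V \<subseteq> U \<longrightarrow> Res L U V \<in> ring_hom (Sec L U) (Sec L V)) \<and>
     sheaf_on (Top L) (\<lambda>U. carrier (Sec L U)) (Res L)"

definition local_ring :: "('r, 'm) ring_scheme \<Rightarrow> bool" where
  "local_ring R \<longleftrightarrow> cring R \<and> (\<exists>!M. maximalideal M R)"

definition max_ideal :: "('r, 'm) ring_scheme \<Rightarrow> 'r set" where
  "max_ideal R = (THE M. maximalideal M R)"

abbreviation germ_ring ::
  "('x, 'r, 'm) ringed_space_scheme \<Rightarrow> 'x \<Rightarrow> 'x set \<Rightarrow> 'r \<Rightarrow> ('x set \<times> 'r) set" where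
  "germ_ring L \<equiv> germ (Top L) (Sec L) (Res L)"

definition stalk_ring :: "('x, 'r, 'm) ringed_space_scheme \<Rightarrow> 'x \<Rightarrow> ('x set \<times> 'r) set ring" where
  "stalk_ring L x =
     \<lparr>carrier = germs (Top L) (Sec L) (Res L) x (\<lambda>U. carrier (Sec L U)),
      monoid.mult = germ_lift (Top L) (Sec L) (Res L) x (Res L) (\<lambda>U. monoid.mult (Sec L U)),
      one = germ_ring L x (topspace (Top L)) \<one>\<^bsub>Sec L (topspace (Top L))\<^esub>,
      ring.zero = germ_ring L x (topspace (Top L)) \<zero>\<^bsub>Sec L (topspace (Top L))\<^esub>,
      add = germ_lift (Top L) (Sec L) (Res L) x (Res L) (\<lambda>U. add (Sec L U))\<rparr>"

definition is_locally_ringed_space :: "('x, 'r, 'm) ringed_space_scheme \<Rightarrow> bool" where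
  "is_locally_ringed_space L \<longleftrightarrow>
     is_ringed_space L \<and> (\<forall>x\<in>topspace (Top L). local_ring (stalk_ring L x))"

definition preim :: "'x topology \<Rightarrow> ('x \<Rightarrow> 'y) \<Rightarrow> 'y set \<Rightarrow> 'x set" where
  "preim T f V = {x \<in> topspace T. f x \<in> V}"

text \<open>
  A morphism \<open>L \<rightarrow> M\<close> consists of a continuous map \<open>f\<close> and of ring homomorphisms
  \<open>h V : O\<^sub>M(V) \<rightarrow> O\<^sub>L(f\<^sup>-\<^sup>1 V)\<close>.
\<close>

definition stalk_map ::
  "('x, 'r, 'm) ringed_space_scheme \<Rightarrow> ('x \<Rightarrow> 'y) \<Rightarrow> ('y set \<Rightarrow> 's \<Rightarrow> 'r) \<Rightarrow> 'x \<Rightarrow>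
   ('y set \<times> 's) set \<Rightarrow> ('x set \<times> 'r) set" where
  "stalk_map L f h x Z = the_elem ((\<lambda>(V, s). germ_ring L x (preim (Top L) f V) (h V s)) ` Z)"

definition lrs_morphism ::
  "('x, 'r, 'm) ringed_space_scheme \<Rightarrow> ('y, 's, 'n) ringed_space_scheme \<Rightarrow>
   ('x \<Rightarrow> 'y) \<Rightarrow> ('y set \<Rightarrow> 's \<Rightarrow> 'r) \<Rightarrow> bool" where
  "lrs_morphism L M f h \<longleftrightarrow>
     continuous_map (Top L) (Top M) f \<and>
     (\<forall>V. openin (Top M) V \<longrightarrow> h V \<in> ring_hom (Sec M V) (Sec L (preim (Top L) f V))) \<and>
     (\<forall>V W. openin (Top M) V \<and> openin (Top M) W \<and> W \<subseteq> V \<longrightarrow> (\<forall>s\<in>carrier (Sec M V).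
        h W (Res M V W s) = Res L (preim (Top L) f V) (preim (Top L) f W) (h V s))) \<and>
     (\<forall>x\<in>topspace (Top L).
        stalk_map L f h x ` max_ideal (stalk_ring M (f x)) \<subseteq> max_ideal (stalk_ring L x))"

definition lrs_isomorphic ::
  "('x, 'r, 'm) ringed_space_scheme \<Rightarrow> ('y, 's, 'n) ringed_space_scheme \<Rightarrow> bool" where
  "lrs_isomorphic L M \<longleftrightarrow> (\<exists>f h. lrs_morphism L M f h \<and> homeomorphic_map (Top L) (Top M) f \<and>
     (\<forall>V. openin (Top M) V \<longrightarrow>
        bij_betw (h V) (carrier (Sec M V)) (carrier (Sec L (preim (Top L) f V)))))"

definition open_subspace ::
  "('x, 'r, 'm) ringed_space_scheme \<Rightarrow> 'x set \<Rightarrow> ('x, 'r) ringed_space" where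
  "open_subspace L U = \<lparr>Top = subtopology (Top L) U, Sec = Sec L, Res = Res L\<rparr>"

text \<open>Fractions \<open>a/s\<close> in the localization \<open>R\<^sub>P\<close>, and its ring operations.\<close>

definition frac :: "('r, 'm) ring_scheme \<Rightarrow> 'r set \<Rightarrow> 'r \<Rightarrow> 'r \<Rightarrow> ('r \<times> 'r) set" where
  "frac R P a s = {(b, t). b \<in> carrier R \<and> t \<in> carrier R - P \<and>
     (\<exists>u\<in>carrier R - P. u \<otimes>\<^bsub>R\<^esub> (t \<otimes>\<^bsub>R\<^esub> a) = u \<otimes>\<^bsub>R\<^esub> (s \<otimes>\<^bsub>R\<^esub> b))}"

definition frac_mult ::
  "('r, 'm) ring_scheme \<Rightarrow> 'r set \<Rightarrow> ('r \<times> 'r) set \<Rightarrow> ('r \<times> 'r) set \<Rightarrow> ('r \<times> 'r) set" where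
  "frac_mult R P C D = the_elem
     ((\<lambda>((a, s), (b, t)). frac R P (a \<otimes>\<^bsub>R\<^esub> b) (s \<otimes>\<^bsub>R\<^esub> t)) ` (C \<times> D))"

definition frac_add ::
  "('r, 'm) ring_scheme \<Rightarrow> 'r set \<Rightarrow> ('r \<times> 'r) set \<Rightarrow> ('r \<times> 'r) set \<Rightarrow> ('r \<times> 'r) set" where
  "frac_add R P C D = the_elem
     ((\<lambda>((a, s), (b, t)). frac R P ((t \<otimes>\<^bsub>R\<^esub> a) \<oplus>\<^bsub>R\<^esub> (s \<otimes>\<^bsub>R\<^esub> b)) (s \<otimes>\<^bsub>R\<^esub> t)) ` (C \<times> D))"

definition zariski_topology :: "('r, 'm) ring_scheme \<Rightarrow> 'r set topology" where
  "zariski_topology R = topology_generated_by {{P. primeideal P R \<and> f \<notin> P} | f. f \<in> carrier R}"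

text \<open>
  Sections of the structure sheaf over \<open>U\<close> are functions assigning to \<open>P \<in> U\<close> an element of \<open>R\<^sub>P\<close>
  that are locally of the form \<open>a/s\<close>.
\<close>

definition Spec :: "('r, 'm) ring_scheme \<Rightarrow> ('r set, 'r set \<Rightarrow> ('r \<times> 'r) set) ringed_space" where
  "Spec R =
     \<lparr>Top = zariski_topology R,
      Sec = (\<lambda>U. \<lparr>carrier = {\<sigma> \<in> extensional U. \<forall>P\<in>U. \<exists>V a s.
                     openin (zariski_topology R) V \<and> P \<in> V \<and> V \<subseteq> U \<and>
                     a \<in> carrier R \<and> s \<in> carrier R \<and> (\<forall>Q\<in>V. s \<notin> Q \<and> \<sigma> Q = frac R Q a s)},
                  monoid.mult = (\<lambda>\<sigma> \<tau>. \<lambda>P\<in>U. frac_mult R P (\<sigma> P) (\<tau> P)),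
                  one = (\<lambda>P\<in>U. frac R P \<one>\<^bsub>R\<^esub> \<one>\<^bsub>R\<^esub>),
                  ring.zero = (\<lambda>P\<in>U. frac R P \<zero>\<^bsub>R\<^esub> \<one>\<^bsub>R\<^esub>),
                  add = (\<lambda>\<sigma> \<tau>. \<lambda>P\<in>U. frac_add R P (\<sigma> P) (\<tau> P))\<rparr>),
      Res = (\<lambda>U V \<sigma>. restrict \<sigma> V)\<rparr>"

text \<open>
  If \<open>U\<close> is affine then it is the spectrum of the ring of sections over \<open>U\<close>, whose elements have
  type \<open>'r\<close>; so it suffices to look for \<open>R\<close> on this type.
\<close>

definition is_scheme :: "('x, 'r, 'm) ringed_space_scheme \<Rightarrow> bool" where
  "is_scheme L \<longleftrightarrow> is_locally_ringed_space L \<and>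
     (\<forall>x\<in>topspace (Top L). \<exists>U. openin (Top L) U \<and> x \<in> U \<and>
        (\<exists>R :: 'r ring. cring R \<and> lrs_isomorphic (open_subspace L U) (Spec R)))"


section \<open>Schemes over a field\<close>

text \<open>A scheme over \<open>K\<close> carries a structure morphism to \<open>Spec K\<close>.\<close>

record ('k, 'x, 'r) scheme_over = "('x, 'r) ringed_space" +
  base_map :: "'x \<Rightarrow> 'k set"
  base_sheaf_map :: "'k set set \<Rightarrow> ('k set \<Rightarrow> ('k \<times> 'k) set) \<Rightarrow> 'r"

definition is_scheme_over :: "('k, 'm) ring_scheme \<Rightarrow> ('k, 'x, 'r) scheme_over \<Rightarrow> bool" where
  "is_scheme_over K S \<longleftrightarrow>
     is_scheme S \<and> lrs_morphism S (Spec K) (base_map S) (base_sheaf_map S)"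

definition morphism_over ::
  "('k, 'm) ring_scheme \<Rightarrow> ('k, 'y, 's) scheme_over \<Rightarrow> ('k, 'x, 'r) scheme_over \<Rightarrow>
   ('y \<Rightarrow> 'x) \<Rightarrow> ('x set \<Rightarrow> 'r \<Rightarrow> 's) \<Rightarrow> bool" where
  "morphism_over K T S f h \<longleftrightarrow> lrs_morphism T S f h \<and>
     (\<forall>y\<in>topspace (Top T). base_map S (f y) = base_map T y) \<and>
     (\<forall>V. openin (Top (Spec K)) V \<longrightarrow> (\<forall>\<sigma>\<in>carrier (Sec (Spec K) V).
        h (preim (Top S) (base_map S) V) (base_sheaf_map S V \<sigma>) = base_sheaf_map T V \<sigma>))"

text \<open>The composite \<open>K \<rightarrow> \<Gamma>(Spec K, O) \<rightarrow> \<Gamma>(S, O\<^sub>S) \<rightarrow> O\<^sub>S\<^sub>,\<^sub>p\<close>.\<close>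

definition const_germ ::
  "('k, 'm) ring_scheme \<Rightarrow> ('k, 'x, 'r) scheme_over \<Rightarrow> 'x \<Rightarrow> 'k \<Rightarrow> ('x set \<times> 'r) set" where
  "const_germ K S p c = germ_ring S p (topspace (Top S))
     (base_sheaf_map S (topspace (Top (Spec K)))
       (\<lambda>P\<in>topspace (Top (Spec K)). frac K P c \<one>\<^bsub>K\<^esub>))"

definition residue_class ::
  "('x, 'r, 'm) ringed_space_scheme \<Rightarrow> 'x \<Rightarrow> ('x set \<times> 'r) set \<Rightarrow> ('x set \<times> 'r) set set" where
  "residue_class S p f = max_ideal (stalk_ring S p) +>\<^bsub>stalk_ring S p\<^esub> f"

definition residue_field ::
  "('x, 'r, 'm) ringed_space_scheme \<Rightarrow> 'x \<Rightarrow> ('x set \<times> 'r) set set ring" where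
  "residue_field S p = stalk_ring S p Quot max_ideal (stalk_ring S p)"

definition closed_K_point :: "('k, 'm) ring_scheme \<Rightarrow> ('k, 'x, 'r) scheme_over \<Rightarrow> 'x \<Rightarrow> bool" where
  "closed_K_point K S p \<longleftrightarrow> p \<in> topspace (Top S) \<and> closedin (Top S) {p} \<and>
     bij_betw (\<lambda>c. residue_class S p (const_germ K S p c)) (carrier K) (carrier (residue_field S p))"

definition square_max_ideal ::
  "('x, 'r, 'm) ringed_space_scheme \<Rightarrow> 'x \<Rightarrow> ('x set \<times> 'r) set set" where
  "square_max_ideal S p =
     ideal_prod (stalk_ring S p) (max_ideal (stalk_ring S p)) (max_ideal (stalk_ring S p))"

definition cotangent_space ::
  "('k, 'm) ring_scheme \<Rightarrow> ('k, 'x, 'r) scheme_over \<Rightarrow> 'x \<Rightarrow> ('k, ('x set \<times> 'r) set set) module" where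
  "cotangent_space K S p = (let R = stalk_ring S p in
     quotient_module
       \<lparr>carrier = max_ideal R, monoid.mult = monoid.mult R, one = one R, ring.zero = ring.zero R, add = add R,
        smult = (\<lambda>c f. const_germ K S p c \<otimes>\<^bsub>R\<^esub> f)\<rparr>
       (square_max_ideal S p))"

definition tangent_space ::
  "('k, 'm) ring_scheme \<Rightarrow> ('k, 'x, 'r) scheme_over \<Rightarrow> 'x \<Rightarrow>
   ('k, ('x set \<times> 'r) set set \<Rightarrow> 'k) module" where
  "tangent_space K S p = dual_space K (cotangent_space K S p)"

definition value_at ::
  "('k, 'm) ring_scheme \<Rightarrow> ('k, 'x, 'r) scheme_over \<Rightarrow> 'x \<Rightarrow> ('x set \<times> 'r) set \<Rightarrow> 'k" where
  "value_at K S p f =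
     (THE c. c \<in> carrier K \<and> residue_class S p (const_germ K S p c) = residue_class S p f)"

text \<open>
  The homomorphism \<open>O\<^sub>S\<^sub>,\<^sub>p \<rightarrow> K[\<epsilon>]\<close>, \<open>f \<mapsto> f(p) + v(f - f(p)) \<epsilon>\<close> of the morphism \<open>Spec K[\<epsilon>] \<rightarrow> S\<close>
  attached to a tangent vector \<open>v\<close>.
\<close>

definition tangent_hom ::
  "('k, 'm) ring_scheme \<Rightarrow> ('k, 'x, 'r) scheme_over \<Rightarrow> 'x \<Rightarrow>
   (('x set \<times> 'r) set set \<Rightarrow> 'k) \<Rightarrow> ('x set \<times> 'r) set \<Rightarrow> 'k \<times> 'k" where
  "tangent_hom K S p v f = (value_at K S p f,
     v (square_max_ideal S p +>\<^bsub>stalk_ring S p\<^esub>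
          (f \<ominus>\<^bsub>stalk_ring S p\<^esub> const_germ K S p (value_at K S p f))))"

text \<open>
  The differential \<open>T\<^sub>qT \<rightarrow> T\<^sub>f\<^sub>(\<^sub>q\<^sub>)S\<close> of a morphism \<open>(f, h) : T \<rightarrow> S\<close> over \<open>K\<close>.
\<close>

definition tangent_map ::
  "('k, 'm) ring_scheme \<Rightarrow> ('k, 'y, 's) scheme_over \<Rightarrow> ('k, 'x, 'r) scheme_over \<Rightarrow>
   ('y \<Rightarrow> 'x) \<Rightarrow> ('x set \<Rightarrow> 'r \<Rightarrow> 's) \<Rightarrow> 'y \<Rightarrow>
   (('y set \<times> 's) set set \<Rightarrow> 'k) \<Rightarrow> (('x set \<times> 'r) set set \<Rightarrow> 'k)" where
  "tangent_map K T S f h q v = (\<lambda>Z\<in>carrier (cotangent_space K S (f q)).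
     v (the_elem ((\<lambda>z. square_max_ideal T q +>\<^bsub>stalk_ring T q\<^esub> stalk_map T f h q z) ` Z)))"


section \<open>Flat families of graded algebras\<close>

text \<open>
  A sheaf of algebras together with subsheaves of homogeneous sections: \<open>grade (ASec A U) i\<close> consists
  of the sections over \<open>U\<close> that are homogeneous of degree \<open>i\<close>.
\<close>

record ('x, 'r, 'a) algebra_sheaf =
  ASec :: "'x set \<Rightarrow> ('r, 'a) graded_algebra"
  ARes :: "'x set \<Rightarrow> 'x set \<Rightarrow> 'a \<Rightarrow> 'a"

text \<open>
  The last two conditions say that the sheaf is the direct sum of its homogeneous subsheaves.  Since a
  direct sum of sheaves is the sheafification of the sectionwise direct sum, sections are finite sums
  of homogeneous ones only locally.
\<close>

definition is_graded_algebra_sheaf ::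
  "('x, 'r, 'm) ringed_space_scheme \<Rightarrow> ('x, 'r, 'a) algebra_sheaf \<Rightarrow> bool" where
  "is_graded_algebra_sheaf S A \<longleftrightarrow>
     (\<forall>U. openin (Top S) U \<longrightarrow> assoc_algebra (Sec S U) (ASec A U)) \<and>
     (\<forall>U V. openin (Top S) U \<and> openin (Top S) V \<and> V \<subseteq> U \<longrightarrow>
        ARes A U V \<in> ring_hom (ASec A U) (ASec A V) \<and>
        (\<forall>r\<in>carrier (Sec S U). \<forall>a\<in>carrier (ASec A U).
           ARes A U V (r \<odot>\<^bsub>ASec A U\<^esub> a) = Res S U V r \<odot>\<^bsub>ASec A V\<^esub> ARes A U V a)) \<and>
     sheaf_on (Top S) (\<lambda>U. carrier (ASec A U)) (ARes A) \<and>
     (\<forall>i. sheaf_on (Top S) (\<lambda>U. grade (ASec A U) i) (ARes A)) \<and>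
     (\<forall>U. openin (Top S) U \<longrightarrow>
        (\<forall>i. submodule (grade (ASec A U) i) (Sec S U) (ASec A U)) \<and>
        \<one>\<^bsub>ASec A U\<^esub> \<in> grade (ASec A U) 0 \<and>
        (\<forall>i j. \<forall>a\<in>grade (ASec A U) i. \<forall>b\<in>grade (ASec A U) j.
           a \<otimes>\<^bsub>ASec A U\<^esub> b \<in> grade (ASec A U) (i + j))) \<and>
     (\<forall>U J a. openin (Top S) U \<and> finite J \<and> (\<forall>i\<in>J. a i \<in> grade (ASec A U) i) \<and>
        (\<Oplus>\<^bsub>ASec A U\<^esub>i\<in>J. a i) = \<zero>\<^bsub>ASec A U\<^esub> \<longrightarrow> (\<forall>i\<in>J. a i = \<zero>\<^bsub>ASec A U\<^esub>)) \<and>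
     (\<forall>U. openin (Top S) U \<longrightarrow> (\<forall>s\<in>carrier (ASec A U). \<forall>x\<in>U.
        \<exists>V J a. openin (Top S) V \<and> x \<in> V \<and> V \<subseteq> U \<and> finite J \<and> (\<forall>i\<in>J. a i \<in> grade (ASec A V) i) \<and>
          ARes A U V s = (\<Oplus>\<^bsub>ASec A V\<^esub>i\<in>J. a i)))"

abbreviation germ_alg ::
  "('x, 'r, 'm) ringed_space_scheme \<Rightarrow> ('x, 'r, 'a) algebra_sheaf \<Rightarrow> 'x \<Rightarrow> 'x set \<Rightarrow> 'a \<Rightarrow>
   ('x set \<times> 'a) set" where
  "germ_alg S A \<equiv> germ (Top S) (ASec A) (ARes A)"

definition stalk_algebra ::
  "('x, 'r, 'm) ringed_space_scheme \<Rightarrow> ('x, 'r, 'a) algebra_sheaf \<Rightarrow> 'x \<Rightarrow>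
   (('x set \<times> 'r) set, ('x set \<times> 'a) set) graded_algebra" where
  "stalk_algebra S A x =
     \<lparr>carrier = germs (Top S) (ASec A) (ARes A) x (\<lambda>U. carrier (ASec A U)),
      monoid.mult = germ_lift (Top S) (ASec A) (ARes A) x (ARes A) (\<lambda>U. monoid.mult (ASec A U)),
      one = germ_alg S A x (topspace (Top S)) \<one>\<^bsub>ASec A (topspace (Top S))\<^esub>,
      ring.zero = germ_alg S A x (topspace (Top S)) \<zero>\<^bsub>ASec A (topspace (Top S))\<^esub>,
      add = germ_lift (Top S) (ASec A) (ARes A) x (ARes A) (\<lambda>U. add (ASec A U)),
      smult = germ_lift (Top S) (ASec A) (ARes A) x (Res S) (\<lambda>U. smult (ASec A U)),
      grade = (\<lambda>i. germs (Top S) (ASec A) (ARes A) x (\<lambda>U. grade (ASec A U) i))\<rparr>"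

definition flat_family ::
  "('x, 'r, 'm) ringed_space_scheme \<Rightarrow> ('x, 'r, 'a) algebra_sheaf \<Rightarrow> bool" where
  "flat_family S A \<longleftrightarrow> is_graded_algebra_sheaf S A \<and>
     (\<forall>x\<in>topspace (Top S). flat_module (stalk_ring S x) (stalk_algebra S A x))"

text \<open>The fibre at \<open>p\<close>, as a \<open>K\<close>-algebra through \<open>K \<rightarrow> \<kappa>(p)\<close>.\<close>

definition fibre ::
  "('k, 'm) ring_scheme \<Rightarrow> ('k, 'x, 'r) scheme_over \<Rightarrow> ('x, 'r, 'a) algebra_sheaf \<Rightarrow> 'x \<Rightarrow>
   ('k, (('x set \<times> 'a) set \<times> ('x set \<times> 'r) set set) list set) graded_algebra" where
  "fibre K S A p = restrict_scalars (\<lambda>c. residue_class S p (const_germ K S p c))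
     (base_change (stalk_ring S p) (residue_class S p) (residue_field S p) (stalk_algebra S A p))"


section \<open>The Kodaira--Spencer map\<close>

text \<open>
  The pullback of \<open>A\<close> along \<open>Spec K[\<epsilon>] \<rightarrow> S\<close> attached to \<open>v \<in> T\<^sub>pS\<close>: a first order deformation of the
  fibre.
\<close>

definition deformation ::
  "('k, 'm) ring_scheme \<Rightarrow> ('k, 'x, 'r) scheme_over \<Rightarrow> ('x, 'r, 'a) algebra_sheaf \<Rightarrow> 'x \<Rightarrow>
   (('x set \<times> 'r) set set \<Rightarrow> 'k) \<Rightarrow>
   ('k \<times> 'k, (('x set \<times> 'a) set \<times> ('k \<times> 'k)) list set) graded_algebra" where
  "deformation K S A p v =
     base_change (stalk_ring S p) (tangent_hom K S p v) (dual_numbers K) (stalk_algebra S A p)"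

text \<open>Reduction modulo \<open>\<epsilon>\<close> of the deformation, \<open>a \<otimes> (x + y \<epsilon>) \<mapsto> a \<otimes> x\<close>.\<close>

definition reduction ::
  "('k, 'm) ring_scheme \<Rightarrow> ('k, 'x, 'r) scheme_over \<Rightarrow> ('x, 'r, 'a) algebra_sheaf \<Rightarrow> 'x \<Rightarrow>
   (('x set \<times> 'a) set \<times> ('k \<times> 'k)) list set \<Rightarrow>
   (('x set \<times> 'a) set \<times> ('x set \<times> 'r) set set) list set" where
  "reduction K S A p C = the_elem ((\<lambda>xs.
     tensor_class (stalk_ring S p) (stalk_algebra S A p)
       (ring_via (residue_class S p) (residue_field S p))
       (map (\<lambda>(a, (x, y)). (a, residue_class S p (const_germ K S p x))) xs)) ` C)"

text \<open>
  The class of this deformation.  A degree-preserving \<open>K\<close>-linear section \<open>s\<close> of the reduction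
  identifies the deformation with \<open>A\<^sub>p \<oplus> \<epsilon> A\<^sub>p\<close>; its product becomes \<open>a * b = a b + \<epsilon> \<mu>(a, b)\<close> and
  \<open>\<mu>\<close> is a Hochschild cocycle.  Elements of Hochschild cohomology are cosets, and the class is the set
  of the \<open>\<mu>\<close> for all choices of \<open>s\<close>; that this set is exactly one such coset needs proof.
\<close>

definition kodaira_spencer ::
  "('k, 'm) ring_scheme \<Rightarrow> ('k, 'x, 'r) scheme_over \<Rightarrow> ('x, 'r, 'a) algebra_sheaf \<Rightarrow> 'x \<Rightarrow>
   (('x set \<times> 'r) set set \<Rightarrow> 'k) \<Rightarrow>
   ((('x set \<times> 'a) set \<times> ('x set \<times> 'r) set set) list set list \<Rightarrow>
    (('x set \<times> 'a) set \<times> ('x set \<times> 'r) set set) list set) set" where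
  "kodaira_spencer K S A p v = (let B = fibre K S A p; D = deformation K S A p v in
     {\<mu> \<in> carrier (hochschild_cochains K B 2).
        \<exists>s \<in> linear_maps K B (restrict_scalars (\<lambda>c. (c, \<zero>\<^bsub>K\<^esub>)) D).
          (\<forall>i. s ` grade B i \<subseteq> grade D i) \<and>
          (\<forall>a\<in>carrier B. reduction K S A p (s a) = a) \<and>
          (\<forall>a\<in>carrier B. \<forall>b\<in>carrier B.
             s a \<otimes>\<^bsub>D\<^esub> s b = s (a \<otimes>\<^bsub>B\<^esub> b) \<oplus>\<^bsub>D\<^esub> ((\<zero>\<^bsub>K\<^esub>, \<one>\<^bsub>K\<^esub>) \<odot>\<^bsub>D\<^esub> s (\<mu> [a, b])))})"


section \<open>Pullbacks of families\<close>

definition stalk_map_alg ::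
  "('y, 's, 'm) ringed_space_scheme \<Rightarrow> ('y, 's, 'b) algebra_sheaf \<Rightarrow> ('y \<Rightarrow> 'x) \<Rightarrow>
   ('x set \<Rightarrow> 'a \<Rightarrow> 'b) \<Rightarrow> 'y \<Rightarrow> ('x set \<times> 'a) set \<Rightarrow> ('y set \<times> 'b) set" where
  "stalk_map_alg T A' f g y Z =
     the_elem ((\<lambda>(V, a). germ_alg T A' y (preim (Top T) f V) (g V a)) ` Z)"

text \<open>
  Maps \<open>g V : A(V) \<rightarrow> A'(f\<^sup>-\<^sup>1 V)\<close> that exhibit \<open>A'\<close> as the pullback of \<open>A\<close> along \<open>(f, h) : T \<rightarrow> S\<close>: the
  induced map \<open>f\<^sup>*A \<rightarrow> A'\<close> is an isomorphism, where \<open>f\<^sup>*A\<close> is the sheaf tensor product of \<open>f\<^sup>-\<^sup>1A\<close> and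
  \<open>O\<^sub>T\<close> over \<open>f\<^sup>-\<^sup>1O\<^sub>S\<close>.  This is expressed on stalks, the stalk of \<open>f\<^sup>*A\<close> at \<open>y\<close> being the base change
  of the stalk of \<open>A\<close> at \<open>f(y)\<close>.
\<close>

definition is_pullback ::
  "('k, 'y, 's) scheme_over \<Rightarrow> ('y, 's, 'b) algebra_sheaf \<Rightarrow>
   ('k, 'x, 'r) scheme_over \<Rightarrow> ('x, 'r, 'a) algebra_sheaf \<Rightarrow>
   ('y \<Rightarrow> 'x) \<Rightarrow> ('x set \<Rightarrow> 'r \<Rightarrow> 's) \<Rightarrow> ('x set \<Rightarrow> 'a \<Rightarrow> 'b) \<Rightarrow> bool" where
  "is_pullback T A' S A f h g \<longleftrightarrow>
     (\<forall>V. openin (Top S) V \<longrightarrow> (let W = preim (Top T) f V in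
        g V \<in> ring_hom (ASec A V) (ASec A' W) \<and>
        (\<forall>r\<in>carrier (Sec S V). \<forall>a\<in>carrier (ASec A V).
           g V (r \<odot>\<^bsub>ASec A V\<^esub> a) = h V r \<odot>\<^bsub>ASec A' W\<^esub> g V a) \<and>
        (\<forall>i. g V ` grade (ASec A V) i \<subseteq> grade (ASec A' W) i))) \<and>
     (\<forall>V W. openin (Top S) V \<and> openin (Top S) W \<and> W \<subseteq> V \<longrightarrow> (\<forall>a\<in>carrier (ASec A V).
        g W (ARes A V W a) = ARes A' (preim (Top T) f V) (preim (Top T) f W) (g V a))) \<and>
     (\<forall>y\<in>topspace (Top T). bij_betw
        (\<lambda>C. the_elem ((\<lambda>xs. foldr
           (\<lambda>(a, r) b. (r \<odot>\<^bsub>stalk_algebra T A' y\<^esub> stalk_map_alg T A' f g y a) \<oplus>\<^bsub>stalk_algebra T A' y\<^esub> b)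
           xs \<zero>\<^bsub>stalk_algebra T A' y\<^esub>) ` C))
        (carrier (base_change (stalk_ring S (f y)) (stalk_map T f h y) (stalk_ring T y)
           (stalk_algebra S A (f y))))
        (carrier (stalk_algebra T A' y)))"

text \<open>The induced isomorphism from the fibre of \<open>A\<close> at \<open>f(q)\<close> to the fibre of \<open>A'\<close> at \<open>q\<close>.\<close>

definition fibre_map ::
  "('k, 'y, 's) scheme_over \<Rightarrow> ('y, 's, 'b) algebra_sheaf \<Rightarrow>
   ('y \<Rightarrow> 'x) \<Rightarrow> ('x set \<Rightarrow> 'r \<Rightarrow> 's) \<Rightarrow> ('x set \<Rightarrow> 'a \<Rightarrow> 'b) \<Rightarrow> 'y \<Rightarrow>
   (('x set \<times> 'a) set \<times> ('x set \<times> 'r) set set) list set \<Rightarrow>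
   (('y set \<times> 'b) set \<times> ('y set \<times> 's) set set) list set" where
  "fibre_map T A' f h g q C = the_elem ((\<lambda>xs.
     tensor_class (stalk_ring T q) (stalk_algebra T A' q)
       (ring_via (residue_class T q) (residue_field T q))
       (map (\<lambda>(a, c). (stalk_map_alg T A' f g q a,
          the_elem ((\<lambda>z. residue_class T q (stalk_map T f h q z)) ` c))) xs)) ` C)"

text \<open>Transport of a class in \<open>HH\<^sup>n\<close> along an isomorphism \<open>\<phi> : B \<rightarrow> B'\<close>.\<close>

definition HH_transport ::
  "('k, 'b) graded_algebra \<Rightarrow> ('k, 'c) graded_algebra \<Rightarrow> ('b \<Rightarrow> 'c) \<Rightarrow> nat \<Rightarrow>
   ('b list \<Rightarrow> 'b) set \<Rightarrow> ('c list \<Rightarrow> 'c) set" where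
  "HH_transport B B' \<phi> n C =
     (\<lambda>\<mu>. \<lambda>xs\<in>tuples B' n. \<phi> (\<mu> (map (inv_into (carrier B) \<phi>) xs))) ` C"

end

theory Submission
  imports Defs
begin

text \<open>
  Let \<open>R\<close> be the local ring at \<open>p\<close>, with maximal ideal \<open>m\<close>, let \<open>M\<close> be the stalk of \<open>A\<close>, and let \<open>B = M/mM\<close>
  be the fibre.  Every element of the deformation attached to \<open>v\<close> is \<open>a \<otimes> 1 + b \<otimes> \<epsilon>\<close> with \<open>a\<close>, \<open>b\<close> in \<open>M\<close>.
  Flatness makes \<open>\<Sum> r\<^sub>k a\<^sub>k \<mapsto> \<Sum> v(r\<^sub>k) [a\<^sub>k]\<close> a well defined map \<open>\<Lambda>\<^sub>v : mM \<rightarrow> B\<close>, and \<open>x \<otimes> 1 = \<epsilon> \<Lambda>\<^sub>v x\<close>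
  for \<open>x\<close> in \<open>mM\<close>.  A graded \<open>K\<close>-linear lift \<open>\<sigma> : B \<rightarrow> M\<close> of the projection, which exists by Zorn's lemma and does
  not depend on \<open>v\<close>, gives a section \<open>b \<mapsto> \<sigma> b \<otimes> 1\<close> whose cocycle is \<open>\<Lambda>\<^sub>v (\<sigma> a \<sigma> b - \<sigma> (a b))\<close>; the other
  sections change it by all coboundaries.  This formula is linear in \<open>v\<close>.  For a pullback, \<open>\<sigma>\<close> induces a
  lift for the pulled back family, and the two cocycles correspond.
\<close>

section \<open>Tensor products\<close>

text \<open>Flatness acts through a single injection. The line \<open>K \<epsilon>\<close> is an
  \<open>R\<close>-submodule of the dual numbers and a copy of the residue field; tensoring its
  inclusion with \<open>M\<close> embeds the fibre into the deformation. Two presentations of one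
  \<open>x\<close> in \<open>m M\<close> produce the same \<open>x \<otimes> 1\<close>, and the
  embedding reads the value of \<open>\<Lambda>\<^sub>v\<close> off that element. The lift takes
  values in \<open>M\<close> and not in a deformation, because deformations for different
  \<open>v\<close> cannot be compared; with \<open>\<sigma>\<close> fixed, \<open>v\<close> occurs
  in \<open>\<Lambda>\<^sub>v\<close> alone. Linearity of \<open>\<sigma>\<close> can only be asked
  over the constants \<open>\<iota> c\<close>, which exist because the point is
  \<open>K\<close>-rational. The class is by definition the set of all cocycles of all sections, so
  an arbitrary section has to be normalised: its value at \<open>b\<close> is
  \<open>a \<otimes> 1 + t \<otimes> \<epsilon>\<close> with \<open>a\<close> merely congruent to
  \<open>\<sigma> b\<close> modulo \<open>m M\<close>, and the difference is moved into the
  \<open>\<epsilon>\<close> part by \<open>\<Lambda>\<^sub>v\<close>. Tensor products, stalks and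
  fractions are sets of representatives, and operations on them are \<open>the_elem\<close> of an
  image; each use therefore starts with independence of representatives.\<close>

lemma the_elem_const:
  assumes "x \<in> A" and "\<And>y. y \<in> A \<Longrightarrow> f y = f x"
  shows "the_elem (f ` A) = f x"
proof -
  have "f ` A = {f x}" using assms by blast
  then show ?thesis by simp
qed

locale tensor = M: module R M + N: module R N
  for R :: "('r, 'k) ring_scheme" and M :: "('r, 'm, 'p) module_scheme"
    and N :: "('r, 'n, 'q) module_scheme"
begin

abbreviation eq where "eq \<equiv> tensor_eq R M N"
abbreviation cls where "cls \<equiv> tensor_class R M N"
abbreviation prs where "prs \<equiv> carrier M \<times> carrier N"

lemma eq_set: "eq xs ys \<Longrightarrow> set xs \<subseteq> prs \<and> set ys \<subseteq> prs"
  by (induction rule: tensor_eq.induct) auto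

lemma eq_set1: "eq xs ys \<Longrightarrow> set xs \<subseteq> prs" using eq_set by blast
lemma eq_set2: "eq xs ys \<Longrightarrow> set ys \<subseteq> prs" using eq_set by blast

lemma cls_eq: "set xs \<subseteq> prs \<Longrightarrow> cls xs = cls ys \<longleftrightarrow> eq xs ys"
  unfolding tensor_class_def
  by (auto intro: tensor_eq.refl tensor_eq.sym tensor_eq.trans)

lemma cls_eqI: "eq xs ys \<Longrightarrow> cls xs = cls ys"
  using cls_eq eq_set1 by blast

lemma mem_cls: "xs \<in> cls ys \<longleftrightarrow> eq ys xs"
  by (simp add: tensor_class_def)

lemma cls_self: "set xs \<subseteq> prs \<Longrightarrow> xs \<in> cls xs"
  by (simp add: mem_cls tensor_eq.refl)

lemma tensor_carrierE:
  assumes "C \<in> tensor_carrier R M N"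
  obtains xs where "set xs \<subseteq> prs" "C = cls xs"
  using assms unfolding tensor_carrier_def by blast

lemma the_elem_cls:
  assumes "set xs \<subseteq> prs" and "\<And>ys. eq xs ys \<Longrightarrow> f ys = f xs"
  shows "the_elem (f ` cls xs) = f xs"
  by (rule the_elem_const[OF cls_self]) (use assms in \<open>auto simp: mem_cls\<close>)

lemma the_elem_cls2:
  assumes "set xs \<subseteq> prs" "set ys \<subseteq> prs"
    and "\<And>xs' ys'. eq xs xs' \<Longrightarrow> eq ys ys' \<Longrightarrow> f xs' ys' = f xs ys"
  shows "the_elem ((\<lambda>(xs, ys). f xs ys) ` (cls xs \<times> cls ys)) = f xs ys"
proof -
  have "the_elem ((\<lambda>(xs, ys). f xs ys) ` (cls xs \<times> cls ys)) = (\<lambda>(xs, ys). f xs ys) (xs, ys)"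
  proof (rule the_elem_const)
    show "(xs, ys) \<in> cls xs \<times> cls ys" using assms(1,2) by (intro SigmaI cls_self)
  next
    fix p assume "p \<in> cls xs \<times> cls ys"
    then show "(case p of (xs, ys) \<Rightarrow> f xs ys) = (case (xs, ys) of (xs, ys) \<Rightarrow> f xs ys)"
      using assms(3) by (cases p) (simp add: mem_cls)
  qed
  then show ?thesis by simp
qed

text \<open>The generator \<open>commute\<close> exchanges two blocks. The head of \<open>xs\<close>
  is moved past the entries that precede its occurrence in \<open>ys\<close>, which leaves a shorter
  pair of lists for the induction.\<close>

lemma eq_perm:
  assumes "mset xs = mset ys" "set xs \<subseteq> prs"
  shows "eq xs ys"
  using assms
proof (induction xs arbitrary: ys)
  case Nil
  then show ?case by (simp add: tensor_eq.refl)
next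
  case (Cons x xs)
  then obtain y1 y2 where ys: "ys = y1 @ x # y2"
    by (metis list.set_intros(1) mset_eq_setD split_list)
  with Cons.prems have m: "mset xs = mset (y1 @ y2)" by simp
  then have e: "eq xs (y1 @ y2)" using Cons by simp
  have x: "set [x] \<subseteq> prs" using Cons.prems by auto
  have y: "set y1 \<subseteq> prs" "set y2 \<subseteq> prs" using eq_set2[OF e] by auto
  have "eq ([x] @ xs) ([x] @ (y1 @ y2))" using e tensor_eq.append tensor_eq.refl[OF x] by blast
  moreover have "eq (([x] @ y1) @ y2) ((y1 @ [x]) @ y2)"
    using x y by (intro tensor_eq.append tensor_eq.commute tensor_eq.refl)
  ultimately show ?case using ys tensor_eq.trans by fastforce
qed

text \<open>The rule \<open>zero\<close> speaks of the left factor only. A zero on the right is the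
  scalar 0 times itself, and \<open>balanced\<close> carries that scalar to the left.\<close>

lemma zero_right:
  assumes "x \<in> carrier M" shows "eq [(x, \<zero>\<^bsub>N\<^esub>)] []"
proof -
  have "eq [(\<zero>\<^bsub>R\<^esub> \<odot>\<^bsub>M\<^esub> x, \<zero>\<^bsub>N\<^esub>)] [(x, \<zero>\<^bsub>R\<^esub> \<odot>\<^bsub>N\<^esub> \<zero>\<^bsub>N\<^esub>)]"
    using assms by (intro tensor_eq.balanced) auto
  then have "eq [(\<zero>\<^bsub>M\<^esub>, \<zero>\<^bsub>N\<^esub>)] [(x, \<zero>\<^bsub>N\<^esub>)]" using assms by simp
  then show ?thesis using tensor_eq.sym tensor_eq.trans tensor_eq.zero N.zero_closed by metis
qed

text \<open>Allowing bilinearity modulo a subgroup \<open>I\<close> avoids forming the quotient of the target by \<open>I\<close>.\<close>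

lemma eq_sum:
  fixes H (structure)
  assumes "abelian_group H" "additive_subgroup I H"
    and cl: "\<And>x y. x \<in> carrier M \<Longrightarrow> y \<in> carrier N \<Longrightarrow> f x y \<in> carrier H"
    and l: "\<And>x x' y. x \<in> carrier M \<Longrightarrow> x' \<in> carrier M \<Longrightarrow> y \<in> carrier N \<Longrightarrow>
      f (x \<oplus>\<^bsub>M\<^esub> x') y \<ominus> (f x y \<oplus> f x' y) \<in> I"
    and r: "\<And>x y y'. x \<in> carrier M \<Longrightarrow> y \<in> carrier N \<Longrightarrow> y' \<in> carrier N \<Longrightarrow>
      f x (y \<oplus>\<^bsub>N\<^esub> y') \<ominus> (f x y \<oplus> f x y') \<in> I"
    and b: "\<And>s x y. s \<in> carrier R \<Longrightarrow> x \<in> carrier M \<Longrightarrow> y \<in> carrier N \<Longrightarrow>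
      f (s \<odot>\<^bsub>M\<^esub> x) y \<ominus> f x (s \<odot>\<^bsub>N\<^esub> y) \<in> I"
    and "eq xs ys"
  shows "foldr (\<lambda>(x, y) h. f x y \<oplus> h) xs \<zero> \<ominus> foldr (\<lambda>(x, y) h. f x y \<oplus> h) ys \<zero> \<in> I"
proof -
  interpret H: abelian_group H by fact
  interpret I: additive_subgroup I H by fact
  let ?s = "\<lambda>xs. foldr (\<lambda>(x, y) h. f x y \<oplus> h) xs \<zero>"
  have sc: "set zs \<subseteq> prs \<Longrightarrow> ?s zs \<in> carrier H" for zs
    by (induction zs) (auto intro: cl)
  have sa: "set zs \<subseteq> prs \<Longrightarrow> set zs' \<subseteq> prs \<Longrightarrow> ?s (zs @ zs') = ?s zs \<oplus> ?s zs'" for zs zs'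
    by (induction zs) (auto simp: sc cl H.a_assoc)
  have IH: "i \<in> I \<Longrightarrow> i \<in> carrier H" for i using I.a_subset by blast
  show ?thesis using \<open>eq xs ys\<close>
  proof (induction rule: tensor_eq.induct)
    case (refl xs)
    then show ?case using sc by (simp add: H.r_neg H.minus_eq)
  next
    case (sym xs ys)
    have "\<ominus> (?s xs \<ominus> ?s ys) \<in> I" using sym I.a_inv_closed by blast
    moreover have "\<ominus> (?s xs \<ominus> ?s ys) = ?s ys \<ominus> ?s xs"
      using sc eq_set[OF sym(1)] by (simp add: H.minus_add H.minus_eq H.a_comm)
    ultimately show ?case by simp
  next
    case (trans xs ys zs)
    have c: "?s xs \<in> carrier H" "?s ys \<in> carrier H" "?s zs \<in> carrier H"
      using sc eq_set[OF trans(1)] eq_set[OF trans(2)] by auto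
    have "(?s xs \<ominus> ?s ys) \<oplus> (?s ys \<ominus> ?s zs) \<in> I" using trans I.a_closed by blast
    moreover have "(?s xs \<ominus> ?s ys) \<oplus> (?s ys \<ominus> ?s zs) = ?s xs \<ominus> ?s zs"
      using c by (simp add: H.minus_eq H.a_assoc H.r_neg1 H.r_neg2)
    ultimately show ?case by simp
  next
    case (append xs ys xs' ys')
    have c: "?s xs \<in> carrier H" "?s ys \<in> carrier H" "?s xs' \<in> carrier H" "?s ys' \<in> carrier H"
      using sc eq_set[OF append(1)] eq_set[OF append(2)] by auto
    have "(?s xs \<ominus> ?s ys) \<oplus> (?s xs' \<ominus> ?s ys') \<in> I" using append I.a_closed by blast
    moreover have "(?s xs \<ominus> ?s ys) \<oplus> (?s xs' \<ominus> ?s ys') = (?s xs \<oplus> ?s xs') \<ominus> (?s ys \<oplus> ?s ys')"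
      using c by (simp add: H.minus_eq H.minus_add H.a_ac)
    ultimately show ?case
      using sa eq_set[OF append(1)] eq_set[OF append(2)] by auto
  next
    case (commute xs ys)
    then have "?s (xs @ ys) = ?s (ys @ xs)" "?s (ys @ xs) \<in> carrier H"
      using sc sa[of xs ys] sa[of ys xs] H.a_comm by auto
    then show ?case by (simp only: H.minus_eq H.r_neg I.zero_closed)
  next
    case (add_left x x' y)
    then show ?case using l[of x x' y] by (simp add: cl H.minus_eq)
  next
    case (add_right x y y')
    then show ?case using r[of x y y'] by (simp add: cl H.minus_eq)
  next
    case (balanced s x y)
    then show ?case using b[of s x y] by (simp add: cl H.minus_eq)
  next
    \<comment> \<open>Additivity at 0 + 0 = 0 puts \<open>- f 0 y\<close> into \<open>I\<close>, and
      \<open>I\<close> is closed under negation.\<close>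
    case (zero y)
    have c: "f \<zero>\<^bsub>M\<^esub> y \<in> carrier H" using zero cl by simp
    have "f \<zero>\<^bsub>M\<^esub> y \<ominus> (f \<zero>\<^bsub>M\<^esub> y \<oplus> f \<zero>\<^bsub>M\<^esub> y) \<in> I" using l[of "\<zero>\<^bsub>M\<^esub>" "\<zero>\<^bsub>M\<^esub>" y] zero by simp
    moreover have "f \<zero>\<^bsub>M\<^esub> y \<ominus> (f \<zero>\<^bsub>M\<^esub> y \<oplus> f \<zero>\<^bsub>M\<^esub> y) = \<ominus> f \<zero>\<^bsub>M\<^esub> y"
      using c by (simp add: H.minus_eq H.minus_add H.r_neg1 H.r_neg2)
    ultimately have "\<ominus> (\<ominus> f \<zero>\<^bsub>M\<^esub> y) \<in> I" using I.a_inv_closed by metis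
    then show ?case using c by (simp add: H.minus_eq)
  qed
qed

text \<open>The case \<open>I = {0}\<close> of \<open>eq_sum\<close>: strictly bilinear, balanced
  maps into an abelian group factor through the tensor product.\<close>

lemma eq_sum_eq:
  fixes H (structure)
  assumes "abelian_group H"
    and cl: "\<And>x y. x \<in> carrier M \<Longrightarrow> y \<in> carrier N \<Longrightarrow> f x y \<in> carrier H"
    and l: "\<And>x x' y. x \<in> carrier M \<Longrightarrow> x' \<in> carrier M \<Longrightarrow> y \<in> carrier N \<Longrightarrow>
      f (x \<oplus>\<^bsub>M\<^esub> x') y = (f x y \<oplus> f x' y)"
    and r: "\<And>x y y'. x \<in> carrier M \<Longrightarrow> y \<in> carrier N \<Longrightarrow> y' \<in> carrier N \<Longrightarrow>
      f x (y \<oplus>\<^bsub>N\<^esub> y') = (f x y \<oplus> f x y')"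
    and b: "\<And>s x y. s \<in> carrier R \<Longrightarrow> x \<in> carrier M \<Longrightarrow> y \<in> carrier N \<Longrightarrow>
      f (s \<odot>\<^bsub>M\<^esub> x) y = f x (s \<odot>\<^bsub>N\<^esub> y)"
    and "eq xs ys"
  shows "foldr (\<lambda>(x, y) h. f x y \<oplus> h) xs \<zero> = foldr (\<lambda>(x, y) h. f x y \<oplus> h) ys \<zero>"
proof -
  interpret H: abelian_group H by fact
  have "additive_subgroup {\<zero>} H"
    by (simp add: additive_subgroup.intro H.a_group subgroup.intro H.add.triv_subgroup)
  then have *: "foldr (\<lambda>(x, y) h. f x y \<oplus> h) xs \<zero> \<ominus> foldr (\<lambda>(x, y) h. f x y \<oplus> h) ys \<zero> \<in> {\<zero>}"
    by (rule eq_sum[OF \<open>abelian_group H\<close> _ cl _ _ _ \<open>eq xs ys\<close>])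
      (use cl l r b in \<open>simp_all add: H.r_neg H.minus_eq\<close>)
  have sc: "set zs \<subseteq> prs \<Longrightarrow> foldr (\<lambda>(x, y) h. f x y \<oplus> h) zs \<zero> \<in> carrier H" for zs
    by (induction zs) (auto intro: cl)
  let ?s = "\<lambda>xs. foldr (\<lambda>(x, y) h. f x y \<oplus> h) xs \<zero>"
  have c: "?s xs \<in> carrier H" "?s ys \<in> carrier H" using sc eq_set[OF \<open>eq xs ys\<close>] by auto
  have "?s xs \<oplus> \<ominus> ?s ys = \<zero>" using * by (simp only: H.minus_eq singleton_iff)
  then have "\<ominus> (\<ominus> ?s ys) = ?s xs" by (intro H.minus_equality) (simp_all only: c H.a_inv_closed)
  then show ?thesis by (simp only: c H.minus_minus)
qed

end

text \<open>Functoriality for two maps that are semilinear along the same change of scalars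
  \<open>h\<close>: every generator of the congruence goes to a generator of the same kind. Most
  well-definedness claims below are instances, with \<open>h\<close> the identity or the map of
  local rings of a pullback.\<close>

lemma tensor_eq_map:
  assumes "tensor R M N" "tensor R' M' N'"
    and f: "\<And>x. x \<in> carrier M \<Longrightarrow> f x \<in> carrier M'"
      "\<And>x x'. x \<in> carrier M \<Longrightarrow> x' \<in> carrier M \<Longrightarrow> f (x \<oplus>\<^bsub>M\<^esub> x') = f x \<oplus>\<^bsub>M'\<^esub> f x'"
      "\<And>r x. r \<in> carrier R \<Longrightarrow> x \<in> carrier M \<Longrightarrow> f (r \<odot>\<^bsub>M\<^esub> x) = h r \<odot>\<^bsub>M'\<^esub> f x"
    and g: "\<And>x. x \<in> carrier N \<Longrightarrow> g x \<in> carrier N'"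
      "\<And>x x'. x \<in> carrier N \<Longrightarrow> x' \<in> carrier N \<Longrightarrow> g (x \<oplus>\<^bsub>N\<^esub> x') = g x \<oplus>\<^bsub>N'\<^esub> g x'"
      "\<And>r x. r \<in> carrier R \<Longrightarrow> x \<in> carrier N \<Longrightarrow> g (r \<odot>\<^bsub>N\<^esub> x) = h r \<odot>\<^bsub>N'\<^esub> g x"
    and h: "\<And>r. r \<in> carrier R \<Longrightarrow> h r \<in> carrier R'"
    and "tensor_eq R M N xs ys"
  shows "tensor_eq R' M' N' (map (\<lambda>(x, y). (f x, g y)) xs) (map (\<lambda>(x, y). (f x, g y)) ys)"
proof -
  interpret T: tensor R M N by fact
  interpret T': tensor R' M' N' by fact
  have st: "set xs \<subseteq> T.prs \<Longrightarrow> set (map (\<lambda>(x, y). (f x, g y)) xs) \<subseteq> T'.prs" for xs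
    using f(1) g(1) by auto
  show ?thesis using \<open>T.eq xs ys\<close>
  proof (induction rule: tensor_eq.induct)
    case (refl xs) then show ?case using st tensor_eq.refl by blast
  next
    case (sym xs ys) then show ?case using tensor_eq.sym by blast
  next
    case (trans xs ys zs) then show ?case using tensor_eq.trans by blast
  next
    case (append xs ys xs' ys') then show ?case using tensor_eq.append by fastforce
  next
    case (commute xs ys)
    then show ?case using tensor_eq.commute[OF st st, of xs ys] by simp
  next
    case (add_left x x' y)
    then show ?case using tensor_eq.add_left[of "f x" M' "f x'" "g y" N'] f g by auto
  next
    case (add_right x y y')
    then show ?case using tensor_eq.add_right[of "f x" M' "g y" N' "g y'"] f g by auto
  next
    case (balanced r x y)
    then show ?case using tensor_eq.balanced[of "h r" R' "f x" M' "g y" N'] f g h by auto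
  next
    case (zero y)
    have z: "f \<zero>\<^bsub>M\<^esub> \<in> carrier M'" using f by simp
    have "f \<zero>\<^bsub>M\<^esub> \<oplus>\<^bsub>M'\<^esub> f \<zero>\<^bsub>M\<^esub> = f \<zero>\<^bsub>M\<^esub>" using f(2)[of "\<zero>\<^bsub>M\<^esub>" "\<zero>\<^bsub>M\<^esub>"] by simp
    then have "f \<zero>\<^bsub>M\<^esub> = \<zero>\<^bsub>M'\<^esub>" using z T'.M.add.r_cancel_one by blast
    then show ?case using zero g(1) tensor_eq.zero[of "g y" N'] by simp
  qed
qed

lemma module_surj_image:
  assumes "module R N" and "carrier N' = e ` carrier N" and "e \<zero>\<^bsub>N\<^esub> = \<zero>\<^bsub>N'\<^esub>"
    and add: "\<And>x y. x \<in> carrier N \<Longrightarrow> y \<in> carrier N \<Longrightarrow> e x \<oplus>\<^bsub>N'\<^esub> e y = e (x \<oplus>\<^bsub>N\<^esub> y)"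
    and smult: "\<And>c x. c \<in> carrier R' \<Longrightarrow> x \<in> carrier N \<Longrightarrow> c \<odot>\<^bsub>N'\<^esub> e x = e (h c \<odot>\<^bsub>N\<^esub> x)"
    and "h \<in> ring_hom R' R" "cring R'"
  shows "module R' N'"
proof -
  interpret module R N by fact
  interpret R': cring R' by fact
  have h: "c \<in> carrier R' \<Longrightarrow> h c \<in> carrier R" for c using ring_hom_closed[OF assms(6)] .
  show ?thesis
  proof (rule moduleI[OF \<open>cring R'\<close> abelian_groupI], unfold assms(2), goal_cases)
    case (6 x)
    then obtain y where "y \<in> carrier N" "x = e y" by auto
    then have "e (\<ominus>\<^bsub>N\<^esub> y) \<oplus>\<^bsub>N'\<^esub> x = \<zero>\<^bsub>N'\<^esub>" by (simp add: add M.l_neg assms(3))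
    with \<open>y \<in> carrier N\<close> show ?case by blast
  next
    case 2 then show ?case using assms(3) M.zero_closed by (metis imageI)
  next
    case (4 x y)
    then obtain a b where "a \<in> carrier N" "b \<in> carrier N" "x = e a" "y = e b" by auto
    then show ?case using M.a_comm[of a b] by (simp add: add)
  qed (auto simp: add smult h M.a_assoc smult_l_distr smult_r_distr smult_assoc1
     ring_hom_add[OF assms(6)] ring_hom_mult[OF assms(6)] ring_hom_one[OF assms(6)]
     simp flip: assms(3))
qed

lemma ring_surj_image:
  assumes "ring N" and "abelian_group N'" and "carrier N' = e ` carrier N" and "e \<one>\<^bsub>N\<^esub> = \<one>\<^bsub>N'\<^esub>"
    and add: "\<And>x y. x \<in> carrier N \<Longrightarrow> y \<in> carrier N \<Longrightarrow> e x \<oplus>\<^bsub>N'\<^esub> e y = e (x \<oplus>\<^bsub>N\<^esub> y)"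
    and mult: "\<And>x y. x \<in> carrier N \<Longrightarrow> y \<in> carrier N \<Longrightarrow> e x \<otimes>\<^bsub>N'\<^esub> e y = e (x \<otimes>\<^bsub>N\<^esub> y)"
  shows "ring N'"
proof -
  interpret ring N by fact
  show ?thesis
    by (rule ringI[OF \<open>abelian_group N'\<close> monoidI], unfold assms(3))
      (auto simp: add mult m_assoc l_distr r_distr simp flip: assms(4))
qed

text \<open>
  The modules in the definition of flatness are carried by lists of ring elements; here the two
  modules are arbitrary, as long as they embed into that type.
\<close>

lemma flat_module_inj:
  fixes R :: "('r, 'k) ring_scheme" and M :: "('r, 'm, 'p) module_scheme"
    and N :: "('r, 'n, 'q) module_scheme" and N' :: "('r, 'n1, 'q1) module_scheme"
    and e :: "'n \<Rightarrow> 'r list" and e' :: "'n1 \<Rightarrow> 'r list"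
  assumes flat: "flat_module R M" and t: "tensor R M N" and t': "tensor R M N'"
    and e: "inj_on e (carrier N)" and e': "inj_on e' (carrier N')"
    and f: "f \<in> linear_maps R N N'" "inj_on f (carrier N)"
    and eq: "tensor_eq R M N' (map (\<lambda>(x, y). (x, f y)) xs) (map (\<lambda>(x, y). (x, f y)) ys)"
    and xs: "set xs \<subseteq> carrier M \<times> carrier N" and ys: "set ys \<subseteq> carrier M \<times> carrier N"
  shows "tensor_eq R M N xs ys"
proof -
  interpret T: tensor R M N by fact
  interpret T': tensor R M N' by fact
  define tr :: "('r, 'n, 'q) module_scheme \<Rightarrow> ('n \<Rightarrow> 'r list) \<Rightarrow> ('r, 'r list) module" where
    "tr = (\<lambda>N e. \<lparr>carrier = e ` carrier N, monoid.mult = undefined, one = undefined,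
      ring.zero = e \<zero>\<^bsub>N\<^esub>,
      add = (\<lambda>a b. e (inv_into (carrier N) e a \<oplus>\<^bsub>N\<^esub> inv_into (carrier N) e b)),
      smult = (\<lambda>r a. e (r \<odot>\<^bsub>N\<^esub> inv_into (carrier N) e a))\<rparr>)"
  \<comment> \<open>The same construction a second time: a name defined inside a proof is
    monomorphic, and the two modules have carriers of different types.\<close>
  define tr' :: "('r, 'n1, 'q1) module_scheme \<Rightarrow> ('n1 \<Rightarrow> 'r list) \<Rightarrow> ('r, 'r list) module" where
    "tr' = (\<lambda>N e. \<lparr>carrier = e ` carrier N, monoid.mult = undefined, one = undefined,
      ring.zero = e \<zero>\<^bsub>N\<^esub>,
      add = (\<lambda>a b. e (inv_into (carrier N) e a \<oplus>\<^bsub>N\<^esub> inv_into (carrier N) e b)),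
      smult = (\<lambda>r a. e (r \<odot>\<^bsub>N\<^esub> inv_into (carrier N) e a))\<rparr>)"
  let ?N = "tr N e" and ?N' = "tr' N' e'"
  note i = inv_into_f_f[OF e] note i' = inv_into_f_f[OF e']
  have m: "module R ?N"
    by (rule module_surj_image[OF T.N.module_axioms, of _ e _ id]) (auto simp: tr_def i T.M.R.is_cring ring_hom_def)
  have m': "module R ?N'"
    by (rule module_surj_image[OF T'.N.module_axioms, of _ e' _ id]) (auto simp: tr'_def i' T.M.R.is_cring ring_hom_def)
  interpret U: tensor R M ?N using T.M.module_axioms m by (simp add: tensor_def)
  interpret U': tensor R M ?N' using T.M.module_axioms m' by (simp add: tensor_def)
  let ?f = "e' \<circ> f \<circ> inv_into (carrier N) e"
  have f': "f y \<in> carrier N'" if "y \<in> carrier N" for y using f that by (auto simp: linear_maps_def)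
  have lf: "?f \<in> linear_maps R ?N ?N'"
    using f' f by (auto simp: linear_maps_def tr_def tr'_def i i')
  have jf: "inj_on ?f (carrier ?N)"
  proof (rule comp_inj_on[OF inj_on_inv_into comp_inj_on])
    show "inj_on f (inv_into (carrier N) e ` carrier ?N)"
      using f(2) by (rule inj_on_subset) (auto simp: tr_def i)
    show "inj_on e' (f ` inv_into (carrier N) e ` carrier ?N)"
      using e' by (rule inj_on_subset) (auto simp: tr_def i f')
  qed (simp add: tr_def)
  have inj: "inj_on (\<lambda>C. the_elem ((\<lambda>xs. U'.cls (map (\<lambda>(x, y). (x, ?f y)) xs)) ` C))
     (tensor_carrier R M ?N)"
    using flat[unfolded flat_module_def, THEN spec[of _ ?N], THEN spec[of _ ?N'], THEN spec[of _ ?f], THEN mp]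
      m m' lf jf by (simp only:)
  let ?xs = "map (\<lambda>(x, y). (x, e y)) xs" and ?ys = "map (\<lambda>(x, y). (x, e y)) ys"
  have xs': "set ?xs \<subseteq> U.prs" and ys': "set ?ys \<subseteq> U.prs" using xs ys by (auto simp: tr_def)
  have map_f: "U'.eq (map (\<lambda>(x, y). (x, ?f y)) zs) (map (\<lambda>(x, y). (x, ?f y)) zs')" if "U.eq zs zs'" for zs zs'
    by (rule tensor_eq_map[OF U.tensor_axioms U'.tensor_axioms _ _ _ _ _ _ _ that, where h = id])
      (use lf in \<open>auto simp: linear_maps_def\<close>)
  have val: "the_elem ((\<lambda>xs. U'.cls (map (\<lambda>(x, y). (x, ?f y)) xs)) ` U.cls zs) =
    U'.cls (map (\<lambda>(x, y). (x, ?f y)) zs)" if "set zs \<subseteq> U.prs" for zs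
    by (rule U.the_elem_cls[OF that], rule U'.cls_eqI[OF tensor_eq.sym[OF map_f]])
  have push: "U'.eq (map (\<lambda>(x, y). (x, e' y)) zs) (map (\<lambda>(x, y). (x, e' y)) zs')" if "T'.eq zs zs'" for zs zs'
    by (rule tensor_eq_map[OF T'.tensor_axioms U'.tensor_axioms _ _ _ _ _ _ _ that, where h = id])
      (auto simp: tr'_def i')
  have comp: "map (\<lambda>(x, y). (x, ?f y)) (map (\<lambda>(x, y). (x, e y)) zs) = map (\<lambda>(x, y). (x, e' y)) (map (\<lambda>(x, y). (x, f y)) zs)"
    if "set zs \<subseteq> T.prs" for zs using that by (auto simp: i)
  have c: "U'.cls (map (\<lambda>(x, y). (x, ?f y)) ?xs) = U'.cls (map (\<lambda>(x, y). (x, ?f y)) ?ys)"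
    by (simp only: comp[OF xs] comp[OF ys] U'.cls_eqI[OF push[OF eq]])
  have "U.cls ?xs \<in> tensor_carrier R M ?N" "U.cls ?ys \<in> tensor_carrier R M ?N"
    using xs' ys' unfolding tensor_carrier_def by blast+
  then have "U.cls ?xs = U.cls ?ys"
    by (rule inj_onD[OF inj HOL.trans[OF val[OF xs'] HOL.trans[OF c val[OF ys', symmetric]]]])
  then have ex: "U.eq ?xs ?ys" by (rule iffD1[OF U.cls_eq[OF xs']])
  \<comment> \<open>The equality obtained between the copies is carried back along the inverse of
    \<open>e\<close>.\<close>
  have "T.eq (map (\<lambda>(x, y). (x, inv_into (carrier N) e y)) ?xs) (map (\<lambda>(x, y). (x, inv_into (carrier N) e y)) ?ys)"
    by (rule tensor_eq_map[OF U.tensor_axioms T.tensor_axioms _ _ _ _ _ _ _ ex, where h = id])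
      (auto simp: tr_def i)
  moreover have "map (\<lambda>(x, y). (x, inv_into (carrier N) e y)) (map (\<lambda>(x, y). (x, e y)) zs) = zs"
    if "set zs \<subseteq> T.prs" for zs
    using that by (induction zs) (auto simp: i)
  note this[OF xs] this[OF ys]
  ultimately show ?thesis by (simp only:)
qed

section \<open>Base change\<close>

text \<open>Exchange of a double sum. It allows the product of two formal sums to be expanded along
  either factor.\<close>

lemma mset_concat_swap:
  "mset (concat (map (\<lambda>x. map (f x) ys) xs)) = mset (concat (map (\<lambda>y. map (\<lambda>x. f x y) xs) ys))"
proof (induction xs)
  case Nil
  then show ?case by (induction ys) auto
next
  case (Cons x xs)
  have "mset (concat (map (\<lambda>y. f x y # map (\<lambda>x. f x y) xs) zs)) =
    mset (map (f x) zs) + mset (concat (map (\<lambda>y. map (\<lambda>x. f x y) xs) zs))" for zs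
    by (induction zs) auto
  with Cons show ?case by simp
qed

lemma module_ring_via:
  assumes "cring R" "cring R'" "\<phi> \<in> ring_hom R R'"
  shows "module R (ring_via \<phi> R')"
proof -
  interpret R: cring R by fact
  interpret R': cring R' by fact
  note h = ring_hom_closed[OF assms(3)] ring_hom_add[OF assms(3)] ring_hom_mult[OF assms(3)]
     ring_hom_one[OF assms(3)]
  have "\<exists>y\<in>carrier R'. y \<oplus>\<^bsub>R'\<^esub> x = \<zero>\<^bsub>R'\<^esub>" if "x \<in> carrier R'" for x
    using that R'.l_neg by blast
  then show ?thesis
    by (intro moduleI[OF assms(1)] abelian_groupI)
      (auto simp: ring_via_def h R'.a_ac R'.l_distr R'.r_distr R'.m_assoc)
qed

locale base_changed =
  R: cring R + R': cring R' + M: ring M + A: module R M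
  for R :: "('r, 'k) ring_scheme" and R' :: "('s, 'l) ring_scheme" and M :: "('r, 'a) graded_algebra" +
  fixes \<phi> :: "'r \<Rightarrow> 's"
  assumes hom: "\<phi> \<in> ring_hom R R'"
    and smult_mult: "r \<in> carrier R \<Longrightarrow> x \<in> carrier M \<Longrightarrow> y \<in> carrier M \<Longrightarrow>
      (r \<odot>\<^bsub>M\<^esub> x) \<otimes>\<^bsub>M\<^esub> y = r \<odot>\<^bsub>M\<^esub> (x \<otimes>\<^bsub>M\<^esub> y)"
    and mult_smult: "r \<in> carrier R \<Longrightarrow> x \<in> carrier M \<Longrightarrow> y \<in> carrier M \<Longrightarrow>
      x \<otimes>\<^bsub>M\<^esub> (r \<odot>\<^bsub>M\<^esub> y) = r \<odot>\<^bsub>M\<^esub> (x \<otimes>\<^bsub>M\<^esub> y)"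
begin

abbreviation "N \<equiv> ring_via \<phi> R'"
abbreviation "D \<equiv> base_change R \<phi> R' M"

lemma N_sel [simp]: "carrier N = carrier R'" "add N = add R'" "\<zero>\<^bsub>N\<^esub> = \<zero>\<^bsub>R'\<^esub>"
  "r \<odot>\<^bsub>N\<^esub> x = \<phi> r \<otimes>\<^bsub>R'\<^esub> x"
  by (simp_all add: ring_via_def)

sublocale T: tensor R M N
  using module_ring_via[OF R.is_cring R'.is_cring hom] A.module_axioms by (simp add: tensor_def)

lemma hom_closed: "r \<in> carrier R \<Longrightarrow> \<phi> r \<in> carrier R'" using ring_hom_closed[OF hom] .

text \<open>Multiplication by one fixed simple tensor, from either side, is an instance of
  \<open>tensor_eq_map\<close>. The product is therefore expanded by rows to replace
  \<open>ys\<close>, reordered by columns to replace \<open>xs\<close>, and reordered back.\<close>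

lemma eq_mult:
  assumes xy: "T.eq xs xs'" "T.eq ys ys'"
  shows "T.eq (concat (map (\<lambda>(a, b). map (\<lambda>(a', b'). (a \<otimes>\<^bsub>M\<^esub> a', b \<otimes>\<^bsub>R'\<^esub> b')) ys) xs))
     (concat (map (\<lambda>(a, b). map (\<lambda>(a', b'). (a \<otimes>\<^bsub>M\<^esub> a', b \<otimes>\<^bsub>R'\<^esub> b')) ys') xs'))"
proof -
  have r: "T.eq (map (\<lambda>(a', b'). (a \<otimes>\<^bsub>M\<^esub> a', b \<otimes>\<^bsub>R'\<^esub> b')) ys) (map (\<lambda>(a', b'). (a \<otimes>\<^bsub>M\<^esub> a', b \<otimes>\<^bsub>R'\<^esub> b')) ys')"
    if "a \<in> carrier M" "b \<in> carrier R'" for a b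
    by (rule tensor_eq_map[OF T.tensor_axioms T.tensor_axioms _ _ _ _ _ _ _ xy(2), where h = "\<lambda>r. r"])
      (use that in \<open>auto simp: M.r_distr R'.r_distr mult_smult R'.m_lcomm hom_closed\<close>)
  have l: "T.eq (map (\<lambda>(a, b). (a \<otimes>\<^bsub>M\<^esub> a', b \<otimes>\<^bsub>R'\<^esub> b')) xs) (map (\<lambda>(a, b). (a \<otimes>\<^bsub>M\<^esub> a', b \<otimes>\<^bsub>R'\<^esub> b')) xs')"
    if "a' \<in> carrier M" "b' \<in> carrier R'" for a' b'
    by (rule tensor_eq_map[OF T.tensor_axioms T.tensor_axioms _ _ _ _ _ _ _ xy(1), where h = "\<lambda>r. r"])
      (use that in \<open>auto simp: M.l_distr R'.l_distr smult_mult R'.m_assoc hom_closed\<close>)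
  let ?f = "\<lambda>x y. (fst x \<otimes>\<^bsub>M\<^esub> fst y, snd x \<otimes>\<^bsub>R'\<^esub> snd y)"
  let ?p = "\<lambda>xs ys. concat (map (\<lambda>x. map (?f x) ys) xs)"
  let ?q = "\<lambda>xs ys. concat (map (\<lambda>y. map (\<lambda>x. ?f x y) xs) ys)"
  note st = T.eq_set[OF xy(1), simplified] T.eq_set[OF xy(2), simplified]
  have p: "T.eq (?p zs ys) (?p zs ys')" if "set zs \<subseteq> T.prs" for zs
    using that
  proof (induction zs)
    case (Cons z zs)
    then show ?case using r[of "fst z" "snd z"] tensor_eq.append by (auto simp: case_prod_unfold)
  qed (simp add: tensor_eq.refl)
  have q: "T.eq (?q xs zs) (?q xs' zs)" if "set zs \<subseteq> T.prs" for zs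
    using that
  proof (induction zs)
    case (Cons z zs)
    then show ?case using l[of "fst z" "snd z"] tensor_eq.append by (auto simp: case_prod_unfold)
  qed (simp add: tensor_eq.refl)
  have in_prs: "set (?p us vs) \<subseteq> T.prs" "set (?q us vs) \<subseteq> T.prs" if "set us \<subseteq> T.prs" "set vs \<subseteq> T.prs" for us vs
    using that by (fastforce simp: image_subset_iff)+
  have 1: "T.eq (?p xs ys) (?p xs ys')" using p st by simp
  have 2: "T.eq (?p xs ys') (?q xs ys')"
    by (rule T.eq_perm[OF mset_concat_swap in_prs(1)]) (use st in simp_all)
  have 3: "T.eq (?q xs ys') (?q xs' ys')" using q st by simp
  have 4: "T.eq (?p xs' ys') (?q xs' ys')"
    by (rule T.eq_perm[OF mset_concat_swap in_prs(1)]) (use st in simp_all)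
  have "T.eq (?p xs ys) (?p xs' ys')"
    by (rule tensor_eq.trans[OF 1 tensor_eq.trans[OF 2 tensor_eq.trans[OF 3 tensor_eq.sym[OF 4]]]])
  then show ?thesis by (simp add: case_prod_unfold)
qed

lemma carrier_D: "carrier D = tensor_carrier R M N"
  by (simp add: base_change_def Let_def)

lemma cls_closed: "set xs \<subseteq> carrier M \<times> carrier R' \<Longrightarrow> T.cls xs \<in> carrier D"
  unfolding carrier_D tensor_carrier_def by auto

lemma mult_cls:
  assumes "set xs \<subseteq> carrier M \<times> carrier R'" "set ys \<subseteq> carrier M \<times> carrier R'"
  shows "T.cls xs \<otimes>\<^bsub>D\<^esub> T.cls ys =
    T.cls (concat (map (\<lambda>(a, b). map (\<lambda>(a', b'). (a \<otimes>\<^bsub>M\<^esub> a', b \<otimes>\<^bsub>R'\<^esub> b')) ys) xs))"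
  using assms
  by (simp add: base_change_def Let_def)
    (rule T.the_elem_cls2, auto intro!: T.cls_eqI eq_mult intro: tensor_eq.sym)

lemma add_cls:
  assumes "set xs \<subseteq> carrier M \<times> carrier R'" "set ys \<subseteq> carrier M \<times> carrier R'"
  shows "T.cls xs \<oplus>\<^bsub>D\<^esub> T.cls ys = T.cls (xs @ ys)"
  using assms
  by (simp add: base_change_def Let_def)
    (rule T.the_elem_cls2, auto intro!: T.cls_eqI tensor_eq.append intro: tensor_eq.sym)

lemma eq_smult:
  assumes "c \<in> carrier R'" "T.eq xs ys"
  shows "T.eq (map (\<lambda>(a, b). (a, c \<otimes>\<^bsub>R'\<^esub> b)) xs) (map (\<lambda>(a, b). (a, c \<otimes>\<^bsub>R'\<^esub> b)) ys)"
  by (rule tensor_eq_map[OF T.tensor_axioms T.tensor_axioms _ _ _ _ _ _ _ assms(2), where h = "\<lambda>r. r"])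
    (use assms in \<open>auto simp: R'.r_distr R'.m_lcomm hom_closed\<close>)

lemma smult_cls:
  assumes "c \<in> carrier R'" "set xs \<subseteq> carrier M \<times> carrier R'"
  shows "c \<odot>\<^bsub>D\<^esub> T.cls xs = T.cls (map (\<lambda>(a, b). (a, c \<otimes>\<^bsub>R'\<^esub> b)) xs)"
  using assms
  by (simp add: base_change_def Let_def)
    (rule T.the_elem_cls, auto intro!: T.cls_eqI eq_smult intro: tensor_eq.sym)

lemma zero_D: "\<zero>\<^bsub>D\<^esub> = T.cls []"
  by (simp add: base_change_def Let_def)

lemma one_D: "\<one>\<^bsub>D\<^esub> = T.cls [(\<one>\<^bsub>M\<^esub>, \<one>\<^bsub>R'\<^esub>)]"
  by (simp add: base_change_def Let_def)

lemma grade_D: "grade D i = T.cls ` {xs. set xs \<subseteq> grade M i \<times> carrier R'}"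
  by (simp add: base_change_def Let_def)

end

section \<open>Graded algebras over a pointed local ring\<close>

text \<open>
  A graded algebra \<open>M\<close> over a local ring \<open>R\<close> with maximal ideal \<open>m\<close> and residue field \<open>K\<close>, the
  map \<open>val\<close> being the evaluation \<open>R \<rightarrow> K\<close> and \<open>\<iota>\<close> the inclusion of the constants.  The grading is
  given by its projections \<open>P i\<close>.
\<close>

locale pointed_algebra =
  K: field K + R: cring R + M: ring M + A: module R M
  for K :: "'k ring" and R :: "'r ring" and M :: "('r, 'a) graded_algebra" +
  fixes m :: "'r set" and \<iota> :: "'k \<Rightarrow> 'r" and val :: "'r \<Rightarrow> 'k" and P :: "int \<Rightarrow> 'a \<Rightarrow> 'a"
  assumes ideal: "ideal m R"
    and iota: "\<iota> \<in> ring_hom K R" and val: "val \<in> ring_hom R K"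
    and val_iota: "c \<in> carrier K \<Longrightarrow> val (\<iota> c) = c"
    and m_iff: "r \<in> carrier R \<Longrightarrow> r \<in> m \<longleftrightarrow> val r = \<zero>\<^bsub>K\<^esub>"
    and smult_mult: "r \<in> carrier R \<Longrightarrow> x \<in> carrier M \<Longrightarrow> y \<in> carrier M \<Longrightarrow>
      (r \<odot>\<^bsub>M\<^esub> x) \<otimes>\<^bsub>M\<^esub> y = r \<odot>\<^bsub>M\<^esub> (x \<otimes>\<^bsub>M\<^esub> y)"
    and mult_smult: "r \<in> carrier R \<Longrightarrow> x \<in> carrier M \<Longrightarrow> y \<in> carrier M \<Longrightarrow>
      x \<otimes>\<^bsub>M\<^esub> (r \<odot>\<^bsub>M\<^esub> y) = r \<odot>\<^bsub>M\<^esub> (x \<otimes>\<^bsub>M\<^esub> y)"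
    and P_closed: "x \<in> carrier M \<Longrightarrow> P i x \<in> carrier M"
    and P_add: "x \<in> carrier M \<Longrightarrow> y \<in> carrier M \<Longrightarrow> P i (x \<oplus>\<^bsub>M\<^esub> y) = P i x \<oplus>\<^bsub>M\<^esub> P i y"
    and P_smult: "r \<in> carrier R \<Longrightarrow> x \<in> carrier M \<Longrightarrow> P i (r \<odot>\<^bsub>M\<^esub> x) = r \<odot>\<^bsub>M\<^esub> P i x"
    and P_P: "x \<in> carrier M \<Longrightarrow> P i (P j x) = (if i = j then P j x else \<zero>\<^bsub>M\<^esub>)"
    and grade_M: "grade M i = {x \<in> carrier M. P i x = x}"
    and grade_gen: "x \<in> carrier M \<Longrightarrow> \<exists>xs. set xs \<subseteq> (\<Union>i. grade M i) \<and> x = foldr (\<oplus>\<^bsub>M\<^esub>) xs \<zero>\<^bsub>M\<^esub>"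
    and grade_mult: "x \<in> grade M i \<Longrightarrow> y \<in> grade M j \<Longrightarrow> x \<otimes>\<^bsub>M\<^esub> y \<in> grade M (i + j)"
begin

sublocale I: ideal m R by (rule ideal)

abbreviation rc where "rc \<equiv> a_r_coset R m"

sublocale BC: base_changed R "R Quot m" M rc
  by (intro base_changed.intro base_changed_axioms.intro)
    (auto intro: R.is_cring M.ring_axioms A.module_axioms I.quotient_is_cring
      I.rcos_ring_hom smult_mult mult_smult)

abbreviation B where "B \<equiv> restrict_scalars (\<lambda>c. rc (\<iota> c)) (base_change R rc (R Quot m) M)"

lemma B_sel [simp]:
  "carrier B = carrier BC.D" "x \<oplus>\<^bsub>B\<^esub> y = x \<oplus>\<^bsub>BC.D\<^esub> y" "x \<otimes>\<^bsub>B\<^esub> y = x \<otimes>\<^bsub>BC.D\<^esub> y" "\<zero>\<^bsub>B\<^esub> = \<zero>\<^bsub>BC.D\<^esub>"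
  "\<one>\<^bsub>B\<^esub> = \<one>\<^bsub>BC.D\<^esub>" "grade B i = grade BC.D i" "c \<odot>\<^bsub>B\<^esub> x = rc (\<iota> c) \<odot>\<^bsub>BC.D\<^esub> x"
  by (simp_all add: restrict_scalars_def)

lemmas iota_simps = ring_hom_closed[OF iota] ring_hom_add[OF iota] ring_hom_mult[OF iota] ring_hom_one[OF iota]
lemmas val_simps = ring_hom_closed[OF val] ring_hom_add[OF val] ring_hom_mult[OF val] ring_hom_one[OF val]
lemmas rc_simps = ring_hom_closed[OF I.rcos_ring_hom] ring_hom_add[OF I.rcos_ring_hom]
  ring_hom_mult[OF I.rcos_ring_hom] ring_hom_one[OF I.rcos_ring_hom]

lemma m_closed: "r \<in> m \<Longrightarrow> r \<in> carrier R" using I.a_subset by blast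

lemma val_zero: "val \<zero>\<^bsub>R\<^esub> = \<zero>\<^bsub>K\<^esub>"
  using m_iff[OF R.zero_closed] I.zero_closed by blast

lemma iota_zero: "\<iota> \<zero>\<^bsub>K\<^esub> = \<zero>\<^bsub>R\<^esub>"
proof -
  have "\<iota> \<zero>\<^bsub>K\<^esub> \<oplus>\<^bsub>R\<^esub> \<iota> \<zero>\<^bsub>K\<^esub> = \<iota> \<zero>\<^bsub>K\<^esub>" by (simp flip: iota_simps(2-4))
  then show ?thesis using R.add.r_cancel_one iota_simps(1) K.zero_closed by blast
qed

lemma val_minus: "r \<in> carrier R \<Longrightarrow> s \<in> carrier R \<Longrightarrow> val (r \<ominus>\<^bsub>R\<^esub> s) = val r \<ominus>\<^bsub>K\<^esub> val s"
proof -
  assume rs: "r \<in> carrier R" "s \<in> carrier R"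
  then have "val (r \<ominus>\<^bsub>R\<^esub> s) \<oplus>\<^bsub>K\<^esub> val s = val r"
    by (simp add: R.minus_eq R.a_assoc R.l_neg flip: val_simps(2-4))
  with rs show ?thesis by (metis K.add.inv_solve_right K.minus_eq R.minus_closed val_simps(1))
qed

lemma sub_const: "r \<in> carrier R \<Longrightarrow> r \<ominus>\<^bsub>R\<^esub> \<iota> (val r) \<in> m"
  by (subst m_iff) (simp_all add: val_simps iota_simps val_minus val_iota K.r_neg K.minus_eq)

lemma rc_eq: "r \<in> carrier R \<Longrightarrow> s \<in> carrier R \<Longrightarrow> rc r = rc s \<longleftrightarrow> val r = val s"
  by (simp add: R.quotient_eq_iff_same_a_r_cos[OF ideal, symmetric] m_iff val_minus val_simps)

text \<open>Elements of the residue field are cosets of \<open>m\<close>; this is the inverse of the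
  isomorphism from \<open>K\<close> onto it. All members of a coset have the same value, so the
  choice is harmless.\<close>

definition vC where "vC C = val (SOME r. r \<in> C)"

lemma vC_rc: "r \<in> carrier R \<Longrightarrow> vC (rc r) = val r"
proof -
  assume r: "r \<in> carrier R"
  have "r \<in> rc r" using r by (rule I.a_rcos_self)
  then have s: "(SOME s. s \<in> rc r) \<in> rc r" by (rule someI)
  then have "(SOME s. s \<in> rc r) \<in> carrier R" using R.a_r_coset_subset_G[OF I.a_subset r] by blast
  moreover have "rc (SOME s. s \<in> rc r) = rc r" using s r I.a_repr_independence' by metis
  ultimately show ?thesis using r rc_eq unfolding vC_def by blast
qed

lemma QuotE:
  assumes "C \<in> carrier (R Quot m)"
  obtains r where "r \<in> carrier R" "C = rc r"
  using assms unfolding FactRing_def A_RCOSETS_def' by auto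

section \<open>Homogeneous components and the submodule \<open>m M\<close>\<close>

lemma P_zero: "P i \<zero>\<^bsub>M\<^esub> = \<zero>\<^bsub>M\<^esub>"
  using P_smult[of "\<zero>\<^bsub>R\<^esub>" "\<zero>\<^bsub>M\<^esub>" i] P_closed by simp

lemma gradeD: "x \<in> grade M i \<Longrightarrow> x \<in> carrier M" by (simp add: grade_M)

lemma P_grade: "x \<in> carrier M \<Longrightarrow> P i x \<in> grade M i" by (simp add: grade_M P_closed P_P)

lemma grade_zero: "\<zero>\<^bsub>M\<^esub> \<in> grade M i" by (simp add: grade_M P_zero)
lemma grade_add: "x \<in> grade M i \<Longrightarrow> y \<in> grade M i \<Longrightarrow> x \<oplus>\<^bsub>M\<^esub> y \<in> grade M i" by (simp add: grade_M P_add)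
lemma grade_smult: "r \<in> carrier R \<Longrightarrow> x \<in> grade M i \<Longrightarrow> r \<odot>\<^bsub>M\<^esub> x \<in> grade M i" by (simp add: grade_M P_smult)

text \<open>The coefficients pass through \<open>h\<close> so that one presentation
  \<open>ms\<close> serves twice: with the identity it gives an element of \<open>m M\<close>, with
  \<open>\<iota>\<close> after \<open>w\<close> it gives a representative of the image of that
  element under \<open>Lam w\<close>.\<close>

definition lin where "lin h ms = foldr (\<lambda>(r, a) x. h r \<odot>\<^bsub>M\<^esub> a \<oplus>\<^bsub>M\<^esub> x) ms \<zero>\<^bsub>M\<^esub>"

definition kl where "kl = {ms. set ms \<subseteq> m \<times> carrier M}"

lemma lin_Nil [simp]: "lin h [] = \<zero>\<^bsub>M\<^esub>" by (simp add: lin_def)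
lemma lin_Cons [simp]: "lin h ((r, a) # ms) = h r \<odot>\<^bsub>M\<^esub> a \<oplus>\<^bsub>M\<^esub> lin h ms" by (simp add: lin_def)

lemma kl_Nil [simp]: "[] \<in> kl" by (simp add: kl_def)
lemma kl_Cons [simp]: "(r, a) # ms \<in> kl \<longleftrightarrow> r \<in> m \<and> a \<in> carrier M \<and> ms \<in> kl" by (auto simp: kl_def)
lemma kl_append [simp]: "ms @ ns \<in> kl \<longleftrightarrow> ms \<in> kl \<and> ns \<in> kl" by (auto simp: kl_def)

lemma lin_closed: "(\<And>r. r \<in> m \<Longrightarrow> h r \<in> carrier R) \<Longrightarrow> ms \<in> kl \<Longrightarrow> lin h ms \<in> carrier M"
  by (induction ms) auto

lemma lin_append: "(\<And>r. r \<in> m \<Longrightarrow> h r \<in> carrier R) \<Longrightarrow> ms \<in> kl \<Longrightarrow> ns \<in> kl \<Longrightarrow>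
    lin h (ms @ ns) = lin h ms \<oplus>\<^bsub>M\<^esub> lin h ns"
  by (induction ms) (auto simp: lin_closed M.a_assoc)

lemma kl_map: "(\<And>x. x \<in> carrier M \<Longrightarrow> F x \<in> carrier M) \<Longrightarrow> ms \<in> kl \<Longrightarrow> map (\<lambda>(r, a). (r, F a)) ms \<in> kl"
  by (auto simp: kl_def)

lemma lin_map:
  assumes "\<And>x. x \<in> carrier M \<Longrightarrow> F x \<in> carrier M"
    and "\<And>x y. x \<in> carrier M \<Longrightarrow> y \<in> carrier M \<Longrightarrow> F (x \<oplus>\<^bsub>M\<^esub> y) = F x \<oplus>\<^bsub>M\<^esub> F y"
    and "\<And>r x. r \<in> carrier R \<Longrightarrow> x \<in> carrier M \<Longrightarrow> F (r \<odot>\<^bsub>M\<^esub> x) = r \<odot>\<^bsub>M\<^esub> F x"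
    and h: "\<And>r. r \<in> m \<Longrightarrow> h r \<in> carrier R" and "ms \<in> kl"
  shows "F (lin h ms) = lin h (map (\<lambda>(r, a). (r, F a)) ms)"
  using \<open>ms \<in> kl\<close>
proof (induction ms)
  case Nil
  then show ?case using assms(3)[of "\<zero>\<^bsub>R\<^esub>" "\<zero>\<^bsub>M\<^esub>"] assms(1)[of "\<zero>\<^bsub>M\<^esub>"] by simp
next
  case (Cons p ms)
  then show ?case using assms by (cases p) (simp add: lin_closed)
qed

definition mM where "mM = lin (\<lambda>r. r) ` kl"

lemma mM_closed: "x \<in> mM \<Longrightarrow> x \<in> carrier M"
  unfolding mM_def by (auto intro: lin_closed m_closed)

text \<open>A linear endomorphism acts on the module entries of a presentation and leaves the
  coefficients in \<open>m\<close> alone.\<close>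

lemma mM_map:
  assumes "\<And>x. x \<in> carrier M \<Longrightarrow> F x \<in> carrier M"
    and "\<And>x y. x \<in> carrier M \<Longrightarrow> y \<in> carrier M \<Longrightarrow> F (x \<oplus>\<^bsub>M\<^esub> y) = F x \<oplus>\<^bsub>M\<^esub> F y"
    and "\<And>r x. r \<in> carrier R \<Longrightarrow> x \<in> carrier M \<Longrightarrow> F (r \<odot>\<^bsub>M\<^esub> x) = r \<odot>\<^bsub>M\<^esub> F x"
    and "x \<in> mM"
  shows "F x \<in> mM"
  using assms(4) lin_map[OF assms(1-3) m_closed] kl_map[OF assms(1)] unfolding mM_def by auto

lemma mM_zero: "\<zero>\<^bsub>M\<^esub> \<in> mM"
  unfolding mM_def by (rule image_eqI[of _ _ "[]"]) auto

lemma mM_add: "x \<in> mM \<Longrightarrow> y \<in> mM \<Longrightarrow> x \<oplus>\<^bsub>M\<^esub> y \<in> mM"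
  unfolding mM_def using lin_append[OF m_closed] by (auto simp flip: lin_append)

lemma mM_minus: "x \<in> mM \<Longrightarrow> \<ominus>\<^bsub>M\<^esub> x \<in> mM"
  by (rule mM_map) (auto simp: M.minus_add A.smult_r_minus)

lemma mM_smult: "r \<in> m \<Longrightarrow> x \<in> carrier M \<Longrightarrow> r \<odot>\<^bsub>M\<^esub> x \<in> mM"
  unfolding mM_def by (rule image_eqI[of _ _ "[(r, x)]"]) (auto simp: m_closed)

lemma mM_subgroup: "additive_subgroup mM M"
  by (intro additive_subgroup.intro group.subgroupI[OF M.a_group])
    (use mM_zero mM_add mM_minus mM_closed in \<open>auto simp flip: a_inv_def\<close>)

section \<open>The projection from the stalk onto the fibre\<close>

definition pr where "pr a = BC.T.cls [(a, rc \<one>\<^bsub>R\<^esub>)]"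

text \<open>Every residue class is some \<open>rc r\<close>, and
  \<open>x \<otimes> [r] = r x \<otimes> 1\<close>; hence a formal sum collapses to one tensor with
  second entry 1. The submodule \<open>G\<close> is left general so that the same argument covers
  all of \<open>M\<close> and a single graded piece.\<close>

lemma eq_pr:
  assumes G: "G \<subseteq> carrier M" "\<zero>\<^bsub>M\<^esub> \<in> G" "\<And>x y. x \<in> G \<Longrightarrow> y \<in> G \<Longrightarrow> x \<oplus>\<^bsub>M\<^esub> y \<in> G"
    "\<And>r x. r \<in> carrier R \<Longrightarrow> x \<in> G \<Longrightarrow> r \<odot>\<^bsub>M\<^esub> x \<in> G"
    and "set xs \<subseteq> G \<times> carrier (R Quot m)"
  shows "\<exists>a\<in>G. BC.T.eq xs [(a, rc \<one>\<^bsub>R\<^esub>)]"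
  using assms(5)
proof (induction xs)
  case Nil
  have "BC.T.eq [(\<zero>\<^bsub>M\<^esub>, rc \<one>\<^bsub>R\<^esub>)] []" by (rule tensor_eq.zero) (simp add: rc_simps)
  then show ?case using G(2) tensor_eq.sym by blast
next
  case (Cons p xs)
  then obtain x r where p: "p = (x, rc r)" "x \<in> G" "r \<in> carrier R" by (auto elim!: QuotE)
  from Cons obtain a where a: "a \<in> G" "BC.T.eq xs [(a, rc \<one>\<^bsub>R\<^esub>)]" by auto
  have xa: "x \<in> carrier M" "a \<in> carrier M" using p a G(1) by auto
  have "BC.T.eq [(r \<odot>\<^bsub>M\<^esub> x, rc \<one>\<^bsub>R\<^esub>)] [(x, r \<odot>\<^bsub>BC.N\<^esub> rc \<one>\<^bsub>R\<^esub>)]"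
    by (rule tensor_eq.balanced) (use p xa in \<open>auto simp: rc_simps\<close>)
  then have 1: "BC.T.eq [p] [(r \<odot>\<^bsub>M\<^esub> x, rc \<one>\<^bsub>R\<^esub>)]"
    using p by (simp flip: rc_simps(2-4)) (rule tensor_eq.sym)
  have 2: "BC.T.eq [(r \<odot>\<^bsub>M\<^esub> x \<oplus>\<^bsub>M\<^esub> a, rc \<one>\<^bsub>R\<^esub>)] [(r \<odot>\<^bsub>M\<^esub> x, rc \<one>\<^bsub>R\<^esub>), (a, rc \<one>\<^bsub>R\<^esub>)]"
    by (rule tensor_eq.add_left) (use p xa in \<open>auto simp: rc_simps\<close>)
  have "BC.T.eq (p # xs) [(r \<odot>\<^bsub>M\<^esub> x \<oplus>\<^bsub>M\<^esub> a, rc \<one>\<^bsub>R\<^esub>)]"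
    using tensor_eq.trans[OF tensor_eq.append[OF 1 a(2), simplified] tensor_eq.sym[OF 2]] .
  then show ?case using G p a by blast
qed

lemma pr_closed [simp]: "a \<in> carrier M \<Longrightarrow> pr a \<in> carrier BC.D"
  unfolding pr_def by (rule BC.cls_closed) (simp add: rc_simps)

lemma pr_surj: "x \<in> carrier BC.D \<Longrightarrow> \<exists>a\<in>carrier M. x = pr a"
proof -
  assume "x \<in> carrier BC.D"
  then obtain xs where xs: "set xs \<subseteq> carrier M \<times> carrier (R Quot m)" "x = BC.T.cls xs"
    unfolding BC.carrier_D by (auto elim: BC.T.tensor_carrierE)
  have "\<exists>a\<in>carrier M. BC.T.eq xs [(a, rc \<one>\<^bsub>R\<^esub>)]" by (rule eq_pr[OF order_refl _ _ _ xs(1)]) auto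
  then show ?thesis using xs(2) BC.T.cls_eqI unfolding pr_def by blast
qed

lemma carrier_B: "carrier BC.D = pr ` carrier M"
  using pr_surj pr_closed by blast

lemma pr_add: "a \<in> carrier M \<Longrightarrow> b \<in> carrier M \<Longrightarrow> pr (a \<oplus>\<^bsub>M\<^esub> b) = pr a \<oplus>\<^bsub>BC.D\<^esub> pr b"
  unfolding pr_def by (subst BC.add_cls) (auto simp: rc_simps intro!: BC.T.cls_eqI tensor_eq.add_left)

lemma pr_mult: "a \<in> carrier M \<Longrightarrow> b \<in> carrier M \<Longrightarrow> pr (a \<otimes>\<^bsub>M\<^esub> b) = pr a \<otimes>\<^bsub>BC.D\<^esub> pr b"
  unfolding pr_def by (subst BC.mult_cls) (auto simp: rc_simps simp flip: rc_simps(2-4))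

lemma pr_smult: "c \<in> carrier K \<Longrightarrow> a \<in> carrier M \<Longrightarrow> pr (\<iota> c \<odot>\<^bsub>M\<^esub> a) = rc (\<iota> c) \<odot>\<^bsub>BC.D\<^esub> pr a"
  unfolding pr_def
  using BC.T.cls_eqI[OF tensor_eq.balanced[of "\<iota> c" R a M "rc \<one>\<^bsub>R\<^esub>" BC.N]]
  by (subst BC.smult_cls) (auto simp: rc_simps iota_simps)

lemma pr_zero: "pr \<zero>\<^bsub>M\<^esub> = \<zero>\<^bsub>BC.D\<^esub>"
  unfolding pr_def BC.zero_D by (intro BC.T.cls_eqI tensor_eq.zero) (simp add: rc_simps)

lemma pr_one: "pr \<one>\<^bsub>M\<^esub> = \<one>\<^bsub>BC.D\<^esub>"
  unfolding pr_def BC.one_D by (simp add: rc_simps)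

lemma grade_B: "grade BC.D i = pr ` grade M i"
proof
  show "grade BC.D i \<subseteq> pr ` grade M i"
  proof
    fix x assume "x \<in> grade BC.D i"
    then obtain xs where xs: "x = BC.T.cls xs" "set xs \<subseteq> grade M i \<times> carrier (R Quot m)"
      unfolding BC.grade_D by auto
    have "\<exists>a\<in>grade M i. BC.T.eq xs [(a, rc \<one>\<^bsub>R\<^esub>)]"
      by (rule eq_pr[OF _ grade_zero grade_add grade_smult xs(2)]) (auto dest: gradeD)
    then show "x \<in> pr ` grade M i" using xs(1) BC.T.cls_eqI unfolding pr_def by blast
  qed
  show "pr ` grade M i \<subseteq> grade BC.D i"
    unfolding BC.grade_D pr_def by (auto simp: rc_simps)
qed

lemma B_module: "module K B"
  by (rule module_surj_image[OF A.module_axioms, of _ pr _ \<iota>])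
    (auto simp: carrier_B pr_zero pr_add pr_smult iota K.is_cring)

lemma B_ring: "ring B"
  by (rule ring_surj_image[OF M.ring_axioms module.axioms(2)[OF B_module], of pr])
    (auto simp: carrier_B pr_one pr_add pr_mult)

text \<open>For \<open>r\<close> in \<open>m\<close> one has
  \<open>r a \<otimes> 1 = a \<otimes> [r] = a \<otimes> 0\<close>.\<close>

lemma pr_mM: "x \<in> mM \<Longrightarrow> pr x = \<zero>\<^bsub>BC.D\<^esub>"
proof -
  interpret B: module K B by (rule B_module)
  have "ms \<in> kl \<Longrightarrow> pr (lin (\<lambda>r. r) ms) = \<zero>\<^bsub>BC.D\<^esub>" for ms
  proof (induction ms)
    case Nil
    then show ?case by (simp add: pr_zero)
  next
    case (Cons p ms)
    obtain r a where p: "p = (r, a)" by (cases p)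
    with Cons have ra: "r \<in> m" "a \<in> carrier M" "ms \<in> kl" by auto
    have "BC.T.eq [(r \<odot>\<^bsub>M\<^esub> a, rc \<one>\<^bsub>R\<^esub>)] [(a, r \<odot>\<^bsub>BC.N\<^esub> rc \<one>\<^bsub>R\<^esub>)]"
      by (rule tensor_eq.balanced) (use ra in \<open>auto simp: rc_simps m_closed\<close>)
    moreover have "r \<odot>\<^bsub>BC.N\<^esub> rc \<one>\<^bsub>R\<^esub> = rc \<zero>\<^bsub>R\<^esub>"
      using ra by (simp add: m_closed rc_eq val_simps val_zero m_iff[THEN iffD1] flip: rc_simps(2-4))
    moreover have "rc \<zero>\<^bsub>R\<^esub> = \<zero>\<^bsub>BC.N\<^esub>"
      using I.a_subset by (simp only: BC.N_sel) (simp add: FactRing_def)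
    ultimately have "pr (r \<odot>\<^bsub>M\<^esub> a) = \<zero>\<^bsub>BC.D\<^esub>"
      unfolding pr_def BC.zero_D using BC.T.zero_right[OF ra(2)] BC.T.cls_eqI tensor_eq.trans by metis
    then show ?case using ra Cons p B.M.l_zero[OF B.M.zero_closed] by (simp add: pr_add lin_closed m_closed)
  qed
  then show "x \<in> mM \<Longrightarrow> pr x = \<zero>\<^bsub>BC.D\<^esub>" unfolding mM_def by blast
qed

text \<open>The map \<open>x \<otimes> [r] \<mapsto> \<iota> (val r) x\<close> inverts the
  projection modulo \<open>m M\<close>. It is additive in both variables but balanced only modulo
  \<open>m M\<close>: the defect is \<open>(s - \<iota> (val s))\<close> times an element of
  \<open>M\<close>, and that coefficient lies in \<open>m\<close>. This is what the subgroup in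
  \<open>eq_sum\<close> is for.\<close>

lemma pr_eq_zero:
  assumes "a \<in> carrier M" "pr a = \<zero>\<^bsub>BC.D\<^esub>"
  shows "a \<in> mM"
proof -
  have eq: "BC.T.eq [(a, rc \<one>\<^bsub>R\<^esub>)] []"
    using assms BC.T.cls_eq[of "[(a, rc \<one>\<^bsub>R\<^esub>)]" "[]"] unfolding pr_def BC.zero_D by (simp add: rc_simps)
  let ?f = "\<lambda>x C. \<iota> (vC C) \<odot>\<^bsub>M\<^esub> x"
  have diff0: "x \<ominus>\<^bsub>M\<^esub> x \<in> mM" if "x \<in> carrier M" for x
    using that mM_zero by (simp add: M.minus_eq M.r_neg)
  have "foldr (\<lambda>(x, y) h. ?f x y \<oplus>\<^bsub>M\<^esub> h) [(a, rc \<one>\<^bsub>R\<^esub>)] \<zero>\<^bsub>M\<^esub> \<ominus>\<^bsub>M\<^esub> foldr (\<lambda>(x, y) h. ?f x y \<oplus>\<^bsub>M\<^esub> h) [] \<zero>\<^bsub>M\<^esub> \<in> mM"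
  proof (rule BC.T.eq_sum[OF M.is_abelian_group mM_subgroup _ _ _ _ eq])
    fix x y assume "x \<in> carrier M" "y \<in> carrier BC.N"
    then show "?f x y \<in> carrier M" by (auto elim!: QuotE simp: vC_rc val_simps iota_simps)
  next
    fix x x' y assume "x \<in> carrier M" "x' \<in> carrier M" "y \<in> carrier BC.N"
    then show "?f (x \<oplus>\<^bsub>M\<^esub> x') y \<ominus>\<^bsub>M\<^esub> (?f x y \<oplus>\<^bsub>M\<^esub> ?f x' y) \<in> mM"
      by (auto elim!: QuotE simp: vC_rc val_simps iota_simps A.smult_r_distr intro!: diff0)
  next
    fix x y y' assume "x \<in> carrier M" "y \<in> carrier BC.N" "y' \<in> carrier BC.N"
    then show "?f x (y \<oplus>\<^bsub>BC.N\<^esub> y') \<ominus>\<^bsub>M\<^esub> (?f x y \<oplus>\<^bsub>M\<^esub> ?f x y') \<in> mM"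
      by (auto elim!: QuotE simp: vC_rc val_simps iota_simps A.smult_l_distr intro!: diff0 simp flip: rc_simps(2-4))
  next
    fix s x y assume a: "s \<in> carrier R" "x \<in> carrier M" "y \<in> carrier BC.N"
    then obtain r where r: "r \<in> carrier R" "y = rc r" by (auto elim!: QuotE)
    have "?f (s \<odot>\<^bsub>M\<^esub> x) y \<ominus>\<^bsub>M\<^esub> ?f x (s \<odot>\<^bsub>BC.N\<^esub> y) = (s \<ominus>\<^bsub>R\<^esub> \<iota> (val s)) \<odot>\<^bsub>M\<^esub> (\<iota> (val r) \<odot>\<^bsub>M\<^esub> x)"
    proof -
      have "s \<odot>\<^bsub>BC.N\<^esub> y = rc (s \<otimes>\<^bsub>R\<^esub> r)" using a r by (simp add: rc_simps)
      then have "?f x (s \<odot>\<^bsub>BC.N\<^esub> y) = (\<iota> (val s) \<otimes>\<^bsub>R\<^esub> \<iota> (val r)) \<odot>\<^bsub>M\<^esub> x"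
        using a r by (simp add: vC_rc val_simps iota_simps)
      moreover have "?f (s \<odot>\<^bsub>M\<^esub> x) y = s \<odot>\<^bsub>M\<^esub> (\<iota> (val r) \<odot>\<^bsub>M\<^esub> x)"
        using a r by (simp add: vC_rc val_simps iota_simps R.m_comm flip: A.smult_assoc1)
      ultimately show ?thesis using a r
        by (simp add: vC_rc val_simps iota_simps A.smult_l_distr A.smult_assoc1 R.minus_eq M.minus_eq A.smult_l_minus)
    qed
    then show "?f (s \<odot>\<^bsub>M\<^esub> x) y \<ominus>\<^bsub>M\<^esub> ?f x (s \<odot>\<^bsub>BC.N\<^esub> y) \<in> mM"
      using mM_smult[OF sub_const] a r by (simp add: val_simps iota_simps)
  qed
  then show ?thesis using assms by (simp add: vC_rc val_simps iota_simps M.minus_eq)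
qed

lemma pr_eq_iff: "a \<in> carrier M \<Longrightarrow> b \<in> carrier M \<Longrightarrow> pr a = pr b \<longleftrightarrow> a \<ominus>\<^bsub>M\<^esub> b \<in> mM"
proof -
  assume ab: "a \<in> carrier M" "b \<in> carrier M"
  interpret B: module K B by (rule B_module)
  have d: "pr (a \<ominus>\<^bsub>M\<^esub> b) \<oplus>\<^bsub>B\<^esub> pr b = pr a"
    using ab by (simp flip: pr_add add: M.minus_eq M.a_assoc M.l_neg)
  have c: "pr b \<in> carrier B" "pr (a \<ominus>\<^bsub>M\<^esub> b) \<in> carrier B" using ab by auto
  have "pr a = pr b \<longleftrightarrow> pr (a \<ominus>\<^bsub>M\<^esub> b) = \<zero>\<^bsub>B\<^esub>"
    using B.M.add.r_cancel_one[OF c(1,2)] d by auto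
  also have "\<dots> \<longleftrightarrow> a \<ominus>\<^bsub>M\<^esub> b \<in> mM"
    using pr_mM[of "a \<ominus>\<^bsub>M\<^esub> b"] pr_eq_zero[OF M.minus_closed[OF ab]] by (auto simp only: B_sel)
  finally show ?thesis .
qed

definition PB where "PB i x = pr (P i (SOME a. a \<in> carrier M \<and> x = pr a))"

text \<open>The representative chosen in \<open>PB\<close> differs from \<open>a\<close> by an
  element of \<open>m M\<close>, and \<open>P i\<close>, being linear, preserves
  \<open>m M\<close>.\<close>

lemma PB_pr: "a \<in> carrier M \<Longrightarrow> PB i (pr a) = pr (P i a)"
proof -
  assume a: "a \<in> carrier M"
  define b where "b = (SOME b. b \<in> carrier M \<and> pr a = pr b)"
  have b: "b \<in> carrier M" "pr a = pr b" using someI[of "\<lambda>b. b \<in> carrier M \<and> pr a = pr b" a] a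
    unfolding b_def[symmetric] by auto
  then have "a \<ominus>\<^bsub>M\<^esub> b \<in> mM" using a pr_eq_iff by blast
  then have "P i (a \<ominus>\<^bsub>M\<^esub> b) \<in> mM" by (rule mM_map[rotated 3]) (auto simp: P_closed P_add P_smult)
  moreover have "P i (\<ominus>\<^bsub>M\<^esub> b) = \<ominus>\<^bsub>M\<^esub> P i b"
    using P_add[of b "\<ominus>\<^bsub>M\<^esub> b" i] b M.minus_equality[of "P i (\<ominus>\<^bsub>M\<^esub> b)" "P i b"]
    by (simp add: M.r_neg P_zero P_closed M.a_comm)
  ultimately have "P i a \<ominus>\<^bsub>M\<^esub> P i b \<in> mM" using a b by (simp add: M.minus_eq P_add)
  then show "PB i (pr a) = pr (P i a)" using a b pr_eq_iff P_closed
    unfolding PB_def b_def[symmetric] by metis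
qed

text \<open>Being homogeneous becomes an equation between elements of the fibre, which transfers
  along maps that commute with the projections, such as \<open>Lam w\<close> and the map of fibres
  of a pullback.\<close>

lemma grade_B_iff: "x \<in> carrier BC.D \<Longrightarrow> x \<in> grade BC.D i \<longleftrightarrow> PB i x = x"
  unfolding grade_B using P_grade by (auto dest!: pr_surj simp: PB_pr grade_M P_closed) (metis P_grade image_eqI grade_M mem_Collect_eq)

end

section \<open>First order deformations\<close>

lemma dual_numbers_sel [simp]:
  "carrier (dual_numbers K) = carrier K \<times> carrier K"
  "(x, y) \<otimes>\<^bsub>dual_numbers K\<^esub> (x', y') = (x \<otimes>\<^bsub>K\<^esub> x', (x \<otimes>\<^bsub>K\<^esub> y') \<oplus>\<^bsub>K\<^esub> (y \<otimes>\<^bsub>K\<^esub> x'))"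
  "(x, y) \<oplus>\<^bsub>dual_numbers K\<^esub> (x', y') = (x \<oplus>\<^bsub>K\<^esub> x', y \<oplus>\<^bsub>K\<^esub> y')"
  "\<one>\<^bsub>dual_numbers K\<^esub> = (\<one>\<^bsub>K\<^esub>, \<zero>\<^bsub>K\<^esub>)" "\<zero>\<^bsub>dual_numbers K\<^esub> = (\<zero>\<^bsub>K\<^esub>, \<zero>\<^bsub>K\<^esub>)"
  by (simp_all add: dual_numbers_def)

lemma cring_dual_numbers:
  assumes "cring K" shows "cring (dual_numbers K)"
proof -
  interpret K: cring K by fact
  have "\<exists>b\<in>carrier K. b \<oplus>\<^bsub>K\<^esub> a = \<zero>\<^bsub>K\<^esub>" if "a \<in> carrier K" for a
    using that K.l_neg by blast
  then show ?thesis
    by (intro cringI abelian_groupI comm_monoidI)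
      (auto simp: K.a_ac K.m_ac K.l_distr K.r_distr)
qed

context pointed_algebra
begin

text \<open>The presentation of \<open>x\<close> is chosen without reference to \<open>w\<close>.
  Linearity in \<open>w\<close> is thus a statement about one fixed list and holds before flatness
  is available; independence of the presentation comes later, in \<open>Lam_lin\<close>.\<close>

definition Lam where "Lam w x = pr (lin (\<lambda>r. \<iota> (w r)) (SOME ms. ms \<in> kl \<and> lin (\<lambda>r. r) ms = x))"

lemma mM_some:
  assumes "x \<in> mM"
  shows "(SOME ms. ms \<in> kl \<and> lin (\<lambda>r. r) ms = x) \<in> kl"
    "lin (\<lambda>r. r) (SOME ms. ms \<in> kl \<and> lin (\<lambda>r. r) ms = x) = x"
  using someI_ex[of "\<lambda>ms. ms \<in> kl \<and> lin (\<lambda>r. r) ms = x"] assms unfolding mM_def by auto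

lemma rc_eqI: "r \<in> carrier R \<Longrightarrow> s \<in> carrier R \<Longrightarrow> val r = val s \<Longrightarrow> rc r = rc s"
  using rc_eq by blast

lemma Lam_closed: "(\<And>r. r \<in> m \<Longrightarrow> w r \<in> carrier K) \<Longrightarrow> x \<in> mM \<Longrightarrow> Lam w x \<in> carrier BC.D"
  unfolding Lam_def by (intro pr_closed lin_closed mM_some) (auto intro: iota_simps)

lemma lin_h_add:
  assumes "\<And>r. r \<in> m \<Longrightarrow> h r \<in> carrier R" "\<And>r. r \<in> m \<Longrightarrow> h' r \<in> carrier R"
    and "\<And>r. r \<in> m \<Longrightarrow> h'' r = h r \<oplus>\<^bsub>R\<^esub> h' r" and "ms \<in> kl"
  shows "lin h'' ms = lin h ms \<oplus>\<^bsub>M\<^esub> lin h' ms"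
  using assms(4)
proof (induction ms)
  case (Cons p ms)
  then show ?case using assms(1-3)
    by (cases p) (simp add: lin_closed A.smult_l_distr M.a_ac)
qed simp

lemma lin_h_smult:
  assumes "\<And>r. r \<in> m \<Longrightarrow> h r \<in> carrier R" "s \<in> carrier R"
    and "\<And>r. r \<in> m \<Longrightarrow> h' r = s \<otimes>\<^bsub>R\<^esub> h r" and "ms \<in> kl"
  shows "lin h' ms = s \<odot>\<^bsub>M\<^esub> lin h ms"
  using assms(4)
proof (induction ms)
  case (Cons p ms)
  then show ?case using assms(1-3)
    by (cases p) (simp add: lin_closed A.smult_r_distr A.smult_assoc1)
qed (simp add: assms)

lemma Lam_w_add:
  assumes "\<And>r. r \<in> m \<Longrightarrow> w r \<in> carrier K" "\<And>r. r \<in> m \<Longrightarrow> w' r \<in> carrier K"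
    "\<And>r. r \<in> m \<Longrightarrow> w'' r = w r \<oplus>\<^bsub>K\<^esub> w' r" and "x \<in> mM"
  shows "Lam w'' x = Lam w x \<oplus>\<^bsub>BC.D\<^esub> Lam w' x"
proof -
  define ms where "ms = (SOME ms. ms \<in> kl \<and> lin (\<lambda>r. r) ms = x)"
  have ms: "ms \<in> kl" unfolding ms_def by (rule mM_some) fact
  have "lin (\<lambda>r. \<iota> (w'' r)) ms = lin (\<lambda>r. \<iota> (w r)) ms \<oplus>\<^bsub>M\<^esub> lin (\<lambda>r. \<iota> (w' r)) ms"
    by (rule lin_h_add) (use assms ms in \<open>auto simp: iota_simps\<close>)
  then show ?thesis unfolding Lam_def ms_def[symmetric]
    using assms ms by (simp add: pr_add lin_closed iota_simps)
qed

lemma Lam_w_smult: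
  assumes "\<And>r. r \<in> m \<Longrightarrow> w r \<in> carrier K" "c \<in> carrier K"
    "\<And>r. r \<in> m \<Longrightarrow> w' r = c \<otimes>\<^bsub>K\<^esub> w r" and "x \<in> mM"
  shows "Lam w' x = rc (\<iota> c) \<odot>\<^bsub>BC.D\<^esub> Lam w x"
proof -
  define ms where "ms = (SOME ms. ms \<in> kl \<and> lin (\<lambda>r. r) ms = x)"
  have ms: "ms \<in> kl" unfolding ms_def by (rule mM_some) fact
  have "lin (\<lambda>r. \<iota> (w' r)) ms = \<iota> c \<odot>\<^bsub>M\<^esub> lin (\<lambda>r. \<iota> (w r)) ms"
    by (rule lin_h_smult) (use assms ms in \<open>auto simp: iota_simps\<close>)
  then show ?thesis unfolding Lam_def ms_def[symmetric]
    using assms ms by (simp add: pr_smult lin_closed iota_simps)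
qed

end

text \<open>
  The base change of \<open>M\<close> along \<open>r \<mapsto> val r + w r \<epsilon>\<close>.  Its elements are written \<open>E a b\<close> for
  \<open>a \<otimes> 1 + b \<otimes> \<epsilon>\<close>.
\<close>

locale deformed_algebra = pointed_algebra K R M m \<iota> val P
  for K :: "'k ring" and R :: "'r ring" and M :: "('r, 'a) graded_algebra"
    and m :: "'r set" and \<iota> :: "'k \<Rightarrow> 'r" and val :: "'r \<Rightarrow> 'k" and P :: "int \<Rightarrow> 'a \<Rightarrow> 'a" +
  fixes w :: "'r \<Rightarrow> 'k"
  assumes w_closed: "r \<in> carrier R \<Longrightarrow> w r \<in> carrier K"
    and w_add: "r \<in> carrier R \<Longrightarrow> s \<in> carrier R \<Longrightarrow> w (r \<oplus>\<^bsub>R\<^esub> s) = w r \<oplus>\<^bsub>K\<^esub> w s"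
    and w_mult: "r \<in> carrier R \<Longrightarrow> s \<in> carrier R \<Longrightarrow>
      w (r \<otimes>\<^bsub>R\<^esub> s) = (val r \<otimes>\<^bsub>K\<^esub> w s) \<oplus>\<^bsub>K\<^esub> (w r \<otimes>\<^bsub>K\<^esub> val s)"
    and w_iota: "c \<in> carrier K \<Longrightarrow> w (\<iota> c) = \<zero>\<^bsub>K\<^esub>"
    and flat: "flat_module R M"
begin

abbreviation \<phi> where "\<phi> \<equiv> \<lambda>r. (val r, w r)"

lemma phi_hom: "\<phi> \<in> ring_hom R (dual_numbers K)"
  by (rule ring_hom_memI) (use w_iota[of "\<one>\<^bsub>K\<^esub>"] in \<open>auto simp: val_simps w_closed w_add w_mult iota_simps\<close>)

sublocale DC: base_changed R "dual_numbers K" M \<phi>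
  by (intro base_changed.intro base_changed_axioms.intro)
    (auto intro: R.is_cring M.ring_axioms A.module_axioms cring_dual_numbers K.is_cring phi_hom smult_mult mult_smult)

abbreviation "kone \<equiv> (\<one>\<^bsub>K\<^esub>, \<zero>\<^bsub>K\<^esub>)"
abbreviation "keps \<equiv> (\<zero>\<^bsub>K\<^esub>, \<one>\<^bsub>K\<^esub>)"

definition E where "E a b = DC.T.cls [(a, kone), (b, keps)]"

lemma E_closed: "a \<in> carrier M \<Longrightarrow> b \<in> carrier M \<Longrightarrow> E a b \<in> carrier DC.D"
  unfolding E_def by (rule DC.cls_closed) auto

lemma E_add:
  assumes "a \<in> carrier M" "b \<in> carrier M" "a' \<in> carrier M" "b' \<in> carrier M"
  shows "E a b \<oplus>\<^bsub>DC.D\<^esub> E a' b' = E (a \<oplus>\<^bsub>M\<^esub> a') (b \<oplus>\<^bsub>M\<^esub> b')"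
proof -
  have 1: "DC.T.eq [(a, kone), (b, keps), (a', kone), (b', keps)] ([(a, kone), (a', kone)] @ [(b, keps), (b', keps)])"
    by (rule DC.T.eq_perm) (use assms in auto)
  have 2: "DC.T.eq ([(a \<oplus>\<^bsub>M\<^esub> a', kone)] @ [(b \<oplus>\<^bsub>M\<^esub> b', keps)]) ([(a, kone), (a', kone)] @ [(b, keps), (b', keps)])"
    by (rule tensor_eq.append) (use assms in \<open>auto intro: tensor_eq.add_left\<close>)
  show ?thesis unfolding E_def
    using assms DC.T.cls_eqI[OF tensor_eq.trans[OF 1 tensor_eq.sym[OF 2]]]
    by (subst DC.add_cls) auto
qed

lemma E_mult:
  assumes "a \<in> carrier M" "b \<in> carrier M" "a' \<in> carrier M" "b' \<in> carrier M"
  shows "E a b \<otimes>\<^bsub>DC.D\<^esub> E a' b' = E (a \<otimes>\<^bsub>M\<^esub> a') ((a \<otimes>\<^bsub>M\<^esub> b') \<oplus>\<^bsub>M\<^esub> (b \<otimes>\<^bsub>M\<^esub> a'))"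
proof -
  \<comment> \<open>The term with \<open>\<epsilon>\<close> squared: its second entry is zero in the
    dual numbers.\<close>
  have 1: "DC.T.eq [(b \<otimes>\<^bsub>M\<^esub> b', (\<zero>\<^bsub>K\<^esub>, \<zero>\<^bsub>K\<^esub>))] []"
    using DC.T.zero_right[of "b \<otimes>\<^bsub>M\<^esub> b'"] assms by simp
  have 2: "DC.T.eq [(a \<otimes>\<^bsub>M\<^esub> b', keps), (b \<otimes>\<^bsub>M\<^esub> a', keps)] [((a \<otimes>\<^bsub>M\<^esub> b') \<oplus>\<^bsub>M\<^esub> (b \<otimes>\<^bsub>M\<^esub> a'), keps)]"
    by (rule tensor_eq.sym, rule tensor_eq.add_left) (use assms in auto)
  have 3: "DC.T.eq [(a \<otimes>\<^bsub>M\<^esub> a', kone)] [(a \<otimes>\<^bsub>M\<^esub> a', kone)]"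
    by (rule tensor_eq.refl) (use assms in auto)
  show ?thesis unfolding E_def
    using assms DC.T.cls_eqI[OF tensor_eq.append[OF 3 tensor_eq.append[OF 2 1]]]
    by (subst DC.mult_cls) auto
qed

text \<open>Since \<open>w\<close> vanishes on constants, \<open>\<iota> x\<close> acts on the dual
  numbers as the plain scalar \<open>x\<close>. So both coordinates of a dual number can be moved
  into \<open>M\<close>, leaving only 1 and \<open>\<epsilon>\<close> on the right.\<close>

lemma eq_single:
  assumes "a \<in> carrier M" "x \<in> carrier K" "y \<in> carrier K"
  shows "DC.T.eq [(a, (x, y))] [(\<iota> x \<odot>\<^bsub>M\<^esub> a, kone), (\<iota> y \<odot>\<^bsub>M\<^esub> a, keps)]"
proof -
  have 1: "DC.T.eq [(\<iota> x \<odot>\<^bsub>M\<^esub> a, kone)] [(a, (x, \<zero>\<^bsub>K\<^esub>))]"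
    using tensor_eq.balanced[of "\<iota> x" R a M kone DC.N] assms
    by (simp add: iota_simps val_iota w_iota)
  have 2: "DC.T.eq [(\<iota> y \<odot>\<^bsub>M\<^esub> a, keps)] [(a, (\<zero>\<^bsub>K\<^esub>, y))]"
    using tensor_eq.balanced[of "\<iota> y" R a M keps DC.N] assms
    by (simp add: iota_simps val_iota w_iota)
  have "DC.T.eq [(a, (x, y))] [(a, (x, \<zero>\<^bsub>K\<^esub>)), (a, (\<zero>\<^bsub>K\<^esub>, y))]"
    using tensor_eq.add_right[of a M "(x, \<zero>\<^bsub>K\<^esub>)" DC.N "(\<zero>\<^bsub>K\<^esub>, y)" R] assms by simp
  then show ?thesis
    using tensor_eq.trans tensor_eq.sym[OF tensor_eq.append[OF 1 2]] by fastforce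
qed

lemma E_single:
  assumes "a \<in> carrier M" "x \<in> carrier K" "y \<in> carrier K"
  shows "DC.T.cls [(a, (x, y))] = E (\<iota> x \<odot>\<^bsub>M\<^esub> a) (\<iota> y \<odot>\<^bsub>M\<^esub> a)"
  unfolding E_def using DC.T.cls_eqI[OF eq_single[OF assms]] .

lemma E_split:
  assumes "a \<in> carrier M" "b \<in> carrier M" "n \<in> carrier K \<times> carrier K" "n' \<in> carrier K \<times> carrier K"
  shows "DC.T.cls [(a, n), (b, n')] = DC.T.cls [(a, n)] \<oplus>\<^bsub>DC.D\<^esub> DC.T.cls [(b, n')]"
  using assms by (subst DC.add_cls) auto

lemma E_zero: "E \<zero>\<^bsub>M\<^esub> \<zero>\<^bsub>M\<^esub> = \<zero>\<^bsub>DC.D\<^esub>"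
proof -
  have "DC.T.eq [(\<zero>\<^bsub>M\<^esub>, kone)] []" "DC.T.eq [(\<zero>\<^bsub>M\<^esub>, keps)] []" by (auto intro: tensor_eq.zero)
  from DC.T.cls_eqI[OF tensor_eq.append[OF this]] show ?thesis by (simp add: E_def DC.zero_D)
qed

lemma E_smult:
  assumes "a \<in> carrier M" "b \<in> carrier M" "c \<in> carrier K"
  shows "(c, \<zero>\<^bsub>K\<^esub>) \<odot>\<^bsub>DC.D\<^esub> E a b = E (\<iota> c \<odot>\<^bsub>M\<^esub> a) (\<iota> c \<odot>\<^bsub>M\<^esub> b)"
proof -
  have "(c, \<zero>\<^bsub>K\<^esub>) \<odot>\<^bsub>DC.D\<^esub> E a b = DC.T.cls [(a, (c, \<zero>\<^bsub>K\<^esub>)), (b, (\<zero>\<^bsub>K\<^esub>, c))]"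
    unfolding E_def using assms by (subst DC.smult_cls) auto
  also have "\<dots> = E (\<iota> c \<odot>\<^bsub>M\<^esub> a) (\<iota> c \<odot>\<^bsub>M\<^esub> b)"
    using assms by (simp add: E_split E_single E_add iota_simps iota_zero)
  finally show ?thesis .
qed

lemma E_eps:
  assumes "a \<in> carrier M" "b \<in> carrier M"
  shows "keps \<odot>\<^bsub>DC.D\<^esub> E a b = E \<zero>\<^bsub>M\<^esub> a"
proof -
  have "keps \<odot>\<^bsub>DC.D\<^esub> E a b = DC.T.cls [(a, keps), (b, (\<zero>\<^bsub>K\<^esub>, \<zero>\<^bsub>K\<^esub>))]"
    unfolding E_def using assms by (subst DC.smult_cls) auto
  also have "\<dots> = E \<zero>\<^bsub>M\<^esub> a"
    using assms by (simp add: E_split E_single E_add iota_simps iota_zero)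
  finally show ?thesis .
qed

text \<open>As in \<open>eq_pr\<close>, the submodule \<open>G\<close> is general in order to treat
  \<open>M\<close> and its graded pieces at once.\<close>

lemma cls_E:
  assumes G: "G \<subseteq> carrier M" "\<zero>\<^bsub>M\<^esub> \<in> G" "\<And>x y. x \<in> G \<Longrightarrow> y \<in> G \<Longrightarrow> x \<oplus>\<^bsub>M\<^esub> y \<in> G"
    "\<And>r x. r \<in> carrier R \<Longrightarrow> x \<in> G \<Longrightarrow> r \<odot>\<^bsub>M\<^esub> x \<in> G"
    and "set xs \<subseteq> G \<times> (carrier K \<times> carrier K)"
  shows "\<exists>a\<in>G. \<exists>b\<in>G. DC.T.cls xs = E a b"
  using assms(5)
proof (induction xs)
  case Nil
  then show ?case using G(2) E_zero by (metis DC.zero_D)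
next
  case (Cons p xs)
  obtain a x y where p: "p = (a, (x, y))" by (cases p) auto
  with Cons have ax: "a \<in> G" "x \<in> carrier K" "y \<in> carrier K" by auto
  obtain c d where cd: "c \<in> G" "d \<in> G" "DC.T.cls xs = E c d" using Cons by auto
  have M: "a \<in> carrier M" "c \<in> carrier M" "d \<in> carrier M" using ax cd G(1) by auto
  have "DC.T.cls (p # xs) = DC.T.cls [p] \<oplus>\<^bsub>DC.D\<^esub> DC.T.cls xs"
    by (subst DC.add_cls) (use Cons(2) p M ax G(1) in auto)
  also have "\<dots> = E (\<iota> x \<odot>\<^bsub>M\<^esub> a \<oplus>\<^bsub>M\<^esub> c) (\<iota> y \<odot>\<^bsub>M\<^esub> a \<oplus>\<^bsub>M\<^esub> d)"
    using ax M by (simp add: p cd E_single E_add iota_simps)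
  finally show ?case
    using G(3)[OF G(4)[OF iota_simps(1) ax(1)] cd(1)] G(3)[OF G(4)[OF iota_simps(1) ax(1)] cd(2)] ax by metis
qed

lemma E_surj: "x \<in> carrier DC.D \<Longrightarrow> \<exists>a\<in>carrier M. \<exists>b\<in>carrier M. x = E a b"
proof -
  assume "x \<in> carrier DC.D"
  then obtain xs where xs: "set xs \<subseteq> carrier M \<times> (carrier K \<times> carrier K)" "x = DC.T.cls xs"
    unfolding DC.carrier_D by (auto elim: DC.T.tensor_carrierE)
  show ?thesis unfolding xs(2) by (rule cls_E[OF order_refl _ _ _ xs(1)]) auto
qed

lemma grade_D_E: "grade DC.D i = {E a b | a b. a \<in> grade M i \<and> b \<in> grade M i}"
proof
  show "grade DC.D i \<subseteq> {E a b | a b. a \<in> grade M i \<and> b \<in> grade M i}"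
  proof
    fix x assume "x \<in> grade DC.D i"
    then obtain xs where xs: "x = DC.T.cls xs" "set xs \<subseteq> grade M i \<times> (carrier K \<times> carrier K)"
      unfolding DC.grade_D by auto
    have "\<exists>a\<in>grade M i. \<exists>b\<in>grade M i. DC.T.cls xs = E a b"
      by (rule cls_E[OF _ grade_zero grade_add grade_smult xs(2)]) (auto dest: gradeD)
    then show "x \<in> {E a b | a b. a \<in> grade M i \<and> b \<in> grade M i}" using xs(1) by blast
  qed
  show "{E a b | a b. a \<in> grade M i \<and> b \<in> grade M i} \<subseteq> grade DC.D i"
    unfolding DC.grade_D E_def by auto
qed

text \<open>This is \<open>reduction\<close> for a family, with the residue map written as the coset
  map of \<open>m\<close>; the agreement is used in \<open>KS_deformed\<close>.\<close>

definition red where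
  "red C = the_elem ((\<lambda>xs. BC.T.cls (map (\<lambda>(a, (x, y)). (a, rc (\<iota> x))) xs)) ` C)"

lemma rc_zero: "rc \<zero>\<^bsub>R\<^esub> = \<zero>\<^bsub>R Quot m\<^esub>"
  using I.a_subset by (simp add: FactRing_def)

lemma red_E:
  assumes "a \<in> carrier M" "b \<in> carrier M"
  shows "red (E a b) = pr a"
proof -
  have eq: "BC.T.eq (map (\<lambda>(a, n). (a, rc (\<iota> (fst n)))) xs) (map (\<lambda>(a, n). (a, rc (\<iota> (fst n)))) ys)"
    if "DC.T.eq xs ys" for xs ys
    by (rule tensor_eq_map[OF DC.T.tensor_axioms BC.T.tensor_axioms _ _ _ _ _ _ _ that, where h = "\<lambda>r. r"])
      (auto simp: rc_simps(1) iota_simps val_simps val_iota simp flip: rc_simps(2-3) intro!: rc_eqI del: equalityI)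
  let ?xs = "[(a, kone), (b, keps)]"
  have "red (E a b) = BC.T.cls (map (\<lambda>(a, n). (a, rc (\<iota> (fst n)))) ?xs)"
    unfolding red_def E_def case_prod_unfold
    by (rule DC.T.the_elem_cls[OF _ BC.T.cls_eqI[OF tensor_eq.sym[OF eq[unfolded case_prod_unfold]]]])
      (use assms in auto)
  also have "\<dots> = pr a"
    using tensor_eq.append[OF tensor_eq.refl BC.T.zero_right[OF assms(2)], of "[(a, rc \<one>\<^bsub>R\<^esub>)]"] assms
    unfolding pr_def by (intro BC.T.cls_eqI) (simp add: iota_simps iota_zero rc_simps rc_zero)
  finally show ?thesis .
qed

abbreviation emb where "emb \<equiv> \<lambda>C. (\<zero>\<^bsub>K\<^esub>, vC C)"

text \<open>On the line spanned by \<open>\<epsilon>\<close> a germ \<open>r\<close> acts through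
  its value, because its part \<open>w r \<epsilon>\<close> is killed by \<open>\<epsilon>\<close>.
  Hence the residue field sits in the dual numbers as an \<open>R\<close>-submodule.\<close>

lemma emb_linear: "emb \<in> linear_maps R BC.N DC.N"
  unfolding linear_maps_def
  by (auto elim!: QuotE simp: vC_rc val_simps w_closed simp flip: rc_simps(2-3))

lemma emb_inj: "inj_on emb (carrier BC.N)"
  by (rule inj_onI) (auto elim!: QuotE simp: vC_rc intro!: rc_eqI del: equalityI)

text \<open>Tensoring \<open>emb\<close> with \<open>M\<close> sends \<open>b \<otimes> 1\<close> in
  the fibre to \<open>b \<otimes> \<epsilon>\<close>, so the second slot of \<open>E\<close> depends
  only on the class of its entry in the fibre.\<close>

lemma E_pr:
  assumes "a \<in> carrier M" "b \<in> carrier M" "b' \<in> carrier M" "pr b = pr b'"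
  shows "E a b = E a b'"
proof -
  have 1: "BC.T.eq [(b, rc \<one>\<^bsub>R\<^esub>)] [(b', rc \<one>\<^bsub>R\<^esub>)]"
    by (rule iffD1[OF BC.T.cls_eq]) (use assms in \<open>auto simp: rc_simps pr_def\<close>)
  have "DC.T.eq (map (\<lambda>(a, C). (a, emb C)) [(b, rc \<one>\<^bsub>R\<^esub>)]) (map (\<lambda>(a, C). (a, emb C)) [(b', rc \<one>\<^bsub>R\<^esub>)])"
    by (rule tensor_eq_map[OF BC.T.tensor_axioms DC.T.tensor_axioms _ _ _ _ _ _ _ 1, where h = "\<lambda>r. r"])
      (use emb_linear in \<open>auto simp: linear_maps_def simp del: BC.N_sel DC.N_sel\<close>)
  then have 2: "DC.T.eq [(b, keps)] [(b', keps)]" by (simp add: vC_rc val_simps)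
  have "DC.T.eq ([(a, kone)] @ [(b, keps)]) ([(a, kone)] @ [(b', keps)])"
    by (rule tensor_eq.append[OF tensor_eq.refl 2]) (use assms in auto)
  then show ?thesis unfolding E_def by (intro DC.T.cls_eqI) simp
qed

text \<open>Flatness is applied here: the injection \<open>emb\<close> stays injective after
  tensoring with \<open>M\<close>, so \<open>b \<otimes> \<epsilon> = 0\<close> forces
  \<open>b \<otimes> 1 = 0\<close> in the fibre.\<close>

lemma E_inj0:
  assumes b: "b \<in> carrier M" and "E \<zero>\<^bsub>M\<^esub> b = \<zero>\<^bsub>DC.D\<^esub>"
  shows "pr b = \<zero>\<^bsub>BC.D\<^esub>"
proof -
  have "DC.T.cls ([(\<zero>\<^bsub>M\<^esub>, kone)] @ [(b, keps)]) = DC.T.cls ([] @ [(b, keps)])"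
    by (intro DC.T.cls_eqI tensor_eq.append tensor_eq.zero tensor_eq.refl) (use b in auto)
  then have "DC.T.cls [(b, keps)] = DC.T.cls []" using assms unfolding E_def DC.zero_D by simp
  then have eq: "DC.T.eq [(b, keps)] []" using DC.T.cls_eq[of "[(b, keps)]"] b by simp
  have "BC.T.eq [(b, rc \<one>\<^bsub>R\<^esub>)] []"
  proof (rule flat_module_inj[OF flat BC.T.tensor_axioms DC.T.tensor_axioms _ _ emb_linear emb_inj])
    \<comment> \<open>Both modules are embedded into lists over \<open>R\<close> by means of
      constants: one entry for a residue class, two for a dual number. These codes are injective
      because \<open>val\<close> recovers \<open>c\<close> from \<open>\<iota> c\<close>.\<close>
    show "inj_on (\<lambda>C. [\<iota> (vC C)]) (carrier BC.N)"
      by (rule inj_onI) (auto elim!: QuotE simp: vC_rc dest!: arg_cong[where f = val] simp: val_iota val_simps intro!: rc_eqI del: equalityI)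
    show "inj_on (\<lambda>(x, y). [\<iota> x, \<iota> y]) (carrier DC.N)"
      by (rule inj_onI) (auto dest!: arg_cong[where f = val] simp: val_iota)
    show "DC.T.eq (map (\<lambda>(x, y). (x, emb y)) [(b, rc \<one>\<^bsub>R\<^esub>)]) (map (\<lambda>(x, y). (x, emb y)) [])"
      using eq by (simp add: vC_rc val_simps)
  qed (use b in \<open>auto simp: rc_simps\<close>)
  then show ?thesis unfolding pr_def BC.zero_D by (rule BC.T.cls_eqI)
qed

lemma E_eq_iff:
  assumes "a \<in> carrier M" "b \<in> carrier M" "b' \<in> carrier M"
  shows "E a b = E a b' \<longleftrightarrow> pr b = pr b'"
proof
  assume eq: "E a b = E a b'"
  have "E a b \<oplus>\<^bsub>DC.D\<^esub> E (\<ominus>\<^bsub>M\<^esub> a) (\<ominus>\<^bsub>M\<^esub> b') = E a b' \<oplus>\<^bsub>DC.D\<^esub> E (\<ominus>\<^bsub>M\<^esub> a) (\<ominus>\<^bsub>M\<^esub> b')" by (simp add: eq)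
  then have "E \<zero>\<^bsub>M\<^esub> (b \<ominus>\<^bsub>M\<^esub> b') = \<zero>\<^bsub>DC.D\<^esub>"
    using assms by (simp add: E_add M.r_neg M.minus_eq E_zero)
  then have "b \<ominus>\<^bsub>M\<^esub> b' \<in> mM" using assms by (intro pr_eq_zero E_inj0) auto
  then show "pr b = pr b'" using assms pr_eq_iff by blast
qed (use assms E_pr in blast)

lemma w_m_closed: "r \<in> m \<Longrightarrow> w r \<in> carrier K" by (simp add: w_closed m_closed)
lemma iw_closed: "r \<in> m \<Longrightarrow> \<iota> (w r) \<in> carrier R" by (simp add: w_m_closed iota_simps)

text \<open>For \<open>r\<close> in \<open>m\<close> the value vanishes, so \<open>r\<close> acts on
  1 as \<open>w r \<epsilon>\<close>, and
  \<open>r a \<otimes> 1 = a \<otimes> w r \<epsilon>\<close>. The constant \<open>w r\<close> is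
  then moved back into \<open>M\<close>.\<close>

lemma E_lin: "ms \<in> kl \<Longrightarrow> E (lin (\<lambda>r. r) ms) \<zero>\<^bsub>M\<^esub> = E \<zero>\<^bsub>M\<^esub> (lin (\<lambda>r. \<iota> (w r)) ms)"
proof (induction ms)
  case (Cons p ms)
  obtain r a where p: "p = (r, a)" by (cases p)
  then have ra: "r \<in> m" "a \<in> carrier M" "ms \<in> kl" using Cons.prems by simp_all
  have r: "r \<in> carrier R" "val r = \<zero>\<^bsub>K\<^esub>" using m_closed[OF ra(1)] m_iff[OF m_closed[OF ra(1)]] ra(1) by (blast, blast)
  have "E (r \<odot>\<^bsub>M\<^esub> a) \<zero>\<^bsub>M\<^esub> = DC.T.cls [(r \<odot>\<^bsub>M\<^esub> a, kone)] \<oplus>\<^bsub>DC.D\<^esub> DC.T.cls [(\<zero>\<^bsub>M\<^esub>, keps)]"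
    unfolding E_def using ra r by (intro E_split) auto
  also have "DC.T.cls [(\<zero>\<^bsub>M\<^esub>, keps)] = E \<zero>\<^bsub>M\<^esub> \<zero>\<^bsub>M\<^esub>" by (simp add: E_single iota_simps)
  also have "DC.T.cls [(r \<odot>\<^bsub>M\<^esub> a, kone)] = DC.T.cls [(a, (\<zero>\<^bsub>K\<^esub>, w r))]"
    using tensor_eq.balanced[of r R a M kone DC.N] ra r by (intro DC.T.cls_eqI) (simp add: w_closed)
  also have "\<dots> = E \<zero>\<^bsub>M\<^esub> (\<iota> (w r) \<odot>\<^bsub>M\<^esub> a)"
    using ra r by (simp add: E_single w_closed iota_zero)
  finally have 1: "E (r \<odot>\<^bsub>M\<^esub> a) \<zero>\<^bsub>M\<^esub> = E \<zero>\<^bsub>M\<^esub> (\<iota> (w r) \<odot>\<^bsub>M\<^esub> a)"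
    using ra r by (simp add: E_add w_closed iota_simps)
  have "E (lin (\<lambda>r. r) (p # ms)) \<zero>\<^bsub>M\<^esub> = E (r \<odot>\<^bsub>M\<^esub> a) \<zero>\<^bsub>M\<^esub> \<oplus>\<^bsub>DC.D\<^esub> E (lin (\<lambda>r. r) ms) \<zero>\<^bsub>M\<^esub>"
    using ra r by (simp add: E_add p lin_closed m_closed)
  also have "\<dots> = E \<zero>\<^bsub>M\<^esub> (lin (\<lambda>r. \<iota> (w r)) (p # ms))"
    using ra r Cons 1 by (simp add: p E_add lin_closed iw_closed)
  finally show ?case .
qed simp

text \<open>The given presentation and the chosen one represent the same element of
  \<open>m M\<close>. By \<open>E_lin\<close> their images in the \<open>\<epsilon>\<close> slot are
  the same element of the deformation, and \<open>E_eq_iff\<close> recovers the class in the fibre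
  from it.\<close>

lemma Lam_lin:
  assumes "ms \<in> kl" shows "Lam w (lin (\<lambda>r. r) ms) = pr (lin (\<lambda>r. \<iota> (w r)) ms)"
proof -
  define ns where "ns = (SOME ns. ns \<in> kl \<and> lin (\<lambda>r. r) ns = lin (\<lambda>r. r) ms)"
  have "lin (\<lambda>r. r) ms \<in> mM" using assms unfolding mM_def by blast
  then have ns: "ns \<in> kl" "lin (\<lambda>r. r) ns = lin (\<lambda>r. r) ms" unfolding ns_def by (rule mM_some)+
  have "E \<zero>\<^bsub>M\<^esub> (lin (\<lambda>r. \<iota> (w r)) ns) = E \<zero>\<^bsub>M\<^esub> (lin (\<lambda>r. \<iota> (w r)) ms)"
    using E_lin[OF ns(1)] E_lin[OF assms] ns(2) by simp
  then show ?thesis unfolding Lam_def ns_def[symmetric]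
    using E_eq_iff ns assms by (simp add: lin_closed iw_closed)
qed

lemma E_Lam:
  assumes "x \<in> mM" "y \<in> carrier M" "pr y = Lam w x"
  shows "E x \<zero>\<^bsub>M\<^esub> = E \<zero>\<^bsub>M\<^esub> y"
proof -
  obtain ms where ms: "ms \<in> kl" "x = lin (\<lambda>r. r) ms" using assms unfolding mM_def by auto
  have "pr y = pr (lin (\<lambda>r. \<iota> (w r)) ms)" unfolding assms(3) ms(2) using Lam_lin[OF ms(1)] .
  then have "E \<zero>\<^bsub>M\<^esub> y = E \<zero>\<^bsub>M\<^esub> (lin (\<lambda>r. \<iota> (w r)) ms)"
    using assms(2) ms(1) by (intro E_pr) (simp_all add: lin_closed iw_closed)
  then show ?thesis unfolding ms(2) using E_lin[OF ms(1)] by simp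
qed

lemma Lam_add:
  assumes "x \<in> mM" "y \<in> mM"
  shows "Lam w (x \<oplus>\<^bsub>M\<^esub> y) = Lam w x \<oplus>\<^bsub>BC.D\<^esub> Lam w y"
proof -
  obtain ms ns where "ms \<in> kl" "x = lin (\<lambda>r. r) ms" "ns \<in> kl" "y = lin (\<lambda>r. r) ns"
    using assms unfolding mM_def by auto
  moreover from this have "x \<oplus>\<^bsub>M\<^esub> y = lin (\<lambda>r. r) (ms @ ns)" by (simp add: lin_append m_closed)
  ultimately show ?thesis
    by (simp add: Lam_lin lin_append[OF iw_closed] pr_add lin_closed iw_closed)
qed

text \<open>\<open>F\<close> acts on presentations entry by entry. Taking for \<open>F\<close> a
  left or right multiplication, the action of a constant, or a grading projection yields that
  \<open>Lam w\<close> is a bimodule map, is \<open>K\<close>-linear, and preserves degrees.\<close>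

lemma Lam_map:
  assumes "\<And>x. x \<in> carrier M \<Longrightarrow> F x \<in> carrier M"
    and "\<And>x y. x \<in> carrier M \<Longrightarrow> y \<in> carrier M \<Longrightarrow> F (x \<oplus>\<^bsub>M\<^esub> y) = F x \<oplus>\<^bsub>M\<^esub> F y"
    and "\<And>r x. r \<in> carrier R \<Longrightarrow> x \<in> carrier M \<Longrightarrow> F (r \<odot>\<^bsub>M\<^esub> x) = r \<odot>\<^bsub>M\<^esub> F x"
    and "\<And>x. x \<in> carrier M \<Longrightarrow> F' (pr x) = pr (F x)" and "x \<in> mM"
  shows "Lam w (F x) = F' (Lam w x)"
proof -
  obtain ms where ms: "ms \<in> kl" "x = lin (\<lambda>r. r) ms" using assms(5) unfolding mM_def by auto
  have "F x = lin (\<lambda>r. r) (map (\<lambda>(r, a). (r, F a)) ms)"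
    unfolding ms(2) by (rule lin_map) (use assms ms in \<open>auto simp: m_closed\<close>)
  then have "Lam w (F x) = pr (lin (\<lambda>r. \<iota> (w r)) (map (\<lambda>(r, a). (r, F a)) ms))"
    using Lam_lin[OF kl_map[OF assms(1) ms(1)]] by simp
  also have "lin (\<lambda>r. \<iota> (w r)) (map (\<lambda>(r, a). (r, F a)) ms) = F (lin (\<lambda>r. \<iota> (w r)) ms)"
    by (rule lin_map[symmetric]) (use assms ms in \<open>auto simp: iw_closed\<close>)
  finally show ?thesis using assms(4) ms by (simp add: Lam_lin lin_closed iw_closed)
qed

end

section \<open>Hochschild cochains in low degrees\<close>

lemma ball_tuples_1: "(\<forall>xs\<in>tuples B 1. Q xs) \<longleftrightarrow> (\<forall>x\<in>carrier B. Q [x])"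
proof -
  have "tuples B 1 = (\<lambda>x. [x]) ` carrier B"
    unfolding tuples_def by (auto simp: length_Suc_conv)
  then show ?thesis by simp
qed

lemma ball_tuples_2: "(\<forall>xs\<in>tuples B 2. Q xs) \<longleftrightarrow> (\<forall>x\<in>carrier B. \<forall>y\<in>carrier B. Q [x, y])"
proof -
  have "tuples B 2 = (\<lambda>(x, y). [x, y]) ` (carrier B \<times> carrier B)"
    unfolding tuples_def by (force simp: length_Suc_conv numeral_2_eq_2 image_iff)
  then show ?thesis by auto
qed

lemma ball_tuples_3: "(\<forall>xs\<in>tuples B 3. Q xs) \<longleftrightarrow>
    (\<forall>x\<in>carrier B. \<forall>y\<in>carrier B. \<forall>z\<in>carrier B. Q [x, y, z])"
proof -
  have "tuples B 3 = (\<lambda>(x, y, z). [x, y, z]) ` (carrier B \<times> carrier B \<times> carrier B)"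
    unfolding tuples_def by (force simp: length_Suc_conv numeral_3_eq_3 image_iff)
  then show ?thesis by auto
qed

lemma all_less_1: "(\<forall>i<(1::nat). Q i) \<longleftrightarrow> Q 0" by auto
lemma all_less_2: "(\<forall>i<(2::nat). Q i) \<longleftrightarrow> Q 0 \<and> Q 1" by (auto simp: less_2_cases_iff)

locale graded_alg = B: ring B + BM: module K B
  for K :: "'k ring" and B :: "('k, 'b) graded_algebra" +
  assumes smult_mult: "r \<in> carrier K \<Longrightarrow> x \<in> carrier B \<Longrightarrow> y \<in> carrier B \<Longrightarrow>
      (r \<odot>\<^bsub>B\<^esub> x) \<otimes>\<^bsub>B\<^esub> y = r \<odot>\<^bsub>B\<^esub> (x \<otimes>\<^bsub>B\<^esub> y)"
    and mult_smult: "r \<in> carrier K \<Longrightarrow> x \<in> carrier B \<Longrightarrow> y \<in> carrier B \<Longrightarrow>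
      x \<otimes>\<^bsub>B\<^esub> (r \<odot>\<^bsub>B\<^esub> y) = r \<odot>\<^bsub>B\<^esub> (x \<otimes>\<^bsub>B\<^esub> y)"
    and gr_sub: "x \<in> grade B i \<Longrightarrow> x \<in> carrier B"
    and gr_zero: "\<zero>\<^bsub>B\<^esub> \<in> grade B i"
    and gr_add: "x \<in> grade B i \<Longrightarrow> y \<in> grade B i \<Longrightarrow> x \<oplus>\<^bsub>B\<^esub> y \<in> grade B i"
    and gr_smult: "c \<in> carrier K \<Longrightarrow> x \<in> grade B i \<Longrightarrow> c \<odot>\<^bsub>B\<^esub> x \<in> grade B i"
    and gr_mult: "x \<in> grade B i \<Longrightarrow> y \<in> grade B j \<Longrightarrow> x \<otimes>\<^bsub>B\<^esub> y \<in> grade B (i + j)"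
begin

text \<open>Degree-preserving cochains as ordinary functions of one argument, and of two arguments
  in \<open>bil\<close>; \<open>E1\<close> and \<open>E2\<close> translate back into the encoding by
  lists.\<close>

definition lin1 :: "('b \<Rightarrow> 'b) \<Rightarrow> bool" where
  "lin1 t \<longleftrightarrow> (\<forall>x\<in>carrier B. t x \<in> carrier B) \<and>
     (\<forall>x\<in>carrier B. \<forall>y\<in>carrier B. t (x \<oplus>\<^bsub>B\<^esub> y) = t x \<oplus>\<^bsub>B\<^esub> t y) \<and>
     (\<forall>c\<in>carrier K. \<forall>x\<in>carrier B. t (c \<odot>\<^bsub>B\<^esub> x) = c \<odot>\<^bsub>B\<^esub> t x) \<and>
     (\<forall>i. \<forall>x\<in>grade B i. t x \<in> grade B i)"

definition bil :: "('b \<Rightarrow> 'b \<Rightarrow> 'b) \<Rightarrow> bool" where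
  "bil f \<longleftrightarrow> (\<forall>x\<in>carrier B. \<forall>y\<in>carrier B. f x y \<in> carrier B) \<and>
     (\<forall>x\<in>carrier B. \<forall>y\<in>carrier B. \<forall>z\<in>carrier B. f (x \<oplus>\<^bsub>B\<^esub> y) z = f x z \<oplus>\<^bsub>B\<^esub> f y z) \<and>
     (\<forall>x\<in>carrier B. \<forall>y\<in>carrier B. \<forall>z\<in>carrier B. f x (y \<oplus>\<^bsub>B\<^esub> z) = f x y \<oplus>\<^bsub>B\<^esub> f x z) \<and>
     (\<forall>c\<in>carrier K. \<forall>x\<in>carrier B. \<forall>y\<in>carrier B. f (c \<odot>\<^bsub>B\<^esub> x) y = c \<odot>\<^bsub>B\<^esub> f x y) \<and>
     (\<forall>c\<in>carrier K. \<forall>x\<in>carrier B. \<forall>y\<in>carrier B. f x (c \<odot>\<^bsub>B\<^esub> y) = c \<odot>\<^bsub>B\<^esub> f x y) \<and>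
     (\<forall>i j. \<forall>x\<in>grade B i. \<forall>y\<in>grade B j. f x y \<in> grade B (i + j))"

definition E1 where "E1 t = (\<lambda>xs\<in>tuples B 1. t (hd xs))"
definition E2 where "E2 f = (\<lambda>xs\<in>tuples B 2. f (xs ! 0) (xs ! 1))"
definition d1 where "d1 t x y = ((x \<otimes>\<^bsub>B\<^esub> t y) \<oplus>\<^bsub>B\<^esub> (\<ominus>\<^bsub>B\<^esub> t (x \<otimes>\<^bsub>B\<^esub> y))) \<oplus>\<^bsub>B\<^esub> (t x \<otimes>\<^bsub>B\<^esub> y)"

abbreviation C where "C \<equiv> hochschild_cochains K B"

lemma pair_in [simp]: "[x, y] \<in> tuples B 2 \<longleftrightarrow> x \<in> carrier B \<and> y \<in> carrier B"
  by (simp add: tuples_def)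

lemma single_in [simp]: "[x] \<in> tuples B (Suc 0) \<longleftrightarrow> x \<in> carrier B"
  by (simp add: tuples_def)

lemma E2_app: "x \<in> carrier B \<Longrightarrow> y \<in> carrier B \<Longrightarrow> E2 f [x, y] = f x y" by (simp add: E2_def)

lemma ext2:
  assumes "f \<in> extensional (tuples B 2)" "g \<in> extensional (tuples B 2)"
    and "\<And>x y. x \<in> carrier B \<Longrightarrow> y \<in> carrier B \<Longrightarrow> f [x, y] = g [x, y]"
  shows "f = g"
proof (rule extensionalityI[OF assms(1,2)])
  have "\<forall>xs\<in>tuples B 2. f xs = g xs" unfolding ball_tuples_2 using assms(3) by blast
  then show "xs \<in> tuples B 2 \<Longrightarrow> f xs = g xs" for xs by blast
qed

lemma E2_ext [simp]: "E2 f \<in> extensional (tuples B 2)" by (simp add: E2_def)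

lemma E2_cong: "(\<And>x y. x \<in> carrier B \<Longrightarrow> y \<in> carrier B \<Longrightarrow> f x y = g x y) \<Longrightarrow> E2 f = E2 g"
  by (rule ext2) (auto simp: E2_app)

lemma ball_const: "(\<forall>u\<in>carrier B. Q) \<longleftrightarrow> Q" using B.zero_closed by blast

lemma C1_iff: "f \<in> carrier (C 1) \<longleftrightarrow> f \<in> extensional (tuples B 1) \<and> lin1 (\<lambda>x. f [x])"
proof -
  have 1: "(\<forall>x\<in>carrier B. \<forall>d. x \<in> grade B (d 0) \<longrightarrow> f [x] \<in> grade B (d (0::nat))) \<longleftrightarrow>
     (\<forall>i. \<forall>x\<in>grade B i. f [x] \<in> grade B i)" (is "?l \<longleftrightarrow> ?r")
  proof
    show "?l \<Longrightarrow> ?r"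
    proof (intro allI ballI)
      fix i x assume l: ?l and x: "x \<in> grade B i"
      show "f [x] \<in> grade B i"
        using l[THEN bspec, OF gr_sub[OF x], THEN spec[of _ "\<lambda>k. i"]] x by simp
    qed
  qed blast
  have s1: "(\<Sum>i<1. d i) = d 0" for d :: "nat \<Rightarrow> int" by simp
  have u: "[x][0 := y] = [y]" "[x] ! 0 = x" for x y :: 'b by simp_all
  show ?thesis
    unfolding hochschild_cochains_def lin1_def 1[symmetric]
    by (simp only: module.simps partial_object.simps mem_Collect_eq Int_iff Pi_iff ball_tuples_1 all_less_1 s1 u ball_const)
      blast
qed

lemma C2_iff: "f \<in> carrier (C 2) \<longleftrightarrow> f \<in> extensional (tuples B 2) \<and> bil (\<lambda>x y. f [x, y])"
proof -
  have 1: "(\<forall>x\<in>carrier B. \<forall>y\<in>carrier B. \<forall>d. x \<in> grade B (d 0) \<and> y \<in> grade B (d (1::nat)) \<longrightarrow>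
      f [x, y] \<in> grade B (d 0 + d 1)) \<longleftrightarrow>
     (\<forall>i j. \<forall>x\<in>grade B i. \<forall>y\<in>grade B j. f [x, y] \<in> grade B (i + j))" (is "?l \<longleftrightarrow> ?r")
  proof
    show "?l \<Longrightarrow> ?r"
    proof (intro allI ballI)
      fix i j x y assume l: ?l and xy: "x \<in> grade B i" "y \<in> grade B j"
      show "f [x, y] \<in> grade B (i + j)"
        using l[THEN bspec, OF gr_sub[OF xy(1)], THEN bspec, OF gr_sub[OF xy(2)], THEN spec[of _ "\<lambda>k. if k = 0 then i else j"]] xy by simp
    qed
  qed blast
  have s2: "(\<Sum>i<2. d i) = d 0 + d 1" for d :: "nat \<Rightarrow> int" by (simp add: numeral_2_eq_2)
  have u: "[x, z][0 := y] = [y, z]" "[x, z][1 := y] = [x, y]" "[x, z] ! 0 = x" "[x, z] ! 1 = z" for x y z :: 'b by simp_all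
  have c: "(\<forall>u\<in>carrier B. \<forall>v\<in>carrier B. Q u v \<and> R u v) \<longleftrightarrow>
    (\<forall>u\<in>carrier B. \<forall>v\<in>carrier B. Q u v) \<and> (\<forall>u\<in>carrier B. \<forall>v\<in>carrier B. R u v)" for Q R
    by blast
  show ?thesis
    unfolding hochschild_cochains_def bil_def 1[symmetric]
    by (simp only: module.simps partial_object.simps mem_Collect_eq Int_iff Pi_iff ball_tuples_2 all_less_2 s2 u c ball_const)
      blast
qed

lemma E2_C: "bil f \<Longrightarrow> E2 f \<in> carrier (C 2)"
  unfolding C2_iff by (simp add: bil_def E2_app BM.smult_closed gr_sub)

lemma C2_E2: "f \<in> carrier (C 2) \<Longrightarrow> f = E2 (\<lambda>x y. f [x, y])"
  by (rule ext2) (auto simp: C2_iff E2_app)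

lemma E1_C: "lin1 t \<Longrightarrow> E1 t \<in> carrier (C 1)"
  unfolding C1_iff by (simp add: lin1_def E1_def BM.smult_closed gr_sub)

lemma diff1:
  assumes "f \<in> carrier (C 1)"
  shows "hochschild_differential B 1 f = E2 (d1 (\<lambda>x. f [x]))"
proof (rule ext2)
  show "hochschild_differential B 1 f \<in> extensional (tuples B 2)"
    by (simp add: hochschild_differential_def numeral_2_eq_2)
next
  fix x y assume xy: "x \<in> carrier B" "y \<in> carrier B"
  have "f [x \<otimes>\<^bsub>B\<^esub> y] \<in> carrier B" using assms xy unfolding C1_iff lin1_def by simp
  then show "hochschild_differential B 1 f [x, y] = E2 (d1 (\<lambda>x. f [x])) [x, y]"
    using xy by (simp add: hochschild_differential_def E2_app d1_def alternate_def lessThan_Suc numeral_2_eq_2[symmetric])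
qed simp

lemma coboundaries_2: "hochschild_coboundaries K B 2 = (\<lambda>t. E2 (d1 t)) ` Collect lin1"
proof -
  have "hochschild_coboundaries K B 2 = hochschild_differential B 1 ` carrier (C 1)"
    by (simp add: hochschild_coboundaries_def numeral_2_eq_2)
  also have "\<dots> = (\<lambda>t. E2 (d1 t)) ` Collect lin1"
  proof
    show "hochschild_differential B 1 ` carrier (C 1) \<subseteq> (\<lambda>t. E2 (d1 t)) ` Collect lin1"
      by (clarify, subst diff1) (simp_all only: C1_iff, blast)
    show "(\<lambda>t. E2 (d1 t)) ` Collect lin1 \<subseteq> hochschild_differential B 1 ` carrier (C 1)"
    proof safe
      fix t assume t: "lin1 t"
      have "hochschild_differential B 1 (E1 t) = E2 (d1 t)"
        unfolding diff1[OF E1_C[OF t]] by (rule E2_cong) (auto simp: d1_def E1_def)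
      then show "E2 (d1 t) \<in> hochschild_differential B 1 ` carrier (C 1)" using E1_C[OF t] by (metis imageI)
    qed
  qed
  finally show ?thesis .
qed

text \<open>The Hochschild cocycle identity with its two negative terms moved to the right, which
  makes it an equation without signs.\<close>

definition cocyc where "cocyc f \<longleftrightarrow> (\<forall>x\<in>carrier B. \<forall>y\<in>carrier B. \<forall>z\<in>carrier B.
   (x \<otimes>\<^bsub>B\<^esub> f y z) \<oplus>\<^bsub>B\<^esub> f x (y \<otimes>\<^bsub>B\<^esub> z) = f (x \<otimes>\<^bsub>B\<^esub> y) z \<oplus>\<^bsub>B\<^esub> (f x y \<otimes>\<^bsub>B\<^esub> z))"

lemma E2_cocycle:
  assumes "bil f" "cocyc f"
  shows "E2 f \<in> hochschild_cocycles K B 2"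
proof -
  have cl: "f x y \<in> carrier B" if "x \<in> carrier B" "y \<in> carrier B" for x y using assms that unfolding bil_def by blast
  have "\<forall>xs\<in>tuples B 3. hochschild_differential B 2 (E2 f) xs = \<zero>\<^bsub>C 3\<^esub> xs"
    unfolding ball_tuples_3
  proof (intro ballI)
    fix x y z assume xyz: "x \<in> carrier B" "y \<in> carrier B" "z \<in> carrier B"
    have s: "{..<2::nat} = insert 0 {1}" by auto
    have "hochschild_differential B 2 (E2 f) [x, y, z] =
      ((x \<otimes>\<^bsub>B\<^esub> f y z) \<oplus>\<^bsub>B\<^esub> (\<ominus>\<^bsub>B\<^esub> f (x \<otimes>\<^bsub>B\<^esub> y) z \<oplus>\<^bsub>B\<^esub> f x (y \<otimes>\<^bsub>B\<^esub> z))) \<oplus>\<^bsub>B\<^esub> \<ominus>\<^bsub>B\<^esub> (f x y \<otimes>\<^bsub>B\<^esub> z)"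
      using xyz cl by (simp add: hochschild_differential_def alternate_def E2_app s tuples_def)
    also have "\<dots> = ((x \<otimes>\<^bsub>B\<^esub> f y z) \<oplus>\<^bsub>B\<^esub> f x (y \<otimes>\<^bsub>B\<^esub> z)) \<oplus>\<^bsub>B\<^esub> \<ominus>\<^bsub>B\<^esub> (f (x \<otimes>\<^bsub>B\<^esub> y) z \<oplus>\<^bsub>B\<^esub> (f x y \<otimes>\<^bsub>B\<^esub> z))"
      using xyz cl by (simp add: B.minus_add B.a_ac)
    also have "\<dots> = \<zero>\<^bsub>B\<^esub>"
      using assms(2) xyz cl unfolding cocyc_def by (simp add: B.r_neg)
    finally show "hochschild_differential B 2 (E2 f) [x, y, z] = \<zero>\<^bsub>C 3\<^esub> [x, y, z]"
      using xyz by (simp add: hochschild_cochains_def tuples_def)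
  qed
  then have "hochschild_differential B 2 (E2 f) = \<zero>\<^bsub>C (Suc 2)\<^esub>"
    by (intro extensionalityI[of _ "tuples B 3"]) (auto simp: hochschild_differential_def hochschild_cochains_def)
  then show ?thesis unfolding hochschild_cocycles_def using E2_C[OF assms(1)] by simp
qed

text \<open>The coset of \<open>f\<close> modulo coboundaries, that is, its class in Hochschild
  cohomology. The coboundary stands on the left to match the cosets formed by
  \<open>+>\<close>.\<close>

definition cos where "cos f = {E2 (\<lambda>x y. d1 t x y \<oplus>\<^bsub>B\<^esub> f x y) | t. lin1 t}"

lemma lin1_closed: "lin1 t \<Longrightarrow> x \<in> carrier B \<Longrightarrow> t x \<in> carrier B" by (simp add: lin1_def)
lemma bil_closed: "bil f \<Longrightarrow> x \<in> carrier B \<Longrightarrow> y \<in> carrier B \<Longrightarrow> f x y \<in> carrier B" by (simp add: bil_def)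
lemma d1_closed: "lin1 t \<Longrightarrow> x \<in> carrier B \<Longrightarrow> y \<in> carrier B \<Longrightarrow> d1 t x y \<in> carrier B"
  by (simp add: lin1_closed d1_def)

lemma lin1_add: "lin1 t \<Longrightarrow> lin1 u \<Longrightarrow> lin1 (\<lambda>x. t x \<oplus>\<^bsub>B\<^esub> u x)"
  unfolding lin1_def by (simp add: B.a_ac BM.smult_r_distr gr_add)

lemma lin1_smult: "c \<in> carrier K \<Longrightarrow> lin1 t \<Longrightarrow> lin1 (\<lambda>x. c \<odot>\<^bsub>B\<^esub> t x)"
  unfolding lin1_def by (simp add: BM.smult_r_distr gr_smult BM.R.m_comm flip: BM.smult_assoc1)

lemma lin1_zero: "lin1 (\<lambda>x. \<zero>\<^bsub>B\<^esub>)"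
  unfolding lin1_def by (simp add: gr_zero)

lemma d1_add: "lin1 t \<Longrightarrow> lin1 u \<Longrightarrow> x \<in> carrier B \<Longrightarrow> y \<in> carrier B \<Longrightarrow>
    d1 (\<lambda>x. t x \<oplus>\<^bsub>B\<^esub> u x) x y = d1 t x y \<oplus>\<^bsub>B\<^esub> d1 u x y"
  by (simp add: lin1_closed d1_def B.r_distr B.l_distr B.minus_add B.a_ac)

lemma d1_smult: "c \<in> carrier K \<Longrightarrow> lin1 t \<Longrightarrow> x \<in> carrier B \<Longrightarrow> y \<in> carrier B \<Longrightarrow>
    d1 (\<lambda>x. c \<odot>\<^bsub>B\<^esub> t x) x y = c \<odot>\<^bsub>B\<^esub> d1 t x y"
  by (simp add: lin1_closed d1_def BM.smult_r_distr smult_mult mult_smult BM.smult_r_minus)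

lemma d1_zero: "x \<in> carrier B \<Longrightarrow> y \<in> carrier B \<Longrightarrow> d1 (\<lambda>x. \<zero>\<^bsub>B\<^esub>) x y = \<zero>\<^bsub>B\<^esub>"
  by (simp add: d1_def)

lemma C_add: "E2 f \<oplus>\<^bsub>C 2\<^esub> E2 g = E2 (\<lambda>x y. f x y \<oplus>\<^bsub>B\<^esub> g x y)"
  by (rule ext2) (auto simp: hochschild_cochains_def E2_app)

lemma C_smult: "c \<odot>\<^bsub>C 2\<^esub> E2 f = E2 (\<lambda>x y. c \<odot>\<^bsub>B\<^esub> f x y)"
  by (rule ext2) (auto simp: hochschild_cochains_def E2_app)

lemma cos_coset: "hochschild_coboundaries K B 2 +>\<^bsub>C 2\<lparr>carrier := Z\<rparr>\<^esub> E2 f = cos f"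
proof -
  have "h \<oplus>\<^bsub>C 2\<lparr>carrier := Z\<rparr>\<^esub> g = h \<oplus>\<^bsub>C 2\<^esub> g" for h g by simp
  then show ?thesis
    unfolding a_r_coset_def' coboundaries_2 cos_def by (auto simp: C_add)
qed

lemma cos_HH0:
  assumes "bil f" "cocyc f" shows "cos f \<in> carrier (HH0 K B 2)"
  unfolding HH0_def quotient_module_def A_RCOSETS_def'
  using E2_cocycle[OF assms] cos_coset[of _ f] by fastforce

lemma cos_add:
  assumes "bil f" "bil g"
  shows "cos f \<oplus>\<^bsub>HH0 K B 2\<^esub> cos g = cos (\<lambda>x y. f x y \<oplus>\<^bsub>B\<^esub> g x y)"
proof -
  have "cos f \<oplus>\<^bsub>HH0 K B 2\<^esub> cos g = (\<Union>h\<in>cos f. \<Union>k\<in>cos g. {h \<oplus>\<^bsub>C 2\<^esub> k})"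
    by (simp add: HH0_def quotient_module_def set_add_def')
  also have "\<dots> = cos (\<lambda>x y. f x y \<oplus>\<^bsub>B\<^esub> g x y)"
  proof (intro equalityI subsetI)
    fix h assume "h \<in> (\<Union>h\<in>cos f. \<Union>k\<in>cos g. {h \<oplus>\<^bsub>C 2\<^esub> k})"
    then obtain t u where tu: "lin1 t" "lin1 u" and
      h: "h = E2 (\<lambda>x y. d1 t x y \<oplus>\<^bsub>B\<^esub> f x y) \<oplus>\<^bsub>C 2\<^esub> E2 (\<lambda>x y. d1 u x y \<oplus>\<^bsub>B\<^esub> g x y)"
      unfolding cos_def by auto
    have "h = E2 (\<lambda>x y. d1 (\<lambda>x. t x \<oplus>\<^bsub>B\<^esub> u x) x y \<oplus>\<^bsub>B\<^esub> (f x y \<oplus>\<^bsub>B\<^esub> g x y))"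
      unfolding h C_add
      by (rule E2_cong) (use assms tu in \<open>simp add: d1_add d1_closed bil_closed B.a_ac\<close>)
    then show "h \<in> cos (\<lambda>x y. f x y \<oplus>\<^bsub>B\<^esub> g x y)" unfolding cos_def using lin1_add[OF tu] by blast
  next
    fix h assume "h \<in> cos (\<lambda>x y. f x y \<oplus>\<^bsub>B\<^esub> g x y)"
    then obtain t where t: "lin1 t" and h: "h = E2 (\<lambda>x y. d1 t x y \<oplus>\<^bsub>B\<^esub> (f x y \<oplus>\<^bsub>B\<^esub> g x y))"
      unfolding cos_def by auto
    \<comment> \<open>The whole coboundary is assigned to the first summand; the second takes the
      coboundary of the zero cochain.\<close>
    have "h = E2 (\<lambda>x y. d1 t x y \<oplus>\<^bsub>B\<^esub> f x y) \<oplus>\<^bsub>C 2\<^esub> E2 (\<lambda>x y. d1 (\<lambda>x. \<zero>\<^bsub>B\<^esub>) x y \<oplus>\<^bsub>B\<^esub> g x y)"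
      unfolding h C_add
      by (rule E2_cong) (use assms t in \<open>simp add: d1_zero d1_closed bil_closed B.a_ac\<close>)
    then show "h \<in> (\<Union>h\<in>cos f. \<Union>k\<in>cos g. {h \<oplus>\<^bsub>C 2\<^esub> k})"
      unfolding cos_def using t lin1_zero by blast
  qed
  finally show ?thesis .
qed

text \<open>In the quotient a scalar multiple is a union of cosets over all members of the given
  one. The extra term \<open>c\<close> times \<open>d1 t\<close> coming from a member is the
  coboundary of \<open>c t\<close>, so all these cosets coincide.\<close>

lemma cos_smult:
  assumes "bil f" "c \<in> carrier K"
  shows "c \<odot>\<^bsub>HH0 K B 2\<^esub> cos f = cos (\<lambda>x y. c \<odot>\<^bsub>B\<^esub> f x y)"
proof -
  let ?N = "hochschild_coboundaries K B 2" and ?Z = "C 2\<lparr>carrier := hochschild_cocycles K B 2\<rparr>"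
  have "c \<odot>\<^bsub>HH0 K B 2\<^esub> cos f = (\<Union>h\<in>cos f. ?N +>\<^bsub>?Z\<^esub> (c \<odot>\<^bsub>C 2\<^esub> h))"
    by (simp add: HH0_def quotient_module_def)
  also have "\<dots> = (\<Union>t\<in>Collect lin1. cos (\<lambda>x y. c \<odot>\<^bsub>B\<^esub> (d1 t x y \<oplus>\<^bsub>B\<^esub> f x y)))"
  proof -
    have "cos f = (\<lambda>t. E2 (\<lambda>x y. d1 t x y \<oplus>\<^bsub>B\<^esub> f x y)) ` Collect lin1" unfolding cos_def by auto
    then show ?thesis by (simp only: image_image UN_simps UN_extend_simps C_smult cos_coset)
  qed
  also have "\<dots> = cos (\<lambda>x y. c \<odot>\<^bsub>B\<^esub> f x y)"
  proof (intro equalityI subsetI)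
    fix h assume "h \<in> (\<Union>t\<in>Collect lin1. cos (\<lambda>x y. c \<odot>\<^bsub>B\<^esub> (d1 t x y \<oplus>\<^bsub>B\<^esub> f x y)))"
    then obtain t u where tu: "lin1 t" "lin1 u" and
      h: "h = E2 (\<lambda>x y. d1 u x y \<oplus>\<^bsub>B\<^esub> c \<odot>\<^bsub>B\<^esub> (d1 t x y \<oplus>\<^bsub>B\<^esub> f x y))" unfolding cos_def by auto
    have "h = E2 (\<lambda>x y. d1 (\<lambda>x. u x \<oplus>\<^bsub>B\<^esub> c \<odot>\<^bsub>B\<^esub> t x) x y \<oplus>\<^bsub>B\<^esub> c \<odot>\<^bsub>B\<^esub> f x y)"
      unfolding h by (rule E2_cong)
        (use assms tu in \<open>simp add: d1_add lin1_smult d1_smult d1_closed bil_closed BM.smult_r_distr B.a_assoc\<close>)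
    then show "h \<in> cos (\<lambda>x y. c \<odot>\<^bsub>B\<^esub> f x y)"
      unfolding cos_def using lin1_add[OF tu(2) lin1_smult[OF assms(2) tu(1)]] by blast
  next
    fix h assume "h \<in> cos (\<lambda>x y. c \<odot>\<^bsub>B\<^esub> f x y)"
    then obtain t where t: "lin1 t" and h: "h = E2 (\<lambda>x y. d1 t x y \<oplus>\<^bsub>B\<^esub> c \<odot>\<^bsub>B\<^esub> f x y)"
      unfolding cos_def by auto
    have "h = E2 (\<lambda>x y. d1 t x y \<oplus>\<^bsub>B\<^esub> c \<odot>\<^bsub>B\<^esub> (d1 (\<lambda>x. \<zero>\<^bsub>B\<^esub>) x y \<oplus>\<^bsub>B\<^esub> f x y))"
      unfolding h by (rule E2_cong) (use assms t in \<open>simp add: d1_zero bil_closed\<close>)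
    then show "h \<in> (\<Union>t\<in>Collect lin1. cos (\<lambda>x y. c \<odot>\<^bsub>B\<^esub> (d1 t x y \<oplus>\<^bsub>B\<^esub> f x y)))"
      unfolding cos_def using t lin1_zero by blast
  qed
  finally show ?thesis .
qed

lemma cos_cong: "(\<And>x y. x \<in> carrier B \<Longrightarrow> y \<in> carrier B \<Longrightarrow> f x y = g x y) \<Longrightarrow> cos f = cos g"
proof -
  assume "\<And>x y. x \<in> carrier B \<Longrightarrow> y \<in> carrier B \<Longrightarrow> f x y = g x y"
  then have "E2 (\<lambda>x y. d1 t x y \<oplus>\<^bsub>B\<^esub> f x y) = E2 (\<lambda>x y. d1 t x y \<oplus>\<^bsub>B\<^esub> g x y)" for t
    by (intro E2_cong) simp
  then show "cos f = cos g" unfolding cos_def by simp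
qed

lemma bil_d1:
  assumes t: "lin1 t" shows "bil (d1 t)"
proof -
  note tc = lin1_closed[OF t]
  have ta: "t (x \<oplus>\<^bsub>B\<^esub> y) = t x \<oplus>\<^bsub>B\<^esub> t y" if "x \<in> carrier B" "y \<in> carrier B" for x y using t that by (simp add: lin1_def)
  have ts: "t (c \<odot>\<^bsub>B\<^esub> x) = c \<odot>\<^bsub>B\<^esub> t x" if "c \<in> carrier K" "x \<in> carrier B" for c x using t that by (simp add: lin1_def)
  have neg: "\<ominus>\<^bsub>B\<^esub> x \<in> grade B i" if "x \<in> grade B i" for x i
    using gr_smult[OF BM.R.a_inv_closed[OF BM.R.one_closed] that] gr_sub[OF that] by (simp add: BM.smult_l_minus)
  have tg: "t x \<in> grade B i" if "x \<in> grade B i" for x i using t that by (simp add: lin1_def)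
  show ?thesis unfolding bil_def d1_def
  proof (intro conjI ballI allI, goal_cases)
    case (6 i j x y)
    then show ?case by (intro gr_add neg tg gr_mult)
  qed (simp_all add: tc ta ts B.l_distr B.r_distr B.minus_add B.a_ac smult_mult mult_smult
     BM.smult_r_distr BM.smult_r_minus)
qed

lemma bil_add: "bil f \<Longrightarrow> bil g \<Longrightarrow> bil (\<lambda>x y. f x y \<oplus>\<^bsub>B\<^esub> g x y)"
  unfolding bil_def by (auto simp: B.a_ac BM.smult_r_distr gr_add)

end

section \<open>Graded linear lifts from the fibre\<close>

context pointed_algebra
begin

declare B_sel [simp del]

text \<open>The facts about the projection and the grading, restated for \<open>B\<close> as a
  \<open>K\<close>-algebra. From here on \<open>B\<close> is kept folded, so that its structure maps
  are not rewritten to those of the base change.\<close>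

lemma
  shows prB_closed: "a \<in> carrier M \<Longrightarrow> pr a \<in> carrier B"
    and prB_surj: "x \<in> carrier B \<Longrightarrow> \<exists>a\<in>carrier M. x = pr a"
    and prB_add: "a \<in> carrier M \<Longrightarrow> b \<in> carrier M \<Longrightarrow> pr (a \<oplus>\<^bsub>M\<^esub> b) = pr a \<oplus>\<^bsub>B\<^esub> pr b"
    and prB_mult: "a \<in> carrier M \<Longrightarrow> b \<in> carrier M \<Longrightarrow> pr (a \<otimes>\<^bsub>M\<^esub> b) = pr a \<otimes>\<^bsub>B\<^esub> pr b"
    and prB_smult: "c \<in> carrier K \<Longrightarrow> a \<in> carrier M \<Longrightarrow> pr (\<iota> c \<odot>\<^bsub>M\<^esub> a) = c \<odot>\<^bsub>B\<^esub> pr a"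
    and prB_zero: "pr \<zero>\<^bsub>M\<^esub> = \<zero>\<^bsub>B\<^esub>"
    and gradeB: "grade B i = pr ` grade M i"
    and gradeB_iff: "x \<in> carrier B \<Longrightarrow> x \<in> grade B i \<longleftrightarrow> PB i x = x"
  using pr_closed pr_surj pr_add pr_mult pr_smult pr_zero grade_B grade_B_iff by (simp_all add: B_sel)

sublocale H: graded_alg K B
proof (intro graded_alg.intro graded_alg_axioms.intro B_ring B_module)
  fix r x y assume "r \<in> carrier K" "x \<in> carrier B" "y \<in> carrier B"
  then show "(r \<odot>\<^bsub>B\<^esub> x) \<otimes>\<^bsub>B\<^esub> y = r \<odot>\<^bsub>B\<^esub> (x \<otimes>\<^bsub>B\<^esub> y)" "x \<otimes>\<^bsub>B\<^esub> (r \<odot>\<^bsub>B\<^esub> y) = r \<odot>\<^bsub>B\<^esub> (x \<otimes>\<^bsub>B\<^esub> y)"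
    by (auto dest!: prB_surj simp: iota_simps smult_mult mult_smult simp flip: prB_mult prB_smult)
next
  show "x \<in> grade B i \<Longrightarrow> x \<in> carrier B" for x i by (auto simp: gradeB prB_closed gradeD)
  show "\<zero>\<^bsub>B\<^esub> \<in> grade B i" for i unfolding gradeB prB_zero[symmetric] by (intro imageI grade_zero)
  show "x \<in> grade B i \<Longrightarrow> y \<in> grade B i \<Longrightarrow> x \<oplus>\<^bsub>B\<^esub> y \<in> grade B i" for x y i
    unfolding gradeB by (auto simp flip: prB_add simp: gradeD intro!: imageI grade_add)
  show "c \<in> carrier K \<Longrightarrow> x \<in> grade B i \<Longrightarrow> c \<odot>\<^bsub>B\<^esub> x \<in> grade B i" for c x i
    unfolding gradeB by (auto simp flip: prB_smult simp: gradeD iota_simps intro!: imageI grade_smult)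
  show "x \<in> grade B i \<Longrightarrow> y \<in> grade B j \<Longrightarrow> x \<otimes>\<^bsub>B\<^esub> y \<in> grade B (i + j)" for x y i j
    unfolding gradeB by (auto simp flip: prB_mult simp: gradeD intro!: imageI grade_mult)
qed

definition is_lift :: "((('a \<times> 'r set) list set) \<Rightarrow> 'a) \<Rightarrow> bool" where
  "is_lift \<sigma> \<longleftrightarrow> (\<forall>x\<in>carrier B. \<sigma> x \<in> carrier M \<and> pr (\<sigma> x) = x) \<and>
     (\<forall>x\<in>carrier B. \<forall>y\<in>carrier B. \<sigma> (x \<oplus>\<^bsub>B\<^esub> y) = \<sigma> x \<oplus>\<^bsub>M\<^esub> \<sigma> y) \<and>
     (\<forall>c\<in>carrier K. \<forall>x\<in>carrier B. \<sigma> (c \<odot>\<^bsub>B\<^esub> x) = \<iota> c \<odot>\<^bsub>M\<^esub> \<sigma> x) \<and>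
     (\<forall>i. \<forall>x\<in>grade B i. \<sigma> x \<in> grade M i)"

text \<open>A lift on part of the fibre is encoded by its image: a \<open>K\<close>-subspace of
  \<open>M\<close>, stable under the grading projections, on which \<open>pr\<close> is injective.
  Stability under the projections is what makes the resulting lift graded, and conditions on subsets
  pass easily to unions of chains.\<close>

definition partial_lift :: "'a set \<Rightarrow> bool" where
  "partial_lift G \<longleftrightarrow> G \<subseteq> carrier M \<and> \<zero>\<^bsub>M\<^esub> \<in> G \<and> (\<forall>x\<in>G. \<forall>y\<in>G. x \<oplus>\<^bsub>M\<^esub> y \<in> G) \<and>
     (\<forall>c\<in>carrier K. \<forall>x\<in>G. \<iota> c \<odot>\<^bsub>M\<^esub> x \<in> G) \<and> (\<forall>i. \<forall>x\<in>G. P i x \<in> G) \<and>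
     (\<forall>x\<in>G. pr x = \<zero>\<^bsub>B\<^esub> \<longrightarrow> x = \<zero>\<^bsub>M\<^esub>)"

lemma partial_lift_neg: "partial_lift G \<Longrightarrow> x \<in> G \<Longrightarrow> \<ominus>\<^bsub>M\<^esub> x \<in> G"
proof -
  assume G: "partial_lift G" "x \<in> G"
  then have x: "x \<in> carrier M" unfolding partial_lift_def by blast
  have "\<iota> (\<ominus>\<^bsub>K\<^esub> \<one>\<^bsub>K\<^esub>) = \<ominus>\<^bsub>R\<^esub> \<one>\<^bsub>R\<^esub>"
    by (rule R.minus_equality[symmetric]) (simp_all add: iota_simps iota_zero K.l_neg flip: iota_simps(2,4))
  then have "\<ominus>\<^bsub>M\<^esub> x = \<iota> (\<ominus>\<^bsub>K\<^esub> \<one>\<^bsub>K\<^esub>) \<odot>\<^bsub>M\<^esub> x" using x by (simp add: A.smult_l_minus)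
  then show "\<ominus>\<^bsub>M\<^esub> x \<in> G" using G unfolding partial_lift_def by simp
qed

text \<open>A homogeneous \<open>a\<close> is used so that the enlarged space stays stable under the
  projections. If \<open>g + c a\<close> with nonzero \<open>c\<close> projected to 0, dividing by
  \<open>c\<close> would express \<open>pr a\<close> as the projection of an element of
  \<open>G\<close>.\<close>

lemma partial_lift_extend:
  assumes G: "partial_lift G" and a: "a \<in> grade M i" and new: "pr a \<notin> pr ` G"
  shows "partial_lift {g \<oplus>\<^bsub>M\<^esub> \<iota> c \<odot>\<^bsub>M\<^esub> a | g c. g \<in> G \<and> c \<in> carrier K}" (is "partial_lift ?G")
proof -
  have aM: "a \<in> carrier M" "P i a = a" using a by (auto simp: grade_M)
  have GM: "g \<in> G \<Longrightarrow> g \<in> carrier M" for g using G unfolding partial_lift_def by blast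
  have G0: "\<zero>\<^bsub>M\<^esub> \<in> G" and Ga: "x \<in> G \<Longrightarrow> y \<in> G \<Longrightarrow> x \<oplus>\<^bsub>M\<^esub> y \<in> G" and
    Gs: "c \<in> carrier K \<Longrightarrow> x \<in> G \<Longrightarrow> \<iota> c \<odot>\<^bsub>M\<^esub> x \<in> G" and GP: "x \<in> G \<Longrightarrow> P j x \<in> G" for x y c j
    using G unfolding partial_lift_def by blast+
  have I: "g \<in> G \<Longrightarrow> c \<in> carrier K \<Longrightarrow> x = g \<oplus>\<^bsub>M\<^esub> \<iota> c \<odot>\<^bsub>M\<^esub> a \<Longrightarrow> x \<in> ?G" for g c x by blast
  show ?thesis unfolding partial_lift_def
  proof (intro conjI ballI allI impI)
    show "?G \<subseteq> carrier M" using GM aM by (auto simp: iota_simps)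
    show "\<zero>\<^bsub>M\<^esub> \<in> ?G" by (rule I[OF G0 K.zero_closed]) (simp add: iota_zero aM)
  next
    fix x y assume "x \<in> ?G" "y \<in> ?G"
    then obtain g c h d where "g \<in> G" "c \<in> carrier K" "x = g \<oplus>\<^bsub>M\<^esub> \<iota> c \<odot>\<^bsub>M\<^esub> a"
      "h \<in> G" "d \<in> carrier K" "y = h \<oplus>\<^bsub>M\<^esub> \<iota> d \<odot>\<^bsub>M\<^esub> a" by blast
    then show "x \<oplus>\<^bsub>M\<^esub> y \<in> ?G"
      by (intro I[OF Ga K.add.m_closed, of g h c d]) (simp_all add: GM aM iota_simps A.smult_l_distr M.a_ac)
  next
    fix c x assume "c \<in> carrier K" "x \<in> ?G"
    then obtain g d where "c \<in> carrier K" "g \<in> G" "d \<in> carrier K" "x = g \<oplus>\<^bsub>M\<^esub> \<iota> d \<odot>\<^bsub>M\<^esub> a" by blast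
    then show "\<iota> c \<odot>\<^bsub>M\<^esub> x \<in> ?G"
      by (intro I[OF Gs K.m_closed, of c g c d]) (simp_all add: GM aM iota_simps A.smult_r_distr A.smult_assoc1)
  next
    fix j x assume "x \<in> ?G"
    then obtain g c where gc: "g \<in> G" "c \<in> carrier K" "x = g \<oplus>\<^bsub>M\<^esub> \<iota> c \<odot>\<^bsub>M\<^esub> a" by blast
    \<comment> \<open>\<open>P j\<close> keeps the summand \<open>c a\<close> when \<open>j\<close>
      is the degree of \<open>a\<close> and kills it otherwise; this determines the new
      coefficient.\<close>
    have "P j a = (if j = i then a else \<zero>\<^bsub>M\<^esub>)" using P_P[OF aM(1), of j i] aM(2) by simp
    then show "P j x \<in> ?G" using gc GM aM
      by (intro I[OF GP, of g "if j = i then c else \<zero>\<^bsub>K\<^esub>" _ j])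
        (auto simp: P_add P_smult iota_simps iota_zero)
  next
    fix x assume "x \<in> ?G" and 0: "pr x = \<zero>\<^bsub>B\<^esub>"
    then obtain g c where gc: "g \<in> G" "c \<in> carrier K" "x = g \<oplus>\<^bsub>M\<^esub> \<iota> c \<odot>\<^bsub>M\<^esub> a" by blast
    have "c = \<zero>\<^bsub>K\<^esub>"
    proof (rule ccontr)
      assume "c \<noteq> \<zero>\<^bsub>K\<^esub>"
      then have u: "inv\<^bsub>K\<^esub> c \<in> carrier K" "inv\<^bsub>K\<^esub> c \<otimes>\<^bsub>K\<^esub> c = \<one>\<^bsub>K\<^esub>"
        using gc K.field_Units by auto
      have "\<iota> (inv\<^bsub>K\<^esub> c) \<odot>\<^bsub>M\<^esub> x = \<iota> (inv\<^bsub>K\<^esub> c) \<odot>\<^bsub>M\<^esub> g \<oplus>\<^bsub>M\<^esub> a"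
        using gc u GM aM by (simp add: iota_simps A.smult_r_distr flip: A.smult_assoc1) (simp flip: iota_simps(3) add: iota_simps(4))
      then have "pr (\<iota> (inv\<^bsub>K\<^esub> c) \<odot>\<^bsub>M\<^esub> x) = pr (\<iota> (inv\<^bsub>K\<^esub> c) \<odot>\<^bsub>M\<^esub> g \<oplus>\<^bsub>M\<^esub> a)" by simp
      moreover have xM: "x \<in> carrier M" using gc GM aM by (simp add: iota_simps)
      ultimately have "\<zero>\<^bsub>B\<^esub> = pr (\<iota> (inv\<^bsub>K\<^esub> c) \<odot>\<^bsub>M\<^esub> g) \<oplus>\<^bsub>B\<^esub> pr a"
        using gc u GM aM 0 by (simp add: prB_add prB_smult iota_simps)
      moreover have ug: "\<iota> (inv\<^bsub>K\<^esub> c) \<odot>\<^bsub>M\<^esub> g \<in> G" using Gs gc u by blast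
      moreover have "pr (\<ominus>\<^bsub>M\<^esub> (\<iota> (inv\<^bsub>K\<^esub> c) \<odot>\<^bsub>M\<^esub> g)) \<oplus>\<^bsub>B\<^esub> pr (\<iota> (inv\<^bsub>K\<^esub> c) \<odot>\<^bsub>M\<^esub> g) = \<zero>\<^bsub>B\<^esub>"
        using GM[OF ug] by (simp flip: prB_add add: M.l_neg prB_zero)
      ultimately have "pr a = pr (\<ominus>\<^bsub>M\<^esub> (\<iota> (inv\<^bsub>K\<^esub> c) \<odot>\<^bsub>M\<^esub> g))"
        using prB_closed GM[OF ug] aM H.B.add.l_cancel H.B.a_comm by (metis M.a_inv_closed)
      then show False using new partial_lift_neg[OF G ug] by blast
    qed
    then have "x = g" using gc GM aM by (simp add: iota_zero)
    then show "x = \<zero>\<^bsub>M\<^esub>" using G gc(1) 0 unfolding partial_lift_def by blast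
  qed
qed

text \<open>A member that is maximal for inclusion must reach the class of every homogeneous
  element, since otherwise \<open>partial_lift_extend\<close> enlarges it. Finite sums of
  homogeneous elements exhaust \<open>M\<close>, so it reaches all of the fibre.\<close>

lemma partial_lift_maximal: "\<exists>G. partial_lift G \<and> pr ` G = carrier B"
proof -
  have "\<exists>G\<in>{G. partial_lift G}. \<forall>H\<in>{G. partial_lift G}. G \<subseteq> H \<longrightarrow> H = G"
  proof (rule subset_Zorn_nonempty)
    have "partial_lift {\<zero>\<^bsub>M\<^esub>}" unfolding partial_lift_def by (simp add: P_zero iota_simps)
    then show "Collect partial_lift \<noteq> {}" by blast
  next
    fix \<C> assume ne: "\<C> \<noteq> {}" and ch: "subset.chain (Collect partial_lift) \<C>"
    have pl: "partial_lift G" if "G \<in> \<C>" for G using ch that unfolding subset_chain_def by (metis mem_Collect_eq subsetD)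
    have two: "\<exists>G\<in>\<C>. x \<in> G \<and> y \<in> G" if "x \<in> \<Union>\<C>" "y \<in> \<Union>\<C>" for x y
    proof -
      from that obtain G1 G2 where G: "x \<in> G1" "G1 \<in> \<C>" "y \<in> G2" "G2 \<in> \<C>" by (elim UnionE)
      then have "G1 \<subseteq> G2 \<or> G2 \<subseteq> G1" using ch unfolding subset_chain_def by metis
      then show ?thesis using G by (metis subsetD)
    qed
    have "partial_lift (\<Union>\<C>)" unfolding partial_lift_def
    proof (intro conjI ballI allI impI)
      show "\<Union>\<C> \<subseteq> carrier M" using pl unfolding partial_lift_def by blast
      show "\<zero>\<^bsub>M\<^esub> \<in> \<Union>\<C>" using ne pl unfolding partial_lift_def by blast
      show "x \<oplus>\<^bsub>M\<^esub> y \<in> \<Union>\<C>" if "x \<in> \<Union>\<C>" "y \<in> \<Union>\<C>" for x y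
        using two[OF that] pl unfolding partial_lift_def by blast
    qed (use pl in \<open>unfold partial_lift_def, blast+\<close>)
    then show "\<Union>\<C> \<in> Collect partial_lift" by blast
  qed
  then obtain G where G: "partial_lift G" and mx: "\<And>H. partial_lift H \<Longrightarrow> G \<subseteq> H \<Longrightarrow> H = G" by blast
  have GM: "g \<in> G \<Longrightarrow> g \<in> carrier M" for g using G unfolding partial_lift_def by blast
  have hom: "pr a \<in> pr ` G" if a: "a \<in> grade M i" for a i
  proof (rule ccontr)
    assume n: "pr a \<notin> pr ` G"
    let ?G = "{g \<oplus>\<^bsub>M\<^esub> \<iota> c \<odot>\<^bsub>M\<^esub> a | g c. g \<in> G \<and> c \<in> carrier K}"
    have aM: "a \<in> carrier M" using a gradeD by blast
    have "G \<subseteq> ?G"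
    proof
      fix g assume "g \<in> G"
      then have "g = g \<oplus>\<^bsub>M\<^esub> \<iota> \<zero>\<^bsub>K\<^esub> \<odot>\<^bsub>M\<^esub> a" using aM GM by (simp add: iota_zero)
      then show "g \<in> ?G" using \<open>g \<in> G\<close> by blast
    qed
    then have "?G = G" by (rule mx[OF partial_lift_extend[OF G a n]])
    moreover have "a \<in> ?G"
    proof -
      have "a = \<zero>\<^bsub>M\<^esub> \<oplus>\<^bsub>M\<^esub> \<iota> \<one>\<^bsub>K\<^esub> \<odot>\<^bsub>M\<^esub> a" using aM by (simp add: iota_simps)
      moreover have "\<zero>\<^bsub>M\<^esub> \<in> G" using G unfolding partial_lift_def by blast
      ultimately show ?thesis by blast
    qed
    ultimately show False using n by blast
  qed
  have sum: "set xs \<subseteq> (\<Union>i. grade M i) \<Longrightarrow> foldr (\<oplus>\<^bsub>M\<^esub>) xs \<zero>\<^bsub>M\<^esub> \<in> carrier M \<and> pr (foldr (\<oplus>\<^bsub>M\<^esub>) xs \<zero>\<^bsub>M\<^esub>) \<in> pr ` G" for xs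
  proof (induction xs)
    case Nil
    then show ?case using G unfolding partial_lift_def by simp
  next
    case (Cons x xs)
    then obtain i g h where x: "x \<in> grade M i" "pr x = pr g" "g \<in> G" "pr (foldr (\<oplus>\<^bsub>M\<^esub>) xs \<zero>\<^bsub>M\<^esub>) = pr h" "h \<in> G"
      using hom by (auto simp: image_iff) metis
    have "pr (foldr (\<oplus>\<^bsub>M\<^esub>) (x # xs) \<zero>\<^bsub>M\<^esub>) = pr (g \<oplus>\<^bsub>M\<^esub> h)"
      using x Cons gradeD GM by (simp add: prB_add)
    moreover have "g \<oplus>\<^bsub>M\<^esub> h \<in> G" using G x unfolding partial_lift_def by blast
    ultimately show ?case using x Cons gradeD by auto
  qed
  have "pr ` G = carrier B"
  proof
    show "pr ` G \<subseteq> carrier B" using GM prB_closed by blast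
    show "carrier B \<subseteq> pr ` G" using prB_surj grade_gen sum by blast
  qed
  then show ?thesis using G by blast
qed

lemma lift_exists: "\<exists>\<sigma>. is_lift \<sigma>"
proof -
  obtain G where G: "partial_lift G" "pr ` G = carrier B" using partial_lift_maximal by blast
  have GM: "g \<in> G \<Longrightarrow> g \<in> carrier M" for g using G unfolding partial_lift_def by blast
  have inj: "g = h" if "g \<in> G" "h \<in> G" "pr g = pr h" for g h
  proof -
    have "g \<oplus>\<^bsub>M\<^esub> \<ominus>\<^bsub>M\<^esub> h \<in> G" using G(1) that partial_lift_neg[OF G(1)] unfolding partial_lift_def by blast
    moreover have "pr (g \<oplus>\<^bsub>M\<^esub> \<ominus>\<^bsub>M\<^esub> h) = pr (h \<oplus>\<^bsub>M\<^esub> \<ominus>\<^bsub>M\<^esub> h)" using that GM by (simp add: prB_add)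
    ultimately have "g \<oplus>\<^bsub>M\<^esub> \<ominus>\<^bsub>M\<^esub> h = \<zero>\<^bsub>M\<^esub>"
      using G(1) that GM unfolding partial_lift_def by (simp add: M.r_neg prB_zero)
    then show ?thesis using that GM M.minus_equality M.minus_minus by (metis M.a_inv_closed)
  qed
  define \<sigma> where "\<sigma> x = inv_into G pr x" for x
  have s: "\<sigma> x \<in> G" "pr (\<sigma> x) = x" if "x \<in> carrier B" for x
    using that G(2) unfolding \<sigma>_def by (simp_all add: inv_into_into f_inv_into_f)
  have sM: "\<sigma> x \<in> carrier M" if "x \<in> carrier B" for x using s(1) GM that by blast
  have "is_lift \<sigma>" unfolding is_lift_def
  proof (intro conjI ballI allI)
    fix x y assume xy: "x \<in> carrier B" "y \<in> carrier B"
    have "\<sigma> x \<oplus>\<^bsub>M\<^esub> \<sigma> y \<in> G" using G(1) s(1) xy unfolding partial_lift_def by blast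
    then show "\<sigma> (x \<oplus>\<^bsub>B\<^esub> y) = \<sigma> x \<oplus>\<^bsub>M\<^esub> \<sigma> y"
      using xy by (intro inj) (simp_all add: s sM prB_add)
  next
    fix c x assume cx: "c \<in> carrier K" "x \<in> carrier B"
    have "\<iota> c \<odot>\<^bsub>M\<^esub> \<sigma> x \<in> G" using G(1) s(1) cx unfolding partial_lift_def by blast
    then show "\<sigma> (c \<odot>\<^bsub>B\<^esub> x) = \<iota> c \<odot>\<^bsub>M\<^esub> \<sigma> x"
      using cx by (intro inj) (simp_all add: s sM prB_smult)
  next
    fix i x assume x: "x \<in> grade B i"
    have xB: "x \<in> carrier B" using x H.gr_sub by blast
    \<comment> \<open>Both \<open>P i (\<sigma> x)\<close> and \<open>\<sigma> x\<close> lie in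
      \<open>G\<close>, and they have the same projection because \<open>x\<close> is homogeneous of
      degree \<open>i\<close>; injectivity of \<open>pr\<close> on \<open>G\<close> makes them
      equal.\<close>
    have "P i (\<sigma> x) \<in> G" using G(1) s(1) xB unfolding partial_lift_def by blast
    moreover have "pr (P i (\<sigma> x)) = x"
      using PB_pr[OF sM[OF xB], of i] gradeB_iff[OF xB, of i] x s(2)[OF xB] by simp
    ultimately have "P i (\<sigma> x) = \<sigma> x" using s[OF xB] by (intro inj) simp_all
    then show "\<sigma> x \<in> grade M i" using P_grade[OF sM[OF xB], of i] by simp
  qed (use s GM in auto)
  then show ?thesis by blast
qed

end

section \<open>The class of a deformation\<close>

context pointed_algebra
begin

definition delta where "delta \<sigma> a b = (\<sigma> a \<otimes>\<^bsub>M\<^esub> \<sigma> b) \<ominus>\<^bsub>M\<^esub> \<sigma> (a \<otimes>\<^bsub>B\<^esub> b)"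
text \<open>The cocycle of the section \<open>b \<mapsto> E (\<sigma> b) 0\<close>. In spite of the
  name it is not a cup product of cohomology classes.\<close>

definition cup where "cup w \<sigma> a b = Lam w (delta \<sigma> a b)"

lemma
  assumes "is_lift \<sigma>"
  shows lift_closed: "x \<in> carrier B \<Longrightarrow> \<sigma> x \<in> carrier M"
    and pr_lift: "x \<in> carrier B \<Longrightarrow> pr (\<sigma> x) = x"
    and lift_add: "x \<in> carrier B \<Longrightarrow> y \<in> carrier B \<Longrightarrow> \<sigma> (x \<oplus>\<^bsub>B\<^esub> y) = \<sigma> x \<oplus>\<^bsub>M\<^esub> \<sigma> y"
    and lift_smult: "c \<in> carrier K \<Longrightarrow> x \<in> carrier B \<Longrightarrow> \<sigma> (c \<odot>\<^bsub>B\<^esub> x) = \<iota> c \<odot>\<^bsub>M\<^esub> \<sigma> x"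
    and lift_grade: "x \<in> grade B i \<Longrightarrow> \<sigma> x \<in> grade M i"
  using assms unfolding is_lift_def by blast+

lemma delta_mM:
  assumes "is_lift \<sigma>" "a \<in> carrier B" "b \<in> carrier B" shows "delta \<sigma> a b \<in> mM"
  unfolding delta_def
  by (rule pr_eq_iff[THEN iffD1]) (use assms in \<open>simp_all add: lift_closed pr_lift prB_mult\<close>)

lemma delta_grade:
  assumes l: "is_lift \<sigma>" and ab: "a \<in> grade B i" "b \<in> grade B j"
  shows "delta \<sigma> a b \<in> grade M (i + j)"
proof -
  have neg: "\<ominus>\<^bsub>M\<^esub> x \<in> grade M k" if "x \<in> grade M k" for x k
    using grade_smult[of "\<ominus>\<^bsub>R\<^esub> \<one>\<^bsub>R\<^esub>" x k] that gradeD[OF that] by (simp add: A.smult_l_minus)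
  have "\<sigma> (a \<otimes>\<^bsub>B\<^esub> b) \<in> grade M (i + j)" using l H.gr_mult[OF ab] by (rule lift_grade)
  then show ?thesis unfolding delta_def M.minus_eq
    using l ab by (intro grade_add grade_mult neg) (auto intro: lift_grade)
qed

end

context deformed_algebra
begin

lemma LamB_closed: "x \<in> mM \<Longrightarrow> Lam w x \<in> carrier B"
  using Lam_closed[of w x] w_m_closed by (simp add: B_sel)

lemma LamB_add: "x \<in> mM \<Longrightarrow> y \<in> mM \<Longrightarrow> Lam w (x \<oplus>\<^bsub>M\<^esub> y) = Lam w x \<oplus>\<^bsub>B\<^esub> Lam w y"
  using Lam_add by (simp add: B_sel)

lemma Lam_const:
  assumes "c \<in> carrier K" "x \<in> mM" shows "Lam w (\<iota> c \<odot>\<^bsub>M\<^esub> x) = c \<odot>\<^bsub>B\<^esub> Lam w x"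
  by (rule Lam_map[of "\<lambda>x. \<iota> c \<odot>\<^bsub>M\<^esub> x"])
    (use assms in \<open>auto simp: iota_simps A.smult_r_distr R.m_comm prB_smult simp flip: A.smult_assoc1\<close>)

lemma Lam_mult_left:
  assumes "y \<in> carrier M" "x \<in> mM" shows "Lam w (y \<otimes>\<^bsub>M\<^esub> x) = pr y \<otimes>\<^bsub>B\<^esub> Lam w x"
  by (rule Lam_map[of "\<lambda>x. y \<otimes>\<^bsub>M\<^esub> x"])
    (use assms in \<open>auto simp: M.r_distr mult_smult prB_mult\<close>)

lemma Lam_mult_right:
  assumes "y \<in> carrier M" "x \<in> mM" shows "Lam w (x \<otimes>\<^bsub>M\<^esub> y) = Lam w x \<otimes>\<^bsub>B\<^esub> pr y"
  by (rule Lam_map[of "\<lambda>x. x \<otimes>\<^bsub>M\<^esub> y" "\<lambda>x. x \<otimes>\<^bsub>B\<^esub> pr y"])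
    (use assms in \<open>auto simp: M.l_distr smult_mult prB_mult\<close>)

lemma Lam_grade:
  assumes "x \<in> mM" "x \<in> grade M i" shows "Lam w x \<in> grade B i"
proof -
  have "Lam w (P i x) = PB i (Lam w x)"
    by (rule Lam_map) (use assms in \<open>auto simp: P_closed P_add P_smult PB_pr\<close>)
  then show ?thesis using gradeB_iff[OF LamB_closed[OF assms(1)]] assms by (simp add: grade_M)
qed

lemma bil_cup:
  assumes l: "is_lift \<sigma>" shows "H.bil (cup w \<sigma>)"
proof -
  note lc = lift_closed[OF l] and la = lift_add[OF l] and ls = lift_smult[OF l]
  note mm = delta_mM[OF l]
  have 1: "delta \<sigma> (x \<oplus>\<^bsub>B\<^esub> y) z = delta \<sigma> x z \<oplus>\<^bsub>M\<^esub> delta \<sigma> y z"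
    if "x \<in> carrier B" "y \<in> carrier B" "z \<in> carrier B" for x y z
    using that by (simp add: delta_def lc la M.minus_eq M.l_distr H.B.l_distr M.minus_add M.a_ac)
  have 2: "delta \<sigma> x (y \<oplus>\<^bsub>B\<^esub> z) = delta \<sigma> x y \<oplus>\<^bsub>M\<^esub> delta \<sigma> x z"
    if "x \<in> carrier B" "y \<in> carrier B" "z \<in> carrier B" for x y z
    using that by (simp add: delta_def lc la M.minus_eq M.r_distr H.B.r_distr M.minus_add M.a_ac)
  have 3: "delta \<sigma> (c \<odot>\<^bsub>B\<^esub> x) y = \<iota> c \<odot>\<^bsub>M\<^esub> delta \<sigma> x y" "delta \<sigma> x (c \<odot>\<^bsub>B\<^esub> y) = \<iota> c \<odot>\<^bsub>M\<^esub> delta \<sigma> x y"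
    if "c \<in> carrier K" "x \<in> carrier B" "y \<in> carrier B" for c x y
    using that by (simp_all add: delta_def lc ls iota_simps M.minus_eq H.smult_mult H.mult_smult smult_mult mult_smult
       A.smult_r_distr A.smult_r_minus)
  show ?thesis unfolding H.bil_def cup_def
    by (auto simp: LamB_closed mm 1 2 3 LamB_add Lam_const H.gr_sub intro!: Lam_grade delta_grade[OF l])
qed

text \<open>This is associativity in \<open>M\<close>: since \<open>Lam w\<close> is a bimodule map,
  both sides are the image under \<open>Lam w\<close> of
  \<open>\<sigma> x \<sigma> y \<sigma> z - \<sigma> (x y z)\<close>.\<close>

lemma cocyc_cup:
  assumes l: "is_lift \<sigma>" shows "H.cocyc (cup w \<sigma>)"
  unfolding H.cocyc_def
proof (intro ballI)
  fix x y z assume xyz: "x \<in> carrier B" "y \<in> carrier B" "z \<in> carrier B"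
  note lc = lift_closed[OF l] and mm = delta_mM[OF l]
  have mx: "\<sigma> x \<otimes>\<^bsub>M\<^esub> delta \<sigma> y z \<in> mM"
    by (rule mM_map[of "\<lambda>u. \<sigma> x \<otimes>\<^bsub>M\<^esub> u"]) (use xyz lc mm in \<open>auto simp: M.r_distr mult_smult\<close>)
  have mz: "delta \<sigma> x y \<otimes>\<^bsub>M\<^esub> \<sigma> z \<in> mM"
    by (rule mM_map[of "\<lambda>u. u \<otimes>\<^bsub>M\<^esub> \<sigma> z"]) (use xyz lc mm in \<open>auto simp: M.l_distr smult_mult\<close>)
  define a b c d e f where abc: "a = \<sigma> x" "b = \<sigma> y" "c = \<sigma> z" "d = \<sigma> (y \<otimes>\<^bsub>B\<^esub> z)" "e = \<sigma> (x \<otimes>\<^bsub>B\<^esub> y)"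
    "f = \<sigma> (x \<otimes>\<^bsub>B\<^esub> y \<otimes>\<^bsub>B\<^esub> z)"
  have cl: "a \<in> carrier M" "b \<in> carrier M" "c \<in> carrier M" "d \<in> carrier M" "e \<in> carrier M" "f \<in> carrier M"
    using xyz lc by (simp_all add: abc)
  have "a \<otimes>\<^bsub>M\<^esub> (b \<otimes>\<^bsub>M\<^esub> c \<ominus>\<^bsub>M\<^esub> d) \<oplus>\<^bsub>M\<^esub> (a \<otimes>\<^bsub>M\<^esub> d \<ominus>\<^bsub>M\<^esub> f) = a \<otimes>\<^bsub>M\<^esub> (b \<otimes>\<^bsub>M\<^esub> c) \<ominus>\<^bsub>M\<^esub> f"
    using cl by (simp add: M.minus_eq M.r_distr M.r_minus M.a_assoc M.r_neg1)
  also have "\<dots> = (e \<otimes>\<^bsub>M\<^esub> c \<ominus>\<^bsub>M\<^esub> f) \<oplus>\<^bsub>M\<^esub> (a \<otimes>\<^bsub>M\<^esub> b \<ominus>\<^bsub>M\<^esub> e) \<otimes>\<^bsub>M\<^esub> c"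
  proof -
    have "(e \<otimes>\<^bsub>M\<^esub> c \<ominus>\<^bsub>M\<^esub> f) \<oplus>\<^bsub>M\<^esub> (a \<otimes>\<^bsub>M\<^esub> b \<ominus>\<^bsub>M\<^esub> e) \<otimes>\<^bsub>M\<^esub> c =
      (a \<otimes>\<^bsub>M\<^esub> (b \<otimes>\<^bsub>M\<^esub> c) \<ominus>\<^bsub>M\<^esub> f) \<oplus>\<^bsub>M\<^esub> (e \<otimes>\<^bsub>M\<^esub> c \<oplus>\<^bsub>M\<^esub> \<ominus>\<^bsub>M\<^esub> (e \<otimes>\<^bsub>M\<^esub> c))"
      using cl by (simp only: M.minus_eq M.l_distr M.l_minus M.a_ac M.m_assoc M.a_inv_closed M.m_closed M.add.m_closed)
    then show ?thesis using cl by (simp add: M.r_neg)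
  qed
  finally have "\<sigma> x \<otimes>\<^bsub>M\<^esub> delta \<sigma> y z \<oplus>\<^bsub>M\<^esub> delta \<sigma> x (y \<otimes>\<^bsub>B\<^esub> z) =
    delta \<sigma> (x \<otimes>\<^bsub>B\<^esub> y) z \<oplus>\<^bsub>M\<^esub> delta \<sigma> x y \<otimes>\<^bsub>M\<^esub> \<sigma> z"
    using xyz by (simp add: delta_def abc H.B.m_assoc)
  then have "Lam w (\<sigma> x \<otimes>\<^bsub>M\<^esub> delta \<sigma> y z \<oplus>\<^bsub>M\<^esub> delta \<sigma> x (y \<otimes>\<^bsub>B\<^esub> z)) =
    Lam w (delta \<sigma> (x \<otimes>\<^bsub>B\<^esub> y) z \<oplus>\<^bsub>M\<^esub> delta \<sigma> x y \<otimes>\<^bsub>M\<^esub> \<sigma> z)" by simp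
  then show "(x \<otimes>\<^bsub>B\<^esub> cup w \<sigma> y z) \<oplus>\<^bsub>B\<^esub> cup w \<sigma> x (y \<otimes>\<^bsub>B\<^esub> z) =
    cup w \<sigma> (x \<otimes>\<^bsub>B\<^esub> y) z \<oplus>\<^bsub>B\<^esub> (cup w \<sigma> x y \<otimes>\<^bsub>B\<^esub> z)"
    using xyz unfolding cup_def
    by (simp add: LamB_add mx mz mm Lam_mult_left Lam_mult_right lc pr_lift[OF l])
qed

text \<open>One has \<open>a \<otimes> 1 = a' \<otimes> 1 + (a - a') \<otimes> 1\<close>, and by
  \<open>E_Lam\<close> the last term is \<open>l \<otimes> \<epsilon>\<close>. So a change of the
  first slot within \<open>m M\<close> is paid for in the second slot.\<close>

lemma E_shift:
  assumes "a \<in> carrier M" "a' \<in> carrier M" "t \<in> carrier M" "l \<in> carrier M"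
    and x: "a \<ominus>\<^bsub>M\<^esub> a' \<in> mM" and l: "pr l = Lam w (a \<ominus>\<^bsub>M\<^esub> a')"
  shows "E a t = E a' (t \<oplus>\<^bsub>M\<^esub> l)"
proof -
  have "E a' (t \<oplus>\<^bsub>M\<^esub> l) = E a' t \<oplus>\<^bsub>DC.D\<^esub> E (a \<ominus>\<^bsub>M\<^esub> a') \<zero>\<^bsub>M\<^esub>"
    unfolding E_Lam[OF x assms(4) l] using assms by (simp add: E_add)
  also have "\<dots> = E a t"
  proof -
    have "a' \<oplus>\<^bsub>M\<^esub> (a \<ominus>\<^bsub>M\<^esub> a') = a" using assms(1,2) by (simp add: M.minus_eq M.a_ac M.r_neg)
    then show ?thesis using assms by (simp add: E_add)
  qed
  finally show ?thesis by simp
qed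

text \<open>The set \<open>kodaira_spencer\<close> expressed in terms of the algebra at the point
  alone; \<open>KS_deformed\<close> identifies the two.\<close>

definition KS where
  "KS = {\<mu> \<in> carrier (hochschild_cochains K B 2).
     \<exists>s \<in> linear_maps K B (restrict_scalars (\<lambda>c. (c, \<zero>\<^bsub>K\<^esub>)) DC.D).
       (\<forall>i. s ` grade B i \<subseteq> grade DC.D i) \<and> (\<forall>a\<in>carrier B. red (s a) = a) \<and>
       (\<forall>a\<in>carrier B. \<forall>b\<in>carrier B.
          s a \<otimes>\<^bsub>DC.D\<^esub> s b = s (a \<otimes>\<^bsub>B\<^esub> b) \<oplus>\<^bsub>DC.D\<^esub> (keps \<odot>\<^bsub>DC.D\<^esub> s (\<mu> [a, b])))}"

lemma linear_maps_D:
  "s \<in> linear_maps K B (restrict_scalars (\<lambda>c. (c, \<zero>\<^bsub>K\<^esub>)) DC.D) \<longleftrightarrow>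
   (\<forall>x\<in>carrier B. s x \<in> carrier DC.D) \<and>
   (\<forall>x\<in>carrier B. \<forall>y\<in>carrier B. s (x \<oplus>\<^bsub>B\<^esub> y) = s x \<oplus>\<^bsub>DC.D\<^esub> s y) \<and>
   (\<forall>c\<in>carrier K. \<forall>x\<in>carrier B. s (c \<odot>\<^bsub>B\<^esub> x) = (c, \<zero>\<^bsub>K\<^esub>) \<odot>\<^bsub>DC.D\<^esub> s x)"
  unfolding linear_maps_def by (auto simp: restrict_scalars_def)

text \<open>
  Every section of the reduction has the form \<open>b \<mapsto> \<sigma> b \<otimes> 1 + \<epsilon> t b\<close>, and its cocycle is computed
  from the product \<open>(\<sigma> a + \<epsilon> t a) (\<sigma> b + \<epsilon> t b)\<close>.
\<close>

lemma section_product: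
  assumes l: "is_lift \<sigma>" and ab: "a \<in> carrier B" "b \<in> carrier B"
    and t: "\<And>x. x \<in> carrier B \<Longrightarrow> t x \<in> carrier M"
    and s: "\<And>x. x \<in> carrier B \<Longrightarrow> s x = E (\<sigma> x) (t x)" and u: "u \<in> carrier B"
  shows "s a \<otimes>\<^bsub>DC.D\<^esub> s b = s (a \<otimes>\<^bsub>B\<^esub> b) \<oplus>\<^bsub>DC.D\<^esub> (keps \<odot>\<^bsub>DC.D\<^esub> s u) \<longleftrightarrow>
    u = H.d1 (\<lambda>x. pr (t x)) a b \<oplus>\<^bsub>B\<^esub> cup w \<sigma> a b"
proof -
  note lc = lift_closed[OF l]
  have Lc: "cup w \<sigma> a b \<in> carrier B" using bil_cup[OF l] ab by (rule H.bil_closed)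
  \<comment> \<open>A representative in \<open>M\<close> of the value of the cocycle, needed to
    write that value into the second slot of \<open>E\<close>; the lift itself provides one.\<close>
  define k where "k = \<sigma> (cup w \<sigma> a b)"
  have k: "k \<in> carrier M" "pr k = cup w \<sigma> a b" using Lc lc pr_lift[OF l] by (auto simp: k_def)
  have tc: "t a \<in> carrier M" "t b \<in> carrier M" "t (a \<otimes>\<^bsub>B\<^esub> b) \<in> carrier M" "\<sigma> u \<in> carrier M" "\<sigma> a \<in> carrier M"
    "\<sigma> b \<in> carrier M" "\<sigma> (a \<otimes>\<^bsub>B\<^esub> b) \<in> carrier M"
    using t lc ab u by simp_all
  have "s a \<otimes>\<^bsub>DC.D\<^esub> s b = E (\<sigma> a \<otimes>\<^bsub>M\<^esub> \<sigma> b) ((\<sigma> a \<otimes>\<^bsub>M\<^esub> t b) \<oplus>\<^bsub>M\<^esub> (t a \<otimes>\<^bsub>M\<^esub> \<sigma> b))"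
    using tc ab by (simp add: s E_mult)
  also have "\<dots> = E (\<sigma> (a \<otimes>\<^bsub>B\<^esub> b)) ((\<sigma> a \<otimes>\<^bsub>M\<^esub> t b) \<oplus>\<^bsub>M\<^esub> (t a \<otimes>\<^bsub>M\<^esub> \<sigma> b) \<oplus>\<^bsub>M\<^esub> k)"
    by (rule E_shift) (use tc k delta_mM[OF l ab] in \<open>simp_all add: cup_def delta_def\<close>)
  finally have left: "s a \<otimes>\<^bsub>DC.D\<^esub> s b = E (\<sigma> (a \<otimes>\<^bsub>B\<^esub> b)) ((\<sigma> a \<otimes>\<^bsub>M\<^esub> t b) \<oplus>\<^bsub>M\<^esub> (t a \<otimes>\<^bsub>M\<^esub> \<sigma> b) \<oplus>\<^bsub>M\<^esub> k)" .
  have right: "s (a \<otimes>\<^bsub>B\<^esub> b) \<oplus>\<^bsub>DC.D\<^esub> (keps \<odot>\<^bsub>DC.D\<^esub> s u) = E (\<sigma> (a \<otimes>\<^bsub>B\<^esub> b)) (t (a \<otimes>\<^bsub>B\<^esub> b) \<oplus>\<^bsub>M\<^esub> \<sigma> u)"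
    using tc ab u t by (simp add: s E_eps E_add)
  have "s a \<otimes>\<^bsub>DC.D\<^esub> s b = s (a \<otimes>\<^bsub>B\<^esub> b) \<oplus>\<^bsub>DC.D\<^esub> (keps \<odot>\<^bsub>DC.D\<^esub> s u) \<longleftrightarrow>
    (a \<otimes>\<^bsub>B\<^esub> pr (t b)) \<oplus>\<^bsub>B\<^esub> (pr (t a) \<otimes>\<^bsub>B\<^esub> b) \<oplus>\<^bsub>B\<^esub> cup w \<sigma> a b = pr (t (a \<otimes>\<^bsub>B\<^esub> b)) \<oplus>\<^bsub>B\<^esub> u"
    unfolding left right using tc k ab u
    by (subst E_eq_iff) (simp_all add: prB_add prB_mult pr_lift[OF l])
  also have "\<dots> \<longleftrightarrow> u = H.d1 (\<lambda>x. pr (t x)) a b \<oplus>\<^bsub>B\<^esub> cup w \<sigma> a b"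
  proof -
    define p q r where pqr: "p = a \<otimes>\<^bsub>B\<^esub> pr (t b)" "q = pr (t a) \<otimes>\<^bsub>B\<^esub> b" "r = pr (t (a \<otimes>\<^bsub>B\<^esub> b))"
    have cl: "p \<in> carrier B" "q \<in> carrier B" "r \<in> carrier B" using tc ab by (simp_all add: pqr prB_closed)
    have "r \<oplus>\<^bsub>B\<^esub> ((p \<oplus>\<^bsub>B\<^esub> \<ominus>\<^bsub>B\<^esub> r \<oplus>\<^bsub>B\<^esub> q) \<oplus>\<^bsub>B\<^esub> cup w \<sigma> a b) =
       (r \<oplus>\<^bsub>B\<^esub> \<ominus>\<^bsub>B\<^esub> r) \<oplus>\<^bsub>B\<^esub> (p \<oplus>\<^bsub>B\<^esub> q \<oplus>\<^bsub>B\<^esub> cup w \<sigma> a b)"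
      using cl Lc by (simp only: H.B.a_ac H.B.a_inv_closed H.B.add.m_closed)
    then have "p \<oplus>\<^bsub>B\<^esub> q \<oplus>\<^bsub>B\<^esub> cup w \<sigma> a b = r \<oplus>\<^bsub>B\<^esub> ((p \<oplus>\<^bsub>B\<^esub> \<ominus>\<^bsub>B\<^esub> r \<oplus>\<^bsub>B\<^esub> q) \<oplus>\<^bsub>B\<^esub> cup w \<sigma> a b)"
      using cl Lc by (simp add: H.B.r_neg)
    then have "p \<oplus>\<^bsub>B\<^esub> q \<oplus>\<^bsub>B\<^esub> cup w \<sigma> a b = r \<oplus>\<^bsub>B\<^esub> u \<longleftrightarrow> (p \<oplus>\<^bsub>B\<^esub> \<ominus>\<^bsub>B\<^esub> r \<oplus>\<^bsub>B\<^esub> q) \<oplus>\<^bsub>B\<^esub> cup w \<sigma> a b = u"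
      using cl Lc u by (simp del: H.B.add.m_assoc)
    then show ?thesis unfolding H.d1_def pqr by auto
  qed
  finally show ?thesis .
qed

text \<open>For one inclusion, the values of a given section are normalised to have first slot
  \<open>\<sigma> x\<close>; the class of the second slot is then a 1-cochain, because
  \<open>E_eq_iff\<close> turns each linearity property of the section into one of that class. For
  the other, every 1-cochain arises from a section built with it. In both directions
  \<open>section_product\<close> computes the cocycle.\<close>

lemma KS_eq:
  assumes l: "is_lift \<sigma>"
  shows "KS = H.cos (cup w \<sigma>)"
proof (intro equalityI subsetI)
  note lc = lift_closed[OF l] and pl = pr_lift[OF l]
  fix \<mu> assume "\<mu> \<in> KS"
  then obtain s where mu: "\<mu> \<in> carrier (hochschild_cochains K B 2)" and
    sl: "s \<in> linear_maps K B (restrict_scalars (\<lambda>c. (c, \<zero>\<^bsub>K\<^esub>)) DC.D)"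
    and sg: "\<And>i x. x \<in> grade B i \<Longrightarrow> s x \<in> grade DC.D i" and sr: "\<And>a. a \<in> carrier B \<Longrightarrow> red (s a) = a"
    and sm: "\<And>a b. a \<in> carrier B \<Longrightarrow> b \<in> carrier B \<Longrightarrow>
          s a \<otimes>\<^bsub>DC.D\<^esub> s b = s (a \<otimes>\<^bsub>B\<^esub> b) \<oplus>\<^bsub>DC.D\<^esub> (keps \<odot>\<^bsub>DC.D\<^esub> s (\<mu> [a, b]))"
    unfolding KS_def
    by (elim CollectE conjE bexE) (rule that, assumption, assumption, erule allE, erule subsetD, erule imageI, erule (1) bspec,
      drule (1) bspec, erule (1) bspec)
  \<comment> \<open>Since the section reduces to the identity, the first slot \<open>a\<close> is
    congruent to \<open>\<sigma> x\<close> modulo \<open>m M\<close>, and \<open>E_shift\<close>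
    replaces it by \<open>\<sigma> x\<close>.\<close>
  have shift: "\<exists>k\<in>carrier M. pr k = Lam w (a \<ominus>\<^bsub>M\<^esub> \<sigma> x) \<and> E a t = E (\<sigma> x) (t \<oplus>\<^bsub>M\<^esub> k) \<and> a \<ominus>\<^bsub>M\<^esub> \<sigma> x \<in> mM"
    if "x \<in> carrier B" "a \<in> carrier M" "t \<in> carrier M" "s x = E a t" for x a t
  proof -
    have "pr a = pr (\<sigma> x)" using sr[OF that(1)] that by (simp add: red_E pl)
    then have m: "a \<ominus>\<^bsub>M\<^esub> \<sigma> x \<in> mM" using that lc pr_eq_iff by blast
    obtain k where k: "k \<in> carrier M" "pr k = Lam w (a \<ominus>\<^bsub>M\<^esub> \<sigma> x)" using prB_surj[OF LamB_closed[OF m]] by metis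
    show ?thesis using E_shift[OF that(2) lc[OF that(1)] that(3) k(1) m k(2)] k m by blast
  qed
  have "\<forall>x\<in>carrier B. \<exists>t. t \<in> carrier M \<and> s x = E (\<sigma> x) t"
  proof
    fix x assume x: "x \<in> carrier B"
    then have "s x \<in> carrier DC.D" using sl unfolding linear_maps_D by blast
    then obtain a t where at: "a \<in> carrier M" "t \<in> carrier M" "s x = E a t" using E_surj by blast
    with shift[OF x] obtain k where "k \<in> carrier M" "E a t = E (\<sigma> x) (t \<oplus>\<^bsub>M\<^esub> k)" by blast
    then show "\<exists>t. t \<in> carrier M \<and> s x = E (\<sigma> x) t" using at by auto
  qed
  from bchoice[OF this] obtain t where "\<forall>x\<in>carrier B. t x \<in> carrier M \<and> s x = E (\<sigma> x) (t x)" ..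
  then have t: "t x \<in> carrier M" and st: "s x = E (\<sigma> x) (t x)" if "x \<in> carrier B" for x
    using that by (simp_all only:)
  have "H.lin1 (\<lambda>x. pr (t x))" unfolding H.lin1_def
  proof (intro conjI ballI allI)
    show "pr (t x) \<in> carrier B" if "x \<in> carrier B" for x using t[OF that] prB_closed by blast
  next
    fix x y assume xy: "x \<in> carrier B" "y \<in> carrier B"
    have "s (x \<oplus>\<^bsub>B\<^esub> y) = s x \<oplus>\<^bsub>DC.D\<^esub> s y" using sl xy unfolding linear_maps_D by blast
    then have "E (\<sigma> (x \<oplus>\<^bsub>B\<^esub> y)) (t (x \<oplus>\<^bsub>B\<^esub> y)) = E (\<sigma> (x \<oplus>\<^bsub>B\<^esub> y)) (t x \<oplus>\<^bsub>M\<^esub> t y)"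
      using xy by (simp add: st E_add lc t lift_add[OF l])
    then show "pr (t (x \<oplus>\<^bsub>B\<^esub> y)) = pr (t x) \<oplus>\<^bsub>B\<^esub> pr (t y)"
      using xy by (subst (asm) E_eq_iff) (simp_all add: lc t prB_add)
  next
    fix c x assume cx: "c \<in> carrier K" "x \<in> carrier B"
    have "s (c \<odot>\<^bsub>B\<^esub> x) = (c, \<zero>\<^bsub>K\<^esub>) \<odot>\<^bsub>DC.D\<^esub> s x" using sl cx unfolding linear_maps_D by blast
    then have "E (\<sigma> (c \<odot>\<^bsub>B\<^esub> x)) (t (c \<odot>\<^bsub>B\<^esub> x)) = E (\<sigma> (c \<odot>\<^bsub>B\<^esub> x)) (\<iota> c \<odot>\<^bsub>M\<^esub> t x)"
      using cx by (simp add: st E_smult lc t lift_smult[OF l])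
    then show "pr (t (c \<odot>\<^bsub>B\<^esub> x)) = c \<odot>\<^bsub>B\<^esub> pr (t x)"
      using cx by (subst (asm) E_eq_iff) (simp_all add: lc t prB_smult iota_simps)
  next
    fix i x assume x: "x \<in> grade B i"
    then have xB: "x \<in> carrier B" by (rule H.gr_sub)
    \<comment> \<open>The function \<open>t\<close> was chosen without regard to degrees. A
      homogeneous representation of \<open>s x\<close>, normalised in the same way, has the same
      second slot up to \<open>pr\<close>, and its class is visibly homogeneous.\<close>
    obtain a u where au: "a \<in> grade M i" "u \<in> grade M i" "s x = E a u" using sg[OF x] grade_D_E by blast
    have auM: "a \<in> carrier M" "u \<in> carrier M" using au gradeD by blast+
    obtain k where k: "k \<in> carrier M" "pr k = Lam w (a \<ominus>\<^bsub>M\<^esub> \<sigma> x)" "E a u = E (\<sigma> x) (u \<oplus>\<^bsub>M\<^esub> k)" "a \<ominus>\<^bsub>M\<^esub> \<sigma> x \<in> mM"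
      using shift[OF xB auM au(3)] by blast
    have "E (\<sigma> x) (t x) = E (\<sigma> x) (u \<oplus>\<^bsub>M\<^esub> k)" using st[OF xB] au(3) k(3) by simp
    then have e: "pr (t x) = pr u \<oplus>\<^bsub>B\<^esub> Lam w (a \<ominus>\<^bsub>M\<^esub> \<sigma> x)"
      using k auM xB by (subst (asm) E_eq_iff) (simp_all add: lc t prB_add)
    have "\<ominus>\<^bsub>M\<^esub> \<sigma> x \<in> grade M i"
      using grade_smult[of "\<ominus>\<^bsub>R\<^esub> \<one>\<^bsub>R\<^esub>" "\<sigma> x" i] lift_grade[OF l x] lc[OF xB] by (simp add: A.smult_l_minus)
    then have "a \<ominus>\<^bsub>M\<^esub> \<sigma> x \<in> grade M i" unfolding M.minus_eq using au(1) by (intro grade_add)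
    then show "pr (t x) \<in> grade B i" unfolding e using au(2) k(4) gradeB
      by (intro H.gr_add Lam_grade) auto
  qed
  moreover have "\<mu> = H.E2 (\<lambda>x y. H.d1 (\<lambda>x. pr (t x)) x y \<oplus>\<^bsub>B\<^esub> cup w \<sigma> x y)"
  proof (subst H.C2_E2[OF mu], rule H.E2_cong)
    fix x y assume xy: "x \<in> carrier B" "y \<in> carrier B"
    have "H.bil (\<lambda>x y. \<mu> [x, y])" using mu unfolding H.C2_iff by (rule conjunct2)
    then have "\<mu> [x, y] \<in> carrier B" using xy by (rule H.bil_closed)
    then show "\<mu> [x, y] = H.d1 (\<lambda>x. pr (t x)) x y \<oplus>\<^bsub>B\<^esub> cup w \<sigma> x y"
      using section_product[OF l xy t st] sm[OF xy] by blast
  qed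
  ultimately show "\<mu> \<in> H.cos (cup w \<sigma>)" unfolding H.cos_def by blast
next
  note lc = lift_closed[OF l] and pl = pr_lift[OF l]
  fix \<mu> assume "\<mu> \<in> H.cos (cup w \<sigma>)"
  then obtain \<theta> where th: "H.lin1 \<theta>" and mu: "\<mu> = H.E2 (\<lambda>x y. H.d1 \<theta> x y \<oplus>\<^bsub>B\<^esub> cup w \<sigma> x y)"
    unfolding H.cos_def by blast
  \<comment> \<open>The 1-cochain takes values in the fibre; composing it with
    \<open>\<sigma>\<close> gives graded linear representatives in \<open>M\<close> for the second
    slot.\<close>
  define s where "s x = E (\<sigma> x) (\<sigma> (\<theta> x))" for x
  note tc = H.lin1_closed[OF th]
  have th': "\<theta> (x \<oplus>\<^bsub>B\<^esub> y) = \<theta> x \<oplus>\<^bsub>B\<^esub> \<theta> y" "c \<in> carrier K \<Longrightarrow> \<theta> (c \<odot>\<^bsub>B\<^esub> x) = c \<odot>\<^bsub>B\<^esub> \<theta> x"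
    if "x \<in> carrier B" "y \<in> carrier B" for x y c using th that unfolding H.lin1_def by blast+
  have thg: "x \<in> grade B i \<Longrightarrow> \<theta> x \<in> grade B i" for x i using th unfolding H.lin1_def by blast
  have bil: "H.bil (\<lambda>x y. H.d1 \<theta> x y \<oplus>\<^bsub>B\<^esub> cup w \<sigma> x y)"
    by (intro H.bil_add H.bil_d1 bil_cup th l)
  have d1c: "H.d1 (\<lambda>x. pr (\<sigma> (\<theta> x))) x y = H.d1 \<theta> x y" if "x \<in> carrier B" "y \<in> carrier B" for x y
    using that by (simp add: H.d1_def pl tc)
  show "\<mu> \<in> KS" unfolding KS_def
  proof (intro CollectI conjI bexI[of _ s] ballI allI)
    show "\<mu> \<in> carrier (hochschild_cochains K B 2)" unfolding mu using bil by (rule H.E2_C)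
    show "s \<in> linear_maps K B (restrict_scalars (\<lambda>c. (c, \<zero>\<^bsub>K\<^esub>)) DC.D)"
      unfolding linear_maps_D s_def
      by (auto simp: E_closed lc tc th' lift_add[OF l] lift_smult[OF l] E_add E_smult)
    show "s ` grade B i \<subseteq> grade DC.D i" for i
      unfolding grade_D_E s_def using lift_grade[OF l] thg by blast
    show "red (s a) = a" if "a \<in> carrier B" for a
      using that by (simp add: s_def red_E lc tc pl)
    fix a b assume ab: "a \<in> carrier B" "b \<in> carrier B"
    have c: "\<mu> [a, b] = H.d1 \<theta> a b \<oplus>\<^bsub>B\<^esub> cup w \<sigma> a b" unfolding mu using ab by (rule H.E2_app)
    have "\<mu> [a, b] \<in> carrier B" unfolding c using bil ab by (rule H.bil_closed)
    then show "s a \<otimes>\<^bsub>DC.D\<^esub> s b = s (a \<otimes>\<^bsub>B\<^esub> b) \<oplus>\<^bsub>DC.D\<^esub> (keps \<odot>\<^bsub>DC.D\<^esub> s (\<mu> [a, b]))"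
      using section_product[OF l ab, of "\<lambda>x. \<sigma> (\<theta> x)" s "\<mu> [a, b]"] c ab by (simp add: s_def lc tc d1c)
  qed
qed

end

section \<open>Pullbacks of graded algebras\<close>

text \<open>The situation on stalks for a morphism sending the point of \<open>T\<close> to that of
  \<open>S\<close>. The condition \<open>h_w\<close> says that the functional on \<open>R\<close> is
  the push-forward of the one on \<open>R'\<close>, and \<open>g_bij\<close> that the map from the
  base change of \<open>M\<close> along \<open>h\<close> to \<open>M'\<close> is bijective.\<close>

locale algebra_pullback =
  S: deformed_algebra K R M m \<iota> val P w + T: deformed_algebra K R' M' m' \<iota>' val' P' w'
  for K :: "'k ring" and R :: "'r ring" and M :: "('r, 'a) graded_algebra"
    and m \<iota> val P w
    and R' :: "'s ring" and M' :: "('s, 'b) graded_algebra" and m' \<iota>' val' P' w' +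
  fixes h :: "'r \<Rightarrow> 's" and g :: "'a \<Rightarrow> 'b"
  assumes h: "h \<in> ring_hom R R'"
    and h_iota: "c \<in> carrier K \<Longrightarrow> h (\<iota> c) = \<iota>' c"
    and h_val: "r \<in> carrier R \<Longrightarrow> val' (h r) = val r"
    and h_w: "r \<in> carrier R \<Longrightarrow> w' (h r) = w r"
    and g_closed: "a \<in> carrier M \<Longrightarrow> g a \<in> carrier M'"
    and g_add: "a \<in> carrier M \<Longrightarrow> b \<in> carrier M \<Longrightarrow> g (a \<oplus>\<^bsub>M\<^esub> b) = g a \<oplus>\<^bsub>M'\<^esub> g b"
    and g_mult: "a \<in> carrier M \<Longrightarrow> b \<in> carrier M \<Longrightarrow> g (a \<otimes>\<^bsub>M\<^esub> b) = g a \<otimes>\<^bsub>M'\<^esub> g b"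
    and g_smult: "r \<in> carrier R \<Longrightarrow> a \<in> carrier M \<Longrightarrow> g (r \<odot>\<^bsub>M\<^esub> a) = h r \<odot>\<^bsub>M'\<^esub> g a"
    and g_grade: "a \<in> grade M i \<Longrightarrow> g a \<in> grade M' i"
    and g_bij: "bij_betw
        (\<lambda>C. the_elem ((\<lambda>xs. foldr (\<lambda>(a, r) b. (r \<odot>\<^bsub>M'\<^esub> g a) \<oplus>\<^bsub>M'\<^esub> b) xs \<zero>\<^bsub>M'\<^esub>) ` C))
        (carrier (base_change R h R' M)) (carrier M')"
begin

lemma h_closed: "r \<in> carrier R \<Longrightarrow> h r \<in> carrier R'" using ring_hom_closed[OF h] .

sublocale Q: base_changed R R' M h
  by (intro base_changed.intro base_changed_axioms.intro)
    (auto intro: S.R.is_cring T.R.is_cring S.M.ring_axioms S.A.module_axioms h S.smult_mult S.mult_smult)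

lemma g_zero: "g \<zero>\<^bsub>M\<^esub> = \<zero>\<^bsub>M'\<^esub>"
  using g_add[of "\<zero>\<^bsub>M\<^esub>" "\<zero>\<^bsub>M\<^esub>"] g_closed[of "\<zero>\<^bsub>M\<^esub>"] T.M.add.r_cancel_one by force

lemma g_minus: "a \<in> carrier M \<Longrightarrow> g (\<ominus>\<^bsub>M\<^esub> a) = \<ominus>\<^bsub>M'\<^esub> g a"
  by (rule T.M.minus_equality[symmetric]) (simp_all add: g_closed S.M.l_neg g_zero flip: g_add)

lemma h_m: "r \<in> m \<Longrightarrow> h r \<in> m'"
  using S.m_iff T.m_iff h_val h_closed S.m_closed by metis

definition Phi where "Phi xs = foldr (\<lambda>(a, r) b. (r \<odot>\<^bsub>M'\<^esub> g a) \<oplus>\<^bsub>M'\<^esub> b) xs \<zero>\<^bsub>M'\<^esub>"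

lemma Phi_simps [simp]: "Phi [] = \<zero>\<^bsub>M'\<^esub>" "Phi ((a, r) # xs) = (r \<odot>\<^bsub>M'\<^esub> g a) \<oplus>\<^bsub>M'\<^esub> Phi xs"
  by (simp_all add: Phi_def)

lemma Phi_closed: "set xs \<subseteq> carrier M \<times> carrier R' \<Longrightarrow> Phi xs \<in> carrier M'"
  by (induction xs) (auto simp: g_closed)

lemma Phi_append: "set xs \<subseteq> carrier M \<times> carrier R' \<Longrightarrow> set ys \<subseteq> carrier M \<times> carrier R' \<Longrightarrow>
   Phi (xs @ ys) = Phi xs \<oplus>\<^bsub>M'\<^esub> Phi ys"
  by (induction xs) (auto simp: g_closed Phi_closed T.M.a_assoc)

lemma Phi_smult: "set xs \<subseteq> carrier M \<times> carrier R' \<Longrightarrow> s \<in> carrier R' \<Longrightarrow>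
   Phi (map (\<lambda>(a, r). (a, s \<otimes>\<^bsub>R'\<^esub> r)) xs) = s \<odot>\<^bsub>M'\<^esub> Phi xs"
  by (induction xs) (auto simp: g_closed Phi_closed T.A.smult_assoc1 T.A.smult_r_distr)

lemma Phi_cls:
  assumes "set xs \<subseteq> carrier M \<times> carrier R'"
  shows "the_elem (Phi ` Q.T.cls xs) = Phi xs"
proof (rule Q.T.the_elem_cls)
  fix ys assume "Q.T.eq xs ys"
  from Q.T.eq_sum_eq[OF T.M.is_abelian_group _ _ _ _ this, of "\<lambda>a r. r \<odot>\<^bsub>M'\<^esub> g a"]
  show "Phi ys = Phi xs" unfolding Phi_def
    by (simp add: g_closed g_add g_smult T.A.smult_r_distr T.A.smult_l_distr T.R.m_comm h_closed
       flip: T.A.smult_assoc1)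
qed (use assms in simp)

lemma Phi_bij: "bij_betw (\<lambda>C. the_elem (Phi ` C)) (carrier Q.D) (carrier M')"
  using g_bij unfolding Phi_def .

lemma Phi_surj:
  assumes "y \<in> carrier M'" shows "\<exists>xs. set xs \<subseteq> carrier M \<times> carrier R' \<and> y = Phi xs"
proof -
  obtain C where "C \<in> carrier Q.D" "y = the_elem (Phi ` C)"
    using Phi_bij assms unfolding bij_betw_def by blast
  moreover from this obtain xs where "set xs \<subseteq> carrier M \<times> carrier R'" "C = Q.T.cls xs"
    unfolding Q.carrier_D by (auto elim: Q.T.tensor_carrierE)
  ultimately show ?thesis using Phi_cls by blast
qed

lemma Phi_inj:
  assumes "set xs \<subseteq> carrier M \<times> carrier R'" "set ys \<subseteq> carrier M \<times> carrier R'" "Phi xs = Phi ys"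
  shows "Q.T.eq xs ys"
proof -
  have "Q.T.cls xs = Q.T.cls ys"
    using Phi_bij Phi_cls assms Q.cls_closed unfolding bij_betw_def by (metis (no_types, lifting) inj_onD)
  then show ?thesis using Q.T.cls_eq[of xs ys] assms by simp
qed

text \<open>On a homogeneous element both sides are its image or zero, according to the degree,
  because \<open>g\<close> preserves degrees; such elements generate \<open>M\<close>
  additively.\<close>

lemma g_P: "a \<in> carrier M \<Longrightarrow> g (P i a) = P' i (g a)"
proof -
  have "set xs \<subseteq> (\<Union>i. grade M i) \<Longrightarrow> foldr (\<oplus>\<^bsub>M\<^esub>) xs \<zero>\<^bsub>M\<^esub> \<in> carrier M \<and>
    g (P i (foldr (\<oplus>\<^bsub>M\<^esub>) xs \<zero>\<^bsub>M\<^esub>)) = P' i (g (foldr (\<oplus>\<^bsub>M\<^esub>) xs \<zero>\<^bsub>M\<^esub>))" for xs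
  proof (induction xs)
    case Nil
    then show ?case by (simp add: S.P_zero T.P_zero g_zero)
  next
    case (Cons x xs)
    then obtain j where x: "x \<in> grade M j" by auto
    have xM: "x \<in> carrier M" "P j x = x" "g x \<in> carrier M'" "P' j (g x) = g x"
      using x g_grade[OF x] by (simp_all add: S.grade_M T.grade_M)
    have "P i x = (if i = j then x else \<zero>\<^bsub>M\<^esub>)" "P' i (g x) = (if i = j then g x else \<zero>\<^bsub>M'\<^esub>)"
      using S.P_P[OF xM(1), of i j] T.P_P[OF xM(3), of i j] xM by simp_all
    then have "g (P i x) = P' i (g x)" by (simp add: g_zero)
    then show ?case using Cons xM by (simp add: S.P_add T.P_add g_add S.P_closed g_closed)
  qed
  then show "a \<in> carrier M \<Longrightarrow> g (P i a) = P' i (g a)" using S.grade_gen by blast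
qed

lemma pr_residue: "r \<in> carrier R' \<Longrightarrow> x \<in> carrier M' \<Longrightarrow> T.pr (r \<odot>\<^bsub>M'\<^esub> x) = T.pr (\<iota>' (val' r) \<odot>\<^bsub>M'\<^esub> x)"
proof -
  assume rx: "r \<in> carrier R'" "x \<in> carrier M'"
  have "(r \<odot>\<^bsub>M'\<^esub> x) \<ominus>\<^bsub>M'\<^esub> (\<iota>' (val' r) \<odot>\<^bsub>M'\<^esub> x) = (r \<ominus>\<^bsub>R'\<^esub> \<iota>' (val' r)) \<odot>\<^bsub>M'\<^esub> x"
    using rx by (simp add: T.iota_simps T.val_simps T.A.smult_l_distr T.R.minus_eq T.M.minus_eq T.A.smult_l_minus)
  then show ?thesis using rx T.mM_smult[OF T.sub_const[OF rx(1)] rx(2)]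
    by (subst T.pr_eq_iff) (simp_all add: T.iota_simps T.val_simps)
qed

definition F where
  "F C = the_elem ((\<lambda>xs. T.BC.T.cls (map (\<lambda>(a, c). (g a, the_elem ((\<lambda>z. T.rc (h z)) ` c))) xs)) ` C)"

text \<open>Germs with equal value have images with equal value, so \<open>h\<close> induces a map
  of residue fields and the formula defining \<open>F\<close> is independent of all
  representatives.\<close>

lemma F_pr:
  assumes "a \<in> carrier M" shows "F (S.pr a) = T.pr (g a)"
proof -
  let ?G = "\<lambda>c. the_elem ((\<lambda>z. T.rc (h z)) ` c)"
  have G: "?G (S.rc r) = T.rc (h r)" if "r \<in> carrier R" for r
  proof (rule the_elem_const)
    show "r \<in> S.rc r" using that by (rule S.I.a_rcos_self)
    fix z assume z: "z \<in> S.rc r"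
    then have zR: "z \<in> carrier R" using S.R.a_r_coset_subset_G[OF S.I.a_subset that] by blast
    have "S.rc z = S.rc r" using S.I.a_repr_independence'[OF z that] by simp
    then have "val z = val r" using S.rc_eq[OF zR that] by blast
    then show "T.rc (h z) = T.rc (h r)" using zR that by (intro T.rc_eqI) (simp_all add: h_closed h_val)
  qed
  have eq: "T.BC.T.eq (map (\<lambda>(a, c). (g a, ?G c)) xs) (map (\<lambda>(a, c). (g a, ?G c)) ys)"
    if "S.BC.T.eq xs ys" for xs ys
    by (rule tensor_eq_map[OF S.BC.T.tensor_axioms T.BC.T.tensor_axioms _ _ _ _ _ _ _ that, where h = h])
      (auto simp: g_closed g_add g_smult h_closed G ring_hom_add[OF h] ring_hom_mult[OF h] T.rc_simps(1)
         elim!: S.QuotE simp flip: S.rc_simps(2-3) T.rc_simps(2-3))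
  have "F (S.pr a) = T.BC.T.cls (map (\<lambda>(a, c). (g a, ?G c)) [(a, S.rc \<one>\<^bsub>R\<^esub>)])"
    unfolding F_def S.pr_def
    by (rule S.BC.T.the_elem_cls[OF _ T.BC.T.cls_eqI[OF tensor_eq.sym[OF eq]]])
      (use assms in \<open>auto simp: S.rc_simps\<close>)
  then show ?thesis by (simp add: G T.pr_def ring_hom_one[OF h])
qed

lemma F_closed: "x \<in> carrier S.B \<Longrightarrow> F x \<in> carrier T.B"
  by (auto dest!: S.prB_surj simp: F_pr T.prB_closed g_closed)

lemma F_add: "x \<in> carrier S.B \<Longrightarrow> y \<in> carrier S.B \<Longrightarrow> F (x \<oplus>\<^bsub>S.B\<^esub> y) = F x \<oplus>\<^bsub>T.B\<^esub> F y"
  by (auto dest!: S.prB_surj simp: F_pr g_closed g_add T.prB_add simp flip: S.prB_add)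

lemma F_mult: "x \<in> carrier S.B \<Longrightarrow> y \<in> carrier S.B \<Longrightarrow> F (x \<otimes>\<^bsub>S.B\<^esub> y) = F x \<otimes>\<^bsub>T.B\<^esub> F y"
  by (auto dest!: S.prB_surj simp: F_pr g_closed g_mult T.prB_mult simp flip: S.prB_mult)

lemma F_smult: "c \<in> carrier K \<Longrightarrow> x \<in> carrier S.B \<Longrightarrow> F (c \<odot>\<^bsub>S.B\<^esub> x) = c \<odot>\<^bsub>T.B\<^esub> F x"
  by (auto dest!: S.prB_surj simp: F_pr g_closed g_smult S.iota_simps h_iota T.prB_smult simp flip: S.prB_smult)

lemma F_grade: "x \<in> grade S.B i \<Longrightarrow> F x \<in> grade T.B i"
  unfolding S.gradeB T.gradeB by (auto simp: F_pr S.gradeD g_grade)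

lemma F_zero: "F \<zero>\<^bsub>S.B\<^esub> = \<zero>\<^bsub>T.B\<^esub>"
  unfolding S.prB_zero[symmetric] by (simp add: F_pr g_zero T.prB_zero)

lemma F_minus: "x \<in> carrier S.B \<Longrightarrow> F (\<ominus>\<^bsub>S.B\<^esub> x) = \<ominus>\<^bsub>T.B\<^esub> F x"
  by (rule T.H.B.minus_equality[symmetric]) (simp_all add: F_closed S.H.B.l_neg F_zero flip: F_add)

text \<open>An element of \<open>M'\<close> is a combination of elements \<open>g a\<close> with
  coefficients in \<open>R'\<close>. Modulo \<open>m' M'\<close> each coefficient may be replaced by
  the constant with the same value, and constants are images of constants of \<open>R\<close>; so
  the class comes from one element of \<open>M\<close>.\<close>

lemma F_surj: "y \<in> carrier T.B \<Longrightarrow> \<exists>x\<in>carrier S.B. F x = y"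
proof -
  have "set xs \<subseteq> carrier M \<times> carrier R' \<Longrightarrow> \<exists>a\<in>carrier M. T.pr (Phi xs) = T.pr (g a)" for xs
  proof (induction xs)
    case Nil
    have "T.pr (Phi []) = T.pr (g \<zero>\<^bsub>M\<^esub>)" by (simp add: g_zero)
    then show ?case using S.M.zero_closed by blast
  next
    case (Cons p xs)
    then obtain a r b where p: "p = (a, r)" "a \<in> carrier M" "r \<in> carrier R'"
      and b: "b \<in> carrier M" "T.pr (Phi xs) = T.pr (g b)" by (cases p) auto
    have v: "val' r \<in> carrier K" using p by (simp add: T.val_simps)
    have "T.pr (Phi (p # xs)) = T.pr (r \<odot>\<^bsub>M'\<^esub> g a) \<oplus>\<^bsub>T.B\<^esub> T.pr (g b)"
      using p b Cons by (simp add: T.prB_add Phi_closed g_closed)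
    also have "\<dots> = T.pr (g (\<iota> (val' r) \<odot>\<^bsub>M\<^esub> a \<oplus>\<^bsub>M\<^esub> b))"
      using p b v by (simp add: pr_residue g_closed g_add g_smult S.iota_simps T.iota_simps h_iota T.prB_add)
    finally show ?case using p b v S.iota_simps(1) by (metis S.A.smult_closed S.M.add.m_closed)
  qed
  note lift = this
  assume "y \<in> carrier T.B"
  then obtain y' where "y' \<in> carrier M'" "y = T.pr y'" using T.prB_surj by blast
  then obtain a where "a \<in> carrier M" "y = T.pr (g a)" using Phi_surj lift by metis
  then show ?thesis using F_pr S.prB_closed by metis
qed

text \<open>
  If \<open>g a\<close> lies in \<open>m' M'\<close>, then \<open>a \<otimes> 1 = \<Sum> a\<^sub>k \<otimes> r\<^sub>k\<close> in \<open>M \<otimes>\<^sub>R R'\<close> with \<open>r\<^sub>k\<close> in \<open>m'\<close>; the functional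
  \<open>a \<otimes> r \<mapsto> r(q) a\<close> with values in the fibre then shows that the class of \<open>a\<close> vanishes.
\<close>

lemma F_ker:
  assumes a: "a \<in> carrier M" and 0: "T.pr (g a) = \<zero>\<^bsub>T.B\<^esub>" shows "S.pr a = \<zero>\<^bsub>S.B\<^esub>"
proof -
  have "\<exists>xs. set xs \<subseteq> carrier M \<times> m' \<and> T.lin (\<lambda>r. r) ms = Phi xs" if "ms \<in> T.kl" for ms
    using that
  proof (induction ms)
    case Nil
    then show ?case by (intro exI[of _ "[]"]) simp
  next
    case (Cons p ms)
    obtain r y where p: "p = (r, y)" by (cases p)
    then have ry: "r \<in> m'" "y \<in> carrier M'" "ms \<in> T.kl" using Cons.prems by simp_all
    obtain xs where xs: "set xs \<subseteq> carrier M \<times> m'" "T.lin (\<lambda>r. r) ms = Phi xs" using Cons.IH[OF ry(3)] by blast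
    obtain ys where ys: "set ys \<subseteq> carrier M \<times> carrier R'" "y = Phi ys" using Phi_surj[OF ry(2)] by blast
    \<comment> \<open>The element \<open>y\<close> is itself a combination of elements
      \<open>g a\<close> with coefficients in \<open>R'\<close>; multiplication by \<open>r\<close>
      brings all these coefficients into \<open>m'\<close>.\<close>
    let ?zs = "map (\<lambda>(a, s). (a, r \<otimes>\<^bsub>R'\<^esub> s)) ys"
    have z: "set ?zs \<subseteq> carrier M \<times> m'" using ys(1) ry(1) T.I.I_r_closed by auto
    have sub: "carrier M \<times> m' \<subseteq> carrier M \<times> carrier R'" using T.m_closed by auto
    have "T.lin (\<lambda>r. r) (p # ms) = Phi (?zs @ xs)"
      using z xs sub ys ry p by (subst Phi_append) (auto simp: Phi_smult T.m_closed)
    then show ?case using z xs(1) by (intro exI[of _ "?zs @ xs"]) auto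
  qed
  moreover have "g a \<in> T.mM" using T.pr_eq_zero[OF g_closed[OF a]] 0 by (simp add: T.B_sel)
  then obtain ms where "ms \<in> T.kl" "g a = T.lin (\<lambda>r. r) ms" unfolding T.mM_def by blast
  ultimately obtain xs where xs: "set xs \<subseteq> carrier M \<times> m'" "g a = Phi xs" by metis
  have xs': "set xs \<subseteq> carrier M \<times> carrier R'" using xs(1) T.m_closed by auto
  have "Phi [(a, \<one>\<^bsub>R'\<^esub>)] = Phi xs" using g_closed[OF a] by (simp flip: xs(2))
  then have eq: "Q.T.eq [(a, \<one>\<^bsub>R'\<^esub>)] xs" using a xs' by (intro Phi_inj) simp_all
  let ?f = "\<lambda>a r. S.pr (\<iota> (val' r) \<odot>\<^bsub>M\<^esub> a)"
  have res: "S.pr (s \<odot>\<^bsub>M\<^esub> x) = S.pr (\<iota> (val s) \<odot>\<^bsub>M\<^esub> x)" if "s \<in> carrier R" "x \<in> carrier M" for s x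
  proof -
    have "(s \<odot>\<^bsub>M\<^esub> x) \<ominus>\<^bsub>M\<^esub> (\<iota> (val s) \<odot>\<^bsub>M\<^esub> x) = (s \<ominus>\<^bsub>R\<^esub> \<iota> (val s)) \<odot>\<^bsub>M\<^esub> x"
      using that by (simp add: S.iota_simps S.val_simps S.A.smult_l_distr S.R.minus_eq S.M.minus_eq S.A.smult_l_minus)
    then show ?thesis using that S.mM_smult[OF S.sub_const[OF that(1)] that(2)]
      by (subst S.pr_eq_iff) (simp_all add: S.iota_simps S.val_simps)
  qed
  have "foldr (\<lambda>(a, r) b. ?f a r \<oplus>\<^bsub>S.B\<^esub> b) [(a, \<one>\<^bsub>R'\<^esub>)] \<zero>\<^bsub>S.B\<^esub> = foldr (\<lambda>(a, r) b. ?f a r \<oplus>\<^bsub>S.B\<^esub> b) xs \<zero>\<^bsub>S.B\<^esub>"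
  proof (rule Q.T.eq_sum_eq[OF S.H.B.is_abelian_group _ _ _ _ eq])
    fix s x y assume s: "s \<in> carrier R" "x \<in> carrier M" "y \<in> carrier Q.N"
    have "?f (s \<odot>\<^bsub>M\<^esub> x) y = val' y \<odot>\<^bsub>S.B\<^esub> S.pr (s \<odot>\<^bsub>M\<^esub> x)" using s by (simp add: S.prB_smult T.val_simps)
    also have "\<dots> = val' y \<odot>\<^bsub>S.B\<^esub> (val s \<odot>\<^bsub>S.B\<^esub> S.pr x)" using s by (simp add: res S.prB_smult S.val_simps)
    also have "\<dots> = ?f x (s \<odot>\<^bsub>Q.N\<^esub> y)"
      using s by (simp add: T.val_simps S.val_simps h_closed h_val S.prB_smult S.prB_closed S.K.m_comm
         flip: S.H.BM.smult_assoc1)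
    finally show "?f (s \<odot>\<^bsub>M\<^esub> x) y = ?f x (s \<odot>\<^bsub>Q.N\<^esub> y)" .
  qed (simp_all add: S.prB_smult S.prB_closed T.val_simps S.prB_add S.H.BM.smult_r_distr S.H.BM.smult_l_distr)
  moreover have "foldr (\<lambda>(a, r) b. ?f a r \<oplus>\<^bsub>S.B\<^esub> b) xs \<zero>\<^bsub>S.B\<^esub> = \<zero>\<^bsub>S.B\<^esub>"
    using xs(1)
  proof (induction xs)
    case (Cons p xs)
    then obtain x r where p: "p = (x, r)" "x \<in> carrier M" "r \<in> m'" by (cases p) auto
    then have "val' r = \<zero>\<^bsub>K\<^esub>" using T.m_iff[OF T.m_closed] by blast
    then show ?case using p Cons by (simp add: S.iota_zero S.prB_zero)
  qed simp
  ultimately show ?thesis using a by (simp add: T.val_simps S.iota_simps S.prB_closed)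
qed

lemma F_inj: "inj_on F (carrier S.B)"
proof (rule inj_onI)
  fix x y assume xy: "x \<in> carrier S.B" "y \<in> carrier S.B" "F x = F y"
  obtain a where a: "a \<in> carrier M" "x \<oplus>\<^bsub>S.B\<^esub> \<ominus>\<^bsub>S.B\<^esub> y = S.pr a"
    using S.prB_surj[OF S.H.B.add.m_closed[OF xy(1) S.H.B.a_inv_closed[OF xy(2)]]] by metis
  have "F (x \<oplus>\<^bsub>S.B\<^esub> \<ominus>\<^bsub>S.B\<^esub> y) = \<zero>\<^bsub>T.B\<^esub>" using xy by (simp add: F_add F_minus F_closed T.H.B.r_neg)
  then have "x \<oplus>\<^bsub>S.B\<^esub> \<ominus>\<^bsub>S.B\<^esub> y = \<zero>\<^bsub>S.B\<^esub>" unfolding a(2) using F_ker[OF a(1)] F_pr[OF a(1)] by simp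
  then have "\<ominus>\<^bsub>S.B\<^esub> (\<ominus>\<^bsub>S.B\<^esub> y) = x" using xy by (intro S.H.B.minus_equality) simp_all
  then show "x = y" using xy by simp
qed

abbreviation F' where "F' \<equiv> inv_into (carrier S.B) F"

lemma F_F': "y \<in> carrier T.B \<Longrightarrow> F (F' y) = y" using F_surj by (intro f_inv_into_f) blast
lemma F'_closed: "y \<in> carrier T.B \<Longrightarrow> F' y \<in> carrier S.B" using F_surj by (intro inv_into_into) blast
lemma F'_F: "x \<in> carrier S.B \<Longrightarrow> F' (F x) = x" using F_inj by (rule inv_into_f_f)

lemma F'_eq: "x \<in> carrier S.B \<Longrightarrow> F x = y \<Longrightarrow> F' y = x" using F'_F by blast

lemma F'_add: "x \<in> carrier T.B \<Longrightarrow> y \<in> carrier T.B \<Longrightarrow> F' (x \<oplus>\<^bsub>T.B\<^esub> y) = F' x \<oplus>\<^bsub>S.B\<^esub> F' y"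
  by (rule F'_eq) (simp_all add: F'_closed F_add F_F')
lemma F'_mult: "x \<in> carrier T.B \<Longrightarrow> y \<in> carrier T.B \<Longrightarrow> F' (x \<otimes>\<^bsub>T.B\<^esub> y) = F' x \<otimes>\<^bsub>S.B\<^esub> F' y"
  by (rule F'_eq) (simp_all add: F'_closed F_mult F_F')
lemma F'_smult: "c \<in> carrier K \<Longrightarrow> x \<in> carrier T.B \<Longrightarrow> F' (c \<odot>\<^bsub>T.B\<^esub> x) = c \<odot>\<^bsub>S.B\<^esub> F' x"
  by (rule F'_eq) (simp_all add: F'_closed F_smult F_F')

text \<open>\<open>F\<close> commutes with the grading projections and is injective, so an element
  whose image is fixed by a projection is itself fixed.\<close>

lemma F'_grade:
  assumes y: "y \<in> grade T.B i" shows "F' y \<in> grade S.B i"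
proof -
  have yB: "y \<in> carrier T.B" using y by (rule T.H.gr_sub)
  obtain a where a: "a \<in> carrier M" "F' y = S.pr a" using S.prB_surj F'_closed[OF yB] by blast
  have ya: "y = T.pr (g a)" using F_F'[OF yB] a F_pr by metis
  have "F (S.PB i (S.pr a)) = T.PB i (T.pr (g a))"
    using a(1) by (simp add: S.PB_pr T.PB_pr F_pr g_P g_closed S.P_closed)
  then have "F (S.PB i (F' y)) = T.PB i y" unfolding a(2)[symmetric] ya[symmetric] .
  also have "\<dots> = F (F' y)" using y T.gradeB_iff[OF yB] F_F'[OF yB] by simp
  finally have "S.PB i (F' y) = F' y"
    using a S.PB_pr F_inj F'_closed[OF yB] by (intro inj_onD[OF F_inj]) (simp_all add: S.prB_closed S.P_closed)
  then show ?thesis using S.gradeB_iff[OF F'_closed[OF yB]] by blast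
qed

text \<open>A presentation of \<open>x\<close> is carried to a presentation of \<open>g x\<close>
  with coefficients \<open>h r\<close>. As \<open>w'\<close> after \<open>h\<close> is
  \<open>w\<close> and \<open>h\<close> preserves constants, the two values correspond;
  \<open>Lam_lin\<close> on both sides permits computing with these presentations instead of the
  chosen ones.\<close>

lemma Lam_g:
  assumes "x \<in> S.mM" shows "g x \<in> T.mM" "T.Lam w' (g x) = F (S.Lam w x)"
proof -
  obtain ms where ms: "ms \<in> S.kl" "x = S.lin (\<lambda>r. r) ms" using assms unfolding S.mM_def by auto
  let ?ns = "map (\<lambda>(r, a). (h r, g a)) ms"
  have ns: "?ns \<in> T.kl" using ms(1) by (auto simp: S.kl_def T.kl_def h_m g_closed)
  have gl: "g (S.lin (\<lambda>r. k r) ms) = T.lin (\<lambda>r. k' r) ?ns"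
    if "\<And>r. r \<in> m \<Longrightarrow> k r \<in> carrier R" "\<And>r. r \<in> m \<Longrightarrow> h (k r) = k' (h r)" for k k'
    using ms(1)
  proof (induction ms)
    case (Cons p ms)
    then show ?case using that by (cases p) (simp add: g_add g_smult S.lin_closed)
  qed (simp add: g_zero)
  have gx: "g x = T.lin (\<lambda>r. r) ?ns" unfolding ms(2) by (rule gl) (simp_all add: S.m_closed)
  then show "g x \<in> T.mM" using ns unfolding T.mM_def by blast
  have "g (S.lin (\<lambda>r. \<iota> (w r)) ms) = T.lin (\<lambda>r. \<iota>' (w' r)) ?ns"
    by (rule gl) (simp_all add: S.iw_closed h_iota S.w_m_closed h_w S.m_closed)
  then show "T.Lam w' (g x) = F (S.Lam w x)"
    unfolding gx T.Lam_lin[OF ns] unfolding ms(2) S.Lam_lin[OF ms(1)]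
    using ms(1) by (simp add: F_pr S.lin_closed S.iw_closed)
qed

lemma lift_transport:
  assumes l: "S.is_lift \<sigma>" shows "T.is_lift (\<lambda>y. g (\<sigma> (F' y)))"
  unfolding T.is_lift_def
  by (auto simp: F'_closed S.lift_closed[OF l] g_closed F'_add S.lift_add[OF l] g_add F'_smult S.lift_smult[OF l]
     S.iota_simps g_smult h_iota F_F' S.pr_lift[OF l] simp flip: F_pr intro: g_grade S.lift_grade[OF l] F'_grade)

lemma cup_transport:
  assumes l: "S.is_lift \<sigma>" and xy: "x \<in> carrier T.B" "y \<in> carrier T.B"
  shows "T.cup w' (\<lambda>y. g (\<sigma> (F' y))) x y = F (S.cup w \<sigma> (F' x) (F' y))"
proof -
  have "T.delta (\<lambda>y. g (\<sigma> (F' y))) x y = g (S.delta \<sigma> (F' x) (F' y))"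
    unfolding T.delta_def S.delta_def using xy
    by (simp add: F'_closed S.lift_closed[OF l] g_closed g_mult g_add g_minus F'_mult S.M.minus_eq T.M.minus_eq)
  then show ?thesis unfolding T.cup_def S.cup_def
    using Lam_g(2) S.delta_mM[OF l] xy F'_closed by simp
qed

text \<open>Conjugation by \<open>F\<close> is a bijection between the graded 1-cochains on the two
  fibres and is compatible with \<open>d1\<close>. So whole cosets are matched, and not only the two
  distinguished cocycles.\<close>

lemma KS_transport: "T.KS = HH_transport S.B T.B F 2 S.KS"
proof -
  obtain \<sigma> where l: "S.is_lift \<sigma>" using S.lift_exists by blast
  let ?\<sigma> = "\<lambda>y. g (\<sigma> (F' y))"
  let ?t = "\<lambda>\<mu>. \<lambda>xs\<in>tuples T.B 2. F (\<mu> (map F' xs))"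
  have lin: "T.H.lin1 (\<lambda>y. F (\<theta> (F' y)))" if "S.H.lin1 \<theta>" for \<theta>
    using that unfolding S.H.lin1_def T.H.lin1_def
    by (auto simp: F'_closed F_closed F'_add F_add F'_smult F_smult F'_grade F_grade)
  have lin': "S.H.lin1 (\<lambda>x. F' (\<theta> (F x)))" if "T.H.lin1 \<theta>" for \<theta>
    using that unfolding S.H.lin1_def T.H.lin1_def
    by (auto simp: F'_closed F_closed F'_add F_add F'_smult F_smult F'_grade F_grade)
  have tr: "?t (S.H.E2 (\<lambda>x y. S.H.d1 \<theta> x y \<oplus>\<^bsub>S.B\<^esub> S.cup w \<sigma> x y)) =
    T.H.E2 (\<lambda>x y. T.H.d1 (\<lambda>y. F (\<theta> (F' y))) x y \<oplus>\<^bsub>T.B\<^esub> T.cup w' ?\<sigma> x y)" if th: "S.H.lin1 \<theta>" for \<theta>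
  proof (rule T.H.ext2)
    fix x y assume xy: "x \<in> carrier T.B" "y \<in> carrier T.B"
    have c: "S.cup w \<sigma> (F' x) (F' y) \<in> carrier S.B"
      using S.H.bil_closed[OF S.bil_cup[OF l]] xy F'_closed by blast
    show "?t (S.H.E2 (\<lambda>x y. S.H.d1 \<theta> x y \<oplus>\<^bsub>S.B\<^esub> S.cup w \<sigma> x y)) [x, y] =
      T.H.E2 (\<lambda>x y. T.H.d1 (\<lambda>y. F (\<theta> (F' y))) x y \<oplus>\<^bsub>T.B\<^esub> T.cup w' ?\<sigma> x y) [x, y]"
      using xy c by (simp add: S.H.E2_app T.H.E2_app F'_closed S.H.d1_closed[OF th] F_add cup_transport[OF l])
        (simp add: S.H.d1_def T.H.d1_def F'_closed S.H.lin1_closed[OF th] F_add F_mult F_minus F_closed F_F' F'_mult)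
  qed simp_all
  have "HH_transport S.B T.B F 2 S.KS = T.H.cos (T.cup w' ?\<sigma>)"
    unfolding HH_transport_def S.KS_eq[OF l]
  proof (intro equalityI subsetI)
    fix \<mu> assume "\<mu> \<in> ?t ` S.H.cos (S.cup w \<sigma>)"
    then obtain \<theta> where th: "S.H.lin1 \<theta>" and "\<mu> = ?t (S.H.E2 (\<lambda>x y. S.H.d1 \<theta> x y \<oplus>\<^bsub>S.B\<^esub> S.cup w \<sigma> x y))"
      unfolding S.H.cos_def by auto
    then show "\<mu> \<in> T.H.cos (T.cup w' ?\<sigma>)" unfolding T.H.cos_def tr[OF th] using lin[OF th] by blast
  next
    fix \<mu> assume "\<mu> \<in> T.H.cos (T.cup w' ?\<sigma>)"
    then obtain \<theta> where th: "T.H.lin1 \<theta>" and mu: "\<mu> = T.H.E2 (\<lambda>x y. T.H.d1 \<theta> x y \<oplus>\<^bsub>T.B\<^esub> T.cup w' ?\<sigma> x y)"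
      unfolding T.H.cos_def by auto
    have "\<mu> = ?t (S.H.E2 (\<lambda>x y. S.H.d1 (\<lambda>x. F' (\<theta> (F x))) x y \<oplus>\<^bsub>S.B\<^esub> S.cup w \<sigma> x y))"
      unfolding tr[OF lin'[OF th]] mu
      by (rule T.H.E2_cong) (simp add: T.H.d1_def F_F' T.H.lin1_closed[OF th])
    then show "\<mu> \<in> ?t ` S.H.cos (S.cup w \<sigma>)" unfolding S.H.cos_def using lin'[OF th] by blast
  qed
  then show ?thesis using T.KS_eq[OF lift_transport[OF l]] by simp
qed

end

section \<open>Stalks\<close>

text \<open>A common frame for the structure sheaf and the sheaf of algebras: computing with germs
  at a point involves the rings of sections and their restriction maps.\<close>

locale presheaf_at =
  fixes T :: "'x topology" and F :: "'x set \<Rightarrow> ('a, 'm) ring_scheme"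
    and \<rho> :: "'x set \<Rightarrow> 'x set \<Rightarrow> 'a \<Rightarrow> 'a" and x :: 'x
  assumes point: "x \<in> topspace T"
    and ring: "openin T U \<Longrightarrow> ring (F U)"
    and res_hom: "openin T U \<Longrightarrow> openin T V \<Longrightarrow> V \<subseteq> U \<Longrightarrow> \<rho> U V \<in> ring_hom (F U) (F V)"
    and res_id: "openin T U \<Longrightarrow> s \<in> carrier (F U) \<Longrightarrow> \<rho> U U s = s"
    and res_res: "openin T U \<Longrightarrow> openin T V \<Longrightarrow> openin T W \<Longrightarrow> V \<subseteq> U \<Longrightarrow> W \<subseteq> V \<Longrightarrow>
      s \<in> carrier (F U) \<Longrightarrow> \<rho> V W (\<rho> U V s) = \<rho> U W s"
begin

definition nb where "nb U \<longleftrightarrow> openin T U \<and> x \<in> U"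

lemma nb_Int: "nb U \<Longrightarrow> nb V \<Longrightarrow> nb (U \<inter> V)" by (auto simp: nb_def)
lemma nb_top: "nb (topspace T)" using point by (simp add: nb_def)
lemma nb_sub_top: "nb U \<Longrightarrow> U \<subseteq> topspace T" by (simp add: nb_def openin_subset)

lemma res_closed: "nb U \<Longrightarrow> nb V \<Longrightarrow> V \<subseteq> U \<Longrightarrow> s \<in> carrier (F U) \<Longrightarrow> \<rho> U V s \<in> carrier (F V)"
  using ring_hom_closed[OF res_hom] unfolding nb_def by blast

lemma nb_ring: "nb U \<Longrightarrow> ring (F U)" using ring by (simp add: nb_def)
lemma nb_hom: "nb U \<Longrightarrow> nb V \<Longrightarrow> V \<subseteq> U \<Longrightarrow> \<rho> U V \<in> ring_hom (F U) (F V)" using res_hom by (simp add: nb_def)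
lemma nb_res_res: "nb U \<Longrightarrow> nb V \<Longrightarrow> nb W \<Longrightarrow> V \<subseteq> U \<Longrightarrow> W \<subseteq> V \<Longrightarrow>
      s \<in> carrier (F U) \<Longrightarrow> \<rho> V W (\<rho> U V s) = \<rho> U W s" using res_res by (simp add: nb_def)
lemma nb_res_id: "nb U \<Longrightarrow> s \<in> carrier (F U) \<Longrightarrow> \<rho> U U s = s" using res_id by (simp add: nb_def)

abbreviation gm where "gm U s \<equiv> germ T F \<rho> x U s"

lemma mem_gm: "(V, t) \<in> gm U s \<longleftrightarrow> nb V \<and> t \<in> carrier (F V) \<and> (\<exists>W. nb W \<and> W \<subseteq> U \<and> W \<subseteq> V \<and> \<rho> U W s = \<rho> V W t)"
  unfolding germ_def nb_def by auto

lemma gm_self: "nb U \<Longrightarrow> s \<in> carrier (F U) \<Longrightarrow> (U, s) \<in> gm U s"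
  unfolding mem_gm by auto

text \<open>A germ is the set of all pairs that agree with the given section near the point. One
  inclusion suffices by symmetry, and agreement on \<open>W\<close> is combined with agreement on
  \<open>W'\<close> by restricting to their intersection.\<close>

lemma gm_eqI:
  assumes U: "nb U" "s \<in> carrier (F U)" and V: "nb V" "t \<in> carrier (F V)"
    and W: "nb W" "W \<subseteq> U" "W \<subseteq> V" "\<rho> U W s = \<rho> V W t"
  shows "gm U s = gm V t"
proof -
  have "gm U s \<subseteq> gm V t" if U: "nb U" "s \<in> carrier (F U)" and V: "nb V" "t \<in> carrier (F V)"
    and W: "W \<subseteq> U" "W \<subseteq> V" "\<rho> U W s = \<rho> V W t" for U V s t
  proof
    fix p assume "p \<in> gm U s"
    then obtain V' t' W' where p: "p = (V', t')" "nb V'" "t' \<in> carrier (F V')" "nb W'" "W' \<subseteq> U" "W' \<subseteq> V'"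
      "\<rho> U W' s = \<rho> V' W' t'" by (cases p) (auto simp: mem_gm)
    have n: "nb (W \<inter> W')" using \<open>nb W\<close> p nb_Int by blast
    have "\<rho> V (W \<inter> W') t = \<rho> W (W \<inter> W') (\<rho> V W t)" using V W n \<open>nb W\<close> by (simp add: nb_res_res)
    also have "\<dots> = \<rho> U (W \<inter> W') s" unfolding W(3)[symmetric] using U W(1,2) n \<open>nb W\<close> by (simp add: nb_res_res)
    also have "\<dots> = \<rho> W' (W \<inter> W') (\<rho> U W' s)" using U p(2-6) n by (simp add: nb_res_res)
    also have "\<dots> = \<rho> V' (W \<inter> W') t'" unfolding p(7) using p(2-6) n by (simp add: nb_res_res)
    finally show "p \<in> gm V t" unfolding p(1) mem_gm using p n W by blast
  qed
  from this[OF U V W(2-4)] this[OF V U W(3,2) W(4)[symmetric]] show ?thesis by blast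
qed

lemma gm_eqD:
  assumes "nb V" "t \<in> carrier (F V)" "gm U s = gm V t"
  obtains W where "nb W" "W \<subseteq> U" "W \<subseteq> V" "\<rho> U W s = \<rho> V W t"
  using gm_self[OF assms(1,2)] unfolding assms(3)[symmetric] mem_gm by blast

lemma gm_res: "nb U \<Longrightarrow> nb V \<Longrightarrow> V \<subseteq> U \<Longrightarrow> s \<in> carrier (F U) \<Longrightarrow> gm V (\<rho> U V s) = gm U s"
  by (rule gm_eqI[of _ _ _ _ V]) (auto simp: res_closed nb_res_id)

text \<open>Allows finitely many germs to be represented by sections over one and the same
  neighbourhood.\<close>

lemma common_nb:
  assumes "finite A" and "\<And>a. a \<in> A \<Longrightarrow> \<exists>U. nb U \<and> Q a U"
    and shrink: "\<And>a U V. Q a U \<Longrightarrow> nb U \<Longrightarrow> nb V \<Longrightarrow> V \<subseteq> U \<Longrightarrow> Q a V"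
  shows "\<exists>U. nb U \<and> (\<forall>a\<in>A. Q a U)"
  using assms(1,2)
proof (induction A)
  case empty
  then show ?case using nb_top by blast
next
  case (insert a A)
  then obtain U V where UV: "nb U" "\<forall>a\<in>A. Q a U" "nb V" "Q a V" by (meson insertCI)
  have "Q b (U \<inter> V)" if "b \<in> insert a A" for b
    using that UV shrink[of b U "U \<inter> V"] shrink[of b V "U \<inter> V"] nb_Int[OF UV(1,3)] by auto
  then show ?case using nb_Int[OF UV(1,3)] by blast
qed

text \<open>An operation that commutes with restriction may be computed on any representatives over
  one neighbourhood. The left operand belongs to a second presheaf \<open>F'\<close> so that scalar
  multiplication by germs of functions is covered as well.\<close>

lemma germ_lift_gm:
  assumes F': "presheaf_at T F' \<rho>' x"
    and closed: "\<And>U s t. nb U \<Longrightarrow> s \<in> carrier (F' U) \<Longrightarrow> t \<in> carrier (F U) \<Longrightarrow> opn U s t \<in> carrier (F U)"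
    and nat: "\<And>U V s t. nb U \<Longrightarrow> nb V \<Longrightarrow> V \<subseteq> U \<Longrightarrow> s \<in> carrier (F' U) \<Longrightarrow> t \<in> carrier (F U) \<Longrightarrow>
      \<rho> U V (opn U s t) = opn V (\<rho>' U V s) (\<rho> U V t)"
    and U: "nb U" and s: "s \<in> carrier (F' U)" and t: "t \<in> carrier (F U)"
  shows "germ_lift T F \<rho> x \<rho>' opn (germ T F' \<rho>' x U s) (gm U t) = gm U (opn U s t)"
proof -
  interpret F': presheaf_at T F' \<rho>' x by fact
  let ?f = "\<lambda>((U, s), (V, t)). gm (U \<inter> V) (opn (U \<inter> V) (\<rho>' U (U \<inter> V) s) (\<rho> V (U \<inter> V) t))"
  have *: "?f ((U1, s1), (V1, t1)) = gm U (opn U s t)" if 1: "(U1, s1) \<in> F'.gm U s" and 2: "(V1, t1) \<in> gm U t" for U1 s1 V1 t1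
  proof -
    obtain W1 where W1: "nb U1" "s1 \<in> carrier (F' U1)" "nb W1" "W1 \<subseteq> U" "W1 \<subseteq> U1" "\<rho>' U W1 s = \<rho>' U1 W1 s1"
      using 1 unfolding F'.mem_gm by blast
    obtain W2 where W2: "nb V1" "t1 \<in> carrier (F V1)" "nb W2" "W2 \<subseteq> U" "W2 \<subseteq> V1" "\<rho> U W2 t = \<rho> V1 W2 t1"
      using 2 unfolding mem_gm by blast
    define W where "W = W1 \<inter> W2"
    have W: "nb W" "W \<subseteq> W1" "W \<subseteq> W2" "W \<subseteq> U" "W \<subseteq> U1" "W \<subseteq> V1" using W1 W2 nb_Int by (auto simp: W_def)
    have n: "nb (U1 \<inter> V1)" using W1 W2 nb_Int by blast
    note rr' = F'.nb_res_res note rc' = F'.res_closed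
    have s_eq: "\<rho>' U W s = \<rho>' U1 W s1"
      using arg_cong[OF W1(6), of "\<rho>' W1 W"] rr'[OF U W1(3) W(1) W1(4) W(2) s] rr'[OF W1(1,3) W(1) W1(5) W(2) W1(2)] by simp
    have t_eq: "\<rho> U W t = \<rho> V1 W t1"
      using arg_cong[OF W2(6), of "\<rho> W2 W"] nb_res_res[OF U W2(3) W(1) W2(4) W(3) t] nb_res_res[OF W2(1,3) W(1) W2(5) W(3) W2(2)] by simp
    let ?s = "\<rho>' U1 (U1 \<inter> V1) s1" and ?t = "\<rho> V1 (U1 \<inter> V1) t1"
    have st: "?s \<in> carrier (F' (U1 \<inter> V1))" "?t \<in> carrier (F (U1 \<inter> V1))"
      using W1 W2 n by (auto intro: rc' res_closed)
    have "\<rho> (U1 \<inter> V1) W (opn (U1 \<inter> V1) ?s ?t) = opn W (\<rho>' U1 W s1) (\<rho> V1 W t1)"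
      using W W1 W2 n st by (simp add: nat rr' nb_res_res)
    also have "\<dots> = \<rho> U W (opn U s t)" using W U s t by (simp add: nat s_eq t_eq)
    finally show ?thesis
      using W n U st s t by (simp, intro gm_eqI[of _ _ _ _ W]) (auto intro: closed)
  qed
  have "germ_lift T F \<rho> x \<rho>' opn (germ T F' \<rho>' x U s) (gm U t) = ?f ((U, s), (U, t))"
    unfolding germ_lift_def
  proof (rule the_elem_const)
    show in1: "((U, s), (U, t)) \<in> F'.gm U s \<times> gm U t" using gm_self[OF U t] F'.gm_self[OF U s] by blast
    fix p assume "p \<in> F'.gm U s \<times> gm U t"
    then obtain U1 s1 V1 t1 where p: "p = ((U1, s1), (V1, t1))" "(U1, s1) \<in> F'.gm U s" "(V1, t1) \<in> gm U t"
      by (cases p) auto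
    show "?f p = ?f ((U, s), (U, t))"
      unfolding p(1) *[OF p(2,3)] *[OF F'.gm_self[OF U s] gm_self[OF U t]] ..
  qed
  also have "\<dots> = gm U (opn U s t)" using gm_self[OF U t] F'.gm_self[OF U s] by (rule *[rotated])
  finally show ?thesis .
qed

lemma lift_mult:
  assumes "nb U" "s \<in> carrier (F U)" "t \<in> carrier (F U)"
  shows "germ_lift T F \<rho> x \<rho> (\<lambda>U. monoid.mult (F U)) (gm U s) (gm U t) = gm U (s \<otimes>\<^bsub>F U\<^esub> t)"
  by (rule germ_lift_gm[OF presheaf_at_axioms])
    (use assms in \<open>auto simp: ring_hom_mult[OF nb_hom] ring.ring_simprules(5)[OF nb_ring]\<close>)

lemma lift_add:
  assumes "nb U" "s \<in> carrier (F U)" "t \<in> carrier (F U)"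
  shows "germ_lift T F \<rho> x \<rho> (\<lambda>U. add (F U)) (gm U s) (gm U t) = gm U (s \<oplus>\<^bsub>F U\<^esub> t)"
  by (rule germ_lift_gm[OF presheaf_at_axioms])
    (use assms in \<open>auto simp: ring_hom_add[OF nb_hom] ring.ring_simprules(1)[OF nb_ring]\<close>)

lemma gm_one: "nb U \<Longrightarrow> gm (topspace T) \<one>\<^bsub>F (topspace T)\<^esub> = gm U \<one>\<^bsub>F U\<^esub>"
  using gm_res[OF nb_top _ nb_sub_top] ring_hom_one[OF nb_hom[OF nb_top _ nb_sub_top]]
    ring.ring_simprules(6)[OF nb_ring[OF nb_top]] by metis

lemma gm_zero: "nb U \<Longrightarrow> gm (topspace T) \<zero>\<^bsub>F (topspace T)\<^esub> = gm U \<zero>\<^bsub>F U\<^esub>"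
  using gm_res[OF nb_top _ nb_sub_top] ring_hom_zero[OF nb_hom[OF nb_top _ nb_sub_top] nb_ring[OF nb_top] nb_ring]
    ring.ring_simprules(2)[OF nb_ring[OF nb_top]] by metis

lemma germsE:
  assumes "a \<in> germs T F \<rho> x G" obtains U s where "nb U" "s \<in> G U" "a = gm U s"
  using assms unfolding germs_def nb_def by blast

lemma germsI: "nb U \<Longrightarrow> s \<in> G U \<Longrightarrow> gm U s \<in> germs T F \<rho> x G"
  unfolding germs_def nb_def by blast

end

section \<open>Maps induced on stalks, and projections of an internal direct sum\<close>

locale presheaf_morphism_at = X: presheaf_at TX F \<rho> x + Y: presheaf_at TY G \<tau> y
  for TX :: "'x topology" and F :: "'x set \<Rightarrow> ('a, 'm) ring_scheme" and \<rho> x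
    and TY :: "'y topology" and G :: "'y set \<Rightarrow> ('b, 'n) ring_scheme" and \<tau> y +
  fixes f :: "'x \<Rightarrow> 'y" and h :: "'y set \<Rightarrow> 'b \<Rightarrow> 'a"
  assumes cont: "continuous_map TX TY f" and fx: "f x = y"
    and hom: "openin TY V \<Longrightarrow> h V \<in> ring_hom (G V) (F (preim TX f V))"
    and nat: "openin TY V \<Longrightarrow> openin TY W \<Longrightarrow> W \<subseteq> V \<Longrightarrow> s \<in> carrier (G V) \<Longrightarrow>
      h W (\<tau> V W s) = \<rho> (preim TX f V) (preim TX f W) (h V s)"
begin

lemma nb_preim: "Y.nb V \<Longrightarrow> X.nb (preim TX f V)"
  using cont X.point fx unfolding continuous_map_def X.nb_def Y.nb_def preim_def by auto

lemma preim_mono: "V \<subseteq> W \<Longrightarrow> preim TX f V \<subseteq> preim TX f W" by (auto simp: preim_def)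

lemma h_hom: "Y.nb V \<Longrightarrow> h V \<in> ring_hom (G V) (F (preim TX f V))"
  using hom by (simp add: Y.nb_def)

lemma h_closed: "Y.nb V \<Longrightarrow> s \<in> carrier (G V) \<Longrightarrow> h V s \<in> carrier (F (preim TX f V))"
  using ring_hom_closed[OF h_hom] by blast

lemma stalk_map_gm:
  assumes V: "Y.nb V" and s: "s \<in> carrier (G V)"
  shows "the_elem ((\<lambda>(V, s). X.gm (preim TX f V) (h V s)) ` Y.gm V s) = X.gm (preim TX f V) (h V s)"
proof -
  have "the_elem ((\<lambda>(V, s). X.gm (preim TX f V) (h V s)) ` Y.gm V s) = (\<lambda>(V, s). X.gm (preim TX f V) (h V s)) (V, s)"
  proof (rule the_elem_const)
    show "(V, s) \<in> Y.gm V s" using Y.gm_self[OF V s] .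
    fix p assume "p \<in> Y.gm V s"
    then obtain V' t W where p: "p = (V', t)" "Y.nb V'" "t \<in> carrier (G V')" "Y.nb W" "W \<subseteq> V" "W \<subseteq> V'" "\<tau> V W s = \<tau> V' W t"
      by (cases p) (auto simp: Y.mem_gm)
    have o: "openin TY V" "openin TY V'" "openin TY W" using V p by (auto simp: Y.nb_def)
    have "X.gm (preim TX f V') (h V' t) = X.gm (preim TX f V) (h V s)"
    proof (rule X.gm_eqI)
      show "\<rho> (preim TX f V') (preim TX f W) (h V' t) = \<rho> (preim TX f V) (preim TX f W) (h V s)"
        using nat[OF o(1,3) p(5) s] nat[OF o(2,3) p(6,3)] p(7) by simp
    qed (use V s p preim_mono in \<open>simp_all add: nb_preim h_closed\<close>)
    then show "(case p of (V, s) \<Rightarrow> X.gm (preim TX f V) (h V s)) = (case (V, s) of (V, s) \<Rightarrow> X.gm (preim TX f V) (h V s))"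
      by (simp add: p(1))
  qed
  then show ?thesis by simp
qed

end

text \<open>Generation gives each element a decomposition into homogeneous components and
  independence makes it unique; \<open>P i\<close> reads off the component of degree
  \<open>i\<close>. Linearity follows by decomposing sums and multiples termwise.\<close>

lemma (in module) graded_projections:
  fixes G :: "int \<Rightarrow> 'c set"
  assumes sub: "\<And>i. submodule (G i) R M"
    and gen: "\<And>a. a \<in> carrier M \<Longrightarrow> \<exists>J f. finite J \<and> (\<forall>i\<in>J. f i \<in> G i) \<and> a = finsum M f J"
    and ind: "\<And>J f. finite J \<Longrightarrow> \<forall>i\<in>J. f i \<in> G i \<Longrightarrow> finsum M f J = \<zero>\<^bsub>M\<^esub> \<Longrightarrow> \<forall>i\<in>J. f i = \<zero>\<^bsub>M\<^esub>"
  shows "\<exists>P. (\<forall>i. \<forall>x\<in>carrier M. P i x \<in> carrier M) \<and>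
    (\<forall>i. \<forall>x\<in>carrier M. \<forall>y\<in>carrier M. P i (x \<oplus>\<^bsub>M\<^esub> y) = P i x \<oplus>\<^bsub>M\<^esub> P i y) \<and>
    (\<forall>i. \<forall>r\<in>carrier R. \<forall>x\<in>carrier M. P i (r \<odot>\<^bsub>M\<^esub> x) = r \<odot>\<^bsub>M\<^esub> P i x) \<and>
    (\<forall>i j. \<forall>x\<in>carrier M. P i (P j x) = (if i = j then P j x else \<zero>\<^bsub>M\<^esub>)) \<and>
    (\<forall>i. G i = {x \<in> carrier M. P i x = x}) \<and>
    (\<forall>x\<in>carrier M. \<exists>xs. set xs \<subseteq> (\<Union>i. G i) \<and> x = foldr (\<oplus>\<^bsub>M\<^esub>) xs \<zero>\<^bsub>M\<^esub>)"
proof -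
  have Gs: "x \<in> G i \<Longrightarrow> x \<in> carrier M" for x i using submoduleE(1)[OF sub] by blast
  have G0: "\<zero>\<^bsub>M\<^esub> \<in> G i" for i using subgroup.one_closed[OF submodule.axioms(1)[OF sub, of i]] by simp
  have Ga: "x \<in> G i \<Longrightarrow> y \<in> G i \<Longrightarrow> x \<oplus>\<^bsub>M\<^esub> y \<in> G i" for x y i using submoduleE(5)[OF sub] by blast
  have Gr: "r \<in> carrier R \<Longrightarrow> x \<in> G i \<Longrightarrow> r \<odot>\<^bsub>M\<^esub> x \<in> G i" for r x i using submoduleE(4)[OF sub] by blast
  have Gn: "x \<in> G i \<Longrightarrow> \<ominus>\<^bsub>M\<^esub> x \<in> G i" for x i using submoduleE(3)[OF sub] by blast
  \<comment> \<open>A decomposition is a function on all integers with finite support instead of a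
    family over a finite set, so that two decompositions can be added and compared degree by
    degree.\<close>
  define dec where "dec f a \<longleftrightarrow> (\<forall>i. f i \<in> G i) \<and> (\<exists>J. finite J \<and> (\<forall>i. i \<notin> J \<longrightarrow> f i = \<zero>\<^bsub>M\<^esub>) \<and> a = finsum M f J)"
    for f :: "int \<Rightarrow> 'c" and a
  have dec_M: "f i \<in> carrier M" if "dec f a" for f a i using that Gs unfolding dec_def by blast
  have dec_J: "a = finsum M f J" if "dec f a" "finite J" "\<And>i. i \<notin> J \<Longrightarrow> f i = \<zero>\<^bsub>M\<^esub>" for f a J
  proof -
    from that(1) have "\<exists>I. finite I \<and> (\<forall>i. i \<notin> I \<longrightarrow> f i = \<zero>\<^bsub>M\<^esub>) \<and> a = finsum M f I"
      unfolding dec_def by (rule conjunct2)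
    then obtain I where I: "finite I" "\<forall>i. i \<notin> I \<longrightarrow> f i = \<zero>\<^bsub>M\<^esub>" "a = finsum M f I" by (elim exE conjE)
    have f: "f \<in> UNIV \<rightarrow> carrier M" using dec_M[OF that(1)] by blast
    have "finsum M f I = finsum M f (I \<union> J)"
      by (rule M.add.finprod_mono_neutral_cong_left) (use I that(2) f in auto)
    moreover have "finsum M f J = finsum M f (I \<union> J)"
      by (rule M.add.finprod_mono_neutral_cong_left) (use I that f in auto)
    ultimately show ?thesis using I(3) by simp
  qed
  have dec_fin: "\<exists>J. finite J \<and> (\<forall>i. i \<notin> J \<longrightarrow> f i = \<zero>\<^bsub>M\<^esub>)" if "dec f a" for f a
    using that[unfolded dec_def, THEN conjunct2] by (elim exE conjE, intro exI conjI)
  have dec_add: "dec (\<lambda>i. f i \<oplus>\<^bsub>M\<^esub> g i) (a \<oplus>\<^bsub>M\<^esub> b)" if f: "dec f a" and g: "dec g b" for f g a b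
  proof -
    obtain I J where IJ: "finite I" "\<And>i. i \<notin> I \<Longrightarrow> f i = \<zero>\<^bsub>M\<^esub>" "finite J" "\<And>i. i \<notin> J \<Longrightarrow> g i = \<zero>\<^bsub>M\<^esub>"
      using dec_fin[OF f] dec_fin[OF g] by blast
    have "a = finsum M f (I \<union> J)" "b = finsum M g (I \<union> J)" using IJ by (auto intro!: dec_J f g)
    then have "a \<oplus>\<^bsub>M\<^esub> b = finsum M (\<lambda>i. f i \<oplus>\<^bsub>M\<^esub> g i) (I \<union> J)"
      using dec_M[OF f] dec_M[OF g] by (simp add: M.finsum_addf Pi_def)
    then show ?thesis unfolding dec_def using IJ f g Ga
      by (intro conjI allI exI[of _ "I \<union> J"]) (auto simp: dec_def)
  qed
  have dec_smult: "dec (\<lambda>i. r \<odot>\<^bsub>M\<^esub> f i) (r \<odot>\<^bsub>M\<^esub> a)" if f: "dec f a" and r: "r \<in> carrier R" for f a r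
  proof -
    obtain I where I: "finite I" "\<And>i. i \<notin> I \<Longrightarrow> f i = \<zero>\<^bsub>M\<^esub>" using dec_fin[OF f] by blast
    have "r \<odot>\<^bsub>M\<^esub> finsum M f I = finsum M (\<lambda>i. r \<odot>\<^bsub>M\<^esub> f i) I"
      using I(1)
    proof (induction I)
      case (insert j J)
      then show ?case using r dec_M[OF f] by (simp add: M.finsum_insert Pi_def smult_r_distr M.finsum_closed)
    qed (use r in simp)
    then have "r \<odot>\<^bsub>M\<^esub> a = finsum M (\<lambda>i. r \<odot>\<^bsub>M\<^esub> f i) I" using dec_J[OF f I] by simp
    then show ?thesis unfolding dec_def using I f Gr r
      by (intro conjI allI exI[of _ I]) (auto simp: dec_def)
  qed
  have dec_zero: "f i = \<zero>\<^bsub>M\<^esub>" if f: "dec f \<zero>\<^bsub>M\<^esub>" for f i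
  proof -
    obtain I where I: "finite I" "\<And>i. i \<notin> I \<Longrightarrow> f i = \<zero>\<^bsub>M\<^esub>" using dec_fin[OF f] by blast
    have "\<forall>i\<in>I. f i = \<zero>\<^bsub>M\<^esub>" by (rule ind) (use I dec_J[OF f I] f in \<open>auto simp: dec_def\<close>)
    then show ?thesis using I by blast
  qed
  have dec_unique: "f = g" if f: "dec f a" and g: "dec g a" and a: "a \<in> carrier M" for f g a
  proof
    fix i
    \<comment> \<open>The difference of the two decompositions is a decomposition of zero; the sign
      is written as the scalar -1 in order to reuse \<open>dec_smult\<close>.\<close>
    have "dec (\<lambda>i. f i \<oplus>\<^bsub>M\<^esub> (\<ominus>\<^bsub>R\<^esub> \<one>\<^bsub>R\<^esub>) \<odot>\<^bsub>M\<^esub> g i) (a \<oplus>\<^bsub>M\<^esub> (\<ominus>\<^bsub>R\<^esub> \<one>\<^bsub>R\<^esub>) \<odot>\<^bsub>M\<^esub> a)"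
      using dec_add[OF f dec_smult[OF g]] by simp
    moreover have "a \<oplus>\<^bsub>M\<^esub> (\<ominus>\<^bsub>R\<^esub> \<one>\<^bsub>R\<^esub>) \<odot>\<^bsub>M\<^esub> a = \<zero>\<^bsub>M\<^esub>" using a by (simp add: smult_l_minus M.r_neg)
    ultimately have "f i \<oplus>\<^bsub>M\<^esub> (\<ominus>\<^bsub>R\<^esub> \<one>\<^bsub>R\<^esub>) \<odot>\<^bsub>M\<^esub> g i = \<zero>\<^bsub>M\<^esub>" using dec_zero by simp
    then have "f i \<oplus>\<^bsub>M\<^esub> \<ominus>\<^bsub>M\<^esub> g i = \<zero>\<^bsub>M\<^esub>" using dec_M[OF g, of i] by (simp add: smult_l_minus)
    then have "\<ominus>\<^bsub>M\<^esub> (\<ominus>\<^bsub>M\<^esub> g i) = f i" using dec_M[OF f, of i] dec_M[OF g, of i] by (intro M.minus_equality) auto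
    then show "f i = g i" using dec_M[OF g, of i] by simp
  qed
  have dec_ex: "\<exists>f. dec f a" if aM: "a \<in> carrier M" for a
  proof -
    obtain J f where J: "finite J" "\<forall>i\<in>J. f i \<in> G i" "a = finsum M f J" using gen[OF aM] by blast
    have "finsum M f J = finsum M (\<lambda>i. if i \<in> J then f i else \<zero>\<^bsub>M\<^esub>) J"
      by (rule M.add.finprod_cong') (use J Gs in auto)
    then have "dec (\<lambda>i. if i \<in> J then f i else \<zero>\<^bsub>M\<^esub>) a"
      unfolding dec_def using J G0 by (intro conjI allI exI[of _ J]) auto
    then show ?thesis by blast
  qed
  define P where "P i a = (THE f. dec f a) i" for i a
  have dec_P: "dec (\<lambda>i. P i a) a" if a: "a \<in> carrier M" for a
  proof -
    obtain f where "dec f a" using dec_ex[OF a] by blast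
    then have "dec (THE f. dec f a) a" by (rule theI[of "\<lambda>f. dec f a"]) (use dec_unique a \<open>dec f a\<close> in blast)
    then show ?thesis unfolding P_def .
  qed
  have P_eq: "P i a = f i" if "dec f a" "a \<in> carrier M" for f a i
    using dec_unique[OF dec_P[OF that(2)] that] by metis
  have dec_hom: "dec (\<lambda>i. if i = j then a else \<zero>\<^bsub>M\<^esub>) a" if "a \<in> G j" for a j
    unfolding dec_def using that G0 Gs[OF that]
    by (intro conjI allI exI[of _ "{j}"]) auto
  have PG: "P i a \<in> G i" if "a \<in> carrier M" for a i using dec_P[OF that] unfolding dec_def by blast
  have Pc: "P i a \<in> carrier M" if "a \<in> carrier M" for a i using PG[OF that] Gs by blast
  have P_hom: "P i a = (if i = j then a else \<zero>\<^bsub>M\<^esub>)" if "a \<in> G j" for a i j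
    using P_eq[OF dec_hom[OF that] Gs[OF that]] by simp
  show ?thesis
  proof (intro exI[of _ P] conjI ballI allI)
    fix i x y assume xy: "x \<in> carrier M" "y \<in> carrier M"
    show "P i (x \<oplus>\<^bsub>M\<^esub> y) = P i x \<oplus>\<^bsub>M\<^esub> P i y"
      using P_eq[OF dec_add[OF dec_P[OF xy(1)] dec_P[OF xy(2)]]] xy by simp
  next
    fix i r x assume rx: "r \<in> carrier R" "x \<in> carrier M"
    show "P i (r \<odot>\<^bsub>M\<^esub> x) = r \<odot>\<^bsub>M\<^esub> P i x"
      using P_eq[OF dec_smult[OF dec_P[OF rx(2)] rx(1)]] rx by simp
  next
    fix i j x assume "x \<in> carrier M"
    then show "P i (P j x) = (if i = j then P j x else \<zero>\<^bsub>M\<^esub>)" using P_hom[OF PG] by blast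
  next
    fix i
    show "G i = {x \<in> carrier M. P i x = x}"
    proof (intro equalityI subsetI)
      fix x assume x: "x \<in> G i"
      then show "x \<in> {x \<in> carrier M. P i x = x}" using P_hom[OF x, of i] Gs[OF x] by simp
    next
      fix x assume "x \<in> {x \<in> carrier M. P i x = x}"
      then show "x \<in> G i" using PG[of x i] by simp
    qed
  next
    fix x assume "x \<in> carrier M"
    then obtain J f where J: "finite J" "\<forall>i\<in>J. f i \<in> G i" "x = finsum M f J" using gen by blast
    have "\<exists>xs. set xs \<subseteq> (\<Union>i. G i) \<and> finsum M f J = foldr (\<oplus>\<^bsub>M\<^esub>) xs \<zero>\<^bsub>M\<^esub>" using J(1,2)
    proof (induction J)
      case empty
      then show ?case by (intro exI[of _ "[]"]) simp
    next
      case (insert j J)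
      then obtain xs where xs: "set xs \<subseteq> (\<Union>i. G i)" "finsum M f J = foldr (\<oplus>\<^bsub>M\<^esub>) xs \<zero>\<^bsub>M\<^esub>" by auto
      have "finsum M f (insert j J) = f j \<oplus>\<^bsub>M\<^esub> finsum M f J" using insert Gs by (intro M.finsum_insert) auto
      then show ?case using xs insert by (intro exI[of _ "f j # xs"]) auto
    qed
    then show "\<exists>xs. set xs \<subseteq> (\<Union>i. G i) \<and> x = foldr (\<oplus>\<^bsub>M\<^esub>) xs \<zero>\<^bsub>M\<^esub>" unfolding J(3) .
  qed (use Pc in auto)
qed

section \<open>Families at a rational point\<close>

text \<open>An element outside a prime ideal is nonzero, hence can be cancelled in a field, and the
  auxiliary factor in the equality of fractions disappears.\<close>

lemma frac_field:
  assumes K: "field K" and P: "primeideal P K" and "a \<in> carrier K" "s \<in> carrier K"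
  shows "frac K P a s = {(b, t). b \<in> carrier K \<and> t \<in> carrier K - P \<and> t \<otimes>\<^bsub>K\<^esub> a = s \<otimes>\<^bsub>K\<^esub> b}"
proof -
  interpret K: field K by fact
  interpret P: primeideal P K by fact
  have "(\<exists>u\<in>carrier K - P. u \<otimes>\<^bsub>K\<^esub> (t \<otimes>\<^bsub>K\<^esub> a) = u \<otimes>\<^bsub>K\<^esub> (s \<otimes>\<^bsub>K\<^esub> b)) \<longleftrightarrow> t \<otimes>\<^bsub>K\<^esub> a = s \<otimes>\<^bsub>K\<^esub> b"
    if "b \<in> carrier K" "t \<in> carrier K" for b t
  proof
    assume "\<exists>u\<in>carrier K - P. u \<otimes>\<^bsub>K\<^esub> (t \<otimes>\<^bsub>K\<^esub> a) = u \<otimes>\<^bsub>K\<^esub> (s \<otimes>\<^bsub>K\<^esub> b)"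
    then obtain u where u: "u \<in> carrier K" "u \<notin> P" "u \<otimes>\<^bsub>K\<^esub> (t \<otimes>\<^bsub>K\<^esub> a) = u \<otimes>\<^bsub>K\<^esub> (s \<otimes>\<^bsub>K\<^esub> b)" by blast
    have "u \<noteq> \<zero>\<^bsub>K\<^esub>" using u(2) P.zero_closed by blast
    then show "t \<otimes>\<^bsub>K\<^esub> a = s \<otimes>\<^bsub>K\<^esub> b" using u that assms K.m_lcancel by simp
  next
    assume e: "t \<otimes>\<^bsub>K\<^esub> a = s \<otimes>\<^bsub>K\<^esub> b"
    have "\<one>\<^bsub>K\<^esub> \<notin> P" using P.I_notcarr P.one_imp_carrier by metis
    then show "\<exists>u\<in>carrier K - P. u \<otimes>\<^bsub>K\<^esub> (t \<otimes>\<^bsub>K\<^esub> a) = u \<otimes>\<^bsub>K\<^esub> (s \<otimes>\<^bsub>K\<^esub> b)"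
      using e by (intro bexI[of _ "\<one>\<^bsub>K\<^esub>"]) auto
  qed
  then show ?thesis unfolding frac_def by auto
qed

text \<open>The pairs in the class of \<open>c/1\<close> are exactly the \<open>(s c, s)\<close>
  with \<open>s\<close> outside \<open>P\<close>. Products and sums of such pairs have numerator
  \<open>s t\<close> times the expected constant, and the nonzero factor \<open>s t\<close>
  cancels.\<close>

lemma frac_const_ops:
  assumes K: "field K" and P: "primeideal P K" and cd: "c \<in> carrier K" "d \<in> carrier K"
  shows "frac_mult K P (frac K P c \<one>\<^bsub>K\<^esub>) (frac K P d \<one>\<^bsub>K\<^esub>) = frac K P (c \<otimes>\<^bsub>K\<^esub> d) \<one>\<^bsub>K\<^esub>"
    and "frac_add K P (frac K P c \<one>\<^bsub>K\<^esub>) (frac K P d \<one>\<^bsub>K\<^esub>) = frac K P (c \<oplus>\<^bsub>K\<^esub> d) \<one>\<^bsub>K\<^esub>"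
proof -
  interpret K: field K by fact
  interpret P: primeideal P K by fact
  have one: "\<one>\<^bsub>K\<^esub> \<notin> P" using P.I_notcarr P.one_imp_carrier by metis
  note fr = frac_field[OF K P]
  have el: "(a, s) \<in> frac K P c \<one>\<^bsub>K\<^esub> \<longleftrightarrow> s \<in> carrier K - P \<and> a = s \<otimes>\<^bsub>K\<^esub> c" if "c \<in> carrier K" for a s c
    using that by (auto simp: fr)
  have same: "frac K P (q \<otimes>\<^bsub>K\<^esub> a) q = frac K P a \<one>\<^bsub>K\<^esub>" if "a \<in> carrier K" "q \<in> carrier K" "q \<noteq> \<zero>\<^bsub>K\<^esub>" for a q
  proof -
    have "t \<otimes>\<^bsub>K\<^esub> (q \<otimes>\<^bsub>K\<^esub> a) = q \<otimes>\<^bsub>K\<^esub> b \<longleftrightarrow> t \<otimes>\<^bsub>K\<^esub> a = b" if "t \<in> carrier K" "b \<in> carrier K" for t b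
      using that \<open>a \<in> carrier K\<close> \<open>q \<in> carrier K\<close> \<open>q \<noteq> \<zero>\<^bsub>K\<^esub>\<close> K.m_lcancel[of q "t \<otimes>\<^bsub>K\<^esub> a" b] by (simp add: K.m_lcomm)
    then show ?thesis using that by (auto simp: fr)
  qed
  have nz: "s \<otimes>\<^bsub>K\<^esub> t \<in> carrier K" "s \<otimes>\<^bsub>K\<^esub> t \<noteq> \<zero>\<^bsub>K\<^esub>" if "s \<in> carrier K - P" "t \<in> carrier K - P" for s t
    using that P.zero_closed K.integral[of s t] by auto
  have ne: "(c, \<one>\<^bsub>K\<^esub>) \<in> frac K P c \<one>\<^bsub>K\<^esub>" if "c \<in> carrier K" for c using that one by (simp add: el)
  have m: "frac K P (a \<otimes>\<^bsub>K\<^esub> b) (s \<otimes>\<^bsub>K\<^esub> t) = frac K P (c \<otimes>\<^bsub>K\<^esub> d) \<one>\<^bsub>K\<^esub>"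
    if "(a, s) \<in> frac K P c \<one>\<^bsub>K\<^esub>" "(b, t) \<in> frac K P d \<one>\<^bsub>K\<^esub>" for a b s t
  proof -
    have st: "s \<in> carrier K - P" "a = s \<otimes>\<^bsub>K\<^esub> c" "t \<in> carrier K - P" "b = t \<otimes>\<^bsub>K\<^esub> d" using that cd by (simp_all add: el)
    then have "a \<otimes>\<^bsub>K\<^esub> b = (s \<otimes>\<^bsub>K\<^esub> t) \<otimes>\<^bsub>K\<^esub> (c \<otimes>\<^bsub>K\<^esub> d)" using cd by (simp add: K.m_ac)
    then show ?thesis using same[OF _ nz[OF st(1,3)]] cd by simp
  qed
  have a: "frac K P ((t \<otimes>\<^bsub>K\<^esub> a) \<oplus>\<^bsub>K\<^esub> (s \<otimes>\<^bsub>K\<^esub> b)) (s \<otimes>\<^bsub>K\<^esub> t) = frac K P (c \<oplus>\<^bsub>K\<^esub> d) \<one>\<^bsub>K\<^esub>"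
    if "(a, s) \<in> frac K P c \<one>\<^bsub>K\<^esub>" "(b, t) \<in> frac K P d \<one>\<^bsub>K\<^esub>" for a b s t
  proof -
    have st: "s \<in> carrier K - P" "a = s \<otimes>\<^bsub>K\<^esub> c" "t \<in> carrier K - P" "b = t \<otimes>\<^bsub>K\<^esub> d" using that cd by (simp_all add: el)
    then have "(t \<otimes>\<^bsub>K\<^esub> a) \<oplus>\<^bsub>K\<^esub> (s \<otimes>\<^bsub>K\<^esub> b) = (s \<otimes>\<^bsub>K\<^esub> t) \<otimes>\<^bsub>K\<^esub> (c \<oplus>\<^bsub>K\<^esub> d)" using cd by (simp add: K.m_ac K.r_distr)
    then show ?thesis using same[OF _ nz[OF st(1,3)]] cd by simp
  qed
  have "frac_mult K P (frac K P c \<one>\<^bsub>K\<^esub>) (frac K P d \<one>\<^bsub>K\<^esub>) =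
    (\<lambda>((a, s), (b, t)). frac K P (a \<otimes>\<^bsub>K\<^esub> b) (s \<otimes>\<^bsub>K\<^esub> t)) ((c, \<one>\<^bsub>K\<^esub>), (d, \<one>\<^bsub>K\<^esub>))"
    unfolding frac_mult_def
    by (rule the_elem_const) (use ne cd m in auto)
  then show "frac_mult K P (frac K P c \<one>\<^bsub>K\<^esub>) (frac K P d \<one>\<^bsub>K\<^esub>) = frac K P (c \<otimes>\<^bsub>K\<^esub> d) \<one>\<^bsub>K\<^esub>" by simp
  have "frac_add K P (frac K P c \<one>\<^bsub>K\<^esub>) (frac K P d \<one>\<^bsub>K\<^esub>) =
    (\<lambda>((a, s), (b, t)). frac K P ((t \<otimes>\<^bsub>K\<^esub> a) \<oplus>\<^bsub>K\<^esub> (s \<otimes>\<^bsub>K\<^esub> b)) (s \<otimes>\<^bsub>K\<^esub> t)) ((c, \<one>\<^bsub>K\<^esub>), (d, \<one>\<^bsub>K\<^esub>))"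
    unfolding frac_add_def
    by (rule the_elem_const) (use ne cd a in auto)
  then show "frac_add K P (frac K P c \<one>\<^bsub>K\<^esub>) (frac K P d \<one>\<^bsub>K\<^esub>) = frac K P (c \<oplus>\<^bsub>K\<^esub> d) \<one>\<^bsub>K\<^esub>" using cd by simp
qed

definition const_section where
  "const_section K c = (\<lambda>P\<in>topspace (Top (Spec K)). frac K P c \<one>\<^bsub>K\<^esub>)"

lemma const_section_hom:
  assumes "field K"
  shows "const_section K \<in> ring_hom K (Sec (Spec K) (topspace (Top (Spec K))))"
proof -
  interpret K: field K by fact
  have pr: "primeideal P K" if "P \<in> topspace (Top (Spec K))" for P
    using that by (auto simp: Spec_def zariski_topology_def)
  have one: "\<one>\<^bsub>K\<^esub> \<notin> P" if "P \<in> topspace (Top (Spec K))" for P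
  proof -
    interpret primeideal P K using that by (rule pr)
    show ?thesis using I_notcarr one_imp_carrier by metis
  qed
  have Z: "zariski_topology K = Top (Spec K)" by (simp add: Spec_def)
  show ?thesis
  proof (rule ring_hom_memI)
    fix c assume c: "c \<in> carrier K"
    have "\<exists>V a s. openin (Top (Spec K)) V \<and> P \<in> V \<and> V \<subseteq> topspace (Top (Spec K)) \<and> a \<in> carrier K \<and> s \<in> carrier K \<and>
        (\<forall>Q\<in>V. s \<notin> Q \<and> const_section K c Q = frac K Q a s)" if "P \<in> topspace (Top (Spec K))" for P
      by (rule exI[of _ "topspace (Top (Spec K))"], rule exI[of _ c], rule exI[of _ "\<one>\<^bsub>K\<^esub>"])
        (use that c one in \<open>auto simp: const_section_def\<close>)
    then show "const_section K c \<in> carrier (Sec (Spec K) (topspace (Top (Spec K))))"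
      unfolding Spec_def[of K] by (simp add: Z const_section_def[of K c])
  next
    fix c d assume cd: "c \<in> carrier K" "d \<in> carrier K"
    let ?X = "topspace (Top (Spec K))"
    have "\<sigma> \<otimes>\<^bsub>Sec (Spec K) ?X\<^esub> \<tau> = (\<lambda>P\<in>?X. frac_mult K P (\<sigma> P) (\<tau> P))"
      "\<sigma> \<oplus>\<^bsub>Sec (Spec K) ?X\<^esub> \<tau> = (\<lambda>P\<in>?X. frac_add K P (\<sigma> P) (\<tau> P))" for \<sigma> \<tau>
      by (simp_all add: Spec_def)
    then show "const_section K (c \<otimes>\<^bsub>K\<^esub> d) = const_section K c \<otimes>\<^bsub>Sec (Spec K) ?X\<^esub> const_section K d"
      "const_section K (c \<oplus>\<^bsub>K\<^esub> d) = const_section K c \<oplus>\<^bsub>Sec (Spec K) ?X\<^esub> const_section K d"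
      using frac_const_ops[OF assms pr cd] by (simp_all add: const_section_def cong: restrict_cong)
  next
    show "const_section K \<one>\<^bsub>K\<^esub> = \<one>\<^bsub>Sec (Spec K) (topspace (Top (Spec K)))\<^esub>"
      unfolding const_section_def by (simp add: Spec_def)
  qed
qed

section \<open>The stalk of a family as a graded algebra over the local ring\<close>

locale family_at =
  fixes K :: "'k ring" and S :: "('k, 'x, 'r) scheme_over" and A :: "('x, 'r, 'a) algebra_sheaf" and p :: 'x
  assumes field: "field K"
    and scheme: "is_scheme_over K S"
    and K_point: "closed_K_point K S p"
    and family: "flat_family S A"
begin

abbreviation "R \<equiv> stalk_ring S p"
abbreviation "M \<equiv> stalk_algebra S A p"
abbreviation "m \<equiv> max_ideal R"
abbreviation "\<iota> \<equiv> const_germ K S p"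
abbreviation "val \<equiv> value_at K S p"

lemma p_top: "p \<in> topspace (Top S)" using K_point by (simp add: closed_K_point_def)

lemma ringed: "is_ringed_space S" and local_R: "local_ring R"
  using scheme p_top by (simp_all add: is_scheme_over_def is_scheme_def is_locally_ringed_space_def)

lemma Sec_cring: "openin (Top S) U \<Longrightarrow> cring (Sec S U)"
  using ringed by (simp add: is_ringed_space_def)

sublocale G: presheaf_at "Top S" "Sec S" "Res S" p
proof (rule presheaf_at.intro)
  show "p \<in> topspace (Top S)" by (rule p_top)
  show "openin (Top S) U \<Longrightarrow> Ring.ring (Sec S U)" for U using Sec_cring cring.axioms(1) by blast
qed (use ringed in \<open>simp_all add: is_ringed_space_def sheaf_on_def\<close>)

lemma graded: "is_graded_algebra_sheaf S A"
  and flat_stalk: "flat_module R M"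
  using family p_top by (simp_all add: flat_family_def)

lemmas graded_conj = graded[unfolded is_graded_algebra_sheaf_def]
lemmas alg = graded_conj[THEN conjunct1]
  and graded_res = graded_conj[THEN conjunct2, THEN conjunct1]
  and alg_sheaf = graded_conj[THEN conjunct2, THEN conjunct2, THEN conjunct1]
  and grade_sheaf = graded_conj[THEN conjunct2, THEN conjunct2, THEN conjunct2, THEN conjunct1]
  and grade_alg = graded_conj[THEN conjunct2, THEN conjunct2, THEN conjunct2, THEN conjunct2, THEN conjunct1]
  and grade_indep = graded_conj[THEN conjunct2, THEN conjunct2, THEN conjunct2, THEN conjunct2, THEN conjunct2, THEN conjunct1]
  and grade_sum = graded_conj[THEN conjunct2, THEN conjunct2, THEN conjunct2, THEN conjunct2, THEN conjunct2, THEN conjunct2]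

sublocale GA: presheaf_at "Top S" "ASec A" "ARes A" p
proof (rule presheaf_at.intro)
  show "p \<in> topspace (Top S)" by (rule p_top)
  show "openin (Top S) U \<Longrightarrow> Ring.ring (ASec A U)" for U using alg by (simp add: assoc_algebra_def)
  show "openin (Top S) U \<Longrightarrow> openin (Top S) V \<Longrightarrow> V \<subseteq> U \<Longrightarrow> ARes A U V \<in> ring_hom (ASec A U) (ASec A V)" for U V
    using graded_res by simp
  show "openin (Top S) U \<Longrightarrow> s \<in> carrier (ASec A U) \<Longrightarrow> ARes A U U s = s" for U s
    using alg_sheaf by (simp add: sheaf_on_def)
  show "openin (Top S) U \<Longrightarrow> openin (Top S) V \<Longrightarrow> openin (Top S) W \<Longrightarrow> V \<subseteq> U \<Longrightarrow> W \<subseteq> V \<Longrightarrow>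
      s \<in> carrier (ASec A U) \<Longrightarrow> ARes A V W (ARes A U V s) = ARes A U W s" for U V W s
    using alg_sheaf by (simp add: sheaf_on_def)
qed

abbreviation nb where "nb \<equiv> G.nb"

lemma nb_open: "nb U \<Longrightarrow> openin (Top S) U" by (simp add: G.nb_def)

lemma Res_smult: "nb U \<Longrightarrow> nb V \<Longrightarrow> V \<subseteq> U \<Longrightarrow> r \<in> carrier (Sec S U) \<Longrightarrow> a \<in> carrier (ASec A U) \<Longrightarrow>
    ARes A U V (r \<odot>\<^bsub>ASec A U\<^esub> a) = Res S U V r \<odot>\<^bsub>ASec A V\<^esub> ARes A U V a"
  using graded_res by (simp add: G.nb_def)

lemma alg_module: "nb U \<Longrightarrow> module (Sec S U) (ASec A U)"
  using alg by (simp add: assoc_algebra_def nb_open)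

lemma R_carrier: "carrier R = germs (Top S) (Sec S) (Res S) p (\<lambda>U. carrier (Sec S U))"
  by (simp add: stalk_ring_def)
lemma M_carrier: "carrier M = germs (Top S) (ASec A) (ARes A) p (\<lambda>U. carrier (ASec A U))"
  by (simp add: stalk_algebra_def)
lemma M_grade: "grade M i = germs (Top S) (ASec A) (ARes A) p (\<lambda>U. grade (ASec A U) i)"
  by (simp add: stalk_algebra_def)

lemma R_in: "nb U \<Longrightarrow> s \<in> carrier (Sec S U) \<Longrightarrow> G.gm U s \<in> carrier R"
  unfolding R_carrier by (rule G.germsI)
lemma M_in: "nb U \<Longrightarrow> s \<in> carrier (ASec A U) \<Longrightarrow> GA.gm U s \<in> carrier M"
  unfolding M_carrier by (rule GA.germsI)

lemma R_add: "nb U \<Longrightarrow> s \<in> carrier (Sec S U) \<Longrightarrow> t \<in> carrier (Sec S U) \<Longrightarrow> G.gm U s \<oplus>\<^bsub>R\<^esub> G.gm U t = G.gm U (s \<oplus>\<^bsub>Sec S U\<^esub> t)"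
  using G.lift_add by (simp add: stalk_ring_def)
lemma R_mult: "nb U \<Longrightarrow> s \<in> carrier (Sec S U) \<Longrightarrow> t \<in> carrier (Sec S U) \<Longrightarrow> G.gm U s \<otimes>\<^bsub>R\<^esub> G.gm U t = G.gm U (s \<otimes>\<^bsub>Sec S U\<^esub> t)"
  using G.lift_mult by (simp add: stalk_ring_def)
lemma R_one: "nb U \<Longrightarrow> \<one>\<^bsub>R\<^esub> = G.gm U \<one>\<^bsub>Sec S U\<^esub>"
  using G.gm_one by (simp add: stalk_ring_def)
lemma M_add: "nb U \<Longrightarrow> s \<in> carrier (ASec A U) \<Longrightarrow> t \<in> carrier (ASec A U) \<Longrightarrow> GA.gm U s \<oplus>\<^bsub>M\<^esub> GA.gm U t = GA.gm U (s \<oplus>\<^bsub>ASec A U\<^esub> t)"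
  using GA.lift_add by (simp add: stalk_algebra_def)
lemma M_mult: "nb U \<Longrightarrow> s \<in> carrier (ASec A U) \<Longrightarrow> t \<in> carrier (ASec A U) \<Longrightarrow> GA.gm U s \<otimes>\<^bsub>M\<^esub> GA.gm U t = GA.gm U (s \<otimes>\<^bsub>ASec A U\<^esub> t)"
  using GA.lift_mult by (simp add: stalk_algebra_def)
lemma M_one: "nb U \<Longrightarrow> \<one>\<^bsub>M\<^esub> = GA.gm U \<one>\<^bsub>ASec A U\<^esub>"
  using GA.gm_one by (simp add: stalk_algebra_def)
lemma M_zero: "nb U \<Longrightarrow> \<zero>\<^bsub>M\<^esub> = GA.gm U \<zero>\<^bsub>ASec A U\<^esub>"
  using GA.gm_zero by (simp add: stalk_algebra_def)

lemma M_smult: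
  assumes "nb U" "r \<in> carrier (Sec S U)" "a \<in> carrier (ASec A U)"
  shows "G.gm U r \<odot>\<^bsub>M\<^esub> GA.gm U a = GA.gm U (r \<odot>\<^bsub>ASec A U\<^esub> a)"
proof -
  have "germ_lift (Top S) (ASec A) (ARes A) p (Res S) (\<lambda>U. smult (ASec A U)) (G.gm U r) (GA.gm U a) =
     GA.gm U (r \<odot>\<^bsub>ASec A U\<^esub> a)"
    by (rule GA.germ_lift_gm[OF G.presheaf_at_axioms])
      (use assms in \<open>auto simp: Res_smult intro: module.smult_closed[OF alg_module]\<close>)
  then show ?thesis by (simp add: stalk_algebra_def)
qed

lemma R_rep: "r \<in> carrier R \<Longrightarrow> \<exists>U. nb U \<and> (\<exists>s\<in>carrier (Sec S U). r = G.gm U s)"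
  unfolding R_carrier by (elim G.germsE) blast

lemma M_rep: "a \<in> carrier M \<Longrightarrow> \<exists>U. nb U \<and> (\<exists>s\<in>carrier (ASec A U). a = GA.gm U s)"
  unfolding M_carrier by (elim GA.germsE) blast

lemma grade_rep: "a \<in> grade M i \<Longrightarrow> \<exists>U. nb U \<and> (\<exists>s\<in>grade (ASec A U) i. a = GA.gm U s)"
  unfolding M_grade by (elim GA.germsE) blast

lemma common_reps:
  assumes "finite X1" "X1 \<subseteq> carrier R" "finite X2" "X2 \<subseteq> carrier M"
  shows "\<exists>U. nb U \<and> (\<forall>r\<in>X1. \<exists>s\<in>carrier (Sec S U). r = G.gm U s) \<and> (\<forall>a\<in>X2. \<exists>s\<in>carrier (ASec A U). a = GA.gm U s)"
proof -
  have sh1: "\<exists>s\<in>carrier (Sec S V). r = G.gm V s"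
    if "\<exists>s\<in>carrier (Sec S U). r = G.gm U s" "nb U" "nb V" "V \<subseteq> U" for r U V
    using that G.gm_res[of U V] G.res_closed[of U V] by metis
  have sh2: "\<exists>s\<in>carrier (ASec A V). r = GA.gm V s"
    if "\<exists>s\<in>carrier (ASec A U). r = GA.gm U s" "nb U" "nb V" "V \<subseteq> U" for r U V
    using that GA.gm_res[of U V] GA.res_closed[of U V] by metis
  have "\<exists>U. nb U \<and> (\<forall>r\<in>X1. \<exists>s\<in>carrier (Sec S U). r = G.gm U s)"
    by (rule G.common_nb[OF assms(1) _ sh1]) (use assms(2) R_rep in blast)
  then obtain U where U: "nb U" "\<forall>r\<in>X1. \<exists>s\<in>carrier (Sec S U). r = G.gm U s" by blast
  have "\<exists>U. nb U \<and> (\<forall>r\<in>X2. \<exists>s\<in>carrier (ASec A U). r = GA.gm U s)"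
    by (rule G.common_nb[OF assms(3) _ sh2]) (use assms(4) M_rep in blast)
  then obtain V where V: "nb V" "\<forall>r\<in>X2. \<exists>s\<in>carrier (ASec A V). r = GA.gm V s" by blast
  have n: "nb (U \<inter> V)" using U V G.nb_Int by blast
  show ?thesis
    using n sh1[of U _ "U \<inter> V"] sh2[of V _ "U \<inter> V"] U V by (intro exI[of _ "U \<inter> V"]) auto
qed

text \<open>Two scalars and three sections over one neighbourhood are enough for every ring and
  module axiom of the stalk; axioms with fewer variables repeat an argument.\<close>

lemma reps:
  assumes "r \<in> carrier R" "s \<in> carrier R" "a \<in> carrier M" "b \<in> carrier M" "c \<in> carrier M"
  obtains U r' s' a' b' c' where "nb U" "r' \<in> carrier (Sec S U)" "s' \<in> carrier (Sec S U)"
    "a' \<in> carrier (ASec A U)" "b' \<in> carrier (ASec A U)" "c' \<in> carrier (ASec A U)"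
    "r = G.gm U r'" "s = G.gm U s'" "a = GA.gm U a'" "b = GA.gm U b'" "c = GA.gm U c'"
proof -
  have "\<exists>U. nb U \<and> (\<forall>r\<in>{r, s}. \<exists>s\<in>carrier (Sec S U). r = G.gm U s) \<and> (\<forall>a\<in>{a, b, c}. \<exists>s\<in>carrier (ASec A U). a = GA.gm U s)"
    by (rule common_reps) (use assms in auto)
  then show thesis using that by (elim exE conjE) (simp only: ball_simps, blast)
qed

lemma R_cring: "cring R" using local_R by (simp add: local_ring_def)

lemma M_abelian: "abelian_group M"
proof -
  interpret R: cring R by (rule R_cring)
  note r1 = R.one_closed
  show ?thesis
  proof (rule abelian_groupI)
    show "\<zero>\<^bsub>M\<^esub> \<in> carrier M" unfolding M_zero[OF G.nb_top] by (intro M_in G.nb_top ring.ring_simprules(2) GA.nb_ring)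
  next
    fix a b assume "a \<in> carrier M" "b \<in> carrier M"
    from reps[OF r1 r1 this this(2)] obtain U a' b' where U: "nb U" "a' \<in> carrier (ASec A U)" "b' \<in> carrier (ASec A U)"
      "a = GA.gm U a'" "b = GA.gm U b'" by metis
    interpret ring "ASec A U" using U(1) by (rule GA.nb_ring)
    show "a \<oplus>\<^bsub>M\<^esub> b \<in> carrier M" "a \<oplus>\<^bsub>M\<^esub> b = b \<oplus>\<^bsub>M\<^esub> a" using U by (simp_all add: M_add M_in a_comm)
  next
    fix a b c assume "a \<in> carrier M" "b \<in> carrier M" "c \<in> carrier M"
    from reps[OF r1 r1 this] obtain U a' b' c' where U: "nb U" "a' \<in> carrier (ASec A U)" "b' \<in> carrier (ASec A U)" "c' \<in> carrier (ASec A U)"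
      "a = GA.gm U a'" "b = GA.gm U b'" "c = GA.gm U c'" by metis
    interpret ring "ASec A U" using U(1) by (rule GA.nb_ring)
    show "a \<oplus>\<^bsub>M\<^esub> b \<oplus>\<^bsub>M\<^esub> c = a \<oplus>\<^bsub>M\<^esub> (b \<oplus>\<^bsub>M\<^esub> c)" using U by (simp add: M_add a_assoc)
  next
    fix a assume "a \<in> carrier M"
    from reps[OF r1 r1 this this this] obtain U a' where U: "nb U" "a' \<in> carrier (ASec A U)" "a = GA.gm U a'" by metis
    interpret ring "ASec A U" using U(1) by (rule GA.nb_ring)
    show "\<zero>\<^bsub>M\<^esub> \<oplus>\<^bsub>M\<^esub> a = a" using U by (simp add: M_zero[OF U(1)] M_add)
    show "\<exists>b\<in>carrier M. b \<oplus>\<^bsub>M\<^esub> a = \<zero>\<^bsub>M\<^esub>"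
      by (rule bexI[of _ "GA.gm U (\<ominus>\<^bsub>ASec A U\<^esub> a')"]) (use U in \<open>simp_all add: M_zero[OF U(1)] M_add M_in l_neg\<close>)
  qed
qed

lemma M_ring: "Ring.ring M"
proof -
  interpret R: cring R by (rule R_cring)
  note r1 = R.one_closed
  have rep3: "\<exists>U a' b' c'. nb U \<and> a' \<in> carrier (ASec A U) \<and> b' \<in> carrier (ASec A U) \<and> c' \<in> carrier (ASec A U) \<and>
      a = GA.gm U a' \<and> b = GA.gm U b' \<and> c = GA.gm U c'" if "a \<in> carrier M" "b \<in> carrier M" "c \<in> carrier M" for a b c
    using reps[OF r1 r1 that] by metis
  show ?thesis
  proof (rule ringI[OF M_abelian monoidI])
    show one: "\<one>\<^bsub>M\<^esub> \<in> carrier M" unfolding M_one[OF G.nb_top] by (intro M_in G.nb_top ring.ring_simprules(6) GA.nb_ring)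
  next
    fix a b assume "a \<in> carrier M" "b \<in> carrier M"
    from rep3[OF this this(2)] obtain U a' b' where U: "nb U" "a' \<in> carrier (ASec A U)" "b' \<in> carrier (ASec A U)"
      "a = GA.gm U a'" "b = GA.gm U b'" by blast
    interpret ring "ASec A U" using U(1) by (rule GA.nb_ring)
    show "a \<otimes>\<^bsub>M\<^esub> b \<in> carrier M" using U by (simp add: M_mult M_in)
  next
    fix a assume "a \<in> carrier M"
    from rep3[OF this this this] obtain U a' where U: "nb U" "a' \<in> carrier (ASec A U)" "a = GA.gm U a'" by blast
    interpret ring "ASec A U" using U(1) by (rule GA.nb_ring)
    show "\<one>\<^bsub>M\<^esub> \<otimes>\<^bsub>M\<^esub> a = a" "a \<otimes>\<^bsub>M\<^esub> \<one>\<^bsub>M\<^esub> = a" using U by (simp_all add: M_one[OF U(1)] M_mult)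
  next
    fix a b c assume "a \<in> carrier M" "b \<in> carrier M" "c \<in> carrier M"
    from rep3[OF this] obtain U a' b' c' where U: "nb U" "a' \<in> carrier (ASec A U)" "b' \<in> carrier (ASec A U)" "c' \<in> carrier (ASec A U)"
      "a = GA.gm U a'" "b = GA.gm U b'" "c = GA.gm U c'" by blast
    interpret ring "ASec A U" using U(1) by (rule GA.nb_ring)
    show "a \<otimes>\<^bsub>M\<^esub> b \<otimes>\<^bsub>M\<^esub> c = a \<otimes>\<^bsub>M\<^esub> (b \<otimes>\<^bsub>M\<^esub> c)" "(a \<oplus>\<^bsub>M\<^esub> b) \<otimes>\<^bsub>M\<^esub> c = a \<otimes>\<^bsub>M\<^esub> c \<oplus>\<^bsub>M\<^esub> b \<otimes>\<^bsub>M\<^esub> c"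
      "c \<otimes>\<^bsub>M\<^esub> (a \<oplus>\<^bsub>M\<^esub> b) = c \<otimes>\<^bsub>M\<^esub> a \<oplus>\<^bsub>M\<^esub> c \<otimes>\<^bsub>M\<^esub> b"
      using U by (simp_all add: M_add M_mult m_assoc l_distr r_distr)
  qed
qed

lemma M_module: "module R M"
  and M_smult_mult: "\<And>r x y. r \<in> carrier R \<Longrightarrow> x \<in> carrier M \<Longrightarrow> y \<in> carrier M \<Longrightarrow>
      (r \<odot>\<^bsub>M\<^esub> x) \<otimes>\<^bsub>M\<^esub> y = r \<odot>\<^bsub>M\<^esub> (x \<otimes>\<^bsub>M\<^esub> y)"
  and M_mult_smult: "\<And>r x y. r \<in> carrier R \<Longrightarrow> x \<in> carrier M \<Longrightarrow> y \<in> carrier M \<Longrightarrow>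
      x \<otimes>\<^bsub>M\<^esub> (r \<odot>\<^bsub>M\<^esub> y) = r \<odot>\<^bsub>M\<^esub> (x \<otimes>\<^bsub>M\<^esub> y)"
proof -
  interpret R: cring R by (rule R_cring)
  have rep4: "\<exists>U r' s' a' b'. nb U \<and> r' \<in> carrier (Sec S U) \<and> s' \<in> carrier (Sec S U) \<and> a' \<in> carrier (ASec A U) \<and> b' \<in> carrier (ASec A U) \<and>
      r = G.gm U r' \<and> s = G.gm U s' \<and> a = GA.gm U a' \<and> b = GA.gm U b'"
    if "r \<in> carrier R" "s \<in> carrier R" "a \<in> carrier M" "b \<in> carrier M" for r s a b
    using reps[OF that that(4)] by metis
  \<comment> \<open>All module and algebra laws are collected in one statement, so that
    representatives are chosen a single time and the laws are inherited from the sections over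
    \<open>U\<close>.\<close>
  have ax: "r \<odot>\<^bsub>M\<^esub> a \<in> carrier M \<and> (r \<oplus>\<^bsub>R\<^esub> s) \<odot>\<^bsub>M\<^esub> a = r \<odot>\<^bsub>M\<^esub> a \<oplus>\<^bsub>M\<^esub> s \<odot>\<^bsub>M\<^esub> a \<and>
    r \<odot>\<^bsub>M\<^esub> (a \<oplus>\<^bsub>M\<^esub> b) = r \<odot>\<^bsub>M\<^esub> a \<oplus>\<^bsub>M\<^esub> r \<odot>\<^bsub>M\<^esub> b \<and> (r \<otimes>\<^bsub>R\<^esub> s) \<odot>\<^bsub>M\<^esub> a = r \<odot>\<^bsub>M\<^esub> (s \<odot>\<^bsub>M\<^esub> a) \<and>
    \<one>\<^bsub>R\<^esub> \<odot>\<^bsub>M\<^esub> a = a \<and> (r \<odot>\<^bsub>M\<^esub> a) \<otimes>\<^bsub>M\<^esub> b = r \<odot>\<^bsub>M\<^esub> (a \<otimes>\<^bsub>M\<^esub> b) \<and> a \<otimes>\<^bsub>M\<^esub> (r \<odot>\<^bsub>M\<^esub> b) = r \<odot>\<^bsub>M\<^esub> (a \<otimes>\<^bsub>M\<^esub> b)"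
    if rsab: "r \<in> carrier R" "s \<in> carrier R" "a \<in> carrier M" "b \<in> carrier M" for r s a b
  proof -
    from rep4[OF rsab] obtain U r' s' a' b' where U: "nb U" "r' \<in> carrier (Sec S U)" "s' \<in> carrier (Sec S U)"
      "a' \<in> carrier (ASec A U)" "b' \<in> carrier (ASec A U)"
      and e: "r = G.gm U r'" "s = G.gm U s'" "a = GA.gm U a'" "b = GA.gm U b'" by blast
    interpret U: module "Sec S U" "ASec A U" using U(1) by (rule alg_module)
    interpret UR: ring "ASec A U" using U(1) by (rule GA.nb_ring)
    have al: "\<forall>r\<in>carrier (Sec S U). \<forall>x\<in>carrier (ASec A U). \<forall>y\<in>carrier (ASec A U).
        (r \<odot>\<^bsub>ASec A U\<^esub> x) \<otimes>\<^bsub>ASec A U\<^esub> y = r \<odot>\<^bsub>ASec A U\<^esub> (x \<otimes>\<^bsub>ASec A U\<^esub> y) \<and>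
        x \<otimes>\<^bsub>ASec A U\<^esub> (r \<odot>\<^bsub>ASec A U\<^esub> y) = r \<odot>\<^bsub>ASec A U\<^esub> (x \<otimes>\<^bsub>ASec A U\<^esub> y)"
      using alg nb_open[OF U(1)] unfolding assoc_algebra_def by simp
    show ?thesis unfolding e R_one[OF U(1)]
      using U al by (simp add: M_smult M_add M_mult R_add R_mult M_in U.smult_l_distr U.smult_r_distr U.smult_assoc1)
  qed
  note r1 = R.one_closed
  show "module R M"
  proof (rule moduleI[OF R_cring M_abelian])
    fix r x assume rx: "r \<in> carrier R" "x \<in> carrier M"
    show "r \<odot>\<^bsub>M\<^esub> x \<in> carrier M" using ax[OF rx(1,1,2,2)] by (elim conjE)
    fix s assume s: "s \<in> carrier R"
    show "(r \<oplus>\<^bsub>R\<^esub> s) \<odot>\<^bsub>M\<^esub> x = r \<odot>\<^bsub>M\<^esub> x \<oplus>\<^bsub>M\<^esub> s \<odot>\<^bsub>M\<^esub> x" "(r \<otimes>\<^bsub>R\<^esub> s) \<odot>\<^bsub>M\<^esub> x = r \<odot>\<^bsub>M\<^esub> (s \<odot>\<^bsub>M\<^esub> x)"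
      using ax[OF rx(1) s rx(2,2)] by (blast, blast)
  next
    fix r x y assume rx: "r \<in> carrier R" "x \<in> carrier M" "y \<in> carrier M"
    show "r \<odot>\<^bsub>M\<^esub> (x \<oplus>\<^bsub>M\<^esub> y) = r \<odot>\<^bsub>M\<^esub> x \<oplus>\<^bsub>M\<^esub> r \<odot>\<^bsub>M\<^esub> y" using ax[OF rx(1,1,2,3)] by (elim conjE)
  next
    fix x assume x: "x \<in> carrier M"
    show "\<one>\<^bsub>R\<^esub> \<odot>\<^bsub>M\<^esub> x = x" using ax[OF r1 r1 x x] by (elim conjE)
  qed
  show "(r \<odot>\<^bsub>M\<^esub> x) \<otimes>\<^bsub>M\<^esub> y = r \<odot>\<^bsub>M\<^esub> (x \<otimes>\<^bsub>M\<^esub> y)" "x \<otimes>\<^bsub>M\<^esub> (r \<odot>\<^bsub>M\<^esub> y) = r \<odot>\<^bsub>M\<^esub> (x \<otimes>\<^bsub>M\<^esub> y)"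
    if "r \<in> carrier R" "x \<in> carrier M" "y \<in> carrier M" for r x y
    using ax[OF that(1) r1 that(2,3)] by (blast, blast)
qed

lemma gr_sub: "nb U \<Longrightarrow> submodule (grade (ASec A U) i) (Sec S U) (ASec A U)"
  using grade_alg by (simp add: nb_open)

lemma gr_closed: "nb U \<Longrightarrow> s \<in> grade (ASec A U) i \<Longrightarrow> s \<in> carrier (ASec A U)"
  using module.submoduleE(1)[OF alg_module gr_sub] by blast

lemma gr_res: "nb U \<Longrightarrow> nb V \<Longrightarrow> V \<subseteq> U \<Longrightarrow> s \<in> grade (ASec A U) i \<Longrightarrow> ARes A U V s \<in> grade (ASec A V) i"
proof -
  assume a: "nb U" "nb V" "V \<subseteq> U" "s \<in> grade (ASec A U) i"
  have "ARes A U V \<in> grade (ASec A U) i \<rightarrow> grade (ASec A V) i"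
    using a grade_sheaf unfolding sheaf_on_def by (simp add: nb_open)
  then show ?thesis using a(4) by blast
qed

lemma M_gradeD: "a \<in> grade M i \<Longrightarrow> a \<in> carrier M"
  unfolding M_grade by (auto elim!: GA.germsE intro!: M_in gr_closed)

lemma common_grade_reps:
  assumes "finite J" "\<forall>i\<in>J. f i \<in> grade M i"
  shows "\<exists>U s. nb U \<and> (\<forall>i\<in>J. s i \<in> grade (ASec A U) i \<and> f i = GA.gm U (s i))"
proof -
  have "\<exists>U. nb U \<and> (\<forall>i\<in>J. \<exists>s\<in>grade (ASec A U) i. f i = GA.gm U s)"
  proof (rule G.common_nb[OF assms(1)])
    show "\<exists>U. nb U \<and> (\<exists>s\<in>grade (ASec A U) i. f i = GA.gm U s)" if "i \<in> J" for i
      using assms(2)[THEN bspec, OF that] by (rule grade_rep)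
    show "\<exists>s\<in>grade (ASec A V) i. f i = GA.gm V s"
      if "\<exists>s\<in>grade (ASec A U) i. f i = GA.gm U s" "nb U" "nb V" "V \<subseteq> U" for i U V
      using that GA.gm_res[of U V] gr_res[of U V] gr_closed[of U] by metis
  qed
  then obtain U where "nb U" "\<forall>i\<in>J. \<exists>s. s \<in> grade (ASec A U) i \<and> f i = GA.gm U s" by blast
  then show ?thesis using bchoice[of J "\<lambda>i s. s \<in> grade (ASec A U) i \<and> f i = GA.gm U s"] by blast
qed

lemma gm_finsum:
  assumes "nb U" "finite J" "\<forall>i\<in>J. s i \<in> carrier (ASec A U)"
  shows "GA.gm U (finsum (ASec A U) s J) = finsum M (\<lambda>i. GA.gm U (s i)) J"
proof -
  interpret M: abelian_group M by (rule M_abelian)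
  interpret U: ring "ASec A U" using assms(1) by (rule GA.nb_ring)
  show ?thesis using assms(2,3)
  proof (induction J)
    case empty
    then show ?case using M_zero[OF assms(1)] by simp
  next
    case (insert j J)
    then have c: "s \<in> J \<rightarrow> carrier (ASec A U)" "s j \<in> carrier (ASec A U)" by auto
    have "GA.gm U (finsum (ASec A U) s (insert j J)) = GA.gm U (s j) \<oplus>\<^bsub>M\<^esub> GA.gm U (finsum (ASec A U) s J)"
      by (simp only: U.finsum_insert[OF insert(1,2) c] M_add[OF assms(1) c(2) U.finsum_closed[OF c(1)]])
    then show ?case using insert c assms(1) by (simp add: M.finsum_insert Pi_def M_in)
  qed
qed

lemma M_grade_sub: "submodule (grade M i) R M"
proof -
  interpret module R M by (rule M_module)
  have two: "\<exists>U s t. nb U \<and> s \<in> grade (ASec A U) i \<and> t \<in> grade (ASec A U) i \<and> a = GA.gm U s \<and> b = GA.gm U t"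
    if "a \<in> grade M i" "b \<in> grade M i" for a b
  proof -
    obtain U s V t where "nb U" "s \<in> grade (ASec A U) i" "a = GA.gm U s" "nb V" "t \<in> grade (ASec A V) i" "b = GA.gm V t"
      using \<open>a \<in> grade M i\<close> \<open>b \<in> grade M i\<close> unfolding M_grade by (auto elim!: GA.germsE)
    then show ?thesis
      using G.nb_Int[of U V] GA.gm_res[of U "U \<inter> V" s] GA.gm_res[of V "U \<inter> V" t] gr_res[of U "U \<inter> V" s i] gr_res[of V "U \<inter> V" t i] gr_closed
      by (intro exI[of _ "U \<inter> V"] exI[of _ "ARes A U (U \<inter> V) s"] exI[of _ "ARes A V (U \<inter> V) t"]) auto
  qed
  have in_gr: "GA.gm U s \<in> grade M i" if "nb U" "s \<in> grade (ASec A U) i" for U s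
    unfolding M_grade using that by (rule GA.germsI[where G = "\<lambda>U. grade (ASec A U) i"])
  show ?thesis
  proof (rule submoduleI)
    show "grade M i \<subseteq> carrier M" using M_gradeD by blast
    have "\<zero>\<^bsub>ASec A (topspace (Top S))\<^esub> \<in> grade (ASec A (topspace (Top S))) i"
      using subgroup.one_closed[OF submodule.axioms(1)[OF gr_sub[OF G.nb_top]]] by simp
    then show "\<zero>\<^bsub>M\<^esub> \<in> grade M i" unfolding M_zero[OF G.nb_top] by (rule in_gr[OF G.nb_top])
  next
    fix a b assume "a \<in> grade M i" "b \<in> grade M i"
    then obtain U s t where U: "nb U" "s \<in> grade (ASec A U) i" "t \<in> grade (ASec A U) i" "a = GA.gm U s" "b = GA.gm U t"
      using two by blast
    show "a \<oplus>\<^bsub>M\<^esub> b \<in> grade M i"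
      using U module.submoduleE(5)[OF alg_module gr_sub] by (simp add: M_add gr_closed in_gr)
  next
    fix r a assume ra: "r \<in> carrier R" "a \<in> grade M i"
    then obtain U s V t where U: "nb U" "s \<in> grade (ASec A U) i" "a = GA.gm U s" "nb V" "t \<in> carrier (Sec S V)" "r = G.gm V t"
      unfolding M_grade R_carrier by (auto elim!: GA.germsE G.germsE)
    define W where "W = U \<inter> V"
    have W: "nb W" "W \<subseteq> U" "W \<subseteq> V" using U G.nb_Int by (auto simp: W_def)
    have "a = GA.gm W (ARes A U W s)" "r = G.gm W (Res S V W t)" "ARes A U W s \<in> grade (ASec A W) i" "Res S V W t \<in> carrier (Sec S W)"
      using U W GA.gm_res[of U W s] G.gm_res[of V W t] gr_closed[of U s i] gr_res[of U W s i] G.res_closed[of V W t] by simp_all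
    then show "r \<odot>\<^bsub>M\<^esub> a \<in> grade M i"
      using W(1) module.submoduleE(4)[OF alg_module gr_sub] by (simp add: M_smult gr_closed in_gr)
  next
    fix a assume "a \<in> grade M i"
    then obtain U s where U: "nb U" "s \<in> grade (ASec A U) i" "a = GA.gm U s" using two by blast
    interpret U: ring "ASec A U" using U(1) by (rule GA.nb_ring)
    have n: "\<ominus>\<^bsub>ASec A U\<^esub> s \<in> grade (ASec A U) i" using module.submoduleE(3)[OF alg_module gr_sub] U by blast
    have s: "s \<in> carrier (ASec A U)" using U gr_closed by blast
    have "\<ominus>\<^bsub>M\<^esub> a = GA.gm U (\<ominus>\<^bsub>ASec A U\<^esub> s)"
      by (rule M.minus_equality) (use U s in \<open>simp_all add: M_add M_zero[OF U(1)] M_in U.l_neg\<close>)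
    then show "\<ominus>\<^bsub>M\<^esub> a \<in> grade M i" using in_gr[OF U(1) n] by simp
  qed
qed

lemma M_grade_mult:
  assumes "x \<in> grade M i" "y \<in> grade M j" shows "x \<otimes>\<^bsub>M\<^esub> y \<in> grade M (i + j)"
proof -
  obtain U s V t where U: "nb U" "s \<in> grade (ASec A U) i" "x = GA.gm U s" "nb V" "t \<in> grade (ASec A V) j" "y = GA.gm V t"
    using assms unfolding M_grade by (auto elim!: GA.germsE)
  define W where "W = U \<inter> V"
  have W: "nb W" "W \<subseteq> U" "W \<subseteq> V" using U G.nb_Int by (auto simp: W_def)
  have e: "x = GA.gm W (ARes A U W s)" "y = GA.gm W (ARes A V W t)" "ARes A U W s \<in> grade (ASec A W) i" "ARes A V W t \<in> grade (ASec A W) j"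
    using U W GA.gm_res[of U W s] GA.gm_res[of V W t] gr_closed[of U s i] gr_closed[of V t j] gr_res[of U W s i] gr_res[of V W t j] by simp_all
  have "ARes A U W s \<otimes>\<^bsub>ASec A W\<^esub> ARes A V W t \<in> grade (ASec A W) (i + j)"
    using e nb_open[OF W(1)] grade_alg by simp
  then show ?thesis using e W(1)
    by (simp add: M_mult gr_closed M_grade) (rule GA.germsI)
qed

definition is_proj where "is_proj P \<longleftrightarrow> (\<forall>i. \<forall>x\<in>carrier M. P i x \<in> carrier M) \<and>
    (\<forall>i. \<forall>x\<in>carrier M. \<forall>y\<in>carrier M. P i (x \<oplus>\<^bsub>M\<^esub> y) = P i x \<oplus>\<^bsub>M\<^esub> P i y) \<and>
    (\<forall>i. \<forall>r\<in>carrier R. \<forall>x\<in>carrier M. P i (r \<odot>\<^bsub>M\<^esub> x) = r \<odot>\<^bsub>M\<^esub> P i x) \<and>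
    (\<forall>i j. \<forall>x\<in>carrier M. P i (P j x) = (if i = j then P j x else \<zero>\<^bsub>M\<^esub>)) \<and>
    (\<forall>i. grade M i = {x \<in> carrier M. P i x = x}) \<and>
    (\<forall>x\<in>carrier M. \<exists>xs. set xs \<subseteq> (\<Union>i. grade M i) \<and> x = foldr (\<oplus>\<^bsub>M\<^esub>) xs \<zero>\<^bsub>M\<^esub>)"

definition P where "P = (SOME P. is_proj P)"

text \<open>A section is a finite sum of homogeneous ones only after shrinking, which is enough for
  its germ. Conversely, a sum of homogeneous germs that vanishes is already zero as a section over a
  smaller neighbourhood, where the homogeneous sections are independent.\<close>

lemma P_proj: "is_proj P"
proof -
  have "\<exists>P. is_proj P" unfolding is_proj_def
  proof (rule module.graded_projections[OF M_module M_grade_sub])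
    fix a assume "a \<in> carrier M"
    then obtain U s where U: "nb U" "s \<in> carrier (ASec A U)" "a = GA.gm U s"
      using M_rep by metis
    from grade_sum[THEN spec[of _ U], THEN mp, OF nb_open[OF U(1)], THEN bspec, OF U(2), THEN bspec[of _ _ p]] U(1)
    obtain V J t where V: "openin (Top S) V" "p \<in> V" "V \<subseteq> U" "finite J" "\<forall>i\<in>J. t i \<in> grade (ASec A V) i"
      "ARes A U V s = finsum (ASec A V) t J" unfolding G.nb_def by metis
    have nV: "nb V" using V by (simp add: G.nb_def)
    have "a = finsum M (\<lambda>i. GA.gm V (t i)) J"
    proof -
      have "GA.gm V (finsum (ASec A V) t J) = finsum M (\<lambda>i. GA.gm V (t i)) J"
        by (rule gm_finsum[OF nV V(4)]) (use V(5) gr_closed[OF nV] in blast)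
      then show ?thesis using GA.gm_res[OF U(1) nV V(3) U(2)] by (simp only: U(3) V(6))
    qed
    moreover have "\<forall>i\<in>J. GA.gm V (t i) \<in> grade M i"
      unfolding M_grade using V(5) nV by (auto intro: GA.germsI)
    ultimately show "\<exists>J f. finite J \<and> (\<forall>i\<in>J. f i \<in> grade M i) \<and> a = finsum M f J"
      using V(4) by (intro exI[of _ J] exI[of _ "\<lambda>i. GA.gm V (t i)"] conjI)
  next
    fix J :: "int set" and f assume J: "finite J" "\<forall>i\<in>J. f i \<in> grade M i" and 0: "finsum M f J = \<zero>\<^bsub>M\<^esub>"
    obtain U s where U: "nb U" and s: "\<And>i. i \<in> J \<Longrightarrow> s i \<in> grade (ASec A U) i" "\<And>i. i \<in> J \<Longrightarrow> f i = GA.gm U (s i)"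
      using common_grade_reps[OF J] by blast
    interpret U: ring "ASec A U" using U by (rule GA.nb_ring)
    interpret M: abelian_group M by (rule M_abelian)
    have sc: "\<forall>i\<in>J. s i \<in> carrier (ASec A U)" using s(1) gr_closed[OF U] by blast
    have "finsum M f J = finsum M (\<lambda>i. GA.gm U (s i)) J"
      by (rule M.finsum_cong'[OF HOL.refl]) (simp_all add: s(2) M_in[OF U] sc)
    then have eq: "GA.gm U (finsum (ASec A U) s J) = GA.gm U \<zero>\<^bsub>ASec A U\<^esub>"
      using gm_finsum[OF U J(1) sc] 0 M_zero[OF U] by simp
    obtain W where W: "nb W" "W \<subseteq> U"
      "ARes A U W (finsum (ASec A U) s J) = ARes A U W \<zero>\<^bsub>ASec A U\<^esub>"
      by (rule GA.gm_eqD[OF U U.zero_closed eq])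
    interpret W: ring "ASec A W" using W(1) by (rule GA.nb_ring)
    have rh: "ARes A U W \<in> ring_hom (ASec A U) (ASec A W)" using GA.nb_hom[OF U W(1,2)] .
    have rz: "ARes A U W \<zero>\<^bsub>ASec A U\<^esub> = \<zero>\<^bsub>ASec A W\<^esub>" by (rule ring_hom_zero[OF rh U.ring_axioms W.ring_axioms])
    have rs: "ARes A U W (finsum (ASec A U) s J) = finsum (ASec A W) (\<lambda>i. ARes A U W (s i)) J"
      using J(1) sc
    proof (induction J)
      case empty
      then show ?case using rz by simp
    next
      case (insert j J)
      then show ?case
        by (simp add: U.finsum_insert W.finsum_insert Pi_def ring_hom_add[OF rh] ring_hom_closed[OF rh] U.finsum_closed)
    qed
    have g: "\<forall>i\<in>J. ARes A U W (s i) \<in> grade (ASec A W) i" using gr_res[OF U W(1,2)] s(1) by blast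
    have z: "\<forall>i\<in>J. ARes A U W (s i) = \<zero>\<^bsub>ASec A W\<^esub>"
      using grade_indep[THEN spec[of _ W], THEN spec[of _ J], THEN spec[of _ "\<lambda>i. ARes A U W (s i)"], THEN mp]
        nb_open[OF W(1)] J(1) g W(3) rs rz by simp
    show "\<forall>i\<in>J. f i = \<zero>\<^bsub>M\<^esub>"
      using z s(2) sc GA.gm_res[OF U W(1,2)] M_zero[OF W(1)] by metis
  qed
  then show ?thesis unfolding P_def by (rule someI_ex)
qed

end

section \<open>Constants, evaluation at the point, and the pointed algebra of the family\<close>

context family_at
begin

lemma base_preim: "preim (Top S) (base_map S) (topspace (Top (Spec K))) = topspace (Top S)"
proof -
  have "continuous_map (Top S) (Top (Spec K)) (base_map S)"
    using scheme by (simp add: is_scheme_over_def lrs_morphism_def)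
  then show ?thesis unfolding preim_def continuous_map_def by blast
qed

lemma base_hom: "base_sheaf_map S (topspace (Top (Spec K))) \<in>
    ring_hom (Sec (Spec K) (topspace (Top (Spec K)))) (Sec S (topspace (Top S)))"
proof -
  have "\<forall>V. openin (Top (Spec K)) V \<longrightarrow>
    base_sheaf_map S V \<in> ring_hom (Sec (Spec K) V) (Sec S (preim (Top S) (base_map S) V))"
    using scheme by (simp add: is_scheme_over_def lrs_morphism_def)
  from this[THEN spec, THEN mp, OF openin_topspace] show ?thesis unfolding base_preim .
qed

lemma iota_eq: "\<iota> c = G.gm (topspace (Top S)) (base_sheaf_map S (topspace (Top (Spec K))) (const_section K c))"
  by (simp add: const_germ_def const_section_def)

lemma iota_hom: "\<iota> \<in> ring_hom K R"
proof -
  note c = const_section_hom[OF field] and b = base_hom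
  note cc = ring_hom_closed[OF c] and bc = ring_hom_closed[OF b]
  show ?thesis
  proof (rule ring_hom_memI)
    show "\<iota> x \<in> carrier R" if "x \<in> carrier K" for x
      unfolding iota_eq by (intro R_in G.nb_top bc cc that)
    show "\<iota> (x \<otimes>\<^bsub>K\<^esub> y) = \<iota> x \<otimes>\<^bsub>R\<^esub> \<iota> y" "\<iota> (x \<oplus>\<^bsub>K\<^esub> y) = \<iota> x \<oplus>\<^bsub>R\<^esub> \<iota> y"
      if "x \<in> carrier K" "y \<in> carrier K" for x y
      unfolding iota_eq using that G.nb_top
      by (simp_all add: R_mult R_add bc cc ring_hom_mult[OF c] ring_hom_mult[OF b] ring_hom_add[OF c] ring_hom_add[OF b])
    show "\<iota> \<one>\<^bsub>K\<^esub> = \<one>\<^bsub>R\<^esub>"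
      unfolding iota_eq R_one[OF G.nb_top] by (simp add: ring_hom_one[OF c] ring_hom_one[OF b])
  qed
qed

lemma m_maximal: "maximalideal m R"
  using local_R theI'[of "\<lambda>M. maximalideal M R"] unfolding local_ring_def max_ideal_def by blast

sublocale K: field K by (rule field)
sublocale Rr: cring R by (rule R_cring)
sublocale I: ideal m R using m_maximal by (rule maximalideal.axioms(1))

abbreviation rc where "rc \<equiv> a_r_coset R m"

lemma residue_class_eq: "residue_class S p = rc"
  by (simp add: fun_eq_iff residue_class_def)

lemma residue_bij: "bij_betw (\<lambda>c. rc (\<iota> c)) (carrier K) (carrier (R Quot m))"
  using K_point by (simp add: closed_K_point_def residue_class_eq residue_field_def)

lemma iota_closed: "c \<in> carrier K \<Longrightarrow> \<iota> c \<in> carrier R" by (rule ring_hom_closed[OF iota_hom])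

lemma val_ex1:
  assumes "r \<in> carrier R" shows "\<exists>!c. c \<in> carrier K \<and> rc (\<iota> c) = rc r"
proof -
  have "rc r \<in> carrier (R Quot m)" by (rule ring_hom_closed[OF I.rcos_ring_hom assms])
  then obtain c where "c \<in> carrier K" "rc (\<iota> c) = rc r"
    using residue_bij unfolding bij_betw_def by (metis (no_types, lifting) imageE)
  then show ?thesis using residue_bij unfolding bij_betw_def inj_on_def by metis
qed

lemma
  assumes "r \<in> carrier R"
  shows val_closed: "val r \<in> carrier K" and rc_val: "rc (\<iota> (val r)) = rc r"
  using theI'[OF val_ex1[OF assms]] unfolding value_at_def residue_class_eq by auto

lemma val_unique: "r \<in> carrier R \<Longrightarrow> c \<in> carrier K \<Longrightarrow> rc (\<iota> c) = rc r \<Longrightarrow> val r = c"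
  using val_ex1 val_closed rc_val by metis

lemma val_iota: "c \<in> carrier K \<Longrightarrow> val (\<iota> c) = c"
  by (rule val_unique) (simp_all add: iota_closed)

text \<open>The value is the unique constant in the given residue class. Since taking constants and
  taking residue classes are both ring homomorphisms, the sum or product of two values has the
  required class.\<close>

lemma val_hom: "val \<in> ring_hom R K"
proof (rule ring_hom_memI)
  note q = I.rcos_ring_hom and i = iota_hom
  show "val x \<in> carrier K" if "x \<in> carrier R" for x using that by (rule val_closed)
  fix x y assume xy: "x \<in> carrier R" "y \<in> carrier R"
  have "rc (\<iota> (val x \<otimes>\<^bsub>K\<^esub> val y)) = rc (\<iota> (val x)) \<otimes>\<^bsub>R Quot m\<^esub> rc (\<iota> (val y))"
    using xy by (simp add: val_closed iota_closed ring_hom_mult[OF i] ring_hom_mult[OF q])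
  then show "val (x \<otimes>\<^bsub>R\<^esub> y) = val x \<otimes>\<^bsub>K\<^esub> val y"
    using xy by (intro val_unique) (simp_all add: val_closed rc_val ring_hom_mult[OF q])
  have "rc (\<iota> (val x \<oplus>\<^bsub>K\<^esub> val y)) = rc (\<iota> (val x)) \<oplus>\<^bsub>R Quot m\<^esub> rc (\<iota> (val y))"
    using xy by (simp add: val_closed iota_closed ring_hom_add[OF i] ring_hom_add[OF q])
  then show "val (x \<oplus>\<^bsub>R\<^esub> y) = val x \<oplus>\<^bsub>K\<^esub> val y"
    using xy by (intro val_unique) (simp_all add: val_closed rc_val ring_hom_add[OF q])
next
  show "val \<one>\<^bsub>R\<^esub> = \<one>\<^bsub>K\<^esub>" by (rule val_unique) (simp_all add: ring_hom_one[OF iota_hom])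
qed

lemma m_iff:
  assumes r: "r \<in> carrier R" shows "r \<in> m \<longleftrightarrow> val r = \<zero>\<^bsub>K\<^esub>"
proof -
  have z: "\<iota> \<zero>\<^bsub>K\<^esub> = \<zero>\<^bsub>R\<^esub>" by (rule ring_hom_zero[OF iota_hom K.ring_axioms Rr.ring_axioms])
  have "r \<in> m \<longleftrightarrow> rc r = rc \<zero>\<^bsub>R\<^esub>"
    using Rr.quotient_eq_iff_same_a_r_cos[OF I.ideal_axioms r Rr.zero_closed] r by (simp add: Rr.minus_eq)
  also have "\<dots> \<longleftrightarrow> val r = \<zero>\<^bsub>K\<^esub>"
    using val_unique[OF r K.zero_closed] rc_val[OF r] z by metis
  finally show ?thesis .
qed

sublocale PA: pointed_algebra K R M m \<iota> val P
proof (intro pointed_algebra.intro pointed_algebra_axioms.intro)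
  show "x \<in> grade M i \<Longrightarrow> y \<in> grade M j \<Longrightarrow> x \<otimes>\<^bsub>M\<^esub> y \<in> grade M (i + j)" for x y i j by (rule M_grade_mult)
  show "\<exists>xs. set xs \<subseteq> (\<Union>i. grade M i) \<and> x = foldr (\<oplus>\<^bsub>M\<^esub>) xs \<zero>\<^bsub>M\<^esub>" if "x \<in> carrier M" for x
    using P_proj that unfolding is_proj_def by (elim conjE) (erule (1) bspec)
  show "grade M i = {x \<in> carrier M. P i x = x}" for i
    using P_proj unfolding is_proj_def by (elim conjE) (erule spec)
qed (use P_proj in \<open>simp_all add: field R_cring M_ring M_module I.ideal_axioms iota_hom val_hom val_iota m_iff
   M_smult_mult M_mult_smult is_proj_def\<close>)

section \<open>Cotangent space, tangent vectors and derivations\<close>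

abbreviation J where "J \<equiv> square_max_ideal S p"
abbreviation Cot where "Cot \<equiv> cotangent_space K S p"

sublocale J: ideal J R
  unfolding square_max_ideal_def by (rule Rr.ideal_prod_is_ideal[OF I.ideal_axioms I.ideal_axioms])

lemma J_mult: "x \<in> m \<Longrightarrow> y \<in> m \<Longrightarrow> x \<otimes>\<^bsub>R\<^esub> y \<in> J"
  unfolding square_max_ideal_def by (rule ideal_prod.prod)

abbreviation jc where "jc \<equiv> a_r_coset R J"

lemma Cot_carrier: "carrier Cot = jc ` m"
  by (auto simp: cotangent_space_def Let_def quotient_module_def A_RCOSETS_def' a_r_coset_def')

lemma jc_eq: "x \<in> carrier R \<Longrightarrow> y \<in> carrier R \<Longrightarrow> jc x = jc y \<longleftrightarrow> x \<ominus>\<^bsub>R\<^esub> y \<in> J"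
  by (simp add: Rr.quotient_eq_iff_same_a_r_cos[OF J.ideal_axioms])

lemma Cot_add: "x \<in> carrier R \<Longrightarrow> y \<in> carrier R \<Longrightarrow> jc x \<oplus>\<^bsub>Cot\<^esub> jc y = jc (x \<oplus>\<^bsub>R\<^esub> y)"
  by (simp add: cotangent_space_def Let_def quotient_module_def set_add_def' flip: J.a_rcos_sum)

text \<open>Scalar multiplication on the quotient is a union of cosets over all representatives;
  they coincide because \<open>J\<close> is an ideal.\<close>

lemma Cot_smult:
  assumes "c \<in> carrier K" "x \<in> carrier R" shows "c \<odot>\<^bsub>Cot\<^esub> jc x = jc (\<iota> c \<otimes>\<^bsub>R\<^esub> x)"
proof -
  have "c \<odot>\<^bsub>Cot\<^esub> jc x = (\<Union>z\<in>jc x. jc (\<iota> c \<otimes>\<^bsub>R\<^esub> z))"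
    by (simp add: cotangent_space_def Let_def quotient_module_def a_r_coset_def')
  moreover have "jc (\<iota> c \<otimes>\<^bsub>R\<^esub> z) = jc (\<iota> c \<otimes>\<^bsub>R\<^esub> x)" if z: "z \<in> jc x" for z
  proof -
    have zR: "z \<in> carrier R" using z Rr.a_r_coset_subset_G[OF J.a_subset assms(2)] by blast
    have "jc z = jc x" using J.a_repr_independence'[OF z assms(2)] by simp
    then have d: "z \<ominus>\<^bsub>R\<^esub> x \<in> J" using jc_eq zR assms by blast
    have "(\<iota> c \<otimes>\<^bsub>R\<^esub> z) \<ominus>\<^bsub>R\<^esub> (\<iota> c \<otimes>\<^bsub>R\<^esub> x) = \<iota> c \<otimes>\<^bsub>R\<^esub> (z \<ominus>\<^bsub>R\<^esub> x)"
      using zR assms iota_closed by (simp add: Rr.minus_eq Rr.r_distr Rr.r_minus)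
    then show ?thesis using J.I_l_closed[OF d iota_closed[OF assms(1)]] zR assms iota_closed
      by (subst jc_eq) simp_all
  qed
  moreover have "x \<in> jc x" using assms(2) by (rule J.a_rcos_self)
  ultimately show ?thesis by blast
qed

text \<open>The point derivation of the local ring that corresponds to a tangent vector:
  \<open>v\<close> is evaluated on the class of \<open>r - r(p)\<close>.\<close>

definition dv :: "(('x set \<times> 'r) set set \<Rightarrow> 'k) \<Rightarrow> ('x set \<times> 'r) set \<Rightarrow> 'k" where
  "dv v r = v (jc (r \<ominus>\<^bsub>R\<^esub> \<iota> (val r)))"

lemma tangent_hom_eq: "tangent_hom K S p v = (\<lambda>r. (val r, dv v r))"
  by (simp add: fun_eq_iff tangent_hom_def dv_def)

lemma T_carrier: "v \<in> carrier (tangent_space K S p) \<longleftrightarrow> v \<in> extensional (carrier Cot) \<and>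
    (\<forall>z\<in>carrier Cot. v z \<in> carrier K) \<and>
    (\<forall>x\<in>carrier Cot. \<forall>y\<in>carrier Cot. v (x \<oplus>\<^bsub>Cot\<^esub> y) = v x \<oplus>\<^bsub>K\<^esub> v y) \<and>
    (\<forall>c\<in>carrier K. \<forall>x\<in>carrier Cot. v (c \<odot>\<^bsub>Cot\<^esub> x) = c \<otimes>\<^bsub>K\<^esub> v x)"
  by (auto simp: tangent_space_def dual_space_def linear_maps_def)

lemma sub_val: "r \<in> carrier R \<Longrightarrow> r \<ominus>\<^bsub>R\<^esub> \<iota> (val r) \<in> m" by (rule PA.sub_const)

context
  fixes v assumes v: "v \<in> carrier (tangent_space K S p)"
begin

lemma v_closed: "x \<in> m \<Longrightarrow> v (jc x) \<in> carrier K"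
  using v unfolding T_carrier Cot_carrier by blast

lemma v_add: "x \<in> m \<Longrightarrow> y \<in> m \<Longrightarrow> v (jc (x \<oplus>\<^bsub>R\<^esub> y)) = v (jc x) \<oplus>\<^bsub>K\<^esub> v (jc y)"
proof -
  assume xy: "x \<in> m" "y \<in> m"
  have "v (jc x \<oplus>\<^bsub>Cot\<^esub> jc y) = v (jc x) \<oplus>\<^bsub>K\<^esub> v (jc y)" using v xy unfolding T_carrier Cot_carrier by blast
  then show ?thesis using xy by (simp add: Cot_add PA.m_closed)
qed

lemma v_smult: "c \<in> carrier K \<Longrightarrow> x \<in> m \<Longrightarrow> v (jc (\<iota> c \<otimes>\<^bsub>R\<^esub> x)) = c \<otimes>\<^bsub>K\<^esub> v (jc x)"
proof -
  assume cx: "c \<in> carrier K" "x \<in> m"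
  have "v (c \<odot>\<^bsub>Cot\<^esub> jc x) = c \<otimes>\<^bsub>K\<^esub> v (jc x)" using v cx unfolding T_carrier Cot_carrier by blast
  then show ?thesis using cx by (simp add: Cot_smult PA.m_closed)
qed

lemma v_zero: "v (jc \<zero>\<^bsub>R\<^esub>) = \<zero>\<^bsub>K\<^esub>"
proof -
  have "v (jc \<zero>\<^bsub>R\<^esub>) \<oplus>\<^bsub>K\<^esub> v (jc \<zero>\<^bsub>R\<^esub>) = v (jc \<zero>\<^bsub>R\<^esub>)"
    using v_add[OF I.zero_closed I.zero_closed] by simp
  then show ?thesis using v_closed[OF I.zero_closed] K.add.r_cancel_one by blast
qed

lemma v_J: "x \<in> J \<Longrightarrow> v (jc x) = \<zero>\<^bsub>K\<^esub>"
  using jc_eq[of x "\<zero>\<^bsub>R\<^esub>"] J.Icarr[of x] v_zero by (simp add: Rr.minus_eq)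

text \<open>For the Leibniz rule write \<open>r = x + a\<close> and \<open>s = y + b\<close> with
  constants \<open>a\<close>, \<open>b\<close> and with \<open>x\<close>, \<open>y\<close> in
  \<open>m\<close>. Then \<open>r s - a b = x y + a y + b x\<close>, and \<open>v\<close> kills
  \<open>x y\<close>, which lies in the square of \<open>m\<close>.\<close>

lemma deformed: "deformed_algebra K R M m \<iota> val P (dv v)"
proof (intro deformed_algebra.intro PA.pointed_algebra_axioms deformed_algebra_axioms.intro flat_stalk)
  show "dv v r \<in> carrier K" if "r \<in> carrier R" for r
    unfolding dv_def using v_closed sub_val[OF that] by blast
next
  fix r s assume rs: "r \<in> carrier R" "s \<in> carrier R"
  have ic: "\<iota> (val r) \<in> carrier R" "\<iota> (val s) \<in> carrier R" using rs by (simp_all add: iota_closed val_closed)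
  have "(r \<oplus>\<^bsub>R\<^esub> s) \<ominus>\<^bsub>R\<^esub> \<iota> (val (r \<oplus>\<^bsub>R\<^esub> s)) = (r \<ominus>\<^bsub>R\<^esub> \<iota> (val r)) \<oplus>\<^bsub>R\<^esub> (s \<ominus>\<^bsub>R\<^esub> \<iota> (val s))"
    using rs ic by (simp add: PA.val_simps PA.iota_simps Rr.minus_eq Rr.minus_add Rr.a_ac)
  then show "dv v (r \<oplus>\<^bsub>R\<^esub> s) = dv v r \<oplus>\<^bsub>K\<^esub> dv v s"
    unfolding dv_def using v_add sub_val rs by simp
  define a b x y where abxy: "a = \<iota> (val r)" "b = \<iota> (val s)" "x = r \<ominus>\<^bsub>R\<^esub> a" "y = s \<ominus>\<^bsub>R\<^esub> b"
  have c: "a \<in> carrier R" "b \<in> carrier R" "x \<in> m" "y \<in> m" "x \<in> carrier R" "y \<in> carrier R"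
    using ic sub_val rs by (simp_all add: abxy)
  have r: "r = x \<oplus>\<^bsub>R\<^esub> a" and s: "s = y \<oplus>\<^bsub>R\<^esub> b" using rs c by (simp_all add: abxy(3,4) Rr.minus_eq Rr.a_assoc Rr.l_neg)
  have "(r \<otimes>\<^bsub>R\<^esub> s) \<ominus>\<^bsub>R\<^esub> \<iota> (val (r \<otimes>\<^bsub>R\<^esub> s)) = (r \<otimes>\<^bsub>R\<^esub> s) \<ominus>\<^bsub>R\<^esub> (a \<otimes>\<^bsub>R\<^esub> b)"
    using rs by (simp add: PA.val_simps PA.iota_simps abxy)
  also have "\<dots> = x \<otimes>\<^bsub>R\<^esub> y \<oplus>\<^bsub>R\<^esub> (a \<otimes>\<^bsub>R\<^esub> y \<oplus>\<^bsub>R\<^esub> b \<otimes>\<^bsub>R\<^esub> x)"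
    unfolding r s using c by (simp add: Rr.minus_eq Rr.l_distr Rr.r_distr Rr.a_assoc Rr.r_neg Rr.m_comm)
  finally have e: "(r \<otimes>\<^bsub>R\<^esub> s) \<ominus>\<^bsub>R\<^esub> \<iota> (val (r \<otimes>\<^bsub>R\<^esub> s)) = x \<otimes>\<^bsub>R\<^esub> y \<oplus>\<^bsub>R\<^esub> (a \<otimes>\<^bsub>R\<^esub> y \<oplus>\<^bsub>R\<^esub> b \<otimes>\<^bsub>R\<^esub> x)" .
  have "dv v (r \<otimes>\<^bsub>R\<^esub> s) = v (jc (x \<otimes>\<^bsub>R\<^esub> y)) \<oplus>\<^bsub>K\<^esub> (v (jc (a \<otimes>\<^bsub>R\<^esub> y)) \<oplus>\<^bsub>K\<^esub> v (jc (b \<otimes>\<^bsub>R\<^esub> x)))"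
    unfolding dv_def e using c by (simp add: v_add I.I_l_closed I.a_closed)
  also have "\<dots> = (val r \<otimes>\<^bsub>K\<^esub> dv v s) \<oplus>\<^bsub>K\<^esub> (dv v r \<otimes>\<^bsub>K\<^esub> val s)"
  proof -
    have "v (jc (a \<otimes>\<^bsub>R\<^esub> y)) = val r \<otimes>\<^bsub>K\<^esub> dv v s" "v (jc (b \<otimes>\<^bsub>R\<^esub> x)) = val s \<otimes>\<^bsub>K\<^esub> dv v r"
      using v_smult c rs val_closed by (simp_all add: dv_def abxy)
    moreover have "dv v r \<in> carrier K" "dv v s \<in> carrier K" using v_closed c by (simp_all add: dv_def abxy)
    ultimately show ?thesis using v_J[OF J_mult[OF c(3,4)]] rs by (simp add: val_closed K.m_comm)
  qed
  finally show "dv v (r \<otimes>\<^bsub>R\<^esub> s) = (val r \<otimes>\<^bsub>K\<^esub> dv v s) \<oplus>\<^bsub>K\<^esub> (dv v r \<otimes>\<^bsub>K\<^esub> val s)" .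
next
  show "dv v (\<iota> c) = \<zero>\<^bsub>K\<^esub>" if "c \<in> carrier K" for c
    using that v_zero iota_closed[OF that] by (simp add: dv_def val_iota Rr.minus_eq Rr.r_neg)
qed

end

section \<open>The Kodaira-Spencer map of the family and its linearity\<close>

lemma fibre_eq: "fibre K S A p = PA.B"
  by (simp add: fibre_def residue_class_eq residue_field_def)

text \<open>Stated for any \<open>v\<close> whose functional \<open>dv v\<close> satisfies the
  derivation laws. For a pullback this is applied to a push-forward of a tangent vector, where the
  laws are known directly.\<close>

lemma KS_deformed:
  assumes "deformed_algebra K R M m \<iota> val P (dv v)"
  shows "kodaira_spencer K S A p v = deformed_algebra.KS K R M m \<iota> val (dv v)"
proof -
  interpret D: deformed_algebra K R M m \<iota> val P "dv v" by fact
  have "reduction K S A p = D.red"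
    by (simp add: fun_eq_iff reduction_def D.red_def residue_class_eq residue_field_def)
  then show ?thesis
    unfolding kodaira_spencer_def D.KS_def Let_def fibre_eq deformation_def tangent_hom_eq by simp
qed

lemma kodaira_spencer_cos:
  assumes "v \<in> carrier (tangent_space K S p)" "PA.is_lift \<sigma>"
  shows "kodaira_spencer K S A p v = PA.H.cos (PA.cup (dv v) \<sigma>)"
  using KS_deformed[OF deformed] deformed_algebra.KS_eq[OF deformed] assms by metis

lemma T_add: "v \<in> carrier (tangent_space K S p) \<Longrightarrow> v' \<in> carrier (tangent_space K S p) \<Longrightarrow> r \<in> carrier R \<Longrightarrow>
    dv (v \<oplus>\<^bsub>tangent_space K S p\<^esub> v') r = dv v r \<oplus>\<^bsub>K\<^esub> dv v' r"
  using sub_val by (simp add: dv_def tangent_space_def dual_space_def Cot_carrier)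

lemma T_smult: "v \<in> carrier (tangent_space K S p) \<Longrightarrow> c \<in> carrier K \<Longrightarrow> r \<in> carrier R \<Longrightarrow>
    dv (c \<odot>\<^bsub>tangent_space K S p\<^esub> v) r = c \<otimes>\<^bsub>K\<^esub> dv v r"
  using sub_val by (simp add: dv_def tangent_space_def dual_space_def Cot_carrier)

lemma T_add_closed:
  assumes "v \<in> carrier (tangent_space K S p)" "v' \<in> carrier (tangent_space K S p)"
  shows "v \<oplus>\<^bsub>tangent_space K S p\<^esub> v' \<in> carrier (tangent_space K S p)"
proof -
  have cl: "x \<oplus>\<^bsub>Cot\<^esub> y \<in> carrier Cot" "c \<in> carrier K \<Longrightarrow> c \<odot>\<^bsub>Cot\<^esub> x \<in> carrier Cot"
    if "x \<in> carrier Cot" "y \<in> carrier Cot" for x y c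
    using that unfolding Cot_carrier
    by (auto simp: Cot_add Cot_smult PA.m_closed intro!: imageI I.a_closed I.I_l_closed iota_closed)
  have e: "v \<oplus>\<^bsub>tangent_space K S p\<^esub> v' = (\<lambda>x\<in>carrier Cot. v x \<oplus>\<^bsub>K\<^esub> v' x)"
    by (simp add: tangent_space_def dual_space_def)
  show ?thesis using assms unfolding T_carrier e by (simp add: cl K.a_ac K.r_distr)
qed

lemma T_smult_closed:
  assumes "v \<in> carrier (tangent_space K S p)" "c \<in> carrier K"
  shows "c \<odot>\<^bsub>tangent_space K S p\<^esub> v \<in> carrier (tangent_space K S p)"
proof -
  have cl: "x \<oplus>\<^bsub>Cot\<^esub> y \<in> carrier Cot" "c \<in> carrier K \<Longrightarrow> c \<odot>\<^bsub>Cot\<^esub> x \<in> carrier Cot"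
    if "x \<in> carrier Cot" "y \<in> carrier Cot" for x y c
    using that unfolding Cot_carrier
    by (auto simp: Cot_add Cot_smult PA.m_closed intro!: imageI I.a_closed I.I_l_closed iota_closed)
  have e: "c \<odot>\<^bsub>tangent_space K S p\<^esub> v = (\<lambda>x\<in>carrier Cot. c \<otimes>\<^bsub>K\<^esub> v x)"
    by (simp add: tangent_space_def dual_space_def)
  show ?thesis using assms unfolding T_carrier e by (simp add: cl K.m_lcomm K.r_distr)
qed

text \<open>With the lift fixed, the cocycles themselves are linear in the tangent vector by
  \<open>Lam_w_add\<close> and \<open>Lam_w_smult\<close>, and passing to cosets is linear by
  \<open>cos_add\<close> and \<open>cos_smult\<close>.\<close>

lemma kodaira_spencer_linear:
  "kodaira_spencer K S A p \<in> linear_maps K (tangent_space K S p) (HH0 K (fibre K S A p) 2)"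
proof -
  obtain \<sigma> where l: "PA.is_lift \<sigma>" using PA.lift_exists by blast
  let ?T = "tangent_space K S p"
  let ?f = "\<lambda>v. PA.cup (dv v) \<sigma>"
  note ks = kodaira_spencer_cos[OF _ l]
  have bil: "PA.H.bil (?f v)" and coc: "PA.H.cocyc (?f v)" if "v \<in> carrier ?T" for v
    using deformed_algebra.bil_cup[OF deformed[OF that] l] deformed_algebra.cocyc_cup[OF deformed[OF that] l] by blast+
  have dc: "dv v r \<in> carrier K" if "v \<in> carrier ?T" "r \<in> m" for v r
    using deformed_algebra.w_closed[OF deformed[OF that(1)] PA.m_closed[OF that(2)]] .
  show ?thesis unfolding linear_maps_def fibre_eq
  proof (intro CollectI conjI ballI funcsetI)
    show "kodaira_spencer K S A p v \<in> carrier (HH0 K PA.B 2)" if "v \<in> carrier ?T" for v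
      unfolding ks[OF that] by (rule PA.H.cos_HH0[OF bil[OF that] coc[OF that]])
  next
    fix v v' assume v: "v \<in> carrier ?T" "v' \<in> carrier ?T"
    have "?f (v \<oplus>\<^bsub>?T\<^esub> v') x y = ?f v x y \<oplus>\<^bsub>PA.B\<^esub> ?f v' x y" if "x \<in> carrier PA.B" "y \<in> carrier PA.B" for x y
      using PA.Lam_w_add[of "dv v" "dv v'" "dv (v \<oplus>\<^bsub>?T\<^esub> v')", OF dc[OF v(1)] dc[OF v(2)] _ PA.delta_mM[OF l that]]
        T_add[OF v PA.m_closed] by (simp add: PA.cup_def PA.B_sel)
    then show "kodaira_spencer K S A p (v \<oplus>\<^bsub>?T\<^esub> v') =
      kodaira_spencer K S A p v \<oplus>\<^bsub>HH0 K PA.B 2\<^esub> kodaira_spencer K S A p v'"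
      unfolding ks[OF v(1)] ks[OF v(2)] ks[OF T_add_closed[OF v]] PA.H.cos_add[OF bil[OF v(1)] bil[OF v(2)]]
      by (rule PA.H.cos_cong)
  next
    fix c v assume v: "c \<in> carrier K" "v \<in> carrier ?T"
    have "?f (c \<odot>\<^bsub>?T\<^esub> v) x y = c \<odot>\<^bsub>PA.B\<^esub> ?f v x y" if "x \<in> carrier PA.B" "y \<in> carrier PA.B" for x y
      using PA.Lam_w_smult[of "dv v" c "dv (c \<odot>\<^bsub>?T\<^esub> v)", OF dc[OF v(2)] v(1) _ PA.delta_mM[OF l that]]
        T_smult[OF v(2,1) PA.m_closed] by (simp add: PA.cup_def PA.B_sel)
    then show "kodaira_spencer K S A p (c \<odot>\<^bsub>?T\<^esub> v) = c \<odot>\<^bsub>HH0 K PA.B 2\<^esub> kodaira_spencer K S A p v"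
      unfolding ks[OF v(2)] ks[OF T_smult_closed[OF v(2,1)]] PA.H.cos_smult[OF bil[OF v(2)] v(1)]
      by (rule PA.H.cos_cong)
  qed
qed

end

section \<open>Pullbacks of families\<close>

locale family_pullback = S: family_at K S A p + T: family_at K T A' q
  for K :: "'k ring" and S :: "('k, 'x, 'r) scheme_over" and A :: "('x, 'r, 'a) algebra_sheaf" and p :: 'x
    and T :: "('k, 'y, 's) scheme_over" and A' :: "('y, 's, 'b) algebra_sheaf" and q :: 'y +
  fixes f :: "'y \<Rightarrow> 'x" and h :: "'x set \<Rightarrow> 'r \<Rightarrow> 's" and g :: "'x set \<Rightarrow> 'a \<Rightarrow> 'b"
  assumes morph: "morphism_over K T S f h" and fq: "f q = p" and pullback: "is_pullback T A' S A f h g"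
begin

lemma lrs: "lrs_morphism T S f h" using morph by (simp add: morphism_over_def)

lemma cont: "continuous_map (Top T) (Top S) f" using lrs by (simp add: lrs_morphism_def)

lemmas pullback_conj = pullback[unfolded is_pullback_def Let_def]
lemmas pullback_sections = pullback_conj[THEN conjunct1, rule_format]

lemma pullback_hom: "openin (Top S) V \<Longrightarrow> g V \<in> ring_hom (ASec A V) (ASec A' (preim (Top T) f V))"
  by (drule pullback_sections) (elim conjE)

lemma pullback_smult: "openin (Top S) V \<Longrightarrow> r \<in> carrier (Sec S V) \<Longrightarrow> a \<in> carrier (ASec A V) \<Longrightarrow>
    g V (r \<odot>\<^bsub>ASec A V\<^esub> a) = h V r \<odot>\<^bsub>ASec A' (preim (Top T) f V)\<^esub> g V a"
  by (drule pullback_sections) simp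

lemma pullback_grade: "openin (Top S) V \<Longrightarrow> a \<in> grade (ASec A V) i \<Longrightarrow> g V a \<in> grade (ASec A' (preim (Top T) f V)) i"
  by (drule pullback_sections) blast

sublocale H: presheaf_morphism_at "Top T" "Sec T" "Res T" q "Top S" "Sec S" "Res S" p f h
  by (intro presheaf_morphism_at.intro T.G.presheaf_at_axioms S.G.presheaf_at_axioms presheaf_morphism_at_axioms.intro cont fq)
    (use lrs in \<open>simp_all add: lrs_morphism_def\<close>)

sublocale G: presheaf_morphism_at "Top T" "ASec A'" "ARes A'" q "Top S" "ASec A" "ARes A" p f g
  by (intro presheaf_morphism_at.intro T.GA.presheaf_at_axioms S.GA.presheaf_at_axioms presheaf_morphism_at_axioms.intro cont fq pullback_hom)
    (use pullback in \<open>simp_all add: is_pullback_def Let_def\<close>)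

abbreviation hs where "hs \<equiv> stalk_map T f h q"
abbreviation gs where "gs \<equiv> stalk_map_alg T A' f g q"
abbreviation "pre \<equiv> preim (Top T) f"

lemma hs_gm: "S.nb V \<Longrightarrow> s \<in> carrier (Sec S V) \<Longrightarrow> hs (S.G.gm V s) = T.G.gm (pre V) (h V s)"
  unfolding stalk_map_def by (rule H.stalk_map_gm)

lemma gs_gm: "S.nb V \<Longrightarrow> s \<in> carrier (ASec A V) \<Longrightarrow> gs (S.GA.gm V s) = T.GA.gm (pre V) (g V s)"
  unfolding stalk_map_alg_def by (rule G.stalk_map_gm)

lemma pre_top: "pre (topspace (Top S)) = topspace (Top T)"
  using cont unfolding preim_def continuous_map_def by blast

lemma R_rep2: "r \<in> carrier S.R \<Longrightarrow> s \<in> carrier S.R \<Longrightarrow> \<exists>U r' s'. S.nb U \<and> r' \<in> carrier (Sec S U) \<and> s' \<in> carrier (Sec S U) \<and>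
    r = S.G.gm U r' \<and> s = S.G.gm U s'"
  using S.common_reps[of "{r, s}" "{}"] by simp metis

lemma M_rep2: "r \<in> carrier S.M \<Longrightarrow> s \<in> carrier S.M \<Longrightarrow> \<exists>U r' s'. S.nb U \<and> r' \<in> carrier (ASec A U) \<and> s' \<in> carrier (ASec A U) \<and>
    r = S.GA.gm U r' \<and> s = S.GA.gm U s'"
  using S.common_reps[of "{}" "{r, s}"] by simp metis

lemma RM_rep2: "r \<in> carrier S.R \<Longrightarrow> s \<in> carrier S.M \<Longrightarrow> \<exists>U r' s'. S.nb U \<and> r' \<in> carrier (Sec S U) \<and> s' \<in> carrier (ASec A U) \<and>
    r = S.G.gm U r' \<and> s = S.GA.gm U s'"
  using S.common_reps[of "{r}" "{s}"] by simp metis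

lemma hs_hom: "hs \<in> ring_hom S.R T.R"
proof (rule ring_hom_memI)
  fix r s assume "r \<in> carrier S.R" "s \<in> carrier S.R"
  then obtain U r' s' where U: "S.nb U" "r' \<in> carrier (Sec S U)" "s' \<in> carrier (Sec S U)" and e: "r = S.G.gm U r'" "s = S.G.gm U s'"
    using R_rep2 by metis
  interpret ring "Sec S U" using U(1) by (rule S.G.nb_ring)
  note n = H.nb_preim[OF U(1)] and hh = H.h_hom[OF U(1)]
  show "hs (r \<otimes>\<^bsub>S.R\<^esub> s) = hs r \<otimes>\<^bsub>T.R\<^esub> hs s" "hs (r \<oplus>\<^bsub>S.R\<^esub> s) = hs r \<oplus>\<^bsub>T.R\<^esub> hs s"
    unfolding e using U n
    by (simp_all add: S.R_mult S.R_add T.R_mult T.R_add hs_gm ring_hom_closed[OF hh] ring_hom_mult[OF hh] ring_hom_add[OF hh])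
next
  fix r assume "r \<in> carrier S.R"
  then obtain U r' where U: "S.nb U" "r' \<in> carrier (Sec S U)" "r = S.G.gm U r'" using S.R_rep by metis
  show "hs r \<in> carrier T.R" unfolding U(3) using U(1,2)
    by (simp add: hs_gm T.R_in H.nb_preim ring_hom_closed[OF H.h_hom])
next
  interpret ring "Sec S (topspace (Top S))" using S.G.nb_top by (rule S.G.nb_ring)
  show "hs \<one>\<^bsub>S.R\<^esub> = \<one>\<^bsub>T.R\<^esub>"
    unfolding S.R_one[OF S.G.nb_top] T.R_one[OF T.G.nb_top]
    using ring_hom_one[OF H.h_hom[OF S.G.nb_top]] by (simp add: hs_gm S.G.nb_top pre_top)
qed

lemma hs_closed: "r \<in> carrier S.R \<Longrightarrow> hs r \<in> carrier T.R" by (rule ring_hom_closed[OF hs_hom])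

lemma gs_closed: "r \<in> carrier S.M \<Longrightarrow> gs r \<in> carrier T.M"
proof -
  assume "r \<in> carrier S.M"
  then obtain U r' where U: "S.nb U" "r' \<in> carrier (ASec A U)" "r = S.GA.gm U r'" using S.M_rep by metis
  show "gs r \<in> carrier T.M" unfolding U(3) using U(1,2)
    by (simp add: gs_gm T.M_in G.nb_preim ring_hom_closed[OF G.h_hom])
qed

lemma
  assumes "r \<in> carrier S.M" "s \<in> carrier S.M"
  shows gs_add: "gs (r \<oplus>\<^bsub>S.M\<^esub> s) = gs r \<oplus>\<^bsub>T.M\<^esub> gs s"
    and gs_mult: "gs (r \<otimes>\<^bsub>S.M\<^esub> s) = gs r \<otimes>\<^bsub>T.M\<^esub> gs s"
proof -
  obtain U r' s' where U: "S.nb U" "r' \<in> carrier (ASec A U)" "s' \<in> carrier (ASec A U)" and e: "r = S.GA.gm U r'" "s = S.GA.gm U s'"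
    using M_rep2[OF assms] by metis
  interpret ring "ASec A U" using U(1) by (rule S.GA.nb_ring)
  note n = G.nb_preim[OF U(1)] and hh = G.h_hom[OF U(1)]
  show "gs (r \<oplus>\<^bsub>S.M\<^esub> s) = gs r \<oplus>\<^bsub>T.M\<^esub> gs s" "gs (r \<otimes>\<^bsub>S.M\<^esub> s) = gs r \<otimes>\<^bsub>T.M\<^esub> gs s"
    unfolding e using U n
    by (simp_all add: S.M_mult S.M_add T.M_mult T.M_add gs_gm ring_hom_closed[OF hh] ring_hom_mult[OF hh] ring_hom_add[OF hh])
qed

lemma gs_smult:
  assumes "r \<in> carrier S.R" "s \<in> carrier S.M"
  shows "gs (r \<odot>\<^bsub>S.M\<^esub> s) = hs r \<odot>\<^bsub>T.M\<^esub> gs s"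
proof -
  obtain U r' s' where U: "S.nb U" "r' \<in> carrier (Sec S U)" "s' \<in> carrier (ASec A U)" and e: "r = S.G.gm U r'" "s = S.GA.gm U s'"
    using RM_rep2[OF assms] by metis
  interpret module "Sec S U" "ASec A U" using U(1) by (rule S.alg_module)
  note n = G.nb_preim[OF U(1)]
  show ?thesis unfolding e using U n
    by (simp add: S.M_smult T.M_smult gs_gm hs_gm ring_hom_closed[OF G.h_hom] ring_hom_closed[OF H.h_hom] pullback_smult[OF S.nb_open])
qed

lemma gs_grade: "a \<in> grade S.M i \<Longrightarrow> gs a \<in> grade T.M i"
proof -
  assume "a \<in> grade S.M i"
  then obtain U s where U: "S.nb U" "s \<in> grade (ASec A U) i" "a = S.GA.gm U s" using S.grade_rep by metis
  have "gs a = T.GA.gm (pre U) (g U s)" unfolding U(3) using U(1) S.gr_closed[OF U(1,2)] by (rule gs_gm)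
  also have "\<dots> \<in> grade T.M i" unfolding T.M_grade
    by (rule T.GA.germsI[OF G.nb_preim[OF U(1)], of _ "\<lambda>U. grade (ASec A' U) i"]) (rule pullback_grade[OF S.nb_open[OF U(1)] U(2)])
  finally show ?thesis .
qed

lemma hs_iota: "c \<in> carrier K \<Longrightarrow> hs (S.\<iota> c) = T.\<iota> c"
proof -
  assume c: "c \<in> carrier K"
  let ?X = "topspace (Top (Spec K))"
  have cc: "const_section K c \<in> carrier (Sec (Spec K) ?X)" by (rule ring_hom_closed[OF const_section_hom[OF S.field] c])
  have "\<forall>V. openin (Top (Spec K)) V \<longrightarrow> (\<forall>\<sigma>\<in>carrier (Sec (Spec K) V).
        h (preim (Top S) (base_map S) V) (base_sheaf_map S V \<sigma>) = base_sheaf_map T V \<sigma>)"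
    using morph by (simp add: morphism_over_def)
  from this[THEN spec, THEN mp, OF openin_topspace, THEN bspec, OF cc]
  have "h (topspace (Top S)) (base_sheaf_map S ?X (const_section K c)) = base_sheaf_map T ?X (const_section K c)"
    unfolding S.base_preim .
  then show "hs (S.\<iota> c) = T.\<iota> c"
    unfolding S.iota_eq T.iota_eq
    by (simp add: hs_gm[OF S.G.nb_top ring_hom_closed[OF S.base_hom cc]] pre_top)
qed

lemma hs_m: "x \<in> S.m \<Longrightarrow> hs x \<in> T.m"
proof -
  have "\<forall>x\<in>topspace (Top T). stalk_map T f h x ` max_ideal (stalk_ring S (f x)) \<subseteq> max_ideal (stalk_ring T x)"
    using lrs by (simp add: lrs_morphism_def)
  from this[THEN bspec, OF T.p_top] show "x \<in> S.m \<Longrightarrow> hs x \<in> T.m" unfolding fq by blast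
qed

lemma hs_minus: "r \<in> carrier S.R \<Longrightarrow> s \<in> carrier S.R \<Longrightarrow> hs (r \<ominus>\<^bsub>S.R\<^esub> s) = hs r \<ominus>\<^bsub>T.R\<^esub> hs s"
proof -
  assume rs: "r \<in> carrier S.R" "s \<in> carrier S.R"
  have z: "hs \<zero>\<^bsub>S.R\<^esub> = \<zero>\<^bsub>T.R\<^esub>" by (rule ring_hom_zero[OF hs_hom S.Rr.ring_axioms T.Rr.ring_axioms])
  have "\<ominus>\<^bsub>T.R\<^esub> hs s = hs (\<ominus>\<^bsub>S.R\<^esub> s)"
    by (rule T.Rr.minus_equality) (use rs in \<open>simp_all add: hs_closed S.Rr.l_neg z flip: ring_hom_add[OF hs_hom]\<close>)
  then show ?thesis using rs by (simp add: S.Rr.minus_eq T.Rr.minus_eq ring_hom_add[OF hs_hom])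
qed

text \<open>The morphism is local, so \<open>r - r(p)\<close> is sent into the maximal ideal at
  \<open>q\<close>; it is a morphism over \<open>K\<close>, so the constant \<open>r(p)\<close> is
  sent to the same constant.\<close>

lemma hs_val: "r \<in> carrier S.R \<Longrightarrow> T.val (hs r) = S.val r"
proof -
  assume r: "r \<in> carrier S.R"
  have "hs (r \<ominus>\<^bsub>S.R\<^esub> S.\<iota> (S.val r)) \<in> T.m" using hs_m S.sub_val[OF r] by blast
  then have "hs r \<ominus>\<^bsub>T.R\<^esub> T.\<iota> (S.val r) \<in> T.m" using r by (simp add: hs_minus S.val_closed S.iota_closed hs_iota)
  then have "T.rc (hs r) = T.rc (T.\<iota> (S.val r))"
    using T.Rr.quotient_eq_iff_same_a_r_cos[OF T.I.ideal_axioms, of "hs r" "T.\<iota> (S.val r)"] r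
    by (simp add: hs_closed T.iota_closed S.val_closed)
  then show ?thesis using r by (intro T.val_unique) (simp_all add: hs_closed S.val_closed)
qed

lemma hs_J: "x \<in> S.J \<Longrightarrow> hs x \<in> T.J"
  unfolding square_max_ideal_def
proof (induction rule: ideal_prod.induct)
  case (prod i j)
  then show ?case
    using ideal_prod.prod[OF hs_m hs_m] by (simp add: ring_hom_mult[OF hs_hom] S.PA.m_closed)
next
  case (sum s1 s2)
  then have "s1 \<in> carrier S.R" "s2 \<in> carrier S.R"
    using S.J.a_subset unfolding square_max_ideal_def by blast+
  then show ?case using ideal_prod.sum[OF sum.IH] by (simp add: ring_hom_add[OF hs_hom])
qed

text \<open>The map of local rings sends the square of one maximal ideal into the square of the
  other, so the coset in \<open>tangent_map\<close> does not depend on the representative. Values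
  are preserved, hence \<open>r - r(p)\<close> goes to the corresponding difference at
  \<open>q\<close>.\<close>

lemma dv_tangent_map:
  assumes r: "r \<in> carrier S.R"
  shows "S.dv (tangent_map K T S f h q v) r = T.dv v (hs r)"
proof -
  define x where "x = r \<ominus>\<^bsub>S.R\<^esub> S.\<iota> (S.val r)"
  have x: "x \<in> S.m" "x \<in> carrier S.R" using S.sub_val[OF r] S.PA.m_closed by (simp_all add: x_def)
  have "S.dv (tangent_map K T S f h q v) r = v (the_elem ((\<lambda>z. T.jc (hs z)) ` S.jc x))"
    using x by (simp add: S.dv_def tangent_map_def fq S.Cot_carrier flip: x_def)
  also have "the_elem ((\<lambda>z. T.jc (hs z)) ` S.jc x) = T.jc (hs x)"
  proof (rule the_elem_const)
    show "x \<in> S.jc x" using x(2) by (rule S.J.a_rcos_self)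
    fix z assume z: "z \<in> S.jc x"
    have zR: "z \<in> carrier S.R" using z S.Rr.a_r_coset_subset_G[OF S.J.a_subset x(2)] by blast
    have "S.jc z = S.jc x" using S.J.a_repr_independence'[OF z x(2)] by simp
    then have "z \<ominus>\<^bsub>S.R\<^esub> x \<in> S.J" using S.jc_eq zR x by blast
    then have "hs z \<ominus>\<^bsub>T.R\<^esub> hs x \<in> T.J" using hs_J zR x by (simp flip: hs_minus)
    then show "T.jc (hs z) = T.jc (hs x)" using T.jc_eq zR x hs_closed by blast
  qed
  also have "hs x = hs r \<ominus>\<^bsub>T.R\<^esub> T.\<iota> (T.val (hs r))"
    unfolding x_def using r by (simp add: hs_minus S.iota_closed S.val_closed hs_iota hs_val)
  finally show ?thesis by (simp add: T.dv_def)
qed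

text \<open>On germs the pushed-forward vector is \<open>T.dv v\<close> composed with the ring
  homomorphism \<open>hs\<close>, and the derivation laws are inherited through this composition.
  They are all that \<open>KS_deformed\<close> asks for, so membership in the tangent space of
  \<open>S\<close> need not be verified separately.\<close>

lemma deformed_tangent_map:
  assumes v: "v \<in> carrier (tangent_space K T q)"
  shows "deformed_algebra K S.R S.M S.m S.\<iota> S.val S.P (S.dv (tangent_map K T S f h q v))"
proof -
  note d = T.deformed[OF v]
  show ?thesis
    by (intro deformed_algebra.intro S.PA.pointed_algebra_axioms deformed_algebra_axioms.intro S.flat_stalk)
      (simp_all add: dv_tangent_map hs_closed S.iota_closed ring_hom_add[OF hs_hom] ring_hom_mult[OF hs_hom] hs_iota hs_val
         deformed_algebra.w_closed[OF d] deformed_algebra.w_add[OF d] deformed_algebra.w_mult[OF d] deformed_algebra.w_iota[OF d])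
qed

lemma pullback_bij: "bij_betw
        (\<lambda>C. the_elem ((\<lambda>xs. foldr (\<lambda>(a, r) b. (r \<odot>\<^bsub>T.M\<^esub> gs a) \<oplus>\<^bsub>T.M\<^esub> b) xs \<zero>\<^bsub>T.M\<^esub>) ` C))
        (carrier (base_change S.R hs T.R S.M)) (carrier T.M)"
  using pullback[unfolded is_pullback_def, THEN conjunct2, THEN conjunct2, THEN bspec, OF T.p_top] unfolding fq .

lemma kodaira_spencer_transport:
  assumes v: "v \<in> carrier (tangent_space K T q)"
  shows "kodaira_spencer K T A' q v =
    HH_transport (fibre K S A p) (fibre K T A' q) (fibre_map T A' f h g q) 2
      (kodaira_spencer K S A p (tangent_map K T S f h q v))"
proof -
  note dT = T.deformed[OF v] and dS = deformed_tangent_map[OF v]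
  have ap: "algebra_pullback K S.R S.M S.m S.\<iota> S.val S.P (S.dv (tangent_map K T S f h q v))
      T.R T.M T.m T.\<iota> T.val T.P (T.dv v) hs gs"
    by (intro algebra_pullback.intro dT dS algebra_pullback_axioms.intro hs_hom hs_iota hs_val gs_closed gs_add gs_mult
       gs_smult gs_grade pullback_bij dv_tangent_map[symmetric])
  have "fibre_map T A' f h g q = algebra_pullback.F T.R T.M T.m hs gs"
    by (simp add: fun_eq_iff fibre_map_def algebra_pullback.F_def[OF ap] T.residue_class_eq residue_field_def)
  then show ?thesis
    using algebra_pullback.KS_transport[OF ap] unfolding T.KS_deformed[OF dT] S.KS_deformed[OF dS] S.fibre_eq T.fibre_eq
    by simp
qed

end

text \<open>Naturality is expressed as compatibility with base change: for a pullback of the family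
  along a morphism over \<open>K\<close>, the Kodaira-Spencer class upstairs corresponds, under the
  induced isomorphism of fibres, to the class of the image tangent vector.\<close>

theorem theorem3p3:
  fixes K :: "'k ring"
    and S :: "('k, 'x, 'r) scheme_over"
    and A :: "('x, 'r, 'a) algebra_sheaf"
    and p :: 'x
  assumes "algebraically_closed K"
    and "\<forall>n::nat. n > 0 \<longrightarrow> add_pow K n \<one>\<^bsub>K\<^esub> \<noteq> \<zero>\<^bsub>K\<^esub>"
    and "is_scheme_over K S"
    and "closed_K_point K S p"
    and "flat_family S A"
  shows "kodaira_spencer K S A p \<in> linear_maps K (tangent_space K S p) (HH0 K (fibre K S A p) 2) \<and>
    (\<forall>(T :: ('k, 'y, 's) scheme_over) (A' :: ('y, 's, 'b) algebra_sheaf) q f h g.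
       is_scheme_over K T \<and> closed_K_point K T q \<and> flat_family T A' \<and>
       morphism_over K T S f h \<and> f q = p \<and> is_pullback T A' S A f h g \<longrightarrow>
       (\<forall>v\<in>carrier (tangent_space K T q).
          kodaira_spencer K T A' q v =
          HH_transport (fibre K S A p) (fibre K T A' q) (fibre_map T A' f h g q) 2
            (kodaira_spencer K S A p (tangent_map K T S f h q v))))"
proof (intro conjI allI impI ballI)
  have field: "field K" using assms(1) by (rule algebraically_closed.axioms(1))
  then have S: "family_at K S A p" using assms(3-5) by (intro family_at.intro)
  then show "kodaira_spencer K S A p \<in> linear_maps K (tangent_space K S p) (HH0 K (fibre K S A p) 2)"
    by (rule family_at.kodaira_spencer_linear)
  fix T :: "('k, 'y, 's) scheme_over" and A' :: "('y, 's, 'b) algebra_sheaf" and q f h g v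
  assume *: "is_scheme_over K T \<and> closed_K_point K T q \<and> flat_family T A' \<and>
    morphism_over K T S f h \<and> f q = p \<and> is_pullback T A' S A f h g"
    and v: "v \<in> carrier (tangent_space K T q)"
  from * have T: "family_at K T A' q" using field by (intro family_at.intro) simp_all
  from * have "family_pullback K S A p T A' q f h g"
    by (intro family_pullback.intro S T family_pullback_axioms.intro) simp_all
  then show "kodaira_spencer K T A' q v =
    HH_transport (fibre K S A p) (fibre K T A' q) (fibre_map T A' f h g q) 2
      (kodaira_spencer K S A p (tangent_map K T S f h q v))"
    using v by (rule family_pullback.kodaira_spencer_transport)
qed

end
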